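(* Let the periodic group $G=AB$ be the product of two locally cyclic subgroups $A$ and $B$. Then $G$ contains uniquely determined locally cyclic normal subgroups $S$ and $T$ and a locally nilpotent subgroup $H=A^*B^*$ with subgroups $A^*\le A$ and $B^*\le B$ such that $$G=(S\times T)\rtimes H=(S\times A^* )(T\times B^* ),$$ where $\pi(S)\cap\pi(A^* )=\emptyset$, $\pi(T)\cap\pi(B^* )=\emptyset$, $S=[S,B^*]$ and $T=[T,A^*]$.
   Context: A group $G=AB$ is the product of subgroups $A$ and $B$ if $G=\{ab\mid a\in A,\ b\in B\}$; more generally, for subgroups $X,Y$, $XY=\{xy\mid x\in X,\ y\in Y\}$. A group is locally cyclic if each of its finitely generated subgroups is cyclic, and locally nilpotent if each of its finitely generated subgroups is nilpotent. For a periodic group $X$, $\pi(X)$ denotes the set of all prime divisors of the orders of elements of $X$. For subgroups $X,Y$, $[X,Y]$ is the subgroup generated by all commutators $x^{-1}y^{-1}xy$ with $x\in X$, $y\in Y$. $X\times Y$ and $X\rtimes Y$ denote internal direct product and internal semidirect product (with $X$ normal), respectively.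
   Formalization: "Uniquely determined" fails literally (quasicyclic 2-group A inverted by B of order 2 has pairs (1,1) and (A,1)); it is replaced by: a least pair (S,T) exists, and two pairs coincide if 2 lies in π(S)∪π(T) for both or for neither. *)

theory Defs
  imports "HOL-Algebra.Algebra"
begin

definition periodic :: "('a, 'b) monoid_scheme \<Rightarrow> bool" where
  "periodic G \<longleftrightarrow> (\<forall>x \<in> carrier G. \<exists>n::nat. 0 < n \<and> x [^]\<^bsub>G\<^esub> n = \<one>\<^bsub>G\<^esub>)"

text \<open>Properties of groups are applied to a subgroup \<open>H\<close> of \<open>G\<close> through the group
  \<open>G\<lparr>carrier := H\<rparr>\<close>.\<close>

definition locally_cyclic :: "('a, 'b) monoid_scheme \<Rightarrow> bool" where
  "locally_cyclic G \<longleftrightarrow>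
     (\<forall>F. finite F \<and> F \<subseteq> carrier G \<longrightarrow> cyclic_group (subgroup_generated G F))"

definition commutator_subgroup ::
    "('a, 'b) monoid_scheme \<Rightarrow> 'a set \<Rightarrow> 'a set \<Rightarrow> 'a set" where
  "commutator_subgroup G U V =
     generate G {inv\<^bsub>G\<^esub> x \<otimes>\<^bsub>G\<^esub> inv\<^bsub>G\<^esub> y \<otimes>\<^bsub>G\<^esub> x \<otimes>\<^bsub>G\<^esub> y | x y. x \<in> U \<and> y \<in> V}"

primrec lower_central :: "('a, 'b) monoid_scheme \<Rightarrow> nat \<Rightarrow> 'a set" where
  "lower_central G 0 = carrier G"
| "lower_central G (Suc n) = commutator_subgroup G (lower_central G n) (carrier G)"

definition nilpotent_group :: "('a, 'b) monoid_scheme \<Rightarrow> bool" where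
  "nilpotent_group G \<longleftrightarrow> (\<exists>n. lower_central G n = {\<one>\<^bsub>G\<^esub>})"

definition locally_nilpotent :: "('a, 'b) monoid_scheme \<Rightarrow> bool" where
  "locally_nilpotent G \<longleftrightarrow>
     (\<forall>F. finite F \<and> F \<subseteq> carrier G \<longrightarrow> nilpotent_group (subgroup_generated G F))"

text \<open>The set \<open>\<pi>(U)\<close> for a subgroup \<open>U\<close> of a periodic group. The library order of an element
  of infinite order is \<open>0\<close>, so this is meaningful for periodic groups only.\<close>

definition prime_set :: "('a, 'b) monoid_scheme \<Rightarrow> 'a set \<Rightarrow> nat set" where
  "prime_set G U = {p. Factorial_Ring.prime p \<and> (\<exists>x \<in> U. p dvd group.ord G x)}"

text \<open>The next two predicates say that the product \<open>U <#> V\<close> is direct, and that the whole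
  group is the semidirect product of \<open>N\<close> by \<open>H\<close>.\<close>

definition direct_product :: "('a, 'b) monoid_scheme \<Rightarrow> 'a set \<Rightarrow> 'a set \<Rightarrow> bool" where
  "direct_product G U V \<longleftrightarrow>
     subgroup U G \<and> subgroup V G \<and> U \<inter> V = {\<one>\<^bsub>G\<^esub>} \<and>
     (\<forall>x \<in> U. \<forall>y \<in> V. x \<otimes>\<^bsub>G\<^esub> y = y \<otimes>\<^bsub>G\<^esub> x)"

definition semidirect_product :: "('a, 'b) monoid_scheme \<Rightarrow> 'a set \<Rightarrow> 'a set \<Rightarrow> bool" where
  "semidirect_product G N H \<longleftrightarrow>
     N \<lhd> G \<and> subgroup H G \<and> N \<inter> H = {\<one>\<^bsub>G\<^esub>} \<and> carrier G = N <#>\<^bsub>G\<^esub> H"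

text \<open>\<open>A1\<close> and \<open>B1\<close> stand for \<open>A*\<close> and \<open>B*\<close>; the subgroup \<open>H\<close> is \<open>A1 <#> B1\<close>.\<close>

definition decomposition ::
    "('a, 'b) monoid_scheme \<Rightarrow> 'a set \<Rightarrow> 'a set \<Rightarrow> 'a set \<Rightarrow> 'a set \<Rightarrow> 'a set \<Rightarrow> 'a set \<Rightarrow> bool" where
  "decomposition G A B S T A1 B1 \<longleftrightarrow>
     S \<lhd> G \<and> locally_cyclic (G\<lparr>carrier := S\<rparr>) \<and>
     T \<lhd> G \<and> locally_cyclic (G\<lparr>carrier := T\<rparr>) \<and>
     subgroup A1 G \<and> A1 \<subseteq> A \<and> subgroup B1 G \<and> B1 \<subseteq> B \<and>
     subgroup (A1 <#>\<^bsub>G\<^esub> B1) G \<and> locally_nilpotent (G\<lparr>carrier := A1 <#>\<^bsub>G\<^esub> B1\<rparr>) \<and>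
     direct_product G S T \<and>
     semidirect_product G (S <#>\<^bsub>G\<^esub> T) (A1 <#>\<^bsub>G\<^esub> B1) \<and>
     direct_product G S A1 \<and> direct_product G T B1 \<and>
     carrier G = (S <#>\<^bsub>G\<^esub> A1) <#>\<^bsub>G\<^esub> (T <#>\<^bsub>G\<^esub> B1) \<and>
     prime_set G S \<inter> prime_set G A1 = {} \<and>
     prime_set G T \<inter> prime_set G B1 = {} \<and>
     S = commutator_subgroup G S B1 \<and>
     T = commutator_subgroup G T A1"

text \<open>The subgroups \<open>S\<close> and \<open>T\<close> of a decomposition, with \<open>A*\<close> and \<open>B*\<close> left unspecified.\<close>

definition decomposition_pair ::
    "('a, 'b) monoid_scheme \<Rightarrow> 'a set \<Rightarrow> 'a set \<Rightarrow> 'a set \<Rightarrow> 'a set \<Rightarrow> bool" where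
  "decomposition_pair G A B S T \<longleftrightarrow> (\<exists>A1 B1. decomposition G A B S T A1 B1)"

text \<open>The pair \<open>(S, T)\<close> is not literally unique. Let \<open>G = A \<rtimes> B\<close> with \<open>A\<close> a quasicyclic
  \<open>2\<close>-group and \<open>B\<close> of order \<open>2\<close> inverting \<open>A\<close>. Then \<open>(S, T, A1, B1) = (1, 1, A, B)\<close> and
  \<open>(S, T, A1, B1) = (A, 1, 1, B)\<close> are both decompositions, because \<open>G\<close> is itself locally
  nilpotent and \<open>[A, B] = A\<close>. Uniqueness is therefore expressed by two properties: among all
  decomposition pairs there is a least one, and two decomposition pairs coincide as soon as
  \<open>S \<times> T\<close> contains an involution for both or for neither of them.\<close>

end

theory Submission
  imports Defs "HOL-Computational_Algebra.Polynomial" "HOL-Number_Theory.Cong"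
begin

text \<open>By Ito's theorem the commutator subgroup \<open>M = [A, B]\<close> is abelian, so \<open>G\<close> acts on \<open>M\<close> through
  commuting automorphisms. For a prime \<open>p\<close> let \<open>M\<^sub>p\<close> be the \<open>p\<close>-component of \<open>M\<close> and put
  \<open>T\<^sub>p = [M\<^sub>p, A\<^sub>p\<^sub>']\<close> and \<open>S\<^sub>p = [M\<^sub>p, B\<^sub>p\<^sub>']\<close>, where \<open>A\<^sub>p\<^sub>'\<close> consists of the elements of \<open>A\<close> of order prime to
  \<open>p\<close>. Coprime action gives \<open>T\<^sub>p \<inter> A = 1\<close> and a complement \<open>M\<^sub>p = T\<^sub>p \<times> C\<^sub>p\<close>. Sending a \<open>p\<close>-element \<open>b\<close> of \<open>B\<close> to
  the \<open>t \<in> T\<^sub>p\<close> with \<open>b \<in> A t\<close> is a crossed homomorphism onto \<open>T\<^sub>p\<close>, and since the \<open>p\<close>-elements of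
  \<open>B\<close> form a chain of cyclic groups, \<open>T\<^sub>p\<close> has at most one subgroup of order \<open>p\<close>, hence is locally
  cyclic. It is centralized by \<open>B\<^sub>p\<^sub>'\<close>, because a normal subgroup of prime order cannot be moved by
  both factors. Then \<open>S\<close> and \<open>T\<close> are the products of all \<open>S\<^sub>p\<close> and all \<open>T\<^sub>p\<close>, and \<open>A*\<close> and \<open>B*\<close> are the
  parts of \<open>A\<close> and \<open>B\<close> of orders prime to \<open>S\<close> and to \<open>T\<close>. The commutators of \<open>A*\<close> with \<open>B*\<close> lie in
  the remaining factor \<open>Z\<close> of \<open>M = S \<times> T \<times> Z\<close>, on whose \<open>p\<close>-component
  the elements of \<open>A\<close> and \<open>B\<close> of order prime to \<open>p\<close> act trivially, and this makes \<open>A*B*\<close> locally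
  nilpotent.

  For uniqueness, a locally cyclic normal \<open>p\<close>-subgroup \<open>D = [D, A]\<close> is contained in \<open>T\<^sub>p\<close> if some
  element of \<open>A\<^sub>p\<^sub>'\<close> moves it. Otherwise \<open>D\<close> is divisible and a \<open>p\<close>-element of \<open>A\<close> moves it while fixing
  its subgroup of order \<open>p\<close>. This is possible only for \<open>p = 2\<close>, by inversion, and then \<open>D\<close> consists
  of all \<open>2\<close>-elements of \<open>B\<close>.\<close>

section \<open>Groups as a type class\<close>

text \<open>The main obstacle is that the crossed homomorphism onto \<open>T\<^sub>p\<close> is not
  additive, so the chain condition on the \<open>p\<close>-elements of \<open>B\<close> does not
  pass to \<open>T\<^sub>p\<close> directly. It is additive on those elements of order
  \<open>p\<close> that its domain fixes. Reaching all elements of order \<open>p\<close> needs the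
  expansion \<open>1 + X + ... + X^(p-1) = p + (X - 1) g\<close> with
  \<open>g(1) = p (p - 1) / 2\<close> divisible by \<open>p\<close>, which is true for odd
  \<open>p\<close> only. For \<open>p = 2\<close> the subgroup \<open>T\<^sub>2\<close> is trivial
  instead: there would be a single fixed involution, while some element of \<open>A\<close> acts on
  \<open>T\<^sub>2\<close> without fixed points. So the pair constructed here contains no
  involutions, and an inverted divisible 2-group is the only thing that can be added to it.

  Such computations are carried out with integral polynomials acting on \<open>M\<close> by
  conjugation. One calculus then covers averaging over elements of coprime order, unipotent action
  of \<open>p\<close>-elements, and powers in \<open>A T\<close>; all these operators commute
  because \<open>M\<close> is abelian and contains all commutators.\<close>

class mult_group = monoid_mult + inverse +
  assumes left_inv [simp]: "inverse x * x = 1"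
begin

lemma inv_cancel_left [simp]: "inverse x * (x * y) = y"
  by (simp add: mult_assoc [symmetric])

lemma right_inv [simp]: "x * inverse x = 1"
  by (metis inv_cancel_left left_inv mult_1_right)

lemma cancel_inv_left [simp]: "x * (inverse x * y) = y"
  by (simp add: mult_assoc [symmetric])

lemma mult_left_cancel_iff [simp]: "x * y = x * z \<longleftrightarrow> y = z"
  by (metis inv_cancel_left)

lemma mult_right_cancel_iff [simp]: "y * x = z * x \<longleftrightarrow> y = z"
  by (metis mult_assoc mult_1_right right_inv)

lemma inv_unique: "x * y = 1 \<Longrightarrow> inverse x = y"
  by (metis inv_cancel_left mult_1_right)

lemma inv_one [simp]: "inverse 1 = 1"
  by (rule inv_unique) simp

lemma inv_inv [simp]: "inverse (inverse x) = x"
  by (rule inv_unique) simp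

lemma inv_mult [simp]: "inverse (x * y) = inverse y * inverse x"
  by (rule inv_unique) (simp add: mult_assoc)

lemma inv_eq_iff [simp]: "inverse x = inverse y \<longleftrightarrow> x = y"
  by (metis inv_inv)

lemma inv_eq_one_iff [simp]: "inverse x = 1 \<longleftrightarrow> x = 1"
  by (metis inv_inv inv_one)

lemma inv_comm: "x * y = y * x \<Longrightarrow> inverse x * y = y * inverse x"
  by (metis inv_cancel_left mult_assoc mult_1_right right_inv)

end

lemma inv_power [simp]: "inverse (x ^ n) = inverse (x::'g::mult_group) ^ n"
  by (induction n) (simp_all add: power_commutes)

lemma power_mult_commuting:
  assumes "x * y = y * (x::'g::monoid_mult)"
  shows "(x * y) ^ n = x ^ n * y ^ n"
proof (induction n)
  case (Suc n)
  have "(x * y) ^ Suc n = x * (y * x ^ n) * y ^ n"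
    using Suc by (simp add: mult.assoc)
  also have "y * x ^ n = x ^ n * y"
    using power_commuting_commutes[of x y n] assms by simp
  finally show ?case by (simp add: mult.assoc)
qed simp

lemma power_eq_mod:
  assumes "x ^ n = (1::'g::monoid_mult)"
  shows "x ^ k = x ^ (k mod n)"
proof -
  have "x ^ k = (x ^ n) ^ (k div n) * x ^ (k mod n)"
    by (simp flip: power_mult power_add)
  then show ?thesis by (simp add: assms)
qed

lemma power_eq_cong:
  assumes "x ^ n = (1::'g::monoid_mult)" "i mod n = j mod n"
  shows "x ^ i = x ^ j"
  by (metis assms power_eq_mod)

lemma power_one_dvd:
  assumes "x ^ n = (1::'g::monoid_mult)" "n dvd m"
  shows "x ^ m = 1"
  using assms by (auto simp: dvd_def power_mult)

lemma power_one_coprime: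
  assumes "x ^ m = (1::'g::monoid_mult)" "x ^ n = 1" "coprime m n" "0 < m"
  shows "x = 1"
proof -
  obtain i j where "i * m = j * n + 1"
    using bezout_nat[of m n] assms by (auto simp: mult.commute)
  then have "x ^ (i * m) = x ^ (j * n) * x" by (simp only: power_add power_one_right)
  moreover have "x ^ (i * m) = 1" "x ^ (j * n) = 1"
    using power_one_dvd[OF assms(1)] power_one_dvd[OF assms(2)] by simp_all
  ultimately show ?thesis by simp
qed

lemma inverse_as_power:
  assumes "x ^ n = (1::'g::mult_group)" "0 < n"
  shows "inverse x = x ^ (n - 1)"
proof (rule inv_unique)
  have "x * x ^ (n - 1) = x ^ Suc (n - 1)" by simp
  also have "Suc (n - 1) = n" using assms by simp
  finally show "x * x ^ (n - 1) = 1" using assms by simp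
qed

section \<open>Conjugation, commutators and generated subgroups\<close>

definition cj :: "'g::mult_group \<Rightarrow> 'g \<Rightarrow> 'g" where
  "cj x g = inverse g * x * g"

definition com :: "'g::mult_group \<Rightarrow> 'g \<Rightarrow> 'g" where
  "com x y = inverse x * inverse y * x * y"

lemma cj_simps [simp]: "cj 1 g = 1" "cj x 1 = x" "cj (x * y) g = cj x g * cj y g"
  "cj (inverse x) g = inverse (cj x g)"
  by (simp_all add: cj_def mult.assoc)

lemma cj_cj: "cj (cj x g) h = cj x (g * h)"
  by (simp add: cj_def mult.assoc)

lemma cj_pow: "cj (x ^ n) g = cj x g ^ n"
  by (induction n) simp_all

lemma cj_fix_iff: "cj x g = x \<longleftrightarrow> x * g = g * x"
  unfolding cj_def by (metis cancel_inv_left inv_cancel_left mult.assoc)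

lemma cj_eq_one [simp]: "cj x g = 1 \<longleftrightarrow> x = 1"
  unfolding cj_def by (metis cancel_inv_left left_inv mult.assoc mult_1_left mult_1_right mult_right_cancel_iff)

lemma com_alt: "com x y = inverse x * cj x y" "com x y = inverse (cj y x) * y"
  by (simp_all add: com_def cj_def mult.assoc)

lemma com_one_iff: "com x y = 1 \<longleftrightarrow> x * y = y * x"
proof -
  have "com x y = 1 \<longleftrightarrow> inverse x * cj x y = inverse x * x"
    by (simp add: com_alt(1))
  also have "\<dots> \<longleftrightarrow> x * y = y * x"
    unfolding mult_left_cancel_iff cj_fix_iff ..
  finally show ?thesis .
qed

lemma com_inv: "inverse (com x y) = com y x"
  by (simp add: com_def mult.assoc)

lemma com_simps [simp]: "com 1 y = 1" "com x 1 = 1" "com x x = 1"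
  by (simp_all add: com_def mult.assoc)

lemma cj_com: "cj x y = x * com x y"
  by (simp add: com_alt(1))

definition sg :: "'g::mult_group set \<Rightarrow> bool" where
  "sg H \<longleftrightarrow> 1 \<in> H \<and> (\<forall>x\<in>H. \<forall>y\<in>H. x * y \<in> H) \<and> (\<forall>x\<in>H. inverse x \<in> H)"

lemma sgI: "1 \<in> H \<Longrightarrow> (\<And>x y. x \<in> H \<Longrightarrow> y \<in> H \<Longrightarrow> x * y \<in> H) \<Longrightarrow> (\<And>x. x \<in> H \<Longrightarrow> inverse x \<in> H) \<Longrightarrow> sg H"
  by (auto simp: sg_def)

lemma sg_one: "sg H \<Longrightarrow> 1 \<in> H"
  and sg_mult: "sg H \<Longrightarrow> x \<in> H \<Longrightarrow> y \<in> H \<Longrightarrow> x * y \<in> H"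
  and sg_inv: "sg H \<Longrightarrow> x \<in> H \<Longrightarrow> inverse x \<in> H"
  by (auto simp: sg_def)

lemma sg_pow: "sg H \<Longrightarrow> x \<in> H \<Longrightarrow> x ^ n \<in> H"
  by (induction n) (auto intro: sg_one sg_mult)

lemma sg_cj: "sg H \<Longrightarrow> x \<in> H \<Longrightarrow> y \<in> H \<Longrightarrow> cj x y \<in> H"
  by (auto simp: cj_def intro!: sg_mult sg_inv)

lemma sg_com: "sg H \<Longrightarrow> x \<in> H \<Longrightarrow> y \<in> H \<Longrightarrow> com x y \<in> H"
  by (auto simp: com_def intro!: sg_mult sg_inv)

lemmas sg_intros = sg_one sg_mult sg_inv sg_pow sg_cj sg_com

lemma sg_mult_iff: "sg H \<Longrightarrow> x \<in> H \<Longrightarrow> x * y \<in> H \<longleftrightarrow> y \<in> H"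
  using sg_mult[of H "inverse x" "x * y"] by (auto intro: sg_mult sg_inv)

definition gen :: "'g::mult_group set \<Rightarrow> 'g set" where
  "gen U = Inter {H. sg H \<and> U \<subseteq> H}"

lemma sg_gen: "sg (gen U)"
  by (rule sgI) (simp_all add: gen_def sg_def)

lemma gen_base: "x \<in> U \<Longrightarrow> x \<in> gen U"
  by (auto simp: gen_def)

lemma gen_least: "sg H \<Longrightarrow> U \<subseteq> H \<Longrightarrow> gen U \<subseteq> H"
  by (auto simp: gen_def)

lemma gen_mono: "U \<subseteq> Y \<Longrightarrow> gen U \<subseteq> gen Y"
  by (rule gen_least [OF sg_gen]) (auto intro: gen_base)

lemma sg_vimage_cj: "sg H \<Longrightarrow> sg {x. cj x g \<in> H}"
  unfolding sg_def by simp

lemma gen_cj: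
  assumes "\<And>x. x \<in> U \<Longrightarrow> cj x g \<in> gen U" "x \<in> gen U"
  shows "cj x g \<in> gen U"
  using gen_least[OF sg_vimage_cj[OF sg_gen], of U g U] assms by auto

lemma sg_centralizer: "sg {y. x * y = y * (x::'g::mult_group)}"
proof (rule sgI; clarsimp)
  fix y z assume "x * y = y * x" "x * z = z * x"
  then show "x * (y * z) = y * z * x" by (metis mult.assoc)
next
  fix y assume "x * y = y * x"
  then show "x * inverse y = inverse y * x" using inv_comm[of y x] by simp
qed

lemma gen_commute:
  assumes "\<And>x y. x \<in> U \<Longrightarrow> y \<in> U \<Longrightarrow> x * y = y * x" "x \<in> gen U" "y \<in> gen U"
  shows "x * y = y * x"
proof -
  have "z * y = y * z" if "z \<in> U" for z
  proof -
    have "U \<subseteq> {y. z * y = y * z}"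
      by (intro subsetI CollectI assms(1) that)
    then have "y \<in> {y. z * y = y * z}"
      using subsetD[OF gen_least[OF sg_centralizer] assms(3)] by metis
    then show ?thesis ..
  qed
  then have "U \<subseteq> {z. y * z = z * y}"
    by (intro subsetI CollectI) (rule sym)
  then have "x \<in> {z. y * z = z * y}"
    using subsetD[OF gen_least[OF sg_centralizer] assms(2)] by metis
  then have "y * x = x * y" ..
  then show ?thesis ..
qed

section \<open>Elements with prescribed prime divisors and their primary parts\<close>

abbreviation is_prime :: "nat \<Rightarrow> bool" where "is_prime \<equiv> Factorial_Ring.prime"

text \<open>The elements of \<open>el Q\<close> are the \<open>Q\<close>-elements in the usual notation: \<open>el {p}\<close> means
  \<open>p\<close>-element, \<open>el (-{p})\<close> means \<open>p'\<close>-element.\<close>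

definition el :: "nat set \<Rightarrow> 'g::mult_group \<Rightarrow> bool" where
  "el Q x \<longleftrightarrow> (\<exists>m>0. x ^ m = 1 \<and> (\<forall>q. is_prime q \<longrightarrow> q dvd m \<longrightarrow> q \<in> Q))"

lemma elI: "0 < m \<Longrightarrow> x ^ m = 1 \<Longrightarrow> (\<And>q. is_prime q \<Longrightarrow> q dvd m \<Longrightarrow> q \<in> Q) \<Longrightarrow> el Q x"
  by (auto simp: el_def)

lemma el_one [simp]: "el Q 1"
  by (rule elI[of 1]) auto

lemma el_mono: "el Q x \<Longrightarrow> Q \<subseteq> Q' \<Longrightarrow> el Q' x"
  by (auto simp: el_def)

lemma el_mult:
  assumes "el Q x" "el Q y" "x * y = y * x"
  shows "el Q (x * y)"
proof -
  obtain m n where "0 < m" "x ^ m = 1" and m: "\<forall>q. is_prime q \<longrightarrow> q dvd m \<longrightarrow> q \<in> Q"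
    and "0 < n" "y ^ n = 1" and n: "\<forall>q. is_prime q \<longrightarrow> q dvd n \<longrightarrow> q \<in> Q"
    using assms by (auto simp: el_def)
  then have "x ^ (m * n) = 1" "y ^ (m * n) = 1"
    using power_one_dvd[of x m "m * n"] power_one_dvd[of y n "m * n"] by simp_all
  then show ?thesis
    using m n \<open>0 < m\<close> \<open>0 < n\<close>
    by (intro elI[of "m * n"]) (auto simp: power_mult_commuting[OF assms(3)] prime_dvd_mult_iff)
qed

lemma el_inv: "el Q x \<Longrightarrow> el Q (inverse x)"
  by (auto simp: el_def simp flip: inv_power)

lemma el_pow: "el Q x \<Longrightarrow> el Q (x ^ n)"
  unfolding el_def by (metis mult.commute power_mult power_one)

lemma el_cj: "el Q x \<Longrightarrow> el Q (cj x g)"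
  by (auto simp: el_def simp flip: cj_pow)

lemma el_power_iff: assumes "el Q (x ^ n)" "0 < n" "\<And>q. is_prime q \<Longrightarrow> q dvd n \<Longrightarrow> q \<in> Q"
  shows "el Q x"
proof -
  obtain m where "0 < m" "(x^n) ^ m = 1" "\<forall>q. is_prime q \<longrightarrow> q dvd m \<longrightarrow> q \<in> Q"
    using assms by (auto simp: el_def)
  then show ?thesis using assms
    by (intro elI[of "n * m"]) (auto simp: power_mult prime_dvd_mult_iff)
qed

lemma coprime_by_primes:
  assumes "\<And>q. is_prime q \<Longrightarrow> q dvd m \<Longrightarrow> q dvd n \<Longrightarrow> False" "0 < m"
  shows "coprime m n"
proof (rule ccontr)
  assume "\<not> coprime m n"
  then have "gcd m n \<noteq> 1" by (simp add: coprime_iff_gcd_eq_1)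
  then obtain q where "is_prime q" "q dvd gcd m n" using prime_factor_nat by blast
  then show False using assms by auto
qed

lemma el_coprime:
  assumes "el Q x" "el Q' x" "Q \<inter> Q' = {}"
  shows "x = 1"
proof -
  obtain m n where "0 < m" "x ^ m = 1" "\<forall>q. is_prime q \<longrightarrow> q dvd m \<longrightarrow> q \<in> Q"
     "0 < n" "x ^ n = 1" "\<forall>q. is_prime q \<longrightarrow> q dvd n \<longrightarrow> q \<in> Q'"
    using assms by (auto simp: el_def)
  moreover from this have "coprime m n" using assms(3)
    by (intro coprime_by_primes) auto
  ultimately show ?thesis by (metis power_one_coprime)
qed

lemma el_p_iff:
  assumes "is_prime p"
  shows "el {p} x \<longleftrightarrow> (\<exists>k. x ^ (p ^ k) = 1)"
proof
  assume "el {p} x"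
  then obtain m where m: "0 < m" "x ^ m = 1" "\<forall>q. is_prime q \<longrightarrow> q dvd m \<longrightarrow> q = p"
    by (auto simp: el_def)
  obtain k n where kn: "m = p ^ k * n" "\<not> p dvd n"
    using prime_power_canonical[OF assms m(1)] by (metis mult.commute)
  have "n = 1"
  proof (rule ccontr)
    assume "n \<noteq> 1"
    then obtain q where "is_prime q" "q dvd n" using prime_factor_nat by blast
    then show False using m(3) kn by (metis dvd_mult)
  qed
  then show "\<exists>k. x ^ (p ^ k) = 1" using m kn by auto
next
  assume "\<exists>k. x ^ (p ^ k) = 1"
  then obtain k where "x ^ (p ^ k) = 1" ..
  then show "el {p} x" using assms prime_gt_0_nat[OF assms]
    by (intro elI[of "p^k"]) (auto dest: prime_dvd_power primes_dvd_imp_eq)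
qed

lemma el_p'_iff:
  assumes "is_prime p"
  shows "el (-{p}) x \<longleftrightarrow> (\<exists>m>0. coprime m p \<and> x ^ m = 1)"
proof
  assume "el (-{p}) x"
  then obtain m where m: "0 < m" "x ^ m = 1" "\<forall>q. is_prime q \<longrightarrow> q dvd m \<longrightarrow> q \<noteq> p"
    by (auto simp: el_def)
  then show "\<exists>m>0. coprime m p \<and> x ^ m = 1"
    using assms by (metis coprime_commute prime_imp_coprime)
next
  assume "\<exists>m>0. coprime m p \<and> x ^ m = 1"
  then obtain m where m: "0 < m" "x ^ m = 1" "coprime m p" by auto
  then show "el (-{p}) x" using assms
    by (intro elI[of m]) (auto simp: coprime_absorb_right)
qed

lemma split_nat_primes:
  assumes "0 < (n::nat)"
  shows "\<exists>m1 m2. n = m1 * m2 \<and> (\<forall>q. is_prime q \<longrightarrow> q dvd m1 \<longrightarrow> q \<in> Q) \<and>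
    (\<forall>q. is_prime q \<longrightarrow> q dvd m2 \<longrightarrow> q \<notin> Q)"
  using assms
proof (induction n rule: less_induct)
  case (less n)
  show ?case
  proof (cases "n = 1")
    case True
    then show ?thesis by (intro exI[of _ 1]) auto
  next
    case False
    then obtain p where p: "is_prime p" "p dvd n" using prime_factor_nat by blast
    then obtain n' where n': "n = p * n'" by (auto simp: dvd_def)
    have "n' < n" "0 < n'" using n' less.prems prime_gt_1_nat[OF p(1)] by auto
    then obtain m1 m2 where m: "n' = m1 * m2" "\<forall>q. is_prime q \<longrightarrow> q dvd m1 \<longrightarrow> q \<in> Q"
      "\<forall>q. is_prime q \<longrightarrow> q dvd m2 \<longrightarrow> q \<notin> Q" using less.IH by blast
    show ?thesis
    proof (cases "p \<in> Q")
      case True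
      then have "n = (p * m1) * (m2) \<and> (\<forall>q. is_prime q \<longrightarrow> q dvd p * m1 \<longrightarrow> q \<in> Q) \<and>
          (\<forall>q. is_prime q \<longrightarrow> q dvd m2 \<longrightarrow> q \<notin> Q)"
        using m n' p by (auto simp: prime_dvd_mult_iff dest: primes_dvd_imp_eq)
      then show ?thesis by blast
    next
      case False
      then have "n = (m1) * (p * m2) \<and> (\<forall>q. is_prime q \<longrightarrow> q dvd m1 \<longrightarrow> q \<in> Q) \<and>
          (\<forall>q. is_prime q \<longrightarrow> q dvd p * m2 \<longrightarrow> q \<notin> Q)"
        using m n' p by (auto simp: prime_dvd_mult_iff dest: primes_dvd_imp_eq)
      then show ?thesis by blast
    qed
  qed
qed

text \<open>The exponents depend on \<open>n\<close> and \<open>Q\<close> but not on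
  \<open>x\<close>, so a single power map projects all elements of exponent \<open>n\<close> onto
  their \<open>Q\<close>-parts. \<open>Sig_sg\<close> relies on this uniformity.\<close>

lemma proj_exists:
  assumes "0 < n"
  shows "\<exists>e e'. \<forall>x::'g::mult_group. x ^ n = 1 \<longrightarrow>
    x = x ^ e * x ^ e' \<and> el Q (x ^ e) \<and> el (-Q) (x ^ e')"
proof -
  obtain m1 m2 where m: "n = m1 * m2" "\<forall>q. is_prime q \<longrightarrow> q dvd m1 \<longrightarrow> q \<in> Q"
    "\<forall>q. is_prime q \<longrightarrow> q dvd m2 \<longrightarrow> q \<notin> Q"
    using split_nat_primes[OF assms] by metis
  have pos: "0 < m1" "0 < m2" using m assms by auto
  have "coprime m1 m2" using m pos by (intro coprime_by_primes) auto
  then have "coprime m2 m1" by (simp add: coprime_commute)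
  then obtain i j where ij: "i * m2 = j * m1 + 1"
    using bezout_nat[of m2 m1] pos by (auto simp: mult.commute)
  \<comment> \<open>\<open>1 = i m2 - j m1\<close>, where \<open>-j m1\<close> is replaced by \<open>j m1 (n - 1)\<close> modulo \<open>n\<close>\<close>
  show ?thesis
  proof (intro exI allI impI conjI)
    fix x :: 'g assume x: "x ^ n = 1"
    have "x ^ (i * m2) * x ^ (j * m1 * (n - 1)) = x * x ^ (j * m1 + j * m1 * (n - 1))"
      by (simp add: ij power_add mult.assoc)
    also have "j * m1 + j * m1 * (n - 1) = n * (j * m1)"
      using assms by (cases n) (auto simp: algebra_simps)
    finally show "x = x ^ (i * m2) * x ^ (j * m1 * (n - 1))"
      using x by (simp add: power_mult)
    show "el Q (x ^ (i * m2))" using m x pos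
      by (intro elI[of m1]) (auto simp flip: power_mult intro!: power_one_dvd[OF x])
    show "el (-Q) (x ^ (j * m1 * (n - 1)))" using m x pos
      by (intro elI[of m2]) (auto simp flip: power_mult intro!: power_one_dvd[OF x])
  qed
qed

lemma el_UNIV: "x ^ n = 1 \<Longrightarrow> 0 < n \<Longrightarrow> el UNIV x"
  by (auto simp: el_def)

lemma el_split:
  assumes "el UNIV x"
  obtains i j where "x = x ^ i * x ^ j" "el Q (x ^ i)" "el (-Q) (x ^ j)"
proof -
  obtain n where "0 < n" "x ^ n = 1" using assms by (auto simp: el_def)
  then show ?thesis using proj_exists[of n Q] that by blast
qed

text \<open>One exponent that is 1 modulo \<open>m * m'\<close> and 0 modulo \<open>n * n'\<close>
  extracts both \<open>u\<close> and \<open>u'\<close> from \<open>x\<close>, although the two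
  factorizations need not commute with each other.\<close>

lemma comm_split_unique:
  assumes "x = u * v" "x = u' * v'" "u * v = v * u" "u' * v' = v' * u'"
    "el Q u" "el Q u'" "el (-Q) v" "el (-Q) v'"
  shows "u = u'"
proof -
  obtain m where m: "0 < m" "u ^ m = 1" "\<forall>q. is_prime q \<longrightarrow> q dvd m \<longrightarrow> q \<in> Q"
    using assms by (auto simp: el_def)
  obtain m' where m': "0 < m'" "u' ^ m' = 1" "\<forall>q. is_prime q \<longrightarrow> q dvd m' \<longrightarrow> q \<in> Q"
    using assms by (auto simp: el_def)
  obtain n where n: "0 < n" "v ^ n = 1" "\<forall>q. is_prime q \<longrightarrow> q dvd n \<longrightarrow> q \<notin> Q"
    using assms by (auto simp: el_def)
  obtain n' where n': "0 < n'" "v' ^ n' = 1" "\<forall>q. is_prime q \<longrightarrow> q dvd n' \<longrightarrow> q \<notin> Q"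
    using assms by (auto simp: el_def)
  have "coprime (m * m') (n * n')"
    using m n m' n' by (intro coprime_by_primes) (auto simp: prime_dvd_mult_iff)
  then have "coprime (n * n') (m * m')" by (simp add: coprime_commute)
  then obtain i j where ij: "i * (n * n') = j * (m * m') + 1"
    using bezout_nat[of "n * n'" "m * m'"] m m' n n' by (auto simp: mult.commute)
  have *: "y ^ (i * (n * n')) = y" if "y ^ (m * m') = 1" for y :: 'a
    using that unfolding ij by (simp add: power_add mult.commute[of j] power_mult)
  have "u ^ (m * m') = 1" "u' ^ (m * m') = 1" "v ^ (i * (n * n')) = 1" "v' ^ (i * (n * n')) = 1"
    using power_one_dvd[OF m(2)] power_one_dvd[OF m'(2)] power_one_dvd[OF n(2)] power_one_dvd[OF n'(2)]
    by simp_all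
  then have "x ^ (i * (n * n')) = u" "x ^ (i * (n * n')) = u'"
    using power_mult_commuting[OF assms(3)] power_mult_commuting[OF assms(4)] assms(1,2)
    by (metis * mult_1_right)+
  then show ?thesis by simp
qed

text \<open>An element of finite order is the product of its own powers of prime power order; the
  induction splits off one prime of the exponent at a time. This is the local-to-global principle
  that turns statements about \<open>p\<close>-components into statements about whole
  subgroups.\<close>

lemma in_sg_by_primes:
  assumes "el UNIV x" "sg K" "\<And>p i. is_prime p \<Longrightarrow> el {p} (x ^ i) \<Longrightarrow> x ^ i \<in> K"
  shows "x \<in> K"
proof -
  obtain n where "0 < n" "x ^ n = 1" using assms by (auto simp: el_def)
  then show ?thesis using assms(3)
  proof (induction n arbitrary: x rule: less_induct)
    case (less n)
    show ?case
    proof (cases "n = 1")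
      case True
      then show ?thesis using less.prems assms(2) by (auto intro: sg_one)
    next
      case False
      then obtain p where p: "is_prime p" "p dvd n" using prime_factor_nat by blast
      have "el UNIV x" using less.prems by (auto simp: el_def)
      then obtain i j where ij: "x = x ^ i * x ^ j" "el {p} (x ^ i)" "el (-{p}) (x ^ j)"
        using el_split by blast
      obtain k n' where kn: "n = p ^ k * n'" "\<not> p dvd n'"
        using prime_power_canonical[OF p(1) less.prems(1)] by (metis mult.commute)
      have "((x ^ j) ^ n') ^ (p ^ k) = 1"
        using less.prems(2) kn by (metis mult.commute power_mult power_one)
      then have "el {p} ((x ^ j) ^ n')" using p el_p_iff by blast
      moreover have "el (-{p}) ((x ^ j) ^ n')" using ij el_pow by blast
      ultimately have "(x ^ j) ^ n' = 1" using el_coprime[of "{p}" _ "-{p}"] by auto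
      moreover have "k \<noteq> 0" using kn p by (metis mult_1 power_0)
      then have "n' < n" "0 < n'" using kn less.prems(1) prime_gt_1_nat[OF p(1)]
        using one_less_power[of p k] by auto
      moreover have "(x ^ j) ^ i \<in> K" if "is_prime q" "el {q} ((x ^ j) ^ i)" for q i
        using less.prems(3)[OF that(1), of "j * i"] that by (simp add: power_mult)
      ultimately have "x ^ j \<in> K" using less.IH[of n' "x ^ j"] by blast
      moreover have "x ^ i \<in> K" using less.prems(3) p ij by blast
      ultimately show ?thesis using ij(1) assms(2) sg_mult by metis
    qed
  qed
qed

section \<open>Integer powers\<close>

lemma powi_add1: "x powi (m + 1) = x powi m * (x::'g::mult_group)"
proof (cases "m \<ge> 0")
  case True
  then show ?thesis by (simp add: power_int_def nat_add_distrib power_Suc2 del: power_Suc)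
next
  case False
  define k where "k = nat (- m) - 1"
  have m: "m = - int (Suc k)" using False by (simp add: k_def)
  have "x powi m = inverse x ^ k * inverse x"
    unfolding m by (simp add: power_int_def power_Suc2 nat_add_distrib del: power_Suc)
  moreover have "x powi (m + 1) = inverse x ^ k"
    unfolding m by (cases k) (simp_all add: power_int_def nat_add_distrib)
  ultimately show ?thesis by (simp add: mult.assoc)
qed

lemma powi_diff1: "x powi (m - 1) = x powi m * inverse (x::'g::mult_group)"
  using powi_add1[of x "m - 1"] by (simp add: mult.assoc)

lemma powi_add: "x powi (m + n) = x powi m * x powi n" for x :: "'g::mult_group"
proof (induction n rule: int_induct[of _ 0])
  case (step1 i)
  then show ?case using powi_add1[of x "m + i"] powi_add1[of x i]
    by (simp add: mult.assoc add.assoc)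
next
  case (step2 i)
  then show ?case using powi_diff1[of x "m + i"] powi_diff1[of x i]
    by (simp add: mult.assoc algebra_simps)
qed simp

lemma powi_minus: "x powi (- n) = inverse (x powi n)" for x :: "'g::mult_group"
  using powi_add[of x n "- n"] by (intro inv_unique[symmetric]) simp

lemma powi_mult: "x powi (m * n) = (x powi m) powi n" for x :: "'g::mult_group"
proof (induction n rule: int_induct[of _ 0])
  case (step1 i)
  then show ?case using powi_add[of x "m * i" m] powi_add1[of "x powi m" i]
    by (simp add: distrib_left)
next
  case (step2 i)
  then show ?case using powi_add[of x "m * i" "- m"] powi_diff1[of "x powi m" i]
    by (simp add: right_diff_distrib powi_minus)
qed simp

lemma powi_mult_distrib:
  assumes "x * y = y * (x::'g::mult_group)"
  shows "(x * y) powi n = x powi n * y powi n"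
proof -
  have "inverse x * inverse y = inverse y * inverse x"
    using assms by (metis inv_mult)
  moreover have "inverse (x * y) = inverse x * inverse y"
    using assms by (metis inv_mult)
  ultimately show ?thesis
    unfolding power_int_def
    using power_mult_commuting[OF assms] power_mult_commuting[of "inverse x" "inverse y"] by simp
qed

lemma powi_one [simp]: "(1::'g::mult_group) powi n = 1"
  by (simp add: power_int_def)

lemma cj_powi: "cj (x powi n) g = cj x g powi n"
  by (simp add: power_int_def cj_pow)

lemma sg_powi: "sg H \<Longrightarrow> x \<in> H \<Longrightarrow> x powi n \<in> H"
  by (simp add: power_int_def sg_pow sg_inv)

section \<open>Integral polynomials acting on abelian groups\<close>

text \<open>The action of an integral polynomial in \<open>b\<close>, with \<open>b\<close> acting by conjugation, on an abelian
  group that is normalised by \<open>b\<close>.\<close>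

definition act :: "'g::mult_group \<Rightarrow> int poly \<Rightarrow> 'g \<Rightarrow> 'g" where
  "act b q x = foldr (\<lambda>c y. x powi c * cj y b) (coeffs q) 1"

lemma act_0 [simp]: "act b 0 x = 1"
  by (simp add: act_def)

lemma act_pCons: "act b (pCons c q) x = x powi c * cj (act b q x) b"
proof (cases "q = 0 \<and> c = 0")
  case False
  then have "cCons c (coeffs q) = c # coeffs q" by (auto simp: cCons_def)
  then show ?thesis unfolding act_def coeffs_pCons_eq_cCons by (simp only: foldr.simps o_def)
qed simp

lemma act_one_right [simp]: "act b q 1 = 1"
  by (induction q) (simp_all add: act_pCons)

lemma act_const: "act b [:c:] x = x powi c"
  by (simp add: act_pCons)

lemma act_1 [simp]: "act b 1 x = x"
  by (simp add: act_const one_pCons)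

lemma act_x: "act b [:0, 1:] x = cj x b"
  by (simp add: act_pCons)

lemma act_com: "act b [:-1, 1:] x = com x b"
  by (simp add: act_pCons com_alt(1) power_int_def)

text \<open>This is \<open>1 + X + ... + X^(n-1)\<close>, the quotient of \<open>X^n - 1\<close> by
  \<open>X - 1\<close>. It describes powers of a product (\<open>power_mult_act\<close>) and
  averages over the powers of \<open>b\<close> (\<open>coprime_decomp\<close>).\<close>

primrec nrm :: "nat \<Rightarrow> int poly" where
  "nrm 0 = 0"
| "nrm (Suc n) = 1 + [:0, 1:] * nrm n"

lemma nrm_mult: "[:-1, 1:] * nrm n = [:0, 1:] ^ n - 1"
proof (induction n)
  case (Suc n)
  have "[:-1, 1:] * nrm (Suc n) = [:-1, 1:] + [:0, 1:] * ([:-1, 1:] * nrm n)"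
    by (simp only: nrm.simps distrib_left mult.left_commute mult_1_right)
  also have "\<dots> = [:0, 1:] ^ Suc n - 1"
    unfolding Suc by (simp add: right_diff_distrib one_pCons)
  finally show ?case .
qed simp

lemma poly_at_one: "\<exists>g. q = [:poly q 1:] + [:-1, 1:] * g" for q :: "int poly"
proof -
  have "poly (q - [:poly q 1:]) 1 = 0" by simp
  then have "[:-1, 1:] dvd q - [:poly q 1:]" by (simp only: poly_eq_0_iff_dvd)
  then obtain g where "q - [:poly q 1:] = [:-1, 1:] * g" by (elim dvdE)
  then show ?thesis by (metis add.commute diff_add_cancel)
qed

lemma nrm_at_one: "poly (nrm n) 1 = int n"
  by (induction n) simp_all

lemma nrm_expand: "\<exists>g. nrm n = [:int n:] + [:-1, 1:] * g"
  using poly_at_one[of "nrm n"] by (simp add: nrm_at_one)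

lemma prime_dvd_binomial:
  assumes "is_prime p" "0 < k" "k < p"
  shows "p dvd (p choose k)"
proof -
  have "k * (p choose k) = p * ((p - 1) choose (k - 1))"
    using assms by (intro times_binomial_minus1_eq) auto
  then have "p dvd k * (p choose k)" by simp
  then show ?thesis using assms by (auto simp: prime_dvd_mult_iff dest: dvd_imp_le)
qed

lemma freshmans_dream_dvd:
  fixes u v :: "'r::comm_ring_1"
  assumes "is_prime p"
  shows "of_nat p dvd (u + v) ^ p - (u ^ p + v ^ p)"
proof -
  have p: "0 < p" using assms prime_gt_0_nat by blast
  define f where "f k = of_nat (p choose k) * u ^ k * v ^ (p - k)" for k
  have "{..p} = insert 0 (insert p {0<..<p})" using p by auto
  then have "(u + v) ^ p = f 0 + (f p + sum f {0<..<p})"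
    unfolding binomial_ring f_def[symmetric] using p by simp
  then have "(u + v) ^ p - (u ^ p + v ^ p) = sum f {0<..<p}"
    by (simp add: f_def)
  moreover have "of_nat p dvd f k" if "k \<in> {0<..<p}" for k
    using prime_dvd_binomial[OF assms, of k] that by (auto simp: f_def dvd_def mult.assoc)
  ultimately show ?thesis by (auto intro: dvd_sum)
qed

text \<open>Taking \<open>p\<close>-th powers is additive modulo \<open>p\<close>. The point is that
  \<open>X^(p^k) - 1\<close> annihilates whatever the \<open>p^k\<close>-th power of the acting
  element fixes, so that \<open>p\<close>-elements act unipotently on
  \<open>p\<close>-groups.\<close>

lemma x_minus_1_power:
  assumes "is_prime p"
  shows "\<exists>r. [:-1, 1:] ^ (p ^ k) = [:0, 1:] ^ (p ^ k) - 1 + [:int p:] * r"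
proof -
  let ?m = "of_nat p :: int poly"
  have m: "[:int p:] = ?m" by (simp add: of_nat_poly)
  have cong: "?m dvd x ^ p - y ^ p" if "?m dvd x - y" for x y
    unfolding power_diff_sumr2 using that by (rule dvd_mult2)
  \<comment> \<open>For odd \<open>p\<close> the difference is 0; for \<open>p = 2\<close> it is 2,
    hence 0 modulo \<open>p\<close>.\<close>
  have odd: "?m dvd (-1) ^ p - (-1)"
  proof (cases "p = 2")
    case False
    then have "odd p" using assms prime_odd_nat[of p] prime_ge_2_nat[OF assms] by auto
    then show ?thesis by simp
  qed simp
  have "?m dvd [:-1, 1:] ^ (p ^ k) - ([:0, 1:] ^ (p ^ k) - 1)"
  proof (induction k)
    case 0
    then show ?case by (simp add: one_pCons)
  next
    case (Suc k)
    let ?q = "[:0, 1:] ^ (p ^ k) :: int poly"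
    have "?m dvd ([:-1, 1:] ^ (p ^ k)) ^ p - (?q - 1) ^ p"
      by (rule cong) (rule Suc)
    moreover have "?m dvd (?q - 1) ^ p - (?q ^ p + (-1) ^ p)"
      using freshmans_dream_dvd[OF assms, of ?q "-1"] by simp
    moreover note odd
    ultimately have "?m dvd (([:-1, 1:] ^ (p ^ k)) ^ p - (?q - 1) ^ p) +
        ((?q - 1) ^ p - (?q ^ p + (-1) ^ p)) + ((-1) ^ p - (-1))"
      by (intro dvd_add)
    then have "?m dvd ([:-1, 1:] ^ (p ^ k)) ^ p - (?q ^ p - 1)"
      by (simp add: algebra_simps)
    then show ?case by (simp add: power_mult[symmetric] mult.commute)
  qed
  then obtain r where "[:-1, 1:] ^ (p ^ k) - ([:0, 1:] ^ (p ^ k) - 1) = ?m * r"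
    by (elim dvdE)
  then show ?thesis unfolding m by (metis add.commute diff_add_cancel)
qed

text \<open>\<open>M\<close> becomes a module over the integral polynomials, with \<open>X\<close>
  acting as conjugation by \<open>b\<close> and \<open>X - 1\<close> as the map sending
  \<open>x\<close> to \<open>[x, b]\<close>. The element \<open>b\<close> itself may lie outside
  \<open>M\<close>.\<close>

locale abn =
  fixes M :: "'g::mult_group set" and b :: 'g
  assumes M_sg: "sg M"
    and M_comm: "\<And>x y. x \<in> M \<Longrightarrow> y \<in> M \<Longrightarrow> x * y = y * x"
    and M_cj: "\<And>x. x \<in> M \<Longrightarrow> cj x b \<in> M"
begin

lemma act_closed: "x \<in> M \<Longrightarrow> act b q x \<in> M"
  by (induction q) (auto simp: act_pCons intro: sg_one sg_mult sg_powi M_sg M_cj)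

lemma M_comm4:
  assumes "x \<in> M" "y \<in> M" "z \<in> M" "w \<in> M"
  shows "(x * y) * (z * w) = (x * z) * (y * w)"
  using M_comm[OF assms(2,3)] by (metis mult.assoc)

lemma act_add: "x \<in> M \<Longrightarrow> act b (p + q) x = act b p x * act b q x"
proof (induction p arbitrary: q)
  case (pCons c p)
  obtain d q' where q: "q = pCons d q'" by (cases q)
  show ?case unfolding q using pCons
    by (simp add: act_pCons powi_add M_comm4 sg_powi M_sg M_cj act_closed)
qed simp

lemma act_hom: "x \<in> M \<Longrightarrow> y \<in> M \<Longrightarrow> act b p (x * y) = act b p x * act b p y"
proof (induction p)
  case (pCons c p)
  have "act b (pCons c p) (x * y) = (x powi c * y powi c) * (cj (act b p x) b * cj (act b p y) b)"
    unfolding act_pCons powi_mult_distrib[OF M_comm[OF pCons.prems]] pCons.IH[OF pCons.prems] cj_simps ..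
  also have "\<dots> = (x powi c * cj (act b p x) b) * (y powi c * cj (act b p y) b)"
    using pCons.prems by (intro M_comm4 sg_powi M_sg M_cj act_closed)
  finally show ?case by (simp only: act_pCons)
qed simp

lemma act_pow: "x \<in> M \<Longrightarrow> act b p (x ^ n) = act b p x ^ n"
  by (induction n) (simp_all add: act_hom sg_pow M_sg)

lemma act_smult: "x \<in> M \<Longrightarrow> act b (smult c p) x = act b p x powi c"
proof (induction p)
  case (pCons a p)
  have "x powi a * cj (act b p x) b = cj (act b p x) b * x powi a"
    using pCons by (intro M_comm) (simp_all add: sg_powi M_sg M_cj act_closed)
  note * = powi_mult_distrib[OF this]
  have "act b (smult c (pCons a p)) x = x powi (a * c) * cj (act b p x powi c) b"
    using pCons by (simp only: smult_pCons act_pCons mult.commute)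
  then show ?case unfolding act_pCons * powi_mult cj_powi .
qed simp

lemma act_mult: "x \<in> M \<Longrightarrow> act b (p * q) x = act b p (act b q x)"
  by (induction p) (simp_all add: act_pCons act_add act_smult)

lemma act_x_power: "x \<in> M \<Longrightarrow> act b ([:0, 1:] ^ n) x = cj x (b ^ n)"
proof (induction n)
  case (Suc n)
  have "act b ([:0, 1:] ^ Suc n) x = act b [:0, 1:] (act b ([:0, 1:] ^ n) x)"
    using Suc.prems by (simp only: power_Suc act_mult)
  also have "\<dots> = cj (cj x (b ^ n)) b"
    using Suc by (simp only: act_x)
  finally show ?case by (simp only: cj_cj power_Suc2)
qed simp

lemma act_cj:
  assumes "\<And>y. y \<in> M \<Longrightarrow> cj (cj y b) g = cj (cj y g) b" "x \<in> M"
  shows "act b p (cj x g) = cj (act b p x) g"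
  by (induction p) (simp_all add: act_pCons cj_powi assms act_closed)

lemma com_closed: "x \<in> M \<Longrightarrow> com x b \<in> M"
  by (auto simp: com_alt(1) intro: sg_mult sg_inv M_sg M_cj)

lemma com_hom: "x \<in> M \<Longrightarrow> y \<in> M \<Longrightarrow> com (x * y) b = com x b * com y b"
  using act_hom[of x y "[:-1, 1:]"] by (simp add: act_com)

lemma com_pow: "x \<in> M \<Longrightarrow> com (x ^ n) b = com x b ^ n"
  using act_pow[of x "[:-1, 1:]"] by (simp add: act_com)

lemma com_inverse: "x \<in> M \<Longrightarrow> com (inverse x) b = inverse (com x b)"
  using com_hom[of x "inverse x"] by (intro inv_unique[symmetric]) (simp add: sg_inv M_sg)

lemma act_xn_minus_1:
  assumes "x \<in> M" "cj x (b ^ n) = x"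
  shows "act b ([:0, 1:] ^ n - 1) x = 1"
proof -
  have "act b ([:0, 1:] ^ n - 1 + 1) x = x"
    using assms act_x_power[of x n] by simp
  then have "act b ([:0, 1:] ^ n - 1) x * x = x"
    using assms act_add[of x "[:0, 1:] ^ n - 1" 1] by simp
  then show ?thesis by (metis mult_1_left mult_right_cancel_iff)
qed

text \<open>Collecting the factors \<open>b\<close> on the left conjugates the copies of
  \<open>x\<close> by the powers \<open>1, b, ..., b^(n-1)\<close>, and their product is the norm of
  \<open>x\<close>.\<close>

lemma power_mult_act:
  assumes "x \<in> M"
  shows "(b * x) ^ n = b ^ n * act b (nrm n) x"
proof (induction n)
  case (Suc n)
  let ?u = "act b (nrm n) x"
  have u: "?u \<in> M" using assms by (rule act_closed)
  have "(b * x) ^ Suc n = b ^ n * ?u * (b * x)"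
    unfolding power_Suc2 Suc ..
  also have "\<dots> = b ^ n * b * (cj ?u b * x)"
    by (simp add: cj_def mult.assoc)
  also have "cj ?u b * x = x * cj ?u b"
    using assms u by (intro M_comm M_cj)
  also have "x * cj ?u b = act b (nrm (Suc n)) x"
    using assms by (simp only: nrm.simps act_add act_mult act_x act_1)
  also have "b ^ n * b = b ^ Suc n" by (rule power_Suc2[symmetric])
  finally show ?case .
qed simp

text \<open>Averaging over the powers of \<open>b\<close>: since
  \<open>(X - 1) nrm n = X^n - 1\<close> annihilates \<open>x\<close>, the polynomial
  \<open>nrm n\<close> sends \<open>x\<close> to a fixed point. Its expansion
  \<open>n + (X - 1) g\<close> then writes \<open>x^n\<close> as a fixed point times a commutator,
  and inverting \<open>n\<close> modulo \<open>m\<close> gives the same for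
  \<open>x\<close>.\<close>

lemma coprime_decomp:
  assumes "x \<in> M" "x ^ m = 1" "cj x (b ^ n) = x" "coprime m n" "0 < m"
  shows "\<exists>c\<in>M. \<exists>y\<in>M. x = c * com y b \<and> cj c b = c"
proof -
  obtain g where g: "nrm n = [:int n:] + [:-1, 1:] * g" using nrm_expand by blast
  define u where "u = act b (nrm n) x"
  define v where "v = act b g x"
  have uv: "u \<in> M" "v \<in> M" using assms by (simp_all add: u_def v_def act_closed)
  have "com u b = act b ([:-1, 1:] * nrm n) x"
    using assms by (simp only: act_mult u_def act_com)
  then have "com u b = 1" using assms(1,3) by (simp only: nrm_mult act_xn_minus_1)
  then have "cj u b = u" by (simp add: cj_com)
  have "u = x ^ n * com v b"
    using assms by (simp only: u_def v_def g act_add act_mult act_com act_const power_int_of_nat)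
  then have xn: "x ^ n = u * com (inverse v) b"
    using uv by (simp add: com_inverse mult.assoc)
  obtain n' where "[n * n' = Suc 0] (mod m)"
    using cong_solve_coprime_nat[of n m] assms by (auto simp: coprime_commute)
  then have "x ^ (n * n') = x ^ 1"
    using assms by (intro power_eq_cong[OF assms(2)]) (simp add: cong_def)
  then have "x = (u * com (inverse v) b) ^ n'"
    by (simp add: power_mult xn)
  also have "\<dots> = u ^ n' * com (inverse v) b ^ n'"
    using uv by (intro power_mult_commuting M_comm com_closed) (auto intro: sg_inv M_sg)
  also have "com (inverse v) b ^ n' = com (inverse v ^ n') b"
    using uv by (intro com_pow[symmetric] sg_inv M_sg)
  finally have "x = u ^ n' * com (inverse v ^ n') b" .
  moreover have "cj (u ^ n') b = u ^ n'" using \<open>cj u b = u\<close> by (simp add: cj_pow)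
  ultimately show ?thesis using uv by (metis M_sg sg_inv sg_pow)
qed

text \<open>On the fixed element \<open>[x, b]\<close> the polynomial \<open>nrm n\<close> acts as
  the \<open>n\<close>-th power, while \<open>nrm n (X - 1) = X^n - 1\<close> annihilates
  \<open>x\<close>. So \<open>[x, b]\<close> has both exponents \<open>n\<close> and
  \<open>m\<close>.\<close>

lemma coprime_fix:
  assumes "x \<in> M" "cj (com x b) b = com x b" "com x b ^ m = 1" "cj x (b ^ n) = x"
    "coprime m n" "0 < m"
  shows "com x b = 1"
proof -
  obtain g where g: "nrm n = [:int n:] + [:-1, 1:] * g" using nrm_expand by blast
  have y: "com x b \<in> M" using assms by (simp add: com_closed)
  have "com (com x b) b = 1"
    unfolding com_alt(1)[of "com x b"] assms(2) by simp
  then have "com x b ^ n = act b ([:int n:] + g * [:-1, 1:]) (com x b)"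
    using y by (simp only: act_add act_mult act_com act_const power_int_of_nat act_one_right mult_1_right)
  also have "\<dots> = act b (nrm n * [:-1, 1:]) x"
    unfolding g mult.commute[of g] using assms by (simp only: act_mult act_com)
  also have "\<dots> = 1"
    using assms(1,4) by (simp only: mult.commute[of "nrm n"] nrm_mult act_xn_minus_1)
  finally show ?thesis using assms power_one_coprime by blast
qed

text \<open>On \<open>x\<close> the operator \<open>(X - 1)^(p^k)\<close> agrees with
  \<open>p\<close> times some polynomial, so each application lowers the exponent \<open>p^j\<close>
  by a factor \<open>p\<close>, and \<open>j\<close> applications leave nothing.\<close>

lemma unipotent:
  assumes "is_prime p" "x \<in> M" "x ^ (p ^ j) = 1" "cj x (b ^ (p ^ k)) = x"
  shows "act b ([:-1, 1:] ^ (p ^ k * j)) x = 1"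
  using assms(2-)
proof (induction j arbitrary: x)
  case (Suc j)
  obtain r where r: "[:-1, 1:] ^ (p ^ k) = [:0, 1:] ^ (p ^ k) - 1 + [:int p:] * r"
    using x_minus_1_power[OF assms(1)] by blast
  define y where "y = act b ([:-1, 1:] ^ (p ^ k)) x"
  have y: "y = act b r x ^ p"
    unfolding y_def r using Suc.prems
    by (simp add: act_add act_xn_minus_1 act_mult act_smult)
  have "y ^ (p ^ j) = act b r x ^ (p ^ Suc j)"
    unfolding y by (simp only: power_mult[symmetric] power_Suc)
  also have "\<dots> = act b r (x ^ (p ^ Suc j))"
    by (rule act_pow[OF Suc.prems(1), symmetric])
  finally have "y ^ (p ^ j) = act b r (x ^ (p ^ Suc j))" .
  then have "y ^ (p ^ j) = 1" using Suc.prems by (simp only: act_one_right)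
  moreover have "y \<in> M" using Suc.prems by (simp add: y_def act_closed)
  moreover have "cj y (b ^ (p ^ k)) = y"
    unfolding y_def using Suc.prems
    by (subst act_cj[symmetric]) (simp_all add: cj_cj power_commutes)
  ultimately have "act b ([:-1, 1:] ^ (p ^ k * j)) y = 1" by (intro Suc.IH)
  then have "act b ([:-1, 1:] ^ (p ^ k * j) * [:-1, 1:] ^ (p ^ k)) x = 1"
    using Suc.prems by (simp only: act_mult y_def)
  then show ?case
    by (simp only: mult_Suc_right power_add mult.commute[of "[:-1, 1:] ^ (p ^ k)"])
qed simp

end

section \<open>Uniserial p-groups\<close>

lemma pow_gen:
  assumes "x ^ n = (1::'g::monoid_mult)" "coprime l n"
  shows "\<exists>l'. x = (x ^ l) ^ l'"
proof -
  obtain l' where "[l * l' = Suc 0] (mod n)"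
    using cong_solve_coprime_nat assms(2) by blast
  then have "x ^ (l * l') = x ^ 1"
    by (intro power_eq_cong[OF assms(1)]) (simp add: cong_def)
  then show ?thesis by (metis power_mult power_one_right)
qed

lemma p_pow_gen:
  assumes "is_prime p" "el {p} x" "\<not> p dvd l"
  shows "\<exists>l'. x = (x ^ l) ^ l'"
proof -
  obtain k where "x ^ (p ^ k) = 1" using assms el_p_iff by blast
  moreover have "coprime l (p ^ k)"
    using assms by (metis coprime_commute coprime_power_right_iff prime_imp_coprime)
  ultimately show ?thesis by (rule pow_gen)
qed

lemma p_least:
  assumes "is_prime p" "el {p} x" "x \<noteq> 1"
  obtains k where "x ^ (p ^ k) \<noteq> 1" "x ^ (p ^ Suc k) = 1"
proof -
  have ex: "\<exists>k. x ^ (p ^ k) = 1" using assms el_p_iff by blast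
  define m where "m = (LEAST k. x ^ (p ^ k) = 1)"
  have m: "x ^ (p ^ m) = 1" unfolding m_def using ex by (rule LeastI_ex)
  moreover have "m \<noteq> 0" using m assms(3) by (cases m) auto
  then have "x ^ (p ^ (m - 1)) \<noteq> 1"
    using not_less_Least[of "m - 1" "\<lambda>k. x ^ (p ^ k) = 1"] by (simp add: m_def)
  ultimately show ?thesis using that[of "m - 1"] \<open>m \<noteq> 0\<close> by simp
qed

lemma order_p_power:
  assumes "is_prime p" "el {p} x" "x \<noteq> 1"
  obtains i where "x ^ i \<noteq> 1" "(x ^ i) ^ p = 1"
proof -
  obtain k where "x ^ (p ^ k) \<noteq> 1" "x ^ (p ^ Suc k) = 1" using p_least[OF assms] .
  then show ?thesis using that[of "p ^ k"] by (simp add: power_mult[symmetric] mult.commute)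
qed

text \<open>For a subgroup of \<open>p\<close>-elements this means that it is cyclic or quasicyclic.
  The formulation by powers transfers to subsets and gives the comparability used
  throughout.\<close>

definition uniserial :: "'g::mult_group set \<Rightarrow> bool" where
  "uniserial D \<longleftrightarrow> (\<forall>x\<in>D. \<forall>y\<in>D. (\<exists>k. x = y ^ k) \<or> (\<exists>k. y = x ^ k))"

lemma uniserialD: "uniserial D \<Longrightarrow> x \<in> D \<Longrightarrow> y \<in> D \<Longrightarrow> (\<exists>k. x = y ^ k) \<or> (\<exists>k. y = x ^ k)"
  by (auto simp: uniserial_def)

lemma uniserial_mono: "uniserial D \<Longrightarrow> E \<subseteq> D \<Longrightarrow> uniserial E"
  unfolding uniserial_def by blast

lemma el_p_of_pow: "is_prime p \<Longrightarrow> x ^ p = 1 \<Longrightarrow> el {p} x"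
  using el_p_iff[of p x] by (metis power_one_right)

lemma uniserial_socle_gen:
  assumes "uniserial D" "is_prime p" "u \<in> D" "v \<in> D" "u \<noteq> 1" "u ^ p = 1" "v ^ p = 1"
  shows "\<exists>k. v = u ^ k"
proof (cases "\<exists>k. u = v ^ k")
  case True
  then obtain k where k: "u = v ^ k" ..
  have "\<not> p dvd k"
  proof
    assume "p dvd k"
    then have "v ^ k = 1" using assms(7) by (rule power_one_dvd[rotated])
    then show False using k assms by simp
  qed
  then show ?thesis using p_pow_gen[OF assms(2) el_p_of_pow[OF assms(2,7)]] k by metis
next
  case False
  then show ?thesis using uniserialD[OF assms(1,3,4)] by blast
qed

text \<open>Induction on the exponent \<open>p^j\<close> of \<open>y\<close> shows that
  \<open>y\<close> is a power of every \<open>x\<close> of order at least \<open>p^j\<close>. If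
  \<open>y^p = x^m\<close>, then \<open>p\<close> divides \<open>m\<close>, as otherwise the order
  of \<open>x\<close> would be too small; so \<open>y\<close> differs from \<open>x^(m/p)\<close> by
  an element of order dividing \<open>p\<close>, which is a power of \<open>w\<close> and hence of
  \<open>x\<close>.\<close>

lemma uniserial_of_socle:
  assumes p: "is_prime p" and D: "sg D" "\<And>x y. x \<in> D \<Longrightarrow> y \<in> D \<Longrightarrow> x * y = y * x"
    "\<And>x. x \<in> D \<Longrightarrow> el {p} x"
    and w: "\<And>x. x \<in> D \<Longrightarrow> x ^ p = 1 \<Longrightarrow> \<exists>k. x = w ^ k" "w ^ p = 1"
  shows "uniserial D"
proof -
  have wx: "\<exists>k. w = x ^ k" if x: "x \<in> D" "x \<noteq> 1" for x
  proof -
    obtain i where i: "x ^ i \<noteq> 1" "(x ^ i) ^ p = 1" using order_p_power[OF p D(3)] x by blast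
    then obtain l where l: "x ^ i = w ^ l" using w(1) x D(1) sg_pow by metis
    have "\<not> p dvd l" using i(1) l w(2) power_one_dvd by metis
    then obtain l' where "w = (w ^ l) ^ l'" using p_pow_gen[OF p el_p_of_pow[OF p w(2)]] by blast
    then have "w = x ^ (i * l')" using l by (simp add: power_mult)
    then show ?thesis ..
  qed
  have claim: "\<exists>k. y = x ^ k"
    if "y \<in> D" "x \<in> D" "y ^ (p ^ j) = 1" "j = 0 \<or> x ^ (p ^ (j - 1)) \<noteq> 1" for x y j
    using that
  proof (induction j arbitrary: y)
    case 0
    then show ?case by (auto intro: exI[of _ 0])
  next
    case (Suc j)
    have x: "x \<noteq> 1" using Suc.prems by auto
    have xj: "x ^ (p ^ j) \<noteq> 1" using Suc.prems by auto
    have "j = 0 \<or> x ^ (p ^ (j - 1)) \<noteq> 1"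
    proof (cases j)
      case (Suc i)
      then show ?thesis using xj by (metis diff_Suc_1 mult.commute power_Suc power_mult power_one)
    qed simp
    moreover have "(y ^ p) ^ (p ^ j) = 1" using Suc.prems by (simp add: power_mult)
    ultimately obtain m where m: "y ^ p = x ^ m"
      using Suc.IH[of "y ^ p"] Suc.prems D(1) sg_pow by metis
    have "p dvd m"
    proof (rule ccontr)
      assume "\<not> p dvd m"
      then obtain m' where "x = (x ^ m) ^ m'" using p_pow_gen[OF p D(3)] Suc.prems by blast
      then have "x ^ (p ^ j) = ((x ^ m) ^ (p ^ j)) ^ m'"
        by (metis mult.commute power_mult)
      also have "(x ^ m) ^ (p ^ j) = 1" using m \<open>(y ^ p) ^ (p ^ j) = 1\<close> by simp
      finally show False using xj by simp
    qed
    then obtain m' where m': "m = m' * p" by (auto simp: dvd_def mult.commute)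
    define v where "v = inverse x ^ m' * y"
    have comm: "inverse x ^ m' * y = y * inverse x ^ m'"
      using Suc.prems D(1,2) by (intro D(2)) (auto intro: sg_pow sg_inv)
    have "v ^ p = inverse (x ^ m) * y ^ p"
      unfolding v_def power_mult_commuting[OF comm] m' by (simp add: power_mult)
    then have "v ^ p = 1" by (simp only: m left_inv)
    moreover have "v \<in> D" using Suc.prems D(1) by (auto simp: v_def intro: sg_mult sg_pow sg_inv)
    ultimately obtain k where "v = w ^ k" using w(1) by blast
    moreover obtain l where "w = x ^ l" using wx Suc.prems x by blast
    moreover have "y = x ^ m' * v" by (simp add: v_def flip: inv_power)
    ultimately have "y = x ^ (m' + l * k)" by (simp add: power_add power_mult)
    then show ?case ..
  qed
  have *: "\<exists>j. x ^ (p ^ j) = 1 \<and> (j = 0 \<or> x ^ (p ^ (j - 1)) \<noteq> 1)" if xD: "x \<in> D" for x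
  proof (cases "x = 1")
    case False
    then obtain k where "x ^ (p ^ k) \<noteq> 1" "x ^ (p ^ Suc k) = 1" using p_least[OF p D(3)[OF xD] False] by blast
    then show ?thesis by (intro exI[of _ "Suc k"]) simp
  qed (auto intro: exI[of _ 0])
  show ?thesis unfolding uniserial_def
  proof (intro ballI)
    fix x y assume xy: "x \<in> D" "y \<in> D"
    obtain i j where ij: "x ^ (p ^ i) = 1" "i = 0 \<or> x ^ (p ^ (i - 1)) \<noteq> 1"
      "y ^ (p ^ j) = 1" "j = 0 \<or> y ^ (p ^ (j - 1)) \<noteq> 1" using * xy by metis
    have up: "z ^ (p ^ l) = 1" if "z ^ (p ^ k) = 1" "k \<le> l" for z :: 'a and k l
      using that power_one_dvd le_imp_power_dvd by metis
    show "(\<exists>k. x = y ^ k) \<or> (\<exists>k. y = x ^ k)"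
    proof (cases "i \<le> j")
      case True
      then have "x ^ (p ^ j) = 1" using up ij(1) by blast
      then show ?thesis using claim[of x y j] ij xy by blast
    next
      case False
      then have "y ^ (p ^ i) = 1" using up ij(3) by simp
      then show ?thesis using claim[of y x i] ij xy by blast
    qed
  qed
qed

text \<open>Conjugation preserves orders, so if \<open>x\<close> is the \<open>k\<close>-th power of
  its conjugate, then \<open>k\<close> is prime to \<open>p\<close> and the relation can be
  inverted. Hence every cyclic subgroup of a normal uniserial \<open>p\<close>-group is
  normal.\<close>

lemma uniserial_cj:
  assumes p: "is_prime p" and "uniserial D" "x \<in> D" "cj x g \<in> D" "el {p} x"
  shows "\<exists>k. cj x g = x ^ k"
proof (cases "x = 1")
  case False
  show ?thesis
  proof (cases "\<exists>k. x = cj x g ^ k")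
    case True
    then obtain k where k: "x = cj x g ^ k" ..
    have "\<not> p dvd k"
    proof
      assume "p dvd k"
      obtain i where i: "x ^ (p ^ i) \<noteq> 1" "x ^ (p ^ Suc i) = 1"
        using p_least[OF p assms(5) False] .
      have "x ^ (p ^ i) = cj x g ^ (k * p ^ i)" using k by (metis power_mult)
      also have "\<dots> = 1"
      proof (rule power_one_dvd)
        show "cj x g ^ (p ^ Suc i) = 1" using i(2) by (metis cj_pow cj_simps(1))
        show "p ^ Suc i dvd k * p ^ i" using \<open>p dvd k\<close> by simp
      qed
      finally show False using i by simp
    qed
    then show ?thesis using p_pow_gen[OF p el_cj[OF assms(5)]] k by metis
  next
    case False
    then show ?thesis using uniserialD[OF assms(2,3,4)] by blast
  qed
qed (auto intro: exI[of _ 0])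

lemma com_mult_right: "com x (y * z) = com x z * cj (com x y) z"
  by (simp add: com_def cj_def mult.assoc)

lemma com_mult_left: "com (x * y) z = cj (com x z) y * com y z"
  by (simp add: com_def cj_def mult.assoc)

lemma cj_com_distrib: "cj (com x y) g = com (cj x g) (cj y g)"
  by (simp add: com_def)

lemma cj_eqI: "x * g = g * x \<Longrightarrow> cj x g = x"
  by (simp add: cj_fix_iff)

section \<open>Products of two abelian subgroups\<close>

text \<open>\<open>BA\<close> says that the factors permute, which makes the product set
  \<open>G\<close> a subgroup. Commutativity of the two factors is what Ito's theorem uses; local
  cyclicity enters with \<open>prod_lc\<close>.\<close>

locale factorized =
  fixes A B :: "'g::mult_group set"
  assumes A_sg: "sg A" and B_sg: "sg B"
    and A_comm: "\<And>x y. x \<in> A \<Longrightarrow> y \<in> A \<Longrightarrow> x * y = y * x"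
    and B_comm: "\<And>x y. x \<in> B \<Longrightarrow> y \<in> B \<Longrightarrow> x * y = y * x"
    and BA: "\<And>a b. a \<in> A \<Longrightarrow> b \<in> B \<Longrightarrow> \<exists>a'\<in>A. \<exists>b'\<in>B. b * a = a' * b'"
begin

definition G :: "'g set" where "G = {a * b | a b. a \<in> A \<and> b \<in> B}"

lemma G_I: "a \<in> A \<Longrightarrow> b \<in> B \<Longrightarrow> a * b \<in> G"
  unfolding G_def by blast

lemma A_G: "a \<in> A \<Longrightarrow> a \<in> G"
  using G_I[OF _ sg_one[OF B_sg]] by simp

lemma B_G: "b \<in> B \<Longrightarrow> b \<in> G"
  using G_I[OF sg_one[OF A_sg]] by simp

lemma G_cases: "g \<in> G \<Longrightarrow> (\<And>a b. a \<in> A \<Longrightarrow> b \<in> B \<Longrightarrow> g = a * b \<Longrightarrow> P) \<Longrightarrow> P"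
  unfolding G_def by blast

lemma G_sg: "sg G"
proof (rule sgI)
  show "1 \<in> G" using A_G A_sg sg_one by blast
next
  fix x y assume "x \<in> G" "y \<in> G"
  then obtain a b a' b' where *: "a \<in> A" "b \<in> B" "a' \<in> A" "b' \<in> B" "x = a * b" "y = a' * b'"
    by (auto elim!: G_cases)
  obtain a2 b2 where "a2 \<in> A" "b2 \<in> B" "b * a' = a2 * b2" using BA[OF *(3,2)] by blast
  have "x * y = a * (b * a') * b'" using * by (simp add: mult.assoc)
  also have "\<dots> = (a * a2) * (b2 * b')" unfolding \<open>b * a' = a2 * b2\<close> by (simp only: mult.assoc)
  finally have "x * y = (a * a2) * (b2 * b')" .
  moreover have "(a * a2) * (b2 * b') \<in> G"
    using * \<open>a2 \<in> A\<close> \<open>b2 \<in> B\<close> by (intro G_I sg_mult A_sg B_sg)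
  ultimately show "x * y \<in> G" by simp
next
  fix x assume "x \<in> G"
  then obtain a b where *: "a \<in> A" "b \<in> B" "x = a * b" by (auto elim!: G_cases)
  then obtain a2 b2 where "a2 \<in> A" "b2 \<in> B" "inverse b * inverse a = a2 * b2"
    using BA[OF sg_inv[OF A_sg *(1)] sg_inv[OF B_sg *(2)]] by blast
  then show "inverse x \<in> G" using *(3) G_I by simp
qed

lemma G_cases2:
  assumes "g \<in> G"
  obtains b a where "a \<in> A" "b \<in> B" "g = b * a"
proof -
  have "inverse g \<in> G" using assms G_sg sg_inv by blast
  then obtain a b where "a \<in> A" "b \<in> B" "inverse g = a * b" by (elim G_cases)
  then have "g = inverse b * inverse a" by (metis inv_inv inv_mult)
  then show ?thesis using \<open>a \<in> A\<close> \<open>b \<in> B\<close> that A_sg B_sg sg_inv by blast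
qed

definition M :: "'g set" where "M = gen {com a b | a b. a \<in> A \<and> b \<in> B}"

lemma com_reduce_right:
  assumes "a \<in> A" "a' \<in> A"
  shows "com a (a' * b) = com a b"
  using assms A_comm by (simp add: com_mult_right com_one_iff[THEN iffD2])

lemma com_reduce_left:
  assumes "b \<in> B" "b' \<in> B"
  shows "com (b' * a) b = com a b"
  using assms B_comm by (simp add: com_mult_left com_one_iff[THEN iffD2])

text \<open>\<open>b2\<close> is the \<open>B\<close>-factor of the conjugate of \<open>b\<close> by
  \<open>a1\<close>; the \<open>A\<close>-factor disappears by \<open>com_reduce_right\<close>. The
  same \<open>b2\<close> serves every \<open>a'\<close>, which makes the two moves in Ito's argument
  independent of each other.\<close>

lemma com_cj_A:
  assumes "a \<in> A" "b \<in> B" "a1 \<in> A"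
  obtains b2 where "b2 \<in> B" "\<And>a'. a' \<in> A \<Longrightarrow> cj (com a' b) a1 = com a' b2"
proof -
  have "cj b a1 \<in> G" using assms by (intro sg_cj G_sg A_G B_G)
  then obtain a2 b2 where ab: "a2 \<in> A" "b2 \<in> B" "cj b a1 = a2 * b2" by (elim G_cases)
  have "cj (com a' b) a1 = com a' b2" if "a' \<in> A" for a'
    using that ab assms A_comm by (simp add: cj_com_distrib cj_eqI com_reduce_right)
  then show ?thesis using that ab by blast
qed

lemma com_cj_B:
  assumes "a \<in> A" "b \<in> B" "b1 \<in> B"
  obtains a2 where "a2 \<in> A" "\<And>b'. b' \<in> B \<Longrightarrow> cj (com a b') b1 = com a2 b'"
proof -
  have "cj a b1 \<in> G" using assms by (intro sg_cj G_sg A_G B_G)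
  then obtain a2 b2 where ab: "a2 \<in> A" "b2 \<in> B" "cj a b1 = b2 * a2" by (elim G_cases2)
  have "cj (com a b') b1 = com a2 b'" if "b' \<in> B" for b'
    using that ab assms B_comm by (simp add: cj_com_distrib cj_eqI com_reduce_left)
  then show ?thesis using that ab by blast
qed

text \<open>Ito's argument: moving a commutator \<open>[a, b]\<close> by \<open>a1\<close> changes only \<open>b\<close>, moving it by \<open>b1\<close> changes
  only \<open>a\<close>, so the two moves commute and \<open>[a1, b1]\<close> centralizes \<open>[a, b]\<close>.\<close>

lemma com_cj_commute:
  assumes "a \<in> A" "b \<in> B" "a1 \<in> A" "b1 \<in> B"
  shows "cj (com a b) (a1 * b1) = cj (com a b) (b1 * a1)"
proof -
  obtain b2 where b2: "b2 \<in> B" "\<And>a'. a' \<in> A \<Longrightarrow> cj (com a' b) a1 = com a' b2"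
    using com_cj_A[OF assms(1,2,3)] by blast
  obtain a2 where a2: "a2 \<in> A" "\<And>b'. b' \<in> B \<Longrightarrow> cj (com a b') b1 = com a2 b'"
    using com_cj_B[OF assms(1,2,4)] by blast
  show ?thesis using assms a2 b2 by (simp flip: cj_cj)
qed

lemma gens_commute:
  assumes "a \<in> A" "b \<in> B" "a1 \<in> A" "b1 \<in> B"
  shows "com a b * com a1 b1 = com a1 b1 * com a b"
proof -
  let ?x = "com a b"
  \<comment> \<open>The commutator \<open>[a1, b1]\<close> is the product of
    \<open>inverse a1 * inverse b1\<close> and \<open>a1 * b1\<close>. Reversing the order in the
    first factor makes it cancel against the second.\<close>
  have "cj ?x (inverse a1 * inverse b1) = cj ?x (inverse b1 * inverse a1)"
    using assms by (intro com_cj_commute sg_inv A_sg B_sg)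
  then have "cj (cj ?x (inverse a1 * inverse b1)) (a1 * b1) = cj (cj ?x (inverse b1 * inverse a1)) (a1 * b1)"
    by simp
  then have "cj ?x (com a1 b1) = ?x"
    unfolding cj_cj by (simp add: com_def mult.assoc)
  then show ?thesis by (simp only: cj_fix_iff)
qed

lemma M_comm: "x \<in> M \<Longrightarrow> y \<in> M \<Longrightarrow> x * y = y * x"
  unfolding M_def by (rule gen_commute) (auto intro: gens_commute)

lemma M_sg: "sg M"
  unfolding M_def by (rule sg_gen)

lemma com_AB_M: "a \<in> A \<Longrightarrow> b \<in> B \<Longrightarrow> com a b \<in> M"
  unfolding M_def by (auto intro: gen_base)

lemma M_G: "x \<in> M \<Longrightarrow> x \<in> G"
proof -
  have "M \<subseteq> G" unfolding M_def by (rule gen_least[OF G_sg]) (auto intro: sg_com G_sg A_G B_G)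
  then show "x \<in> M \<Longrightarrow> x \<in> G" by blast
qed

lemma M_normal:
  assumes "x \<in> M" "g \<in> G"
  shows "cj x g \<in> M"
proof -
  have A: "cj x a \<in> M" if xa: "x \<in> M" "a \<in> A" for x a
  proof (rule gen_cj[of "{com a b | a b. a \<in> A \<and> b \<in> B}" a x, folded M_def])
    fix y assume "y \<in> {com a b | a b. a \<in> A \<and> b \<in> B}"
    then obtain a1 b1 where y: "a1 \<in> A" "b1 \<in> B" "y = com a1 b1" by blast
    then obtain b2 where "b2 \<in> B" "cj (com a1 b1) a = com a1 b2"
      using com_cj_A[of a1 b1 a] xa(2) by metis
    then show "cj y a \<in> M" using y com_AB_M by metis
  qed (use xa in simp)
  have B: "cj x b \<in> M" if xb: "x \<in> M" "b \<in> B" for x b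
  proof (rule gen_cj[of "{com a b | a b. a \<in> A \<and> b \<in> B}" b x, folded M_def])
    fix y assume "y \<in> {com a b | a b. a \<in> A \<and> b \<in> B}"
    then obtain a1 b1 where y: "a1 \<in> A" "b1 \<in> B" "y = com a1 b1" by blast
    then obtain a2 where "a2 \<in> A" "cj (com a1 b1) b = com a2 b1"
      using com_cj_B[of a1 b1 b] xb(2) by metis
    then show "cj y b \<in> M" using y com_AB_M by metis
  qed (use xb in simp)
  obtain a b where "a \<in> A" "b \<in> B" "g = a * b" using assms(2) by (elim G_cases)
  then show ?thesis using A[OF assms(1)] B by (simp flip: cj_cj)
qed

lemma com_M:
  assumes "g \<in> G" "h \<in> G"
  shows "com g h \<in> M"
proof -
  obtain a b a' b' where *: "a \<in> A" "b \<in> B" "a' \<in> A" "b' \<in> B" "g = a * b" "h = a' * b'"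
    using assms by (elim G_cases) blast
  have "com a h \<in> M" using * com_reduce_right com_AB_M by simp
  moreover have "com b h = cj (inverse (com a' b)) b'"
    using * B_comm by (simp add: com_mult_right com_one_iff[THEN iffD2] com_inv)
  then have "com b h \<in> M" using * by (simp add: M_normal B_G com_AB_M M_sg sg_inv)
  ultimately show ?thesis using * by (simp only: com_mult_left M_normal B_G M_sg sg_mult)
qed

text \<open>The elements \<open>g * h\<close> and \<open>h * g\<close> differ by a commutator, which
  lies in \<open>M\<close> by \<open>com_M\<close> and therefore centralizes
  \<open>M\<close>.\<close>

lemma M_cj_commute:
  assumes "x \<in> M" "g \<in> G" "h \<in> G"
  shows "cj (cj x g) h = cj (cj x h) g"
proof -
  have "g * h = h * g * com g h" by (simp add: com_def mult.assoc)
  then have "cj x (g * h) = cj (cj x (h * g)) (com g h)" by (simp add: cj_cj)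
  also have "\<dots> = cj x (h * g)"
    using assms by (intro cj_eqI M_comm M_normal com_M sg_mult G_sg)
  finally show ?thesis by (simp add: cj_cj)
qed

text \<open>Exchanging the factors changes neither \<open>G\<close> nor \<open>M\<close>. Every
  result on \<open>A\<close> and \<open>T\<close> therefore yields its mirror image on
  \<open>B\<close> and \<open>S\<close> by interpretation.\<close>

lemma swap: "factorized B A"
proof
  fix a b assume "a \<in> B" "b \<in> A"
  then have "b * a \<in> G" using G_sg A_G B_G sg_mult by blast
  then show "\<exists>a'\<in>B. \<exists>b'\<in>A. b * a = a' * b'" by (elim G_cases2) blast
qed (use A_sg B_sg A_comm B_comm in auto)

lemma swap_G: "factorized.G B A = G"
proof -
  interpret s: factorized B A by (rule swap)
  show ?thesis
    using s.G_cases s.A_G s.B_G A_G B_G G_sg s.G_sg sg_mult G_cases by (metis subsetI subset_antisym)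
qed

lemma swap_M: "factorized.M B A = M"
proof -
  interpret s: factorized B A by (rule swap)
  have "s.M \<subseteq> M" unfolding s.M_def
    by (rule gen_least[OF M_sg]) (auto intro: com_M A_G B_G)
  moreover have "M \<subseteq> s.M" unfolding M_def
    by (rule gen_least[OF s.M_sg]) (auto intro: s.com_M s.A_G s.B_G)
  ultimately show ?thesis by blast
qed

section \<open>The primary components of the commutator subgroup\<close>

definition Mp :: "nat \<Rightarrow> 'g set" where "Mp p = {x \<in> M. el {p} x}"

lemma Mp_M: "x \<in> Mp p \<Longrightarrow> x \<in> M" and Mp_el: "x \<in> Mp p \<Longrightarrow> el {p} x"
  by (auto simp: Mp_def)

lemma Mp_sg: "sg (Mp p)"
  by (rule sgI) (auto simp: Mp_def intro: sg_one sg_mult sg_inv M_sg el_mult M_comm el_inv)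

lemma Mp_normal: "x \<in> Mp p \<Longrightarrow> g \<in> G \<Longrightarrow> cj x g \<in> Mp p"
  by (auto simp: Mp_def M_normal el_cj)

lemma abn_M:
  assumes "sg N" "N \<subseteq> M" "\<And>x. x \<in> N \<Longrightarrow> cj x g \<in> N"
  shows "abn N g"
  using assms M_comm by unfold_locales blast+

lemma abn_Mp: "g \<in> G \<Longrightarrow> abn (Mp p) g"
  by (rule abn_M) (auto simp: Mp_sg Mp_normal Mp_M)

lemma act_act:
  assumes "x \<in> M" "g \<in> G" "h \<in> G"
  shows "act g q (act h r x) = act h r (act g q x)"
proof -
  interpret g: abn M g by (rule abn_M) (use assms M_sg M_normal in auto)
  interpret h: abn M h by (rule abn_M) (use assms M_sg M_normal in auto)
  show ?thesis using assms
  proof (induction r)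
    case (pCons c r)
    have "act g q (act h (pCons c r) x) = act g q (x powi c) * act g q (cj (act h r x) h)"
      unfolding act_pCons using pCons
      by (intro g.act_hom) (auto intro: sg_powi M_sg M_normal h.act_closed)
    also have "act g q (cj (act h r x) h) = cj (act g q (act h r x)) h"
      using pCons by (intro g.act_cj) (auto simp: M_cj_commute h.act_closed)
    also have "act g q (x powi c) = act g q x powi c"
      using pCons g.act_mult[of x q "[:c:]"] g.act_mult[of x "[:c:]" q]
      by (simp add: act_const g.act_smult)
    finally show ?case using pCons by (simp add: act_pCons)
  qed simp
qed

lemma cj_com_M:
  assumes "x \<in> M" "g \<in> G" "h \<in> G"
  shows "cj (com x g) h = com (cj x h) g"
  using assms by (simp add: com_alt(1) M_cj_commute)

end

lemma act_fixed: "cj w b = w \<Longrightarrow> act b q w = w powi (poly q 1)"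
  by (induction q) (simp_all add: act_pCons cj_powi powi_add)

text \<open>The derivative at 1 is the sum \<open>0 + 1 + ... + (n-1)\<close>; doubling it avoids a
  division.\<close>

lemma poly_pderiv_nrm: "2 * poly (pderiv (nrm n)) 1 = int n * (int n - 1)"
proof (induction n)
  case (Suc n)
  have "pderiv (nrm (Suc n)) = nrm n + [:0, 1:] * pderiv (nrm n)"
    by (simp add: pderiv_add pderiv_pCons)
  then have "2 * poly (pderiv (nrm (Suc n))) 1 = 2 * int n + 2 * poly (pderiv (nrm n)) 1"
    by (simp add: nrm_at_one)
  then show ?case unfolding Suc by (simp add: algebra_simps)
qed simp

text \<open>Differentiating the expansion at 1 gives \<open>g(1) = p (p - 1) / 2\<close>, a multiple
  of \<open>p\<close> for odd \<open>p\<close>. The exclusion of the prime 2 in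
  \<open>W_socle\<close> and the conclusion of \<open>p_eq_2\<close> originate here.\<close>

lemma nrm_expand2:
  assumes "is_prime p" "p \<noteq> 2"
  shows "\<exists>g. nrm p = [:int p:] + [:-1, 1:] * g \<and> int p dvd poly g 1"
proof -
  obtain g where g: "nrm p = [:int p:] + [:-1, 1:] * g" using nrm_expand by blast
  have "pderiv (nrm p) = [:-1, 1:] * pderiv g + g"
    unfolding g pderiv_add pderiv_mult by (simp add: pderiv_pCons)
  then have "poly (pderiv (nrm p)) 1 = poly g 1" by simp
  then have "2 * poly g 1 = int p * (int p - 1)" using poly_pderiv_nrm[of p] by simp
  then have "int p dvd 2 * poly g 1" by simp
  moreover have "\<not> int p dvd 2" using assms
    by (metis int_dvd_int_iff of_nat_numeral primes_dvd_imp_eq two_is_prime_nat)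
  ultimately have "int p dvd poly g 1" using assms(1)
    by (metis prime_dvd_multD prime_int_nat_transfer prime_nat_int_transfer)
  then show ?thesis using g by blast
qed

lemma cj_inj [simp]: "cj x g = cj y g \<longleftrightarrow> x = y"
  by (simp add: cj_def)

lemma cyclic_p_comparable:
  assumes p: "is_prime p" and u: "el {p} u"
  shows "(\<exists>k. u ^ i = (u ^ j) ^ k) \<or> (\<exists>k. u ^ j = (u ^ i) ^ k)"
proof (cases "i = 0 \<or> j = 0")
  case True
  then show ?thesis by (metis power_0)
next
  case False
  have *: "\<exists>k. u ^ (p ^ b * j') = (u ^ (p ^ a * i')) ^ k" if ab: "a \<le> b" "\<not> p dvd i'" for a b i' j'
  proof -
    obtain l where l: "u ^ (p ^ a) = ((u ^ (p ^ a)) ^ i') ^ l"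
      using p_pow_gen[OF p el_pow[OF u] ab(2)] by blast
    have "u ^ (p ^ b * j') = (u ^ (p ^ a)) ^ (p ^ (b - a) * j')"
      using ab(1) by (metis le_add_diff_inverse mult.assoc power_add power_mult)
    also have "\<dots> = (((u ^ (p ^ a)) ^ i') ^ l) ^ (p ^ (b - a) * j')" using l by simp
    also have "\<dots> = (u ^ (p ^ a * i')) ^ (l * (p ^ (b - a) * j'))"
      by (simp only: power_mult)
    finally show ?thesis by blast
  qed
  obtain a i' where "i = p ^ a * i'" "\<not> p dvd i'"
    using prime_power_canonical[OF p, of i] False by (metis mult.commute neq0_conv)
  moreover obtain b j' where "j = p ^ b * j'" "\<not> p dvd j'"
    using prime_power_canonical[OF p, of j] False by (metis mult.commute neq0_conv)
  ultimately show ?thesis using *[of a b i' j'] *[of b a j' i'] by (metis nat_le_linear)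
qed

lemma locally_cyclic_uniserial:
  assumes p: "is_prime p" and D: "\<And>x. x \<in> D \<Longrightarrow> el UNIV x"
    "\<And>x y. x \<in> D \<Longrightarrow> y \<in> D \<Longrightarrow> \<exists>z\<in>D. \<exists>i j. x = z ^ i \<and> y = z ^ j"
  shows "uniserial {x \<in> D. el {p} x}"
  unfolding uniserial_def
proof (intro ballI)
  fix x y assume "x \<in> {x \<in> D. el {p} x}" "y \<in> {x \<in> D. el {p} x}"
  then have xy: "x \<in> D" "y \<in> D" "el {p} x" "el {p} y" by auto
  then obtain z i j where z: "z \<in> D" "x = z ^ i" "y = z ^ j" using D(2) by blast
  obtain e f where ef: "z = z ^ e * z ^ f" "el {p} (z ^ e)" "el (-{p}) (z ^ f)"
    using el_split[OF D(1)[OF z(1)], of "{p}"] by blast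
  have *: "z ^ k = (z ^ e) ^ k" if "el {p} (z ^ k)" for k
  proof (rule comm_split_unique)
    show "z ^ k = z ^ k * 1" by simp
    have c: "z ^ e * z ^ f = z ^ f * z ^ e" by (simp add: add.commute flip: power_add)
    show "z ^ k = (z ^ e) ^ k * (z ^ f) ^ k"
      using ef(1) power_mult_commuting[OF c] by metis
    show "(z ^ e) ^ k * (z ^ f) ^ k = (z ^ f) ^ k * (z ^ e) ^ k"
      by (simp add: add.commute flip: power_add power_mult)
    show "el {p} (z ^ k)" by (rule that)
    show "el {p} ((z ^ e) ^ k)" "el (-{p}) ((z ^ f) ^ k)" using ef el_pow by blast+
  qed simp_all
  show "(\<exists>k. x = y ^ k) \<or> (\<exists>k. y = x ^ k)"
    using cyclic_p_comparable[OF p ef(2), of i j] * xy z by metis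
qed

locale prod_lc = factorized +
  assumes periodic: "\<And>g. g \<in> G \<Longrightarrow> el UNIV g"
    and A_lc: "\<And>x y. x \<in> A \<Longrightarrow> y \<in> A \<Longrightarrow> \<exists>z\<in>A. \<exists>i j. x = z ^ i \<and> y = z ^ j"
    and B_lc: "\<And>x y. x \<in> B \<Longrightarrow> y \<in> B \<Longrightarrow> \<exists>z\<in>B. \<exists>i j. x = z ^ i \<and> y = z ^ j"
begin

lemma swap_lc: "prod_lc B A"
proof -
  interpret s: factorized B A by (rule swap)
  show ?thesis
    by unfold_locales (use periodic A_lc B_lc in \<open>auto simp: swap_G\<close>)
qed

lemma A_uniserial: "is_prime p \<Longrightarrow> uniserial {x \<in> A. el {p} x}"
  by (rule locally_cyclic_uniserial) (simp_all only: periodic A_G A_lc)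

lemma B_uniserial: "is_prime p \<Longrightarrow> uniserial {x \<in> B. el {p} x}"
  by (rule locally_cyclic_uniserial) (simp_all only: periodic B_G B_lc)

end

section \<open>The sections of the commutator subgroup are locally cyclic\<close>

text \<open>These are the properties of \<open>[M\<^sub>p, a]\<close> on which the crossed
  homomorphism rests. \<open>T_A\<close> makes the representative \<open>t\<close> of a coset
  \<open>A t\<close> unique.\<close>

locale p_section = prod_lc +
  fixes p :: nat and T
  assumes p: "is_prime p" and T_sg: "sg T" and T_Mp: "\<And>t. t \<in> T \<Longrightarrow> t \<in> Mp p"
    and T_normal: "\<And>t g. t \<in> T \<Longrightarrow> g \<in> G \<Longrightarrow> cj t g \<in> T"
    and T_A: "\<And>t. t \<in> T \<Longrightarrow> t \<in> A \<Longrightarrow> t = 1"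
begin

lemma T_M: "t \<in> T \<Longrightarrow> t \<in> M"
  using T_Mp Mp_M by blast

lemma T_G: "t \<in> T \<Longrightarrow> t \<in> G"
  using T_M M_G by blast

lemma T_comm: "t \<in> T \<Longrightarrow> u \<in> T \<Longrightarrow> t * u = u * t"
  by (rule M_comm) (auto intro: T_M)

lemma T_el: "t \<in> T \<Longrightarrow> el {p} t"
  using T_Mp Mp_el by blast

lemma abn_T: "g \<in> G \<Longrightarrow> abn T g"
  by (rule abn_M) (auto intro: T_sg T_M T_normal)

text \<open>A \<open>p'\<close>-element of \<open>B\<close> in \<open>AT\<close> is conjugate under \<open>T\<close> to an element of \<open>A\<close>, and by
  factorizing the conjugating element it is equal to it.\<close>

lemma p'_elements_in_A:
  assumes e: "e \<in> B" "a \<in> A" "t \<in> T" "e = a * t" "el (-{p}) e"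
  shows "e \<in> A"
proof -
  interpret abn T a using e by (intro abn_T A_G)
  obtain n where n: "0 < n" "coprime n p" "e ^ n = 1"
    using e(5) el_p'_iff[OF p] by blast
  have "a ^ n * act a (nrm n) t = 1"
    using power_mult_act[OF e(3), of n] n(3) e(4) by simp
  then have "inverse (a ^ n) = act a (nrm n) t" by (rule inv_unique)
  moreover have "inverse (a ^ n) \<in> A" using e A_sg sg_inv sg_pow by metis
  moreover have "act a (nrm n) t \<in> T" using act_closed e(3) by simp
  ultimately have "inverse (a ^ n) = 1" using T_A by metis
  then have an: "a ^ n = 1" by (simp only: inv_eq_one_iff)
  obtain k where k: "t ^ (p ^ k) = 1" using T_el[OF e(3)] el_p_iff[OF p] by blast
  have "coprime (p ^ k) n" using n(2) by (simp add: coprime_commute)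
  \<comment> \<open>Conjugation by \<open>inverse y\<close> absorbs the commutator
    \<open>[y, a]\<close>, so \<open>e\<close> is conjugate to \<open>a * c\<close> with commuting
    factors. Since \<open>e\<close> and \<open>a\<close> have exponent \<open>n\<close>, so does the
    \<open>p\<close>-element \<open>c\<close>, which is therefore trivial.\<close>
  then obtain c y where cy: "c \<in> T" "y \<in> T" "t = c * com y a" "cj c a = c"
    using coprime_decomp[OF e(3) k, of n] an prime_gt_0_nat[OF p] by auto
  let ?y = "inverse y"
  have y': "?y \<in> T" using cy T_sg sg_inv by blast
  have "cj (a * c) ?y = cj a ?y * c"
    using T_comm[OF cy(1) y'] by (simp add: cj_eqI)
  also have "cj a ?y = a * com y a"
    unfolding cj_com[of a] com_inv[of ?y a, symmetric] com_inverse[OF cy(2)] by simp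
  also have "a * com y a * c = e"
    unfolding e(4) cy(3) using T_comm[OF cy(1) com_closed[OF cy(2)]] by (simp add: mult.assoc)
  finally have conj: "cj (a * c) ?y = e" .
  then have "cj ((a * c) ^ n) ?y = 1" using n(3) by (simp only: cj_pow)
  then have "(a * c) ^ n = 1" by (simp only: cj_eq_one)
  moreover have "a * c = c * a" using cy(4) by (simp only: cj_fix_iff)
  ultimately have "c ^ n = 1" using power_mult_commuting[of a c n] an by simp
  moreover have "el {p} c" using T_el cy(1) by blast
  ultimately have "c = 1"
    using el_coprime[of "{p}" c "-{p}"] el_p'_iff[OF p, of c] n by blast
  then have conj: "cj a ?y = e" using conj by simp
  obtain a1 b1 where ab: "a1 \<in> A" "b1 \<in> B" "?y = a1 * b1" using T_G[OF y'] by (elim G_cases)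
  have "e = cj (cj a a1) b1" using conj ab by (simp add: cj_cj)
  also have "cj a a1 = a" using A_comm[OF e(2) ab(1)] by (rule cj_eqI)
  finally have "cj e b1 = cj a b1" using B_comm[OF e(1) ab(2)] by (simp add: cj_eqI)
  then show ?thesis using e(2) by simp
qed

text \<open>The relation \<open>D\<close> is the graph of a crossed homomorphism from the \<open>p\<close>-elements of \<open>B\<close> in \<open>AT\<close>
  onto \<open>T\<close>; on the preimage of \<open>W\<close> it is a homomorphism, so that \<open>W\<close> inherits from \<open>B\<close> that
  its subgroups form a chain.\<close>

definition D :: "'a \<Rightarrow> 'a \<Rightarrow> bool" where
  "D b t \<longleftrightarrow> b \<in> B \<and> el {p} b \<and> t \<in> T \<and> b * inverse t \<in> A"

lemma D_B: "D b t \<Longrightarrow> b \<in> B" and D_el: "D b t \<Longrightarrow> el {p} b" and D_T: "D b t \<Longrightarrow> t \<in> T"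
  and D_A: "D b t \<Longrightarrow> b * inverse t \<in> A"
  by (auto simp: D_def)

lemma D_G: "D b t \<Longrightarrow> b \<in> G"
  using D_B B_G by blast

lemma D_unique:
  assumes "D b t" "D b u"
  shows "t = u"
proof -
  have "inverse (b * inverse t) * (b * inverse u) \<in> A"
    using assms by (intro sg_mult sg_inv A_sg D_A)
  then have "t * inverse u \<in> A" by (simp add: mult.assoc)
  moreover have "t * inverse u \<in> T" using assms by (intro sg_mult sg_inv T_sg D_T)
  ultimately have "t * inverse u = 1" using T_A by blast
  then show ?thesis by (metis inv_unique inv_inv inv_eq_iff)
qed

lemma D_one: "b \<in> A \<Longrightarrow> D b t \<Longrightarrow> t = 1"
  using D_unique[of b t 1] by (auto simp: D_def intro: sg_one T_sg)

text \<open>The cocycle law. As \<open>c\<close> and \<open>c * inverse u\<close> act alike on the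
  abelian group \<open>T\<close>, the element to be placed in \<open>A\<close> is the product of
  \<open>b * inverse t\<close> and \<open>c * inverse u\<close>.\<close>

lemma D_mult:
  assumes "D b t" "D c u"
  shows "D (b * c) (cj t c * u)"
proof -
  let ?a = "c * inverse u"
  have *: "cj (inverse t) c = cj (inverse t) ?a"
  proof -
    have t: "cj (inverse t) ?a \<in> T"
      using assms by (intro T_normal sg_inv T_sg A_G D_A D_T)
    have "cj (cj (inverse t) ?a) u = cj (inverse t) ?a"
      using T_comm[OF t D_T[OF assms(2)]] by (rule cj_eqI)
    then show ?thesis by (simp only: cj_cj mult.assoc left_inv mult_1_right)
  qed
  have "b * c * inverse (cj t c * u) = b * ?a * cj (inverse t) c"
    by (simp add: mult.assoc)
  also have "\<dots> = (b * inverse t) * ?a"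
    unfolding * by (simp add: cj_def mult.assoc)
  finally have "b * c * inverse (cj t c * u) \<in> A" using assms by (simp add: sg_mult A_sg D_A)
  moreover have "cj t c * u \<in> T" using assms by (intro sg_mult T_sg T_normal D_T D_G)
  moreover have "el {p} (b * c)" using assms by (intro el_mult B_comm D_el D_B)
  ultimately show ?thesis using assms unfolding D_def by (simp add: sg_mult B_sg)
qed

lemma D_pow:
  assumes "D b t"
  shows "D (b ^ n) (act b (nrm n) t)"
proof (induction n)
  case 0
  then show ?case by (simp add: D_def sg_one A_sg B_sg T_sg)
next
  case (Suc n)
  interpret abn T b using assms by (intro abn_T D_G)
  have t: "t \<in> T" using assms by (rule D_T)
  have "D (b ^ n * b) (cj (act b (nrm n) t) b * t)" using Suc assms by (rule D_mult)
  also have "cj (act b (nrm n) t) b * t = t * cj (act b (nrm n) t) b"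
    using t by (intro T_comm M_cj act_closed)
  also have "\<dots> = act b (nrm (Suc n)) t"
    using t by (simp only: nrm.simps act_add act_mult act_x act_1)
  finally show ?case by (simp only: power_Suc2)
qed

text \<open>Write \<open>t = a * c\<close>. All powers of \<open>c = inverse a * t\<close> stay in
  \<open>A T\<close>, so the \<open>p'\<close>-part of \<open>c\<close> lies in \<open>A\<close> by
  \<open>p'_elements_in_A\<close>, and the \<open>p\<close>-part is the required partner of
  \<open>t\<close>.\<close>

lemma D_ex:
  assumes t: "t \<in> T"
  obtains b where "D b t"
proof -
  obtain a c where ac: "a \<in> A" "c \<in> B" "t = a * c" using T_G[OF t] by (elim G_cases)
  let ?a = "inverse a"
  have a: "?a \<in> A" using ac A_sg sg_inv by blast
  interpret abn T ?a using a by (intro abn_T A_G)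
  have c: "c = ?a * t" using ac by simp
  obtain i j where ij: "c = c ^ i * c ^ j" "el {p} (c ^ i)" "el (-{p}) (c ^ j)"
    using el_split[OF periodic[OF B_G[OF ac(2)]], of "{p}"] by blast
  have "c ^ j = ?a ^ j * act ?a (nrm j) t"
    unfolding c by (rule power_mult_act[OF t])
  moreover have "?a ^ j \<in> A" "act ?a (nrm j) t \<in> T" "c ^ j \<in> B"
    using a ac(2) t by (simp_all add: sg_pow A_sg B_sg act_closed)
  ultimately have cj: "c ^ j \<in> A"
    using p'_elements_in_A[of "c ^ j" "?a ^ j" "act ?a (nrm j) t"] ij(3) by simp
  have "c ^ i * c ^ j = c ^ j * c ^ i" by (simp add: add.commute flip: power_add)
  then have eq: "c ^ j * c ^ i = c" using ij(1) by metis
  have "c ^ i = inverse (c ^ j) * (c ^ j * c ^ i)"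
    by (rule inv_cancel_left[symmetric])
  also have "\<dots> = inverse (c ^ j) * (?a * t)" unfolding eq by (rule arg_cong[OF c])
  finally have "c ^ i * inverse t = inverse (c ^ j) * ?a"
    by (simp only: mult.assoc right_inv mult_1_right)
  then have "c ^ i * inverse t \<in> A" using cj a A_sg sg_inv sg_mult by metis
  then show ?thesis using that[of "c ^ i"] ij(2) ac(2) t unfolding D_def by (simp add: sg_pow B_sg)
qed

lemma D_comparable: "D b t \<Longrightarrow> D c u \<Longrightarrow> (\<exists>k. b = c ^ k) \<or> (\<exists>k. c = b ^ k)"
  using uniserialD[OF B_uniserial[OF p], of b c] by (auto simp: D_def)

definition W :: "'a set" where
  "W = {w \<in> T. w ^ p = 1 \<and> (\<forall>b t. D b t \<longrightarrow> cj w b = w)}"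

lemma W_fixed_pow:
  assumes "w \<in> W" "D c w"
  shows "D (c ^ k) (w ^ k)"
proof -
  have "cj w c = w" using assms by (auto simp: W_def)
  then have "act c (nrm k) w = w ^ k" by (simp add: act_fixed nrm_at_one)
  then show ?thesis using D_pow[OF assms(2), of k] by simp
qed

lemma W_sg: "sg W"
proof (rule sgI)
  show "1 \<in> W" by (simp add: W_def sg_one T_sg)
next
  fix x y assume xy: "x \<in> W" "y \<in> W"
  then have T: "x \<in> T" "y \<in> T" by (auto simp: W_def)
  show "x * y \<in> W"
    using xy sg_mult[OF T_sg T] power_mult_commuting[OF T_comm[OF T], of p] by (auto simp: W_def)
next
  fix x assume "x \<in> W"
  then show "inverse x \<in> W" by (auto simp: W_def sg_inv T_sg simp flip: inv_power)
qed

lemma W_uniserial: "uniserial W"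
  unfolding uniserial_def
proof (intro ballI)
  fix w u assume wu: "w \<in> W" "u \<in> W"
  then have T: "w \<in> T" "u \<in> T" by (auto simp: W_def)
  obtain b c where bc: "D b w" "D c u" using D_ex T by metis
  from D_comparable[OF bc] show "(\<exists>k. w = u ^ k) \<or> (\<exists>k. u = w ^ k)"
  proof (elim disjE exE)
    fix k assume "b = c ^ k"
    then have "w = u ^ k" using W_fixed_pow[OF wu(2) bc(2), of k] bc D_unique by blast
    then show ?thesis by blast
  next
    fix k assume "c = b ^ k"
    then have "u = w ^ k" using W_fixed_pow[OF wu(1) bc(1), of k] bc D_unique by blast
    then show ?thesis by blast
  qed
qed

text \<open>An element outside \<open>W\<close> whose partner in \<open>B\<close> has least order lies in the second layer of
  the upper central series of \<open>T\<close>: otherwise \<open>x = \<theta> (b - 1) x\<close> for some \<open>b\<close> and an operator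
  \<open>\<theta>\<close> that commutes with the nilpotent operator \<open>b - 1\<close>.\<close>

lemma second_layer:
  assumes w: "w \<in> T" "w ^ p = 1" "w \<notin> W"
  obtains c x where "D c x" "x ^ p = 1" "x \<notin> W" "\<And>b t. D b t \<Longrightarrow> com x b \<in> W"
proof -
  define P where "P k \<longleftrightarrow> (\<exists>c x. D c x \<and> x ^ p = 1 \<and> x \<notin> W \<and> c ^ (p ^ k) = 1)" for k
  obtain b where b: "D b w" using D_ex w by metis
  then obtain k where "b ^ (p ^ k) = 1" using D_el el_p_iff[OF p] by metis
  then have "P k" using b w by (auto simp: P_def)
  define m where "m = (LEAST k. P k)"
  have "P m" unfolding m_def using \<open>P k\<close> by (rule LeastI)
  then obtain c x where cx: "D c x" "x ^ p = 1" "x \<notin> W" "c ^ (p ^ m) = 1" by (auto simp: P_def)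
  have x: "x \<in> T" using cx D_T by blast
  have m0: "m \<noteq> 0"
  proof
    assume "m = 0"
    then have "c \<in> A" using cx(4) sg_one[OF A_sg] by simp
    then have "x = 1" using cx(1) D_one by blast
    then show False using cx(3) W_sg sg_one by blast
  qed
  have "com x b \<in> W" if bt: "D b t" for b t
  proof (rule ccontr)
    assume nW: "com x b \<notin> W"
    interpret abn T b using bt by (intro abn_T D_G)
    have f: "com x b \<in> T" "com x b ^ p = 1"
      using x cx(2) by (simp_all add: com_closed flip: com_pow)
    obtain d where d: "D d (com x b)" using D_ex f by metis
    \<comment> \<open>The partner \<open>d\<close> of \<open>[x, b]\<close> is comparable with
      \<open>c\<close>. It cannot be a power of \<open>c^p\<close>, because \<open>[x, b]\<close> is
      outside \<open>W\<close> and \<open>c\<close> has least order among the partners of such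
      elements.\<close>
    have "\<exists>l. c = d ^ l"
    proof (rule ccontr)
      assume n: "\<nexists>l. c = d ^ l"
      then obtain l where l: "d = c ^ l" using D_comparable[OF cx(1) d] by blast
      show False
      proof (cases "p dvd l")
        case True
        have "p ^ m = p * p ^ (m - 1)" using m0 by (cases m) auto
        then have "p ^ m dvd l * p ^ (m - 1)" using True by simp
        then have "c ^ (l * p ^ (m - 1)) = 1" by (rule power_one_dvd[OF cx(4)])
        then have "d ^ (p ^ (m - 1)) = 1" unfolding l power_mult[symmetric] .
        then have "P (m - 1)" using d f nW by (auto simp: P_def)
        then show False using m0 not_less_Least[of "m - 1" P] by (simp add: m_def)
      next
        case False
        then show False using p_pow_gen[OF p D_el[OF cx(1)] False] l n by blast
      qed
    qed
    then obtain l where l: "c = d ^ l" ..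
    define q where "q = nrm l"
    have xq: "x = act d q (com x b)"
      using D_pow[OF d, of l] cx(1) l D_unique by (simp add: q_def)
    have dG: "d \<in> G" using d D_G by blast
    have bG: "b \<in> G" using bt D_G by blast
    interpret d: abn T d using dG by (rule abn_T)
    let ?F = "[:-1, 1:] :: int poly"
    have iter: "x = act d (q ^ n) (act b (?F ^ n) x)" for n
    proof (induction n)
      case (Suc n)
      have "act d (q ^ Suc n) (act b (?F ^ Suc n) x) =
          act d (q ^ n) (act d q (act b (?F ^ n) (com x b)))"
        using x f by (simp only: power_Suc2 act_mult d.act_mult act_com act_closed)
      also have "act d q (act b (?F ^ n) (com x b)) = act b (?F ^ n) (act d q (com x b))"
        using f dG bG by (intro act_act T_M)
      also have "act d q (com x b) = x" using xq by (rule sym)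
      finally show ?case using Suc by simp
    qed simp
    obtain j where j: "b ^ (p ^ j) = 1" using bt D_el el_p_iff[OF p] by metis
    \<comment> \<open>The factor 1 is the exponent in \<open>x ^ (p ^ 1) = 1\<close>, in the form
      that \<open>unipotent\<close> expects.\<close>
    have "act b (?F ^ (p ^ j * 1)) x = 1"
      using x cx(2) j by (intro unipotent p) simp_all
    then have "x = 1" using iter[of "p ^ j * 1"] by (simp only: act_one_right)
    then show False using cx(3) W_sg sg_one by blast
  qed
  then show ?thesis using that cx by blast
qed

text \<open>A nontrivial \<open>T\<close> has an element of order \<open>p\<close>. It is outside
  \<open>W = {1}\<close>, so \<open>second_layer\<close> yields another such element whose
  commutators with the domain of \<open>D\<close> are trivial; but that one belongs to
  \<open>W\<close>.\<close>

lemma W_trivial: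
  assumes "W = {1}" "t \<in> T"
  shows "t = 1"
proof (rule ccontr)
  assume "t \<noteq> 1"
  then obtain i where i: "t ^ i \<noteq> 1" "(t ^ i) ^ p = 1"
    using order_p_power[OF p T_el[OF assms(2)]] by blast
  then obtain c x where cx: "D c x" "x ^ p = 1" "x \<notin> W" "\<And>b t. D b t \<Longrightarrow> com x b \<in> W"
    using second_layer[of "t ^ i"] assms sg_pow[OF T_sg] by auto
  then have "cj x b = x" if "D b s" for b s
    using that assms(1) by (auto simp: cj_com)
  then have "x \<in> W" using cx D_T by (auto simp: W_def)
  then show False using cx by simp
qed

text \<open>For a counterexample \<open>x\<close> from the second layer, \<open>y = [x, c]\<close>
  is fixed by \<open>c\<close>, so by \<open>nrm_expand2\<close> the partner of \<open>c^p\<close>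
  in \<open>T\<close> is \<open>x^p y^(g(1)) = 1\<close>, and \<open>c^p\<close> lies in
  \<open>A\<close>. A nontrivial \<open>w\<close> in \<open>W\<close> has a partner comparable with
  \<open>c\<close> but not generating it, hence a power of \<open>c^p\<close>. So this partner is in
  \<open>A\<close>, forcing \<open>w = 1\<close>.\<close>

lemma W_socle:
  assumes p2: "p \<noteq> 2" and t: "t \<in> T" "t ^ p = 1"
  shows "t \<in> W"
proof (rule ccontr)
  assume "t \<notin> W"
  then obtain c x where cx: "D c x" "x ^ p = 1" "x \<notin> W" "\<And>b t. D b t \<Longrightarrow> com x b \<in> W"
    using second_layer t by metis
  have x: "x \<in> T" using cx D_T by blast
  interpret abn T c using cx(1) by (intro abn_T D_G)
  define y where "y = com x c"
  have y: "y \<in> W" using cx by (simp add: y_def)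
  then have yc: "cj y c = y" "y ^ p = 1" using cx(1) by (auto simp: W_def)
  obtain g where g: "nrm p = [:int p:] + [:-1, 1:] * g" "int p dvd poly g 1"
    using nrm_expand2[OF p p2] by blast
  have "act c (nrm p) x = x powi int p * act c g y"
    unfolding g(1) mult.commute[of _ g] using x by (simp only: act_add act_mult act_com act_const y_def)
  also have "x powi int p = 1" using cx(2) by simp
  also have "act c g y = 1"
  proof -
    obtain r where "poly g 1 = int p * r" using g(2) by (auto simp: dvd_def)
    then show ?thesis using yc by (simp add: act_fixed powi_mult)
  qed
  finally have "D (c ^ p) 1" using D_pow[OF cx(1), of p] by simp
  then have cp: "c ^ p \<in> A" using D_A by fastforce
  have "x \<noteq> 1" using cx(3) W_sg sg_one by blast
  then have "W \<noteq> {1}" using W_trivial x by blast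
  then obtain w where w: "w \<in> W" "w \<noteq> 1" using W_sg sg_one by blast
  then have "w \<in> T" by (auto simp: W_def)
  then obtain d where d: "D d w" using D_ex by metis
  have contra: "\<nexists>l. c = d ^ l"
  proof
    assume "\<exists>l. c = d ^ l"
    then obtain l where "c = d ^ l" ..
    then have "x = w ^ l" using W_fixed_pow[OF w(1) d] cx(1) D_unique by blast
    then show False using cx(3) w W_sg sg_pow by blast
  qed
  then obtain l where l: "d = c ^ l" using D_comparable[OF cx(1) d] by blast
  have "p dvd l"
  proof (rule ccontr)
    assume "\<not> p dvd l"
    then show False using p_pow_gen[OF p D_el[OF cx(1)]] l contra by blast
  qed
  then have "d = (c ^ p) ^ (l div p)" unfolding l by (simp flip: power_mult)
  then have "d \<in> A" using cp A_sg sg_pow by metis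
  then show False using D_one d w by blast
qed

lemma T_uniserial:
  assumes "p \<noteq> 2"
  shows "uniserial T"
proof (cases "W = {1}")
  case True
  then show ?thesis using W_trivial unfolding uniserial_def by (metis power_0)
next
  case False
  then obtain w where w: "w \<in> W" "w \<noteq> 1" using W_sg sg_one by blast
  then have "w ^ p = 1" by (auto simp: W_def)
  show ?thesis
  proof (rule uniserial_of_socle[OF p T_sg T_comm T_el])
    fix x assume "x \<in> T" "x ^ p = 1"
    then have "x \<in> W" using W_socle assms by blast
    then show "\<exists>k. x = w ^ k"
      using uniserial_socle_gen[OF W_uniserial p w(1) _ w(2) \<open>w ^ p = 1\<close>] \<open>x ^ p = 1\<close> by blast
  qed (use \<open>w ^ p = 1\<close> in auto)
qed

text \<open>The uniserial group \<open>W\<close> has at most one involution, and \<open>a\<close>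
  would have to fix it. Hence \<open>W\<close> is trivial, and \<open>T\<close> with it.\<close>

lemma T_trivial_2:
  assumes "p = 2" "a \<in> A" "\<And>t. t \<in> T \<Longrightarrow> cj t a = t \<Longrightarrow> t = 1" "t \<in> T"
  shows "t = 1"
proof (rule W_trivial)
  show "W = {1}"
  proof (rule ccontr)
    assume "W \<noteq> {1}"
    then obtain w where w: "w \<in> W" "w \<noteq> 1" using W_sg sg_one by blast
    then have wT: "w \<in> T" "w ^ p = 1" by (auto simp: W_def)
    have "cj w a \<in> W" unfolding W_def
    proof (safe)
      show "cj w a \<in> T" using wT assms(2) by (intro T_normal A_G)
      show "cj w a ^ p = 1" using wT(2) by (simp flip: cj_pow)
      fix b t assume bt: "D b t"
      have "cj (cj w a) b = cj (cj w b) a"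
        using wT(1) assms(2) bt by (intro M_cj_commute T_M A_G D_G)
      then show "cj (cj w a) b = cj w a" using w(1) bt by (auto simp: W_def)
    qed
    moreover from this have "cj w a ^ p = 1" unfolding W_def by blast
    ultimately obtain k where k: "cj w a = w ^ k"
      using uniserial_socle_gen[OF W_uniserial p w(1) _ w(2) wT(2)] by blast
    have "odd k"
    proof
      assume "even k"
      then have "w ^ k = 1" using wT(2) assms(1) power_one_dvd by metis
      then show False using k w by simp
    qed
    then have "w ^ k = w ^ 1" using assms(1)
      by (intro power_eq_cong[OF wT(2)]) (simp add: odd_iff_mod_2_eq_one)
    then show False using k w wT assms(3) by simp
  qed
qed (rule assms)

end

section \<open>The subgroups of commutators of M_p with a p'-element of A\<close>

context prod_lc
begin

text \<open>No \<open>gen\<close> is required for \<open>a\<close> in \<open>G\<close>: as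
  \<open>M\<^sub>p\<close> is abelian and normal, these commutators are the image of the
  endomorphism \<open>a - 1\<close>.\<close>

definition Tc :: "nat \<Rightarrow> 'a \<Rightarrow> 'a set" where "Tc p a = {com x a | x. x \<in> Mp p}"

lemma TcI: "x \<in> Mp p \<Longrightarrow> com x a \<in> Tc p a"
  by (auto simp: Tc_def)

lemma Tc_sg:
  assumes "a \<in> G"
  shows "sg (Tc p a)"
proof -
  interpret abn "Mp p" a using assms by (rule abn_Mp)
  show ?thesis
  proof (rule sgI)
    show "1 \<in> Tc p a" using TcI[OF sg_one[OF Mp_sg], of a p] by simp
  next
    fix x y assume "x \<in> Tc p a" "y \<in> Tc p a"
    then obtain u v where "u \<in> Mp p" "v \<in> Mp p" "x = com u a" "y = com v a" by (auto simp: Tc_def)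
    then show "x * y \<in> Tc p a" using TcI[of "u * v" p a] com_hom sg_mult[OF Mp_sg] by simp
  next
    fix x assume "x \<in> Tc p a"
    then obtain u where "u \<in> Mp p" "x = com u a" by (auto simp: Tc_def)
    then show "inverse x \<in> Tc p a" using TcI[of "inverse u" p a] com_inverse sg_inv[OF Mp_sg] by simp
  qed
qed

lemma Tc_Mp: "a \<in> G \<Longrightarrow> t \<in> Tc p a \<Longrightarrow> t \<in> Mp p"
  using abn.com_closed[OF abn_Mp] by (auto simp: Tc_def)

lemma Tc_normal:
  assumes "a \<in> G" "t \<in> Tc p a" "g \<in> G"
  shows "cj t g \<in> Tc p a"
proof -
  obtain u where u: "u \<in> Mp p" "t = com u a" using assms by (auto simp: Tc_def)
  then have "cj t g = com (cj u g) a" using assms cj_com_M Mp_M by simp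
  then show ?thesis using TcI Mp_normal u assms by simp
qed

lemma Tc_fix:
  assumes p: "is_prime p" and a: "a \<in> G" "el (-{p}) a" and t: "t \<in> Tc p a" "cj t a = t"
  shows "t = 1"
proof -
  interpret abn "Mp p" a using a by (intro abn_Mp)
  obtain n where n: "0 < n" "coprime n p" "a ^ n = 1"
    using a(2) el_p'_iff[OF p] by blast
  obtain u where u: "u \<in> Mp p" "t = com u a" using t by (auto simp: Tc_def)
  have "t \<in> Mp p" using Tc_Mp a t by blast
  then obtain k where k: "t ^ (p ^ k) = 1" using Mp_el el_p_iff[OF p] by metis
  show ?thesis unfolding u(2)
  proof (rule coprime_fix)
    show "coprime (p ^ k) n" using n(2) by (simp add: coprime_commute)
  qed (use u t k n prime_gt_0_nat[OF p] in auto)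
qed

lemma Tc_section:
  assumes p: "is_prime p" and a: "a \<in> A" "el (-{p}) a"
  shows "p_section A B p (Tc p a)"
proof unfold_locales
  fix t assume "t \<in> Tc p a" "t \<in> A"
  then show "t = 1" using a A_comm by (intro Tc_fix[OF p A_G[OF a(1)] a(2)] cj_eqI)
qed (simp_all only: p Tc_sg[OF A_G[OF a(1)]] Tc_Mp[OF A_G[OF a(1)]] Tc_normal[OF A_G[OF a(1)]])

lemma Tc_uniserial:
  assumes "is_prime p" "a \<in> A" "el (-{p}) a"
  shows "uniserial (Tc p a)"
proof -
  interpret p_section A B p "Tc p a" using assms by (rule Tc_section)
  show ?thesis
  proof (cases "p = 2")
    case True
    have "t = 1" if "t \<in> Tc p a" for t
      by (rule T_trivial_2[OF True assms(2) _ that])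
        (rule Tc_fix[OF assms(1) A_G[OF assms(2)] assms(3)])
    then show ?thesis unfolding uniserial_def by (metis power_0)
  qed (rule T_uniserial)
qed

lemma Tc_2:
  assumes "a \<in> A" "el (-{2}) a" "t \<in> Tc 2 a"
  shows "t = 1"
proof -
  interpret p_section A B 2 "Tc 2 a" using assms by (intro Tc_section) auto
  show ?thesis
    by (rule T_trivial_2[OF refl assms(1) _ assms(3)])
      (rule Tc_fix[OF two_is_prime_nat A_G[OF assms(1)] assms(2)])
qed

end

section \<open>Interaction of the two factors on normal p-subgroups\<close>

lemma sg_pow_coprime:
  assumes H: "sg H" and "z ^ m \<in> H" "z ^ n \<in> H" "coprime m n" "0 < m"
  shows "z \<in> H"
proof -
  obtain i j where ij: "i * m = j * n + 1"
    using bezout_nat[of m n] assms by (auto simp: mult.commute)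
  have "z ^ (i * m) \<in> H" "z ^ (j * n) \<in> H"
    using assms sg_pow[OF H] by (metis mult.commute power_mult)+
  moreover have "z ^ (i * m) = z ^ (j * n) * z" unfolding ij by (simp only: power_add power_one_right)
  ultimately show ?thesis using sg_mult_iff[OF H] by metis
qed

text \<open>Modulo \<open>K\<close>, the element \<open>g ^ n\<close> moves \<open>x\<close> by \<open>u ^ n\<close>.\<close>

lemma moved_order:
  assumes K: "sg K" "\<And>k. k \<in> K \<Longrightarrow> cj k g \<in> K" "\<And>k. k \<in> K \<Longrightarrow> u * k = k * u"
    and u: "cj u g = u" and x: "cj x g = x * u * k" "k \<in> K" and n: "g ^ n = 1"
  shows "u ^ n \<in> K"
proof -
  have "\<exists>k'\<in>K. cj x (g ^ i) = x * u ^ i * k'" for i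
  proof (induction i)
    case 0
    then show ?case using sg_one[OF K(1)] by (intro bexI[of _ 1]) simp_all
  next
    case (Suc i)
    then obtain k' where k': "k' \<in> K" "cj x (g ^ i) = x * u ^ i * k'" by blast
    have "u ^ i * k = k * u ^ i"
      using K(3)[OF x(2)] power_commuting_commutes[of u k i] by simp
    moreover have "cj x (g ^ Suc i) = cj (cj x (g ^ i)) g" by (simp only: cj_cj power_Suc2)
    ultimately have "cj x (g ^ Suc i) = x * u ^ Suc i * (k * cj k' g)"
      unfolding k'(2) by (simp add: cj_pow u x(1) mult.assoc)
        (simp flip: mult.assoc)
    moreover have "k * cj k' g \<in> K" using K x(2) k'(1) by (intro sg_mult)
    ultimately show ?case by blast
  qed
  then obtain k' where "k' \<in> K" "x = x * u ^ n * k'" using n by (metis cj_simps(2))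
  then have "inverse (u ^ n) = k'" by (intro inv_unique) (metis mult.assoc mult_1_right mult_left_cancel_iff)
  then show ?thesis using \<open>k' \<in> K\<close> K(1) by (metis inv_inv sg_inv)
qed

lemma locally_cyclic_el:
  assumes "\<And>x. x \<in> D \<Longrightarrow> el UNIV x" "sg D"
    "\<And>x y. x \<in> D \<Longrightarrow> y \<in> D \<Longrightarrow> \<exists>z\<in>D. \<exists>i j. x = z ^ i \<and> y = z ^ j"
    "x \<in> D" "y \<in> D" "el Q x" "el Q y"
  obtains z i j where "z \<in> D" "el Q z" "x = z ^ i" "y = z ^ j"
proof -
  obtain z i j where z: "z \<in> D" "x = z ^ i" "y = z ^ j" using assms(3)[OF assms(4,5)] by blast
  obtain e f where ef: "z = z ^ e * z ^ f" "el Q (z ^ e)" "el (-Q) (z ^ f)"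
    using el_split[OF assms(1)[OF z(1)], of Q] by blast
  have *: "z ^ k = (z ^ e) ^ k" if "el Q (z ^ k)" for k
  proof (rule comm_split_unique)
    show "z ^ k = z ^ k * 1" by simp
    have c: "z ^ e * z ^ f = z ^ f * z ^ e" by (simp add: add.commute flip: power_add)
    show "z ^ k = (z ^ e) ^ k * (z ^ f) ^ k"
      using ef(1) power_mult_commuting[OF c] by metis
    show "(z ^ e) ^ k * (z ^ f) ^ k = (z ^ f) ^ k * (z ^ e) ^ k"
      by (simp add: add.commute flip: power_add power_mult)
    show "el Q (z ^ k)" by (rule that)
    show "el Q ((z ^ e) ^ k)" "el (-Q) ((z ^ f) ^ k)" using ef el_pow by blast+
  qed simp_all
  show ?thesis using that[of "z ^ e" i j] * z assms(6,7) ef(2) sg_pow[OF assms(2) z(1)] by metis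
qed

context factorized
begin

lemma M_pow_mult:
  assumes "g \<in> G" "h \<in> G"
  shows "\<exists>m\<in>M. (g * h) ^ n = g ^ n * h ^ n * m"
proof (induction n)
  case 0
  then show ?case using sg_one[OF M_sg] by (intro bexI[of _ 1]) simp_all
next
  case (Suc n)
  then obtain m where m: "m \<in> M" "(g * h) ^ n = g ^ n * h ^ n * m" by blast
  let ?c = "cj (com (h ^ n) g) h * cj m (g * h)"
  have *: "u * v * m * (g * h) = u * g * (v * h) * (cj (com v g) h * cj m (g * h))" for u v
    by (simp add: com_def cj_def mult.assoc)
  have "(g * h) ^ Suc n = g ^ n * h ^ n * m * (g * h)"
    unfolding power_Suc2 m(2) ..
  also have "\<dots> = g ^ Suc n * h ^ Suc n * ?c"
    unfolding power_Suc2 by (rule *)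
  finally have "(g * h) ^ Suc n = g ^ Suc n * h ^ Suc n * ?c" .
  moreover have "?c \<in> M"
    using assms m by (intro sg_mult M_sg M_normal com_M sg_pow G_sg)
  ultimately show ?case by blast
qed

lemma M_pow_closed:
  assumes "g \<in> G" "h \<in> G" "g ^ n \<in> M" "h ^ n \<in> M"
  shows "(g * h) ^ n \<in> M"
proof -
  obtain m where "m \<in> M" "(g * h) ^ n = g ^ n * h ^ n * m" using M_pow_mult[OF assms(1,2)] by blast
  then show ?thesis using assms(3,4) by (simp only: sg_mult[OF M_sg])
qed

text \<open>Factorizing \<open>w\<close> gives \<open>x\<close> in \<open>A\<close> and
  \<open>c = x * w\<close> in \<open>B\<close>, so \<open>A\<close> fixes \<open>x\<close>,
  \<open>B\<close> fixes \<open>c\<close>, and \<open>G\<close> preserves the coset of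
  \<open>x\<close> modulo \<open>P\<close>, the group generated by \<open>w\<close>. The commutator
  \<open>g = [a, b]\<close> centralizes \<open>P\<close> and acts on the coset as a nontrivial
  translation, so some \<open>g^k\<close> sends \<open>x\<close> to \<open>c\<close>. Writing
  \<open>g^k\<close> as a product from \<open>A\<close> and \<open>B\<close> then gives
  \<open>c = x\<close>.\<close>

lemma prime_normal_centralized:
  assumes p: "is_prime p" and w: "w \<in> G" "w ^ p = 1" "\<And>g. g \<in> G \<Longrightarrow> \<exists>k. cj w g = w ^ k"
    and a: "a \<in> A" "cj w a \<noteq> w" and b: "b \<in> B" "cj w b \<noteq> w"
  shows False
proof -
  define P where "P = range (\<lambda>k. w ^ k)"
  have P_sg: "sg P"
  proof (rule sgI)
    show "1 \<in> P" unfolding P_def by (metis power_0 rangeI)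
    show "x * y \<in> P" if xy: "x \<in> P" "y \<in> P" for x y
    proof -
      obtain k l where "x = w ^ k" "y = w ^ l" using xy unfolding P_def by blast
      then have "x * y = w ^ (k + l)" by (simp only: power_add)
      then show ?thesis unfolding P_def by (rule range_eqI)
    qed
    show "inverse x \<in> P" if x: "x \<in> P" for x
    proof -
      obtain k where "x = w ^ k" using x unfolding P_def by blast
      then have "inverse x = inverse w ^ k" by simp
      also have "inverse w = w ^ (p - 1)"
        using w(2) prime_gt_0_nat[OF p] by (rule inverse_as_power)
      also have "(w ^ (p - 1)) ^ k = w ^ ((p - 1) * k)" by (rule power_mult[symmetric])
      finally show ?thesis unfolding P_def by (rule range_eqI)
    qed
  qed
  have wP: "w \<in> P" unfolding P_def by (metis power_one_right rangeI)
  have P_cj: "cj y g \<in> P" if y: "y \<in> P" and g: "g \<in> G" for y g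
  proof -
    obtain k l where "y = w ^ k" "cj w g = w ^ l" using y w(3)[OF g] unfolding P_def by blast
    then have "cj y g = w ^ (l * k)" by (simp add: cj_pow power_mult)
    then show ?thesis unfolding P_def by (rule range_eqI)
  qed
  have P_comm: "y * z = z * y" if "y \<in> P" "z \<in> P" for y z
    using that unfolding P_def by (auto simp: add.commute simp flip: power_add)
  have P_gen: "\<exists>l. w = y ^ l" if y: "y \<in> P" "y \<noteq> 1" for y
  proof -
    obtain k where k: "y = w ^ k" using y unfolding P_def by blast
    have "\<not> p dvd k" using k y(2) power_one_dvd[OF w(2)] by blast
    then show ?thesis using p_pow_gen[OF p el_p_of_pow[OF p w(2)]] k by blast
  qed
  have P_cj2: "cj y (g * h) = cj y (h * g)" if y: "y \<in> P" and g: "g \<in> G" and h: "h \<in> G" for y g h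
  proof -
    obtain k l m where "y = w ^ k" "cj w g = w ^ l" "cj w h = w ^ m"
      using y w(3)[OF g] w(3)[OF h] unfolding P_def by blast
    then have "cj (cj y g) h = cj (cj y h) g"
      by (simp add: cj_pow mult_ac flip: power_mult)
    then show ?thesis by (simp only: cj_cj)
  qed
  obtain a1 c where ac: "a1 \<in> A" "c \<in> B" "w = a1 * c" using w(1) by (elim G_cases)
  define x where "x = inverse a1"
  have x: "x \<in> A" using ac A_sg sg_inv x_def by blast
  have c: "c = x * w" using ac by (simp add: x_def)
  have xB: "cj x b' = x * (w * cj (inverse w) b')" if "b' \<in> B" for b'
  proof -
    have xc: "x = c * inverse w" using c by (simp add: mult.assoc)
    have "cj x b' = cj c b' * cj (inverse w) b'" by (subst xc) (simp only: cj_simps)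
    also have "cj c b' = c" using B_comm[OF ac(2) that] by (rule cj_eqI)
    finally show ?thesis unfolding c by (simp only: mult.assoc)
  qed
  have xA: "cj x a' = x" if "a' \<in> A" for a'
    using A_comm[OF x that] by (rule cj_eqI)
  have coset: "inverse x * cj x g \<in> P" if g: "g \<in> G" for g
  proof -
    obtain a' b' where ab: "a' \<in> A" "b' \<in> B" "g = a' * b'" using g by (elim G_cases)
    then have "cj x g = cj (cj x a') b'" by (simp only: cj_cj)
    also have "\<dots> = x * (w * cj (inverse w) b')" using ab xA xB by simp
    finally have "inverse x * cj x g = w * cj (inverse w) b'" by simp
    then show ?thesis using ab wP P_sg P_cj B_G by (simp only: sg_mult sg_inv)
  qed
  define g where "g = com a b"
  have gG: "g \<in> G" unfolding g_def using a b by (intro sg_com G_sg A_G B_G)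
  have g_fix: "cj y g = y" if y: "y \<in> P" for y
  proof -
    have "cj y (inverse (b * a)) \<in> P" using y a b by (intro P_cj sg_inv sg_mult G_sg A_G B_G)
    then have "cj (cj y (inverse (b * a))) (a * b) = cj (cj y (inverse (b * a))) (b * a)"
      using a b by (intro P_cj2 A_G B_G)
    then show ?thesis unfolding g_def com_def cj_cj by (simp add: mult.assoc)
  qed
  define v where "v = inverse x * cj x g"
  have vP: "v \<in> P" unfolding v_def using gG by (rule coset)
  \<comment> \<open>If \<open>g\<close> fixed \<open>x\<close>, then \<open>inverse b\<close> would
    move \<open>x\<close> by an element \<open>u\<close> of \<open>P\<close> fixed by
    \<open>a\<close>. Either \<open>u = 1\<close>, and \<open>b\<close> fixes \<open>w\<close>, or
    \<open>u\<close> generates \<open>P\<close>, and \<open>a\<close> fixes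
    \<open>w\<close>.\<close>
  have v1: "v \<noteq> 1"
  proof
    assume "v = 1"
    then have "cj x g = x" unfolding v_def by (metis inv_unique inv_inv inv_eq_iff)
    define u where "u = w * cj (inverse w) (inverse b)"
    have ib: "inverse b \<in> B" using b B_sg sg_inv by blast
    have xb: "cj x (inverse b) = x * u" unfolding u_def using ib by (rule xB)
    have uP: "u \<in> P" unfolding u_def by (rule sg_mult[OF P_sg wP P_cj[OF sg_inv[OF P_sg wP] B_G[OF ib]]])
    have "cj x g = cj (cj (cj (cj x (inverse a)) (inverse b)) a) b"
      by (simp only: g_def com_def cj_cj mult.assoc)
    also have "cj x (inverse a) = x" using a A_sg by (intro xA sg_inv)
    finally have "cj (cj (x * u) a) b = x" using xb \<open>cj x g = x\<close> by simp
    then have "cj (cj (cj (x * u) a) b) (inverse b) = x * u" using xb by simp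
    then have "cj (x * u) a = x * u" unfolding cj_cj by (simp add: mult.assoc)
    then have ua: "cj u a = u" using xA[OF a(1)] by simp
    show False
    proof (cases "u = 1")
      case True
      then have "w = inverse (cj (inverse w) (inverse b))"
        unfolding u_def by (metis inv_inv inv_unique)
      then have "cj w (inverse b) = w" by simp
      then have "cj (cj w (inverse b)) b = cj w b" by simp
      then show False using b(2) by (simp add: cj_cj)
    next
      case False
      then obtain l where "w = u ^ l" using P_gen uP by blast
      then have "cj w a = w" using ua by (simp add: cj_pow)
      then show False using a(2) by simp
    qed
  qed
  have pow: "cj x (g ^ k) = x * v ^ k" for k
  proof (induction k)
    case (Suc k)
    have "cj x (g ^ Suc k) = cj (x * v ^ k) g" using Suc by (simp only: power_Suc2 cj_cj[symmetric])
    also have "\<dots> = x * v * v ^ k" using g_fix[OF vP] by (simp add: cj_pow v_def)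
    finally show ?case by (simp add: mult.assoc)
  qed simp
  obtain k where k: "w = v ^ k" using P_gen vP v1 by blast
  have "g ^ k \<in> G" using gG G_sg sg_pow by blast
  then obtain a' b' where ab: "a' \<in> A" "b' \<in> B" "g ^ k = a' * b'" by (elim G_cases)
  have "c = cj (cj x a') b'" using pow[of k] ab k c by (simp only: cj_cj)
  then have "cj c b' = cj x b'" using xA[OF ab(1)] B_comm[OF ac(2) ab(2)] by (simp add: cj_eqI)
  then have "c = x" by simp
  then have "w = 1" using c by (metis mult_1_right mult_left_cancel_iff)
  then show False using a(2) by simp
qed

definition Mp' :: "nat \<Rightarrow> 'g set" where "Mp' p = {x \<in> M. el (-{p}) x}"

lemma Mp'_M: "x \<in> Mp' p \<Longrightarrow> x \<in> M" and Mp'_el: "x \<in> Mp' p \<Longrightarrow> el (-{p}) x"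
  by (auto simp: Mp'_def)

lemma Mp'_sg: "sg (Mp' p)"
  by (rule sgI) (auto simp: Mp'_def intro: sg_one sg_mult sg_inv M_sg el_mult M_comm el_inv)

lemma Mp'_normal: "x \<in> Mp' p \<Longrightarrow> g \<in> G \<Longrightarrow> cj x g \<in> Mp' p"
  by (auto simp: Mp'_def M_normal el_cj)

lemma Mp_Mp': "x \<in> Mp p \<Longrightarrow> x \<in> Mp' p \<Longrightarrow> x = 1"
  using el_coprime[of "{p}" x "-{p}"] by (auto simp: Mp_def Mp'_def)

end

context prod_lc
begin

lemma M_split:
  assumes "x \<in> M"
  obtains i j where "x = x ^ i * x ^ j" "x ^ i \<in> Mp p" "x ^ j \<in> Mp' p"
proof -
  obtain i j where "x = x ^ i * x ^ j" "el {p} (x ^ i)" "el (-{p}) (x ^ j)"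
    using el_split[OF periodic[OF M_G[OF assms]], of "{p}"] .
  then show ?thesis
    using sg_pow[OF M_sg assms] by (intro that[of i j]) (simp_all only: Mp_def Mp'_def mem_Collect_eq simp_thms)
qed

text \<open>On elements of order \<open>p\<close> this is \<open>prime_normal_centralized\<close>,
  as \<open>a\<close> moves all of them except 1. If \<open>[t, b]\<close> were nontrivial, a power
  \<open>w = [t^i, b]\<close> of order \<open>p\<close> would be fixed by the
  \<open>p'\<close>-element \<open>b\<close>, which \<open>coprime_fix\<close> excludes.\<close>

lemma Tc_centralized:
  assumes p: "is_prime p" and a: "a \<in> A" "el (-{p}) a" and b: "b \<in> B" "el (-{p}) b"
    and t: "t \<in> Tc p a"
  shows "cj t b = t"
proof (rule ccontr)
  assume n: "cj t b \<noteq> t"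
  have aG: "a \<in> G" and bG: "b \<in> G" using a b A_G B_G by auto
  interpret abn "Tc p a" b
    using aG bG by (intro abn_M Tc_sg Tc_normal subsetI) (auto intro: Mp_M Tc_Mp)
  have el: "el {p} s" if "s \<in> Tc p a" for s using that Tc_Mp[OF aG] Mp_el by blast
  define s where "s = com t b"
  have s: "s \<in> Tc p a" "s \<noteq> 1" using t n by (auto simp: s_def com_closed cj_com)
  obtain i where i: "s ^ i \<noteq> 1" "(s ^ i) ^ p = 1" using order_p_power[OF p el[OF s(1)] s(2)] by blast
  define w where "w = s ^ i"
  have w: "w \<in> Tc p a" "w \<noteq> 1" "w ^ p = 1" using i s sg_pow[OF M_sg] by (auto simp: w_def)
  have wb: "cj w b = w"
  proof (rule ccontr)
    assume "cj w b \<noteq> w"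
    moreover have "cj w a \<noteq> w" using Tc_fix[OF p aG a(2) w(1)] w(2) by blast
    moreover have "\<exists>k. cj w g = w ^ k" if "g \<in> G" for g
      using uniserial_cj[OF p Tc_uniserial[OF p a] w(1) Tc_normal[OF aG w(1) that] el[OF w(1)]] .
    moreover have "w \<in> G" using Tc_Mp[OF aG w(1)] Mp_M M_G by blast
    ultimately show False using prime_normal_centralized[OF p _ w(3) _ a(1) _ b(1)] by blast
  qed
  obtain n where n: "0 < n" "coprime n p" "b ^ n = 1" using b(2) el_p'_iff[OF p] by blast
  have wt: "w = com (t ^ i) b" using t by (simp add: w_def s_def com_pow)
  have "com (t ^ i) b = 1"
  proof (rule coprime_fix)
    show "t ^ i \<in> Tc p a" using t M_sg sg_pow by blast
    show "cj (com (t ^ i) b) b = com (t ^ i) b" using wb wt by simp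
    show "com (t ^ i) b ^ p = 1" using w(3) wt by simp
    show "cj (t ^ i) (b ^ n) = t ^ i" using n by simp
    show "coprime p n" using n by (simp add: coprime_commute)
    show "0 < p" using p prime_gt_0_nat by blast
  qed
  then show False using w wt by simp
qed

lemma Tc_pow_subset:
  assumes "a \<in> G"
  shows "Tc p (a ^ i) \<subseteq> Tc p a"
proof
  fix t assume "t \<in> Tc p (a ^ i)"
  then obtain x where x: "x \<in> Mp p" "t = com x (a ^ i)" by (auto simp: Tc_def)
  have "com x (a ^ i) \<in> Tc p a"
  proof (induction i)
    case 0
    then show ?case using sg_one[OF Tc_sg[OF assms]] by simp
  next
    case (Suc i)
    have "com x (a ^ Suc i) = com x a * cj (com x (a ^ i)) a"
      by (simp only: power_Suc2 com_mult_right)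
    then show ?case using Suc assms x
      by (simp only: sg_mult[OF Tc_sg] TcI Tc_normal)
  qed
  then show "t \<in> Tc p a" using x by simp
qed

text \<open>Nontrivial elements of a uniserial group have powers of order \<open>p\<close> that
  generate each other. So a fixed element would make \<open>a\<close> fix a nontrivial power of
  \<open>[t0, a]\<close>, against \<open>coprime_fix\<close>. Without fixed points,
  \<open>coprime_decomp\<close> leaves only commutators.\<close>

lemma uniserial_act_coprime:
  assumes p: "is_prime p" and T: "sg T" "\<And>t. t \<in> T \<Longrightarrow> t \<in> Mp p" "\<And>t. t \<in> T \<Longrightarrow> cj t a \<in> T" "uniserial T"
    and a: "el (-{p}) a" "a \<in> G" and t0: "t0 \<in> T" "cj t0 a \<noteq> t0"
  shows "t \<in> T \<Longrightarrow> \<exists>y\<in>T. t = com y a" and "t \<in> T \<Longrightarrow> cj t a = t \<Longrightarrow> t = 1"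
proof -
  interpret abn T a using T Mp_M by (intro abn_M) auto
  obtain n where n: "0 < n" "coprime n p" "a ^ n = 1" using a(1) el_p'_iff[OF p] by blast
  then have cn: "coprime (p ^ k) n" for k by (simp add: coprime_commute)
  have pk: "\<exists>k. t ^ (p ^ k) = 1" if "t \<in> T" for t
    using T(2)[OF that] Mp_el el_p_iff[OF p] by blast
  have fixed_1: "t = 1" if t: "t \<in> T" "cj t a = t" for t
  proof (rule ccontr)
    assume "t \<noteq> 1"
    then obtain i where i: "t ^ i \<noteq> 1" "(t ^ i) ^ p = 1"
      using order_p_power[OF p Mp_el[OF T(2)[OF t(1)]]] by blast
    define s where "s = com t0 a"
    have s: "s \<in> T" "s \<noteq> 1" using t0 by (auto simp: s_def com_closed cj_com)
    then obtain j where j: "s ^ j \<noteq> 1" "(s ^ j) ^ p = 1"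
      using order_p_power[OF p Mp_el[OF T(2)[OF s(1)]]] by blast
    obtain k where k: "s ^ j = (t ^ i) ^ k"
      using uniserial_socle_gen[OF T(4) p sg_pow[OF T(1) t(1)] sg_pow[OF T(1) s(1)] i j(2)] by blast
    then have "cj (s ^ j) a = s ^ j" using t(2) by (simp add: cj_pow)
    moreover have sj: "s ^ j = com (t0 ^ j) a" using t0 by (simp add: s_def com_pow)
    ultimately have "com (t0 ^ j) a = 1"
      using coprime_fix[of "t0 ^ j" "p ^ 1" n] sg_pow[OF T(1) t0(1)] j(2) n cn[of 1] prime_gt_0_nat[OF p]
      by simp
    then show False using sj j by simp
  qed
  show "t = 1" if "t \<in> T" "cj t a = t" using fixed_1 that by blast
  show "\<exists>y\<in>T. t = com y a" if t: "t \<in> T"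
  proof -
    obtain k where k: "t ^ (p ^ k) = 1" using pk t by blast
    obtain c y where cy: "c \<in> T" "y \<in> T" "t = c * com y a" "cj c a = c"
      using coprime_decomp[OF t k, of n] cn n prime_gt_0_nat[OF p] by auto
    then show ?thesis using fixed_1[of c] by auto
  qed
qed

text \<open>Any \<open>a0\<close> with \<open>[M\<^sub>p, a0]\<close> nontrivial will do. Together
  with \<open>a\<close> it lies in the group generated by some \<open>z\<close> in \<open>A\<close>,
  and since \<open>a0\<close> moves the uniserial group \<open>[M\<^sub>p, z]\<close>, every element
  of the latter is a commutator with \<open>a0\<close>.\<close>

lemma Tc_max:
  assumes p: "is_prime p"
  shows "\<exists>a0. a0 \<in> A \<and> el (-{p}) a0 \<and> (\<forall>a\<in>A. el (-{p}) a \<longrightarrow> Tc p a \<subseteq> Tc p a0)"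
proof (cases "\<forall>a\<in>A. el (-{p}) a \<longrightarrow> Tc p a \<subseteq> {1}")
  case True
  then have "Tc p a \<subseteq> Tc p 1" if "a \<in> A" "el (-{p}) a" for a
    using that sg_one[OF Tc_sg[OF sg_one[OF G_sg]]] by blast
  then show ?thesis using sg_one[OF A_sg] el_one by blast
next
  case False
  then obtain a0 t0 where a0: "a0 \<in> A" "el (-{p}) a0" "t0 \<in> Tc p a0" "t0 \<noteq> 1" by blast
  have "Tc p a \<subseteq> Tc p a0" if a: "a \<in> A" "el (-{p}) a" for a
  proof -
    obtain z i j where z: "z \<in> A" "el (-{p}) z" "a = z ^ i" "a0 = z ^ j"
      using locally_cyclic_el[OF periodic[OF A_G] A_sg A_lc a(1) a0(1) a(2) a0(2)] by blast
    have zG: "z \<in> G" and a0G: "a0 \<in> G" using z a0 A_G by auto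
    have sub: "Tc p a \<subseteq> Tc p z" "Tc p a0 \<subseteq> Tc p z" using Tc_pow_subset[OF zG] z by auto
    have "cj t0 a0 \<noteq> t0" using Tc_fix[OF p a0G a0(2,3)] a0(4) by blast
    moreover have "t0 \<in> Tc p z" using sub a0 by blast
    ultimately have *: "\<exists>y\<in>Tc p z. t = com y a0" if "t \<in> Tc p z" for t
      using uniserial_act_coprime(1)[OF p Tc_sg[OF zG] Tc_Mp[OF zG] Tc_normal[OF zG _ a0G]
          Tc_uniserial[OF p z(1,2)] a0(2) a0G _ _ that] by blast
    have "Tc p z \<subseteq> Tc p a0"
    proof
      fix t assume "t \<in> Tc p z"
      then obtain y where "y \<in> Tc p z" "t = com y a0" using * by blast
      then show "t \<in> Tc p a0" using TcI Tc_Mp[OF zG] by blast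
    qed
    then show ?thesis using sub by blast
  qed
  then show ?thesis using a0 by blast
qed

text \<open>The subgroup \<open>[M\<^sub>p, A\<^sub>p\<^sub>']\<close> is already \<open>[M\<^sub>p, a]\<close> for a single \<open>p'\<close>-element \<open>a\<close> of \<open>A\<close>; it is
  \<open>TT p\<close>, and its complement \<open>AC p\<close> in \<open>M\<^sub>p\<close> is the centralizer of \<open>a\<close>.\<close>

definition ap :: "nat \<Rightarrow> 'a" where
  "ap p = (SOME a0. a0 \<in> A \<and> el (-{p}) a0 \<and> (\<forall>a\<in>A. el (-{p}) a \<longrightarrow> Tc p a \<subseteq> Tc p a0))"

definition TT :: "nat \<Rightarrow> 'a set" where "TT p = Tc p (ap p)"

definition AC :: "nat \<Rightarrow> 'a set" where "AC p = {x \<in> Mp p. cj x (ap p) = x}"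

lemma
  assumes "is_prime p"
  shows ap_A: "ap p \<in> A" and ap_el: "el (-{p}) (ap p)"
    and Tc_TT: "\<And>a. a \<in> A \<Longrightarrow> el (-{p}) a \<Longrightarrow> Tc p a \<subseteq> TT p"
  using someI_ex[OF Tc_max[OF assms]] unfolding ap_def TT_def by blast+

lemma ap_G: "is_prime p \<Longrightarrow> ap p \<in> G"
  using ap_A A_G by blast

lemma TT_sg: "is_prime p \<Longrightarrow> sg (TT p)"
  unfolding TT_def by (intro Tc_sg ap_G)

lemma TT_Mp: "is_prime p \<Longrightarrow> t \<in> TT p \<Longrightarrow> t \<in> Mp p"
  unfolding TT_def using Tc_Mp ap_G by blast

lemma TT_M: "is_prime p \<Longrightarrow> t \<in> TT p \<Longrightarrow> t \<in> M"
  using TT_Mp Mp_M by blast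

lemma TT_normal: "is_prime p \<Longrightarrow> t \<in> TT p \<Longrightarrow> g \<in> G \<Longrightarrow> cj t g \<in> TT p"
  unfolding TT_def using Tc_normal ap_G by blast

lemma TT_fix: "is_prime p \<Longrightarrow> t \<in> TT p \<Longrightarrow> cj t (ap p) = t \<Longrightarrow> t = 1"
  unfolding TT_def using Tc_fix ap_G ap_el by blast

lemma TT_uniserial: "is_prime p \<Longrightarrow> uniserial (TT p)"
  unfolding TT_def by (intro Tc_uniserial ap_A ap_el)

lemma TT_2: "t \<in> TT 2 \<Longrightarrow> t = 1"
  unfolding TT_def using Tc_2 ap_A ap_el two_is_prime_nat by blast

lemma TT_centralized:
  "is_prime p \<Longrightarrow> t \<in> TT p \<Longrightarrow> b \<in> B \<Longrightarrow> el (-{p}) b \<Longrightarrow> cj t b = t"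
  unfolding TT_def using Tc_centralized ap_A ap_el by blast

lemma TT_com:
  assumes p: "is_prime p" and t: "t \<in> TT p"
  shows "\<exists>y\<in>TT p. t = com y (ap p)"
proof (cases "t = 1")
  case True
  then show ?thesis using TT_sg[OF p] sg_one by (intro bexI[of _ 1]) auto
next
  case False
  then have "cj t (ap p) \<noteq> t" using TT_fix[OF p t] by blast
  from uniserial_act_coprime(1)[OF p TT_sg[OF p] TT_Mp[OF p] TT_normal[OF p _ ap_G[OF p]] TT_uniserial[OF p]
      ap_el[OF p] ap_G[OF p] t this t]
  show ?thesis .
qed

lemma AC_Mp: "x \<in> AC p \<Longrightarrow> x \<in> Mp p" and AC_fix: "x \<in> AC p \<Longrightarrow> cj x (ap p) = x"
  by (auto simp: AC_def)

lemma AC_sg: "sg (AC p)"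
  by (rule sgI) (auto simp: AC_def intro: sg_one sg_mult sg_inv Mp_sg)

lemma AC_normal: "is_prime p \<Longrightarrow> x \<in> AC p \<Longrightarrow> g \<in> G \<Longrightarrow> cj x g \<in> AC p"
  using M_cj_commute[OF Mp_M ap_G, of x p p g] by (simp add: AC_def Mp_normal)

lemma AC_TT: "is_prime p \<Longrightarrow> x \<in> AC p \<Longrightarrow> x \<in> TT p \<Longrightarrow> x = 1"
  using TT_fix AC_fix by blast

text \<open>By the maximality of \<open>ap p\<close> the commutator \<open>[c, a]\<close> lies in
  \<open>TT p\<close>. Since operators on \<open>M\<close> commute, \<open>ap p\<close> fixes it,
  and so it is trivial.\<close>

lemma AC_centralized:
  assumes p: "is_prime p" and c: "c \<in> AC p" and a: "a \<in> A" "el (-{p}) a"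
  shows "cj c a = c"
proof -
  have cM: "c \<in> Mp p" "c \<in> M" using c AC_Mp Mp_M by auto
  have "com c a \<in> TT p" using Tc_TT[OF p a] TcI[OF cM(1)] by blast
  moreover have "cj (com c a) (ap p) = com c a"
    using cM(2) AC_fix[OF c] cj_com_M[OF cM(2) A_G[OF a(1)] ap_G[OF p]] by simp
  ultimately have "com c a = 1" using TT_fix[OF p] by blast
  then show ?thesis by (simp add: cj_com)
qed

lemma Mp_split:
  assumes p: "is_prime p" and x: "x \<in> Mp p"
  obtains c t where "c \<in> AC p" "t \<in> TT p" "x = c * t"
proof -
  interpret abn "Mp p" "ap p" using ap_G[OF p] by (rule abn_Mp)
  obtain n where n: "0 < n" "coprime n p" "ap p ^ n = 1" using ap_el[OF p] el_p'_iff[OF p] by blast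
  obtain k where k: "x ^ (p ^ k) = 1" using Mp_el[OF x] el_p_iff[OF p] by blast
  have "coprime (p ^ k) n" using n by (simp add: coprime_commute)
  then obtain c y where cy: "c \<in> Mp p" "y \<in> Mp p" "x = c * com y (ap p)" "cj c (ap p) = c"
    using coprime_decomp[OF x k, of n] n prime_gt_0_nat[OF p] by auto
  then show ?thesis using that[of c "com y (ap p)"] TcI by (auto simp: AC_def TT_def)
qed

end

text \<open>Every element of \<open>G\<close> is congruent modulo \<open>TT p\<close> to an element of \<open>R\<close>, the centralizer of
  \<open>ap p\<close> modulo the \<open>p'\<close>-part of \<open>M\<close>, and the \<open>p\<close>-elements of \<open>B\<close> that lie in \<open>R\<close> lie in \<open>A\<close>.\<close>

locale nontrivial_section = prod_lc +
  fixes p t1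
  assumes p: "is_prime p" and t1: "t1 \<in> TT p" "t1 \<noteq> 1"
begin

sublocale sec: p_section A B p "TT p"
  unfolding TT_def by (rule Tc_section) (intro p ap_A ap_el)+

definition R :: "'a set" where "R = {g \<in> G. com g (ap p) \<in> Mp' p}"

lemma R_sg: "sg R"
proof (rule sgI)
  show "1 \<in> R" by (simp add: R_def sg_one G_sg Mp'_sg)
next
  fix g h assume "g \<in> R" "h \<in> R"
  then show "g * h \<in> R"
    by (simp add: R_def com_mult_left sg_mult[OF G_sg] sg_mult[OF Mp'_sg] Mp'_normal)
next
  fix g assume g: "g \<in> R"
  have "com (inverse g) (ap p) = inverse (cj (com g (ap p)) (inverse g))"
    by (simp add: com_def cj_def mult.assoc)
  then show "inverse g \<in> R" using g
    by (simp add: R_def sg_inv[OF G_sg] sg_inv[OF Mp'_sg] Mp'_normal del: cj_simps)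
qed

lemma A_R: "a \<in> A \<Longrightarrow> a \<in> R"
  using A_comm[OF _ ap_A[OF p]] com_one_iff[of a "ap p"] by (simp add: R_def A_G sg_one Mp'_sg)

lemma R_TT:
  assumes "t \<in> R" "t \<in> TT p"
  shows "t = 1"
proof -
  have "com t (ap p) \<in> TT p"
    unfolding com_alt(1) using assms(2) p by (intro sg_mult sg_inv TT_sg TT_normal ap_G)
  then have "com t (ap p) \<in> Mp p" using TT_Mp[OF p] by blast
  then have "com t (ap p) = 1" using assms Mp_Mp' by (auto simp: R_def)
  then show ?thesis using TT_fix[OF p assms(2)] by (simp add: cj_com)
qed

text \<open>The partner \<open>c1\<close> of \<open>t1\<close> is not in \<open>R\<close>, so it is
  not a power of \<open>b\<close>; by comparability \<open>b\<close> is a power of \<open>c1\<close>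
  and has itself a partner \<open>u\<close> in \<open>TT p\<close>. Now \<open>u\<close> lies in
  \<open>R\<close>, and \<open>R_TT\<close> makes it trivial.\<close>

lemma R_B_p:
  assumes b: "b \<in> B" "b \<in> R" "el {p} b"
  shows "b \<in> A"
proof -
  obtain c1 where c1: "sec.D c1 t1" using sec.D_ex t1 by metis
  have "c1 \<notin> R"
  proof
    assume "c1 \<in> R"
    then have "inverse (c1 * inverse t1) * c1 \<in> R"
      by (intro sg_mult[OF R_sg sg_inv[OF R_sg A_R[OF sec.D_A[OF c1]]]])
    then have "t1 \<in> R" by (simp add: mult.assoc)
    then show False using R_TT t1 by blast
  qed
  then have "\<nexists>k. c1 = b ^ k" using b R_sg sg_pow by metis
  then obtain k where k: "b = c1 ^ k"
    using uniserialD[OF B_uniserial[OF p], of b c1] b sec.D_B[OF c1] sec.D_el[OF c1] by auto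
  define u where "u = act c1 (nrm k) t1"
  have D: "sec.D b u" unfolding k u_def by (rule sec.D_pow[OF c1])
  have "inverse (b * inverse u) * b \<in> R"
    using b(2) by (intro sg_mult[OF R_sg sg_inv[OF R_sg A_R[OF sec.D_A[OF D]]]])
  then have "u \<in> R" by (simp add: mult.assoc)
  then have "u = 1" using R_TT sec.D_T[OF D] by blast
  then show ?thesis using sec.D_A[OF D] by simp
qed

lemma R_decomp:
  assumes r: "r \<in> R"
  obtains a b where "a \<in> A" "b \<in> B" "el (-{p}) b" "r = a * b"
proof -
  obtain a b where ab: "a \<in> A" "b \<in> B" "r = a * b" using r by (auto simp: R_def elim: G_cases)
  then have "b \<in> R" using r A_R R_sg sg_mult_iff by blast
  obtain i j where ij: "b = b ^ i * b ^ j" "el {p} (b ^ i)" "el (-{p}) (b ^ j)"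
    using el_split[OF periodic[OF B_G[OF ab(2)]], of "{p}"] by blast
  have "b ^ i \<in> A" using ij ab(2) \<open>b \<in> R\<close> by (intro R_B_p sg_pow B_sg R_sg)
  moreover have "r = (a * b ^ i) * b ^ j" using ab(3) ij(1) by (metis mult.assoc)
  ultimately show ?thesis using that ab ij sg_mult[OF A_sg] sg_pow[OF B_sg] by blast
qed

text \<open>In \<open>c = a * b\<close> let \<open>b\<close> have exponent \<open>n\<close> prime to
  \<open>p\<close>. Then \<open>a^n\<close> is in \<open>M\<^sub>p\<close>, and so is the
  \<open>p\<close>-part \<open>u\<close> of \<open>a\<close>. This exhibits \<open>b\<close> as the
  product of the commuting elements \<open>inverse u * c\<close>, a \<open>p\<close>-element, and
  \<open>inverse v\<close>, a \<open>p'\<close>-element. As \<open>b\<close> is a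
  \<open>p'\<close>-element, \<open>c = u\<close>.\<close>

lemma AC_subset_A:
  assumes c: "c \<in> AC p"
  shows "c \<in> A"
proof -
  have cM: "c \<in> Mp p" "c \<in> M" using c AC_Mp Mp_M by auto
  have "com c (ap p) = 1" using AC_fix[OF c] by (simp add: com_alt(1))
  then have "c \<in> R" using cM by (simp add: R_def M_G sg_one Mp'_sg)
  then obtain a b where ab: "a \<in> A" "b \<in> B" "el (-{p}) b" "c = a * b" using R_decomp by blast
  obtain n where n: "0 < n" "coprime n p" "b ^ n = 1" using ab(3) el_p'_iff[OF p] by blast
  obtain i j where ij: "a = a ^ i * a ^ j" "el {p} (a ^ i)" "el (-{p}) (a ^ j)"
    using el_split[OF periodic[OF A_G[OF ab(1)]], of "{p}"] by blast
  define u where "u = a ^ i"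
  define v where "v = a ^ j"
  have uv: "u \<in> A" "v \<in> A" "a = u * v" "el {p} u" "el (-{p}) v"
    using ij ab(1) sg_pow[OF A_sg] by (auto simp: u_def v_def)
  have ia: "inverse a \<in> A" using ab A_sg sg_inv by blast
  have b: "b = inverse a * c" using ab(4) by simp
  interpret abn "Mp p" "inverse a" using A_G[OF ia] by (rule abn_Mp)
  have "inverse a ^ n * act (inverse a) (nrm n) c = 1"
    using power_mult_act[OF cM(1), of n] n(3) b by simp
  then have "inverse (inverse a ^ n) \<in> Mp p" using act_closed[OF cM(1)] inv_unique by metis
  then have an: "a ^ n \<in> Mp p" by simp
  have "a ^ n = u ^ n * v ^ n" unfolding uv(3) by (rule power_mult_commuting[OF A_comm[OF uv(1,2)]])
  moreover have "u ^ n * v ^ n = v ^ n * u ^ n" using uv A_comm sg_pow[OF A_sg] by blast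
  moreover have "el {p} (u ^ n)" "el (-{p}) (v ^ n)" using uv el_pow by auto
  ultimately have "a ^ n = u ^ n"
    using comm_split_unique[of "a ^ n" "a ^ n" 1 "u ^ n" "v ^ n" "{p}"] Mp_el[OF an] by simp
  moreover have "\<not> p dvd n" using n(2) p by (metis coprime_absorb_right not_prime_unit)
  then obtain l where "u = (u ^ n) ^ l" using p_pow_gen[OF p uv(4)] by blast
  ultimately have "u \<in> Mp p" using an Mp_sg sg_pow by metis
  then have "u \<in> AC p" using A_comm[OF uv(1) ap_A[OF p]] by (simp add: AC_def cj_eqI)
  then have c': "inverse u * c \<in> AC p" using c by (intro sg_mult sg_inv AC_sg)
  have "cj (inverse u * c) (inverse v) = inverse u * c"
    using uv by (intro AC_centralized[OF p c'] el_inv sg_inv[OF A_sg])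
  then have comm: "(inverse u * c) * inverse v = inverse v * (inverse u * c)" by (simp only: cj_fix_iff)
  moreover have "b = inverse v * (inverse u * c)" unfolding b uv(3) by (simp add: mult.assoc)
  ultimately have "b = (inverse u * c) * inverse v" by simp
  then have "inverse u * c = 1"
    using comm_split_unique[of b "inverse u * c" "inverse v" 1 b "{p}"] comm ab(3) el_inv[OF uv(5)]
      Mp_el[OF AC_Mp[OF c']] by simp
  then have "c = u" by (metis inv_unique inv_inv)
  then show ?thesis using uv by simp
qed

text \<open>The \<open>AC p\<close>-part of \<open>[y, ap p]\<close> vanishes because
  \<open>ap p\<close> has order prime to \<open>p\<close>, and the \<open>TT p\<close>-part is
  removed by multiplying \<open>y\<close> by a suitable \<open>t\<close> in \<open>TT p\<close>.
  Then \<open>y * t\<close> lies in \<open>R\<close>, where \<open>R_decomp\<close> applies.\<close>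

lemma B_p_decomp:
  assumes y: "y \<in> B" "el {p} y"
  obtains a t m where "a \<in> A" "el {p} a" "t \<in> TT p" "m \<in> Mp' p" "y = a * t * m"
proof -
  note apG = ap_G[OF p]
  have yG: "y \<in> G" using y B_G by blast
  have yM: "com y (ap p) \<in> M" using yG apG by (rule com_M)
  then obtain i j where ij: "com y (ap p) = com y (ap p) ^ i * com y (ap p) ^ j"
    "com y (ap p) ^ i \<in> Mp p" "com y (ap p) ^ j \<in> Mp' p" using M_split by metis
  define m' where "m' = com y (ap p) ^ j"
  obtain c t0 where ct: "c \<in> AC p" "t0 \<in> TT p" "com y (ap p) ^ i = c * t0"
    using Mp_split[OF p ij(2)] by blast
  have m': "m' \<in> Mp' p" using ij by (simp add: m'_def)
  have com_y: "com y (ap p) = c * t0 * m'" using ij(1) ct(3) m'_def by metis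
  define K where "K = {t * m | t m. t \<in> TT p \<and> m \<in> Mp' p}"
  have K_M: "k \<in> M" if "k \<in> K" for k
    using that TT_M[OF p] Mp'_M sg_mult[OF M_sg] by (auto simp: K_def)
  have KI: "t * m \<in> K" if "t \<in> TT p" "m \<in> Mp' p" for t m using that by (auto simp: K_def)
  have K_sg: "sg K"
  proof (rule sgI)
    show "1 \<in> K" using KI[of 1 1] sg_one[OF TT_sg[OF p]] sg_one[OF Mp'_sg] by simp
  next
    fix x z assume "x \<in> K" "z \<in> K"
    then obtain t m u n where *: "t \<in> TT p" "m \<in> Mp' p" "u \<in> TT p" "n \<in> Mp' p" "x = t * m" "z = u * n"
      by (auto simp: K_def)
    have "m * u = u * m" using * TT_M[OF p] Mp'_M M_comm by blast
    then have "x * z = (t * u) * (m * n)" using *(5,6) by (metis mult.assoc)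
    then show "x * z \<in> K" using KI * sg_mult[OF TT_sg[OF p]] sg_mult[OF Mp'_sg] by simp
  next
    fix x assume "x \<in> K"
    then obtain t m where *: "t \<in> TT p" "m \<in> Mp' p" "x = t * m" by (auto simp: K_def)
    have "inverse m * inverse t = inverse t * inverse m"
      using * TT_M[OF p] Mp'_M M_comm M_sg sg_inv by blast
    then show "inverse x \<in> K" using KI * sg_inv[OF TT_sg[OF p]] sg_inv[OF Mp'_sg] by simp
  qed
  have K_cj: "cj k g \<in> K" if "k \<in> K" "g \<in> G" for k g
    using that KI TT_normal[OF p] Mp'_normal by (auto simp: K_def)
  have cM: "c \<in> M" using ct AC_Mp Mp_M by blast
  obtain n where n: "0 < n" "coprime n p" "ap p ^ n = 1" using ap_el[OF p] el_p'_iff[OF p] by blast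
  have "c ^ n \<in> K"
  proof (rule moved_order[OF K_sg])
    show "cj y (ap p) = y * c * (t0 * m')" unfolding cj_com com_y by (simp only: mult.assoc)
    show "t0 * m' \<in> K" using ct m' KI by blast
  qed (use K_cj apG K_M cM M_comm AC_fix[OF ct(1)] n in auto)
  then obtain t m where tm: "t \<in> TT p" "m \<in> Mp' p" "c ^ n = t * m" by (auto simp: K_def)
  have cn: "c ^ n \<in> AC p" using ct AC_sg sg_pow by blast
  have "m = inverse t * c ^ n" using tm(3) by simp
  then have "m \<in> Mp p" using tm(1) cn AC_Mp TT_Mp[OF p] Mp_sg sg_mult sg_inv by metis
  then have "m = 1" using tm(2) Mp_Mp' by blast
  then have "c ^ n = 1" using AC_TT[OF p cn] tm by simp
  then have c1: "c = 1"
    using el_coprime[of "{p}" c "-{p}"] Mp_el[OF AC_Mp[OF ct(1)]] el_p'_iff[OF p, of c] n by blast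
  obtain y' where y': "y' \<in> TT p" "t0 = com y' (ap p)" using TT_com[OF p ct(2)] by blast
  interpret ab: abn "Mp p" "ap p" using apG by (rule abn_Mp)
  define t where "t = inverse y'"
  have t: "t \<in> TT p" unfolding t_def using y' TT_sg[OF p] sg_inv by blast
  have tM: "t \<in> M" "t0 \<in> M" "m' \<in> M" using t ct m' TT_M[OF p] Mp'_M by auto
  have ta: "com t (ap p) = inverse t0"
    using ab.com_inverse[OF TT_Mp[OF p y'(1)]] by (simp add: t_def y'(2))
  have "com (y * t) (ap p) = cj (com y (ap p)) t * com t (ap p)" by (rule com_mult_left)
  also have "cj (com y (ap p)) t = com y (ap p)" using M_comm[OF yM tM(1)] by (rule cj_eqI)
  also have "com y (ap p) * com t (ap p) = t0 * m' * inverse t0" using com_y c1 ta by simp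
  also have "\<dots> = m'" using M_comm[OF tM(2,3)] by (simp add: mult.assoc)
  finally have "com (y * t) (ap p) = m'" .
  then have "y * t \<in> R" using m' yG tM M_G by (simp add: R_def sg_mult[OF G_sg])
  then obtain a b where ab: "a \<in> A" "b \<in> B" "el (-{p}) b" "y * t = a * b" using R_decomp by blast
  obtain i j where ij: "a = a ^ i * a ^ j" "el {p} (a ^ i)" "el (-{p}) (a ^ j)"
    using el_split[OF periodic[OF A_G[OF ab(1)]], of "{p}"] by blast
  define u where "u = a ^ i"
  define v where "v = a ^ j"
  have uv: "u \<in> A" "v \<in> A" "a = u * v" "el {p} u" "el (-{p}) v"
    using ij ab(1) sg_pow[OF A_sg] by (auto simp: u_def v_def)
  define z where "z = inverse u * y"
  have z: "z = v * b * inverse t"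
  proof -
    have "y = a * b * inverse t" using ab(4) by (metis mult.assoc mult_1_right right_inv)
    then show ?thesis unfolding z_def uv(3) by (simp add: mult.assoc)
  qed
  have mem: "u \<in> G" "v \<in> G" "b \<in> G" "inverse u \<in> G" "inverse t \<in> G" "inverse t \<in> M"
    using uv ab tM A_G B_G M_G sg_inv[OF G_sg] sg_inv[OF M_sg] by auto
  \<comment> \<open>Modulo \<open>M\<close>, which contains all commutators, \<open>z\<close> is a
    product of two \<open>p\<close>-elements and also a product of two \<open>p'\<close>-elements.
    Hence \<open>z\<close> is in \<open>M\<close>.\<close>
  obtain k l where kl: "u ^ (p ^ k) = 1" "y ^ (p ^ l) = 1" using uv y el_p_iff[OF p] by blast
  have "inverse u ^ (p ^ k) = 1" using kl(1) by (metis inv_one inv_power)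
  then have "inverse u ^ (p ^ (k + l)) \<in> M" "y ^ (p ^ (k + l)) \<in> M"
    using power_one_dvd[of "inverse u" "p ^ k" "p ^ (k + l)"] power_one_dvd[OF kl(2), of "p ^ (k + l)"]
      sg_one[OF M_sg] by (simp_all add: power_add)
  then have z1: "z ^ (p ^ (k + l)) \<in> M" unfolding z_def using mem yG by (intro M_pow_closed)
  obtain n1 n2 where n: "0 < n1" "coprime n1 p" "v ^ n1 = 1" "0 < n2" "coprime n2 p" "b ^ n2 = 1"
    using uv ab el_p'_iff[OF p] by blast
  have "v ^ (n1 * n2) \<in> M" "b ^ (n1 * n2) \<in> M"
    using power_one_dvd[OF n(3), of "n1 * n2"] power_one_dvd[OF n(6), of "n1 * n2"] sg_one[OF M_sg] by simp_all
  then have "(v * b) ^ (n1 * n2) \<in> M" using mem by (intro M_pow_closed)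
  then have z2: "z ^ (n1 * n2) \<in> M" unfolding z
    using M_pow_closed[OF sg_mult[OF G_sg mem(2,3)] mem(5)] sg_pow[OF M_sg mem(6)] by blast
  have "coprime (p ^ (k + l)) (n1 * n2)" "0 < p ^ (k + l)"
    using n prime_gt_0_nat[OF p] by (simp_all add: coprime_commute)
  then have "z \<in> M" by (rule sg_pow_coprime[OF M_sg z1 z2])
  then obtain i j where ij: "z = z ^ i * z ^ j" "z ^ i \<in> Mp p" "z ^ j \<in> Mp' p" using M_split by blast
  obtain c2 t2 where ct2: "c2 \<in> AC p" "t2 \<in> TT p" "z ^ i = c2 * t2" using Mp_split[OF p ij(2)] by blast
  have "y = u * z" by (simp add: z_def)
  then have "y = (u * c2) * t2 * z ^ j" using ij(1) ct2(3) by (metis mult.assoc)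
  moreover have c2: "c2 \<in> A" using ct2 AC_subset_A by blast
  moreover have "el {p} (u * c2)"
    using uv c2 Mp_el[OF AC_Mp[OF ct2(1)]] by (intro el_mult A_comm)
  ultimately show ?thesis using that[of "u * c2" t2 "z ^ j"] uv(1) ct2(2) ij(3) sg_mult[OF A_sg] by blast
qed

end

section \<open>The subgroups S and T\<close>

definition pr :: "'g::mult_group set \<Rightarrow> 'g set \<Rightarrow> 'g set" where
  "pr H K = {h * k | h k. h \<in> H \<and> k \<in> K}"

lemma prI: "h \<in> H \<Longrightarrow> k \<in> K \<Longrightarrow> h * k \<in> pr H K"
  by (auto simp: pr_def)

lemma prE: "x \<in> pr H K \<Longrightarrow> (\<And>h k. h \<in> H \<Longrightarrow> k \<in> K \<Longrightarrow> x = h * k \<Longrightarrow> P) \<Longrightarrow> P"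
  by (auto simp: pr_def)

lemma sg_pr:
  assumes "sg H" "sg K" "\<And>h k. h \<in> H \<Longrightarrow> k \<in> K \<Longrightarrow> cj h k \<in> H"
  shows "sg (pr H K)"
proof (rule sgI)
  show "1 \<in> pr H K" using prI[OF sg_one[OF assms(1)] sg_one[OF assms(2)]] by simp
next
  fix x y assume "x \<in> pr H K" "y \<in> pr H K"
  then obtain h k h' k' where *: "h \<in> H" "k \<in> K" "h' \<in> H" "k' \<in> K" "x = h * k" "y = h' * k'"
    by (elim prE) blast
  have "x * y = (h * cj h' (inverse k)) * (k * k')"
    unfolding *(5,6) by (simp add: cj_def mult.assoc)
  moreover have "h * cj h' (inverse k) \<in> H" "k * k' \<in> K"
    using * assms by (simp_all only: sg_mult sg_inv)
  ultimately show "x * y \<in> pr H K" using prI by simp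
next
  fix x assume "x \<in> pr H K"
  then obtain h k where *: "h \<in> H" "k \<in> K" "x = h * k" by (elim prE)
  have "inverse x = cj (inverse h) k * inverse k"
    unfolding *(3) by (simp add: cj_def mult.assoc)
  moreover have "cj (inverse h) k \<in> H" "inverse k \<in> K"
    using * assms by (simp_all only: sg_inv)
  ultimately show "inverse x \<in> pr H K" using prI by simp
qed

lemma pr_left: "sg K \<Longrightarrow> h \<in> H \<Longrightarrow> h \<in> pr H K"
  using prI[OF _ sg_one, of h H K] by simp

lemma pr_right: "sg H \<Longrightarrow> k \<in> K \<Longrightarrow> k \<in> pr H K"
  using prI[OF sg_one, of H k K] by simp

lemma pow_mod_normal:
  assumes "sg N" "\<And>n. n \<in> N \<Longrightarrow> cj n g \<in> N" "u \<in> N"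
  shows "\<exists>v\<in>N. (g * u) ^ q = g ^ q * v"
proof (induction q)
  case 0
  then show ?case using sg_one[OF assms(1)] by (intro bexI[of _ 1]) simp_all
next
  case (Suc q)
  then obtain v where v: "v \<in> N" "(g * u) ^ q = g ^ q * v" by blast
  have "(g * u) ^ Suc q = g ^ q * v * (g * u)" unfolding power_Suc2 v(2) ..
  also have "\<dots> = g ^ Suc q * (cj v g * u)"
    unfolding power_Suc2 by (simp add: cj_def mult.assoc)
  finally have "(g * u) ^ Suc q = g ^ Suc q * (cj v g * u)" .
  moreover have "cj v g * u \<in> N" using v assms by (simp only: sg_mult)
  ultimately show ?case by blast
qed

lemma sg_com_into:
  assumes "sg V" "\<And>v k. v \<in> V \<Longrightarrow> k \<in> K \<Longrightarrow> cj v k \<in> V" "sg K"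
  shows "sg {x \<in> K. com x g \<in> V}"
proof (rule sgI)
  show "1 \<in> {x \<in> K. com x g \<in> V}" using assms by (simp add: sg_one)
next
  fix x y assume "x \<in> {x \<in> K. com x g \<in> V}" "y \<in> {x \<in> K. com x g \<in> V}"
  then show "x * y \<in> {x \<in> K. com x g \<in> V}"
    using assms by (simp add: com_mult_left sg_mult)
next
  fix x assume x: "x \<in> {x \<in> K. com x g \<in> V}"
  then have x': "inverse x \<in> K" "com x g \<in> V" using assms(3) by (auto intro: sg_inv)
  have "com (inverse x) g = inverse (cj (com x g) (inverse x))"
    by (simp add: com_def cj_def mult.assoc)
  also have "\<dots> \<in> V" using x' assms(1,2) by (simp only: sg_inv)
  finally show "inverse x \<in> {x \<in> K. com x g \<in> V}" using x' by simp
qed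

text \<open>The elements whose commutators with \<open>g\<close> fall into \<open>V\<close> form a
  subgroup, so the two generators decide.\<close>

lemma gen2_com:
  assumes V: "sg V" "\<And>v k. v \<in> V \<Longrightarrow> k \<in> gen {a, b} \<Longrightarrow> cj v k \<in> V"
    and "com g a \<in> V" "com g b \<in> V" "y \<in> gen {a, b}"
  shows "com g y \<in> V"
proof -
  let ?K = "gen {a, b}"
  have ab: "a \<in> ?K" "b \<in> ?K" by (auto intro: gen_base)
  have "com a g \<in> V" "com b g \<in> V"
    using sg_inv[OF V(1) assms(3)] sg_inv[OF V(1) assms(4)] by (simp_all only: com_inv)
  then have "?K \<subseteq> {x \<in> ?K. com x g \<in> V}"
    using ab by (intro gen_least sg_com_into V sg_gen) auto
  then have "com y g \<in> V" using assms(5) by blast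
  then show ?thesis using sg_inv[OF V(1)] by (metis com_inv)
qed

primrec lower_series :: "'g::mult_group set \<Rightarrow> nat \<Rightarrow> 'g set" where
  "lower_series K 0 = K"
| "lower_series K (Suc n) = gen {com x y | x y. x \<in> lower_series K n \<and> y \<in> K}"

lemma lower_series_mono: "K \<subseteq> L \<Longrightarrow> lower_series K n \<subseteq> lower_series L n"
  by (induction n) (auto intro!: gen_mono)

section \<open>Subgroups of M assembled from primary components\<close>

context prod_lc
begin

text \<open>The subgroup of \<open>M\<close> with the \<open>p\<close>-components \<open>F p\<close>.\<close>

definition Sig :: "(nat \<Rightarrow> 'a set) \<Rightarrow> 'a set" where
  "Sig F = {x \<in> M. \<forall>p i. is_prime p \<longrightarrow> el {p} (x ^ i) \<longrightarrow> x ^ i \<in> F p}"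

lemma M_el: "x \<in> M \<Longrightarrow> el UNIV x"
  using periodic M_G by blast

lemma Sig_M: "x \<in> Sig F \<Longrightarrow> x \<in> M"
  by (simp add: Sig_def)

lemma Sig_pow: "x \<in> Sig F \<Longrightarrow> is_prime p \<Longrightarrow> el {p} (x ^ i) \<Longrightarrow> x ^ i \<in> F p"
  by (simp add: Sig_def)

lemma Sig_p: "x \<in> Sig F \<Longrightarrow> is_prime p \<Longrightarrow> el {p} x \<Longrightarrow> x \<in> F p"
  using Sig_pow[of x F p 1] by simp

lemma part_in:
  assumes F: "sg F" "F \<subseteq> Mp p" and x: "c \<in> F" "m \<in> Mp' p" "x = c * m" "el {p} (x ^ i)"
  shows "x ^ i \<in> F"
proof -
  have M: "c \<in> M" "m \<in> M" using F(2) x Mp_M Mp'_M by blast+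
  have "x ^ i = c ^ i * m ^ i" unfolding x(3) by (rule power_mult_commuting[OF M_comm[OF M]])
  moreover have "c ^ i * m ^ i = m ^ i * c ^ i" using M by (intro M_comm sg_pow[OF M_sg])
  moreover have "el {p} c" using F(2) x Mp_el by blast
  ultimately have "x ^ i = c ^ i"
    using comm_split_unique[of "x ^ i" "x ^ i" 1 "c ^ i" "m ^ i" "{p}"] x(4)
      el_pow[of "{p}" c i] el_pow[OF Mp'_el[OF x(2)], of i]
    by simp
  then show ?thesis using sg_pow[OF F(1) x(1)] by simp
qed

lemma Sig_sg:
  assumes F: "\<And>p. is_prime p \<Longrightarrow> sg (F p)"
  shows "sg (Sig F)"
proof (rule sgI)
  show "1 \<in> Sig F" using F sg_one M_sg by (auto simp: Sig_def)
next
  fix x y assume xy: "x \<in> Sig F" "y \<in> Sig F"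
  then have M: "x \<in> M" "y \<in> M" by (auto dest: Sig_M)
  have "(x * y) ^ i \<in> F p" if p: "is_prime p" "el {p} ((x * y) ^ i)" for p i
  proof -
    obtain n1 n2 where n: "0 < n1" "x ^ n1 = 1" "0 < n2" "y ^ n2 = 1"
      using M_el[OF M(1)] M_el[OF M(2)] by (auto simp: el_def)
    let ?n = "n1 * n2"
    have xyn: "x ^ ?n = 1" "y ^ ?n = 1" using power_one_dvd[OF n(2)] power_one_dvd[OF n(4)] by simp_all
    \<comment> \<open>The exponent \<open>?n\<close> serves both \<open>x\<close> and
      \<open>y\<close>, so the same \<open>e\<close> projects \<open>x^i\<close>, \<open>y^i\<close>
      and their product onto the \<open>p\<close>-parts.\<close>
    obtain e e' where e: "\<And>z::'a. z ^ ?n = 1 \<Longrightarrow> z = z ^ e * z ^ e' \<and> el {p} (z ^ e) \<and> el (-{p}) (z ^ e')"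
      using proj_exists[of ?n "{p}"] n by auto
    define z where "z = (x * y) ^ i"
    have zi: "z = x ^ i * y ^ i" unfolding z_def by (rule power_mult_commuting[OF M_comm[OF M]])
    have c: "x ^ k * y ^ l = y ^ l * x ^ k" for k l using M by (intro M_comm sg_pow[OF M_sg])
    have "x ^ (i * ?n) = 1" "y ^ (i * ?n) = 1"
      using power_one_dvd[OF xyn(1), of "i * ?n"] power_one_dvd[OF xyn(2), of "i * ?n"] by simp_all
    then have xn: "(x ^ i) ^ ?n = 1" "(y ^ i) ^ ?n = 1" by (simp_all only: power_mult[symmetric])
    then have zn: "z ^ ?n = 1" unfolding zi power_mult_commuting[OF c] by simp
    have "z ^ e * z ^ e' = z ^ e' * z ^ e" by (simp add: add.commute flip: power_add)
    then have "z = z ^ e"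
      using comm_split_unique[of z z 1 "z ^ e" "z ^ e'" "{p}"] e[OF zn] p(2) z_def by simp
    also have "\<dots> = (x ^ i) ^ e * (y ^ i) ^ e" unfolding zi by (rule power_mult_commuting[OF c])
    also have "\<dots> = x ^ (i * e) * y ^ (i * e)" by (simp only: power_mult)
    also have "\<dots> \<in> F p"
      using e[OF xn(1)] e[OF xn(2)] xy p(1) F
      by (intro sg_mult F Sig_pow) (simp_all add: power_mult)
    finally show ?thesis by (simp only: z_def)
  qed
  then show "x * y \<in> Sig F" using M sg_mult[OF M_sg] by (simp add: Sig_def)
next
  fix x assume x: "x \<in> Sig F"
  have "inverse x ^ i \<in> F p" if p: "is_prime p" "el {p} (inverse x ^ i)" for p i
  proof -
    have "el {p} (inverse (inverse x ^ i))" using p(2) by (rule el_inv)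
    then have "x ^ i \<in> F p" using x p by (intro Sig_pow) simp_all
    then show ?thesis using sg_inv[OF F[OF p(1)]] by fastforce
  qed
  then show "inverse x \<in> Sig F" using x sg_inv[OF M_sg] by (simp add: Sig_def)
qed

lemma Sig_base:
  assumes F: "\<And>q. is_prime q \<Longrightarrow> sg (F q)" and p: "is_prime p" and x: "x \<in> F p" "F p \<subseteq> Mp p"
  shows "x \<in> Sig F"
proof -
  have xM: "x \<in> Mp p" using x by blast
  have "x ^ i \<in> F q" if q: "is_prime q" "el {q} (x ^ i)" for q i
  proof (cases "q = p")
    case True
    then show ?thesis using sg_pow[OF F[OF p] x(1)] by simp
  next
    case False
    then have "x ^ i = 1" using el_coprime[OF q(2) el_pow[OF Mp_el[OF xM]]] by auto
    then show ?thesis using sg_one[OF F[OF q(1)]] by simp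
  qed
  then show ?thesis using Mp_M[OF xM] by (simp add: Sig_def)
qed

lemma Sig_least:
  assumes "sg K" "\<And>p. is_prime p \<Longrightarrow> F p \<subseteq> K"
  shows "Sig F \<subseteq> K"
proof
  fix x assume x: "x \<in> Sig F"
  show "x \<in> K"
  proof (rule in_sg_by_primes[OF M_el[OF Sig_M[OF x]] assms(1)])
    fix p i assume "is_prime p" "el {p} (x ^ i)"
    then show "x ^ i \<in> K" using Sig_pow[OF x] assms(2) by blast
  qed
qed

lemma Sig_mono: "(\<And>p. is_prime p \<Longrightarrow> F p \<subseteq> F' p) \<Longrightarrow> Sig F \<subseteq> Sig F'"
  unfolding Sig_def by blast

lemma Sig_normal:
  assumes "\<And>p x. is_prime p \<Longrightarrow> x \<in> F p \<Longrightarrow> cj x g \<in> F p" "g \<in> G" "x \<in> Sig F"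
  shows "cj x g \<in> Sig F"
proof -
  have "cj x g ^ i \<in> F p" if p: "is_prime p" "el {p} (cj x g ^ i)" for p i
  proof -
    have "el {p} (cj (cj x g ^ i) (inverse g))" using p(2) by (rule el_cj)
    then have "el {p} (x ^ i)" by (simp add: cj_pow cj_cj)
    then show ?thesis using assms p Sig_pow by (simp flip: cj_pow)
  qed
  then show ?thesis using M_normal[OF Sig_M[OF assms(3)] assms(2)] by (simp add: Sig_def)
qed

lemma Sig_Int:
  assumes "\<And>p x. is_prime p \<Longrightarrow> x \<in> F p \<Longrightarrow> x \<in> F' p \<Longrightarrow> x = 1" "x \<in> Sig F" "x \<in> Sig F'"
  shows "x = 1"
proof -
  have "x \<in> {1}"
  proof (rule in_sg_by_primes[OF M_el[OF Sig_M[OF assms(2)]]])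
    show "sg {1::'a}" by (simp add: sg_def)
    fix p i assume "is_prime p" "el {p} (x ^ i)"
    then show "x ^ i \<in> {1}" using assms Sig_pow by blast
  qed
  then show ?thesis by simp
qed

lemma AC_A: "is_prime p \<Longrightarrow> TT p \<noteq> {1} \<Longrightarrow> c \<in> AC p \<Longrightarrow> c \<in> A"
proof -
  assume a: "is_prime p" "TT p \<noteq> {1}" "c \<in> AC p"
  then obtain t1 where "t1 \<in> TT p" "t1 \<noteq> 1" using sg_one[OF TT_sg] by blast
  then interpret nontrivial_section A B p t1 using a by unfold_locales
  show "c \<in> A" using a by (intro AC_subset_A)
qed

lemma B_decomp:
  assumes a: "is_prime p" "TT p \<noteq> {1}" and y: "y \<in> B" "el {p} y"
  obtains a t m where "a \<in> A" "el {p} a" "t \<in> TT p" "m \<in> Mp' p" "y = a * t * m"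
proof -
  obtain t1 where "t1 \<in> TT p" "t1 \<noteq> 1" using a sg_one[OF TT_sg] by blast
  then interpret nontrivial_section A B p t1 using a by unfold_locales
  show ?thesis using B_p_decomp[OF y] that by blast
qed

lemma AC_all: "is_prime p \<Longrightarrow> TT p = {1} \<Longrightarrow> x \<in> Mp p \<Longrightarrow> x \<in> AC p"
  using Mp_split[of p x] by force

text \<open>A normal complement of \<open>TT p\<close> in \<open>M\<close>.\<close>

definition K1 :: "nat \<Rightarrow> 'a set" where "K1 p = pr (AC p) (Mp' p)"

lemma K1_sg: "is_prime p \<Longrightarrow> sg (K1 p)"
  unfolding K1_def by (intro sg_pr AC_sg Mp'_sg AC_normal) (auto intro: M_G Mp'_M)

lemma K1_normal: "is_prime p \<Longrightarrow> k \<in> K1 p \<Longrightarrow> g \<in> G \<Longrightarrow> cj k g \<in> K1 p"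
  unfolding K1_def by (elim prE) (simp add: prI AC_normal Mp'_normal)

lemma K1_M: "k \<in> K1 p \<Longrightarrow> k \<in> M"
  unfolding K1_def by (elim prE) (simp add: sg_mult[OF M_sg] Mp_M[OF AC_Mp] Mp'_M)

lemma K1_TT:
  assumes p: "is_prime p" and t: "t \<in> K1 p" "t \<in> TT p"
  shows "t = 1"
proof -
  obtain c m where cm: "c \<in> AC p" "m \<in> Mp' p" "t = c * m" using t(1) unfolding K1_def by (elim prE)
  have "m = inverse c * t" using cm(3) by simp
  then have "m \<in> Mp p" using cm(1) t(2) AC_Mp TT_Mp[OF p] Mp_sg sg_mult sg_inv by metis
  then have "m = 1" using cm(2) Mp_Mp' by blast
  then show ?thesis using AC_TT[OF p, of t] cm t by simp
qed

lemma K1_pow: "is_prime p \<Longrightarrow> x \<in> K1 p \<Longrightarrow> el {p} (x ^ i) \<Longrightarrow> x ^ i \<in> AC p"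
  unfolding K1_def by (elim prE) (rule part_in[OF AC_sg], auto dest: AC_Mp)

text \<open>Let \<open>t\<close> be the component of \<open>[a, b]\<close> in \<open>TT p\<close>.
  Since \<open>b\<close> centralizes \<open>t\<close>, \<open>moved_order\<close> puts
  \<open>t^n\<close> into the complement, where \<open>n\<close> is an exponent of \<open>b\<close>
  prime to \<open>p\<close>; so \<open>t = 1\<close>.\<close>

lemma com_K1:
  assumes p: "is_prime p" and ab: "a \<in> A" "b \<in> B" "el (-{p}) b"
  shows "com a b \<in> K1 p"
proof -
  have G: "a \<in> G" "b \<in> G" using ab A_G B_G by auto
  obtain i j where ij: "com a b = com a b ^ i * com a b ^ j" "com a b ^ i \<in> Mp p" "com a b ^ j \<in> Mp' p"
    using M_split[OF com_M[OF G]] by blast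
  obtain c t where ct: "c \<in> AC p" "t \<in> TT p" "com a b ^ i = c * t" using Mp_split[OF p ij(2)] by blast
  define k where "k = c * com a b ^ j"
  have k: "k \<in> K1 p" unfolding k_def K1_def using ct(1) ij(3) by (rule prI)
  have M: "t \<in> M" "c \<in> M" "com a b ^ j \<in> M" using TT_M[OF p ct(2)] Mp_M[OF AC_Mp[OF ct(1)]] Mp'_M[OF ij(3)] .
  have "com a b = t * c * com a b ^ j" using ij(1) ct(3) M_comm[OF M(1,2)] by metis
  then have eq: "com a b = t * k" by (simp only: k_def mult.assoc)
  obtain n where n: "0 < n" "coprime n p" "b ^ n = 1" using ab(3) el_p'_iff[OF p] by blast
  have "t ^ n \<in> K1 p"
  proof (rule moved_order[OF K1_sg[OF p] _ _ _ _ k n(3)])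
    show "cj a b = a * t * k" unfolding cj_com eq by (simp only: mult.assoc)
    show "cj t b = t" using TT_centralized[OF p ct(2) ab(2,3)] .
    show "t * k = k * t" if "k \<in> K1 p" for k using M_comm[OF M(1) K1_M[OF that]] .
  qed (rule K1_normal[OF p _ G(2)])
  then have "t ^ n = 1" using K1_TT[OF p] sg_pow[OF TT_sg[OF p] ct(2)] by blast
  then have "t = 1"
    using el_coprime[of "{p}" t "-{p}"] Mp_el[OF TT_Mp[OF p ct(2)]] el_p'_iff[OF p, of t] n by blast
  then show ?thesis using eq k by simp
qed

text \<open>On the \<open>p\<close>-component of \<open>v\<close> the \<open>p'\<close>-part of
  \<open>a\<close> acts trivially, so \<open>unipotent\<close> applies with \<open>p^k\<close>
  dividing \<open>n\<close> and \<open>p^j\<close> dividing \<open>N\<close>. The bound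
  \<open>n * N\<close> dominates \<open>p^k * j\<close>, since \<open>j \<le> p^j\<close>, and works
  for all primes at once.\<close>

lemma act_AC:
  assumes a: "a \<in> A" "a ^ n = 1" "0 < n"
    and v: "v \<in> M" "v ^ N = 1" "0 < N" "\<And>p i. is_prime p \<Longrightarrow> el {p} (v ^ i) \<Longrightarrow> v ^ i \<in> AC p"
  shows "act a ([:-1, 1:] ^ (n * N)) v = 1"
proof -
  let ?F = "[:-1, 1:] :: int poly"
  interpret abn M a using A_G[OF a(1)] M_normal M_sg by (intro abn_M) auto
  have "v \<in> {u \<in> M. act a (?F ^ (n * N)) u = 1}"
  proof (rule in_sg_by_primes[OF M_el[OF v(1)]])
    show "sg {u \<in> M. act a (?F ^ (n * N)) u = 1}"
    proof (rule sgI)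
      fix x assume x: "x \<in> {u \<in> M. act a (?F ^ (n * N)) u = 1}"
      then have "act a (?F ^ (n * N)) (x * inverse x) = act a (?F ^ (n * N)) (inverse x)"
        by (subst act_hom) (auto intro: sg_inv M_sg)
      then show "inverse x \<in> {u \<in> M. act a (?F ^ (n * N)) u = 1}" using x by (auto intro: sg_inv M_sg)
    qed (auto simp: act_hom intro: sg_one sg_mult M_sg)
    fix p i assume p: "is_prime p" "el {p} (v ^ i)"
    define u where "u = v ^ i"
    have uM: "u \<in> M" unfolding u_def using M_sg v(1) by (rule sg_pow)
    have uA: "u \<in> AC p" unfolding u_def using v(4) p by blast
    have uN: "u ^ N = 1" unfolding u_def using v(2) by (metis mult.commute power_mult power_one)
    have p1: "1 < p" using p(1) prime_gt_1_nat by blast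
    obtain j N' where N: "N = p ^ j * N'" "\<not> p dvd N'"
      using prime_power_canonical[OF p(1) v(3)] by (metis mult.commute)
    obtain k n' where n: "n = p ^ k * n'" "\<not> p dvd n'"
      using prime_power_canonical[OF p(1) a(3)] by (metis mult.commute)
    have pos: "0 < N'" "0 < n'" using N n v(3) a(3) by (auto intro: gr0I)
    have cop: "coprime N' p" "coprime n' p"
      using N n p(1) by (metis coprime_commute prime_imp_coprime)+
    have "(u ^ (p ^ j)) ^ N' = 1" using uN N by (simp add: power_mult)
    then have "el (-{p}) (u ^ (p ^ j))" using el_p'_iff[OF p(1)] pos cop by blast
    moreover have "el {p} (u ^ (p ^ j))" using p(2) by (intro el_pow) (simp add: u_def)
    ultimately have upj: "u ^ (p ^ j) = 1" using el_coprime[of "{p}" _ "-{p}"] by auto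
    have "(a ^ (p ^ k)) ^ n' = 1" using a(2) n by (simp add: power_mult)
    then have "el (-{p}) (a ^ (p ^ k))" using el_p'_iff[OF p(1)] pos cop by blast
    then have "cj u (a ^ (p ^ k)) = u"
      using sg_pow[OF A_sg a(1)] by (intro AC_centralized[OF p(1) uA])
    then have one: "act a (?F ^ (p ^ k * j)) u = 1" by (rule unipotent[OF p(1) uM upj])
    have "j \<le> p ^ j" using p1 by (simp add: less_imp_le)
    also have "p ^ j \<le> N" using N(1) pos by simp
    finally have "p ^ k * j \<le> n * N" using n(1) pos by (intro mult_le_mono) auto
    then have "?F ^ (n * N) = ?F ^ (n * N - p ^ k * j) * ?F ^ (p ^ k * j)"
      by (simp flip: power_add)
    then have "act a (?F ^ (n * N)) u = 1" using uM one by (simp only: act_mult act_one_right)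
    then show "v ^ i \<in> {u \<in> M. act a (?F ^ (n * N)) u = 1}" using uM by (simp add: u_def)
  qed
  then show ?thesis by simp
qed

end

section \<open>Nilpotency of subgroups generated by two elements\<close>

context factorized
begin

text \<open>The upper central series of \<open>V\<close> relative to \<open>a\<close> and
  \<open>b\<close>; \<open>gen2_com\<close> extends the condition from \<open>a\<close> and
  \<open>b\<close> to all of \<open>gen {a, b}\<close>.\<close>

primrec Uc :: "'g \<Rightarrow> 'g \<Rightarrow> 'g set \<Rightarrow> nat \<Rightarrow> 'g set" where
  "Uc a b V 0 = {1}"
| "Uc a b V (Suc n) = {v \<in> V. com v a \<in> Uc a b V n \<and> com v b \<in> Uc a b V n}"

text \<open>Every commutator of \<open>gen {a, b}\<close> lies in \<open>V\<close>, as
  \<open>[a, b]\<close> does. On \<open>V\<close> the operators \<open>a - 1\<close> and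
  \<open>b - 1\<close> commute and are nilpotent, so \<open>V\<close> is the term
  \<open>l1 + l2\<close> of its relative upper central series, through which the lower central
  series descends.\<close>

lemma nilpotent_pair:
  assumes ab: "a \<in> G" "b \<in> G" and V: "sg V" "V \<subseteq> M" "\<And>v g. v \<in> V \<Longrightarrow> g \<in> G \<Longrightarrow> cj v g \<in> V" "com a b \<in> V"
    and L: "\<And>v. v \<in> V \<Longrightarrow> act a ([:-1, 1:] ^ l1) v = 1" "\<And>v. v \<in> V \<Longrightarrow> act b ([:-1, 1:] ^ l2) v = 1"
  shows "\<exists>n. lower_series (gen {a, b}) n \<subseteq> {1}"
proof -
  let ?F = "[:-1, 1:] :: int poly"
  let ?K = "gen {a, b}"
  let ?U = "Uc a b V"
  have K_G: "?K \<subseteq> G" using ab by (intro gen_least G_sg) auto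
  interpret a: abn V a using V ab by (intro abn_M) auto
  interpret b: abn V b using V ab by (intro abn_M) auto
  have U_V: "?U n \<subseteq> V" for n using V(1) sg_one by (cases n) auto
  have U_sg: "sg (?U n)" for n
  proof (induction n)
    case 0
    then show ?case by (simp add: sg_def)
  next
    case (Suc n)
    show ?case
      by (rule sgI) (auto simp: a.com_hom b.com_hom a.com_inverse b.com_inverse
          intro: sg_one[OF V(1)] sg_mult[OF V(1)] sg_inv[OF V(1)] sg_one[OF Suc] sg_mult[OF Suc] sg_inv[OF Suc])
  qed
  have U_cj: "cj v g \<in> ?U n" if "v \<in> ?U n" "g \<in> G" for v g n
    using that
  proof (induction n arbitrary: v)
    case (Suc n)
    then have "v \<in> M" using V(2) U_V by blast
    then have "com (cj v g) a = cj (com v a) g" "com (cj v g) b = cj (com v b) g"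
      using ab Suc.prems by (simp_all add: cj_com_M)
    then show ?case using Suc V(3) by simp
  qed simp
  have U_com: "com v y \<in> ?U n" if v: "v \<in> ?U (Suc n)" and y: "y \<in> ?K" for v y n
    by (rule gen2_com[OF U_sg _ _ _ y]) (use v U_cj K_G in auto)
  \<comment> \<open>A commutator with \<open>a\<close> uses up one factor \<open>a - 1\<close>, one
    with \<open>b\<close> a factor \<open>b - 1\<close>, and the other exponent is preserved because
    the operators commute. So \<open>i + j\<close> drops.\<close>
  have V_U: "v \<in> ?U (i + j)" if "v \<in> V" "act a (?F ^ i) v = 1" "act b (?F ^ j) v = 1" for v i j
    using that
  proof (induction "i + j" arbitrary: i j v)
    case 0
    then show ?case by simp
  next
    case (Suc n)
    have vM: "v \<in> M" using Suc.prems V(2) by blast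
    have aa: "act a (?F ^ k) (com v a) = act a (?F ^ Suc k) v" for k
      using Suc.prems by (simp only: power_Suc2 a.act_mult act_com)
    have bb: "act b (?F ^ k) (com v b) = act b (?F ^ Suc k) v" for k
      using Suc.prems by (simp only: power_Suc2 b.act_mult act_com)
    have ba: "act b (?F ^ j) (com v a) = 1"
      using act_act[OF vM ab(2,1), of "?F ^ j" ?F] Suc.prems(3) by (simp only: act_com act_one_right)
    have ab': "act a (?F ^ i) (com v b) = 1"
      using act_act[OF vM ab, of "?F ^ i" ?F] Suc.prems(2) by (simp only: act_com act_one_right)
    show ?case
    proof (cases "i = 0 \<or> j = 0")
      case True
      then have "v = 1" using Suc.prems by auto
      then show ?thesis using U_sg sg_one by blast
    next
      case False
      then obtain i' j' where ij: "i = Suc i'" "j = Suc j'" by (meson not0_implies_Suc)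
      have "com v a \<in> ?U (i' + j)"
        using Suc.hyps(2) ij Suc.prems ba aa by (intro Suc.hyps(1)) (auto simp: a.com_closed simp del: power_Suc)
      moreover have "com v b \<in> ?U (i + j')"
        using Suc.hyps(2) ij Suc.prems ab' bb by (intro Suc.hyps(1)) (auto simp: b.com_closed simp del: power_Suc)
      ultimately show ?thesis using Suc.prems ij by simp
    qed
  qed
  define L where "L = l1 + l2"
  have VL: "V \<subseteq> ?U L" using V_U L unfolding L_def by blast
  have com_V: "com x y \<in> V" if x: "x \<in> ?K" and y: "y \<in> ?K" for x y
  proof -
    have VK: "cj v k \<in> V" if "v \<in> V" "k \<in> ?K" for v k using V(3) K_G that by blast
    have "com b a \<in> V" using sg_inv[OF V(1) V(4)] by (simp only: com_inv)
    then have "com a y \<in> V" "com b y \<in> V"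
      using gen2_com[OF V(1) VK _ _ y, of a] gen2_com[OF V(1) VK _ _ y, of b] V(4) sg_one[OF V(1)]
      by simp_all
    then have "com y a \<in> V" "com y b \<in> V"
      using sg_inv[OF V(1)] by (metis com_inv)+
    then have "com y x \<in> V" using gen2_com[OF V(1) VK _ _ x, of y] by blast
    then show ?thesis using sg_inv[OF V(1)] by (metis com_inv)
  qed
  have "lower_series ?K (Suc k) \<subseteq> ?U (L - k)" if "k \<le> L" for k
    using that
  proof (induction k)
    case 0
    have "lower_series ?K (Suc 0) \<subseteq> V"
      unfolding lower_series.simps by (rule gen_least[OF V(1)]) (use com_V in blast)
    then show ?case using VL unfolding diff_zero by (rule subset_trans)
  next
    case (Suc k)
    then have sub: "lower_series ?K (Suc k) \<subseteq> ?U (Suc (L - Suc k))"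
      by (simp add: Suc_diff_Suc del: lower_series.simps Uc.simps)
    show ?case unfolding lower_series.simps(2)[of _ "Suc k"]
    proof (rule gen_least[OF U_sg], safe)
      fix x y assume "x \<in> lower_series ?K (Suc k)" "y \<in> ?K"
      then show "com x y \<in> ?U (L - Suc k)" using U_com[of x] subsetD[OF sub] by simp
    qed
  qed
  from this[of L] show ?thesis by (intro exI[of _ "Suc L"]) (simp del: lower_series.simps)
qed

end

lemma Compl_el: "el Q x \<Longrightarrow> el (- Q) x \<Longrightarrow> x = 1"
  using el_coprime[of Q x "- Q"] by auto

context prod_lc
begin

lemma swap_Mp: "factorized.Mp B A = Mp"
proof -
  interpret s: factorized B A by (rule swap)
  show ?thesis by (rule ext) (simp add: s.Mp_def Mp_def swap_M)
qed

lemma swap_Mp': "factorized.Mp' B A = Mp'"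
proof -
  interpret s: factorized B A by (rule swap)
  show ?thesis by (rule ext) (simp add: s.Mp'_def Mp'_def swap_M)
qed

lemma swap_Sig: "prod_lc.Sig B A = Sig"
proof -
  interpret s: prod_lc B A by (rule swap_lc)
  show ?thesis by (rule ext) (simp add: s.Sig_def Sig_def swap_M)
qed

end

section \<open>The subgroups S, T and Z and the parts of A and B that remain\<close>

context prod_lc
begin

interpretation s: prod_lc B A
  rewrites "factorized.G B A = G" and "factorized.M B A = M"
    and "factorized.Mp B A = Mp" and "factorized.Mp' B A = Mp'" and "prod_lc.Sig B A = Sig"
  by (rule swap_lc swap_G swap_M swap_Mp swap_Mp' swap_Sig)+

text \<open>The prefix \<open>s\<close> marks the notions in which \<open>A\<close> and \<open>B\<close> have exchanged their roles.\<close>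

definition S :: "'a set" where "S = Sig s.TT"
definition T :: "'a set" where "T = Sig TT"
text \<open>The part of \<open>M\<^sub>p\<close> centralized by the \<open>p'\<close>-elements of
  both factors; it is what remains of \<open>M\<^sub>p\<close> after splitting off
  \<open>s.TT p\<close> and \<open>TT p\<close>.\<close>

definition ZZ :: "nat \<Rightarrow> 'a set" where "ZZ p = AC p \<inter> s.AC p"
definition Z :: "'a set" where "Z = Sig ZZ"
definition ST :: "'a set" where "ST = pr S T"
definition piS :: "nat set" where "piS = {p. is_prime p \<and> s.TT p \<noteq> {1}}"
definition piT :: "nat set" where "piT = {p. is_prime p \<and> TT p \<noteq> {1}}"
definition As :: "'a set" where "As = {a \<in> A. el (- piS) a}"
definition Bs :: "'a set" where "Bs = {b \<in> B. el (- piT) b}"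

lemma TT_sAC: "is_prime p \<Longrightarrow> x \<in> TT p \<Longrightarrow> x \<in> s.AC p"
  using TT_centralized[of p x "s.ap p"] s.ap_A[of p] s.ap_el[of p] TT_Mp[of p x] by (simp add: s.AC_def)

lemma ZZ_sg: "sg (ZZ p)"
  using AC_sg[of p] s.AC_sg[of p] unfolding ZZ_def sg_def by blast

lemma ZZ_Mp: "x \<in> ZZ p \<Longrightarrow> x \<in> Mp p"
  unfolding ZZ_def using AC_Mp by blast

lemma ZZ_normal: "is_prime p \<Longrightarrow> x \<in> ZZ p \<Longrightarrow> g \<in> G \<Longrightarrow> cj x g \<in> ZZ p"
  unfolding ZZ_def using AC_normal s.AC_normal by blast

lemma T_sg: "sg T"
  unfolding T_def by (intro Sig_sg TT_sg)

lemma Z_sg: "sg Z"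
  unfolding Z_def by (intro Sig_sg ZZ_sg)

lemma T_normal: "x \<in> T \<Longrightarrow> g \<in> G \<Longrightarrow> cj x g \<in> T"
  unfolding T_def by (rule Sig_normal[of TT]) (auto intro: TT_normal)

lemma Z_normal: "x \<in> Z \<Longrightarrow> g \<in> G \<Longrightarrow> cj x g \<in> Z"
  unfolding Z_def by (rule Sig_normal[of ZZ]) (auto intro: ZZ_normal)

lemma T_M: "x \<in> T \<Longrightarrow> x \<in> M" and Z_M: "x \<in> Z \<Longrightarrow> x \<in> M"
  unfolding T_def Z_def by (rule Sig_M, assumption)+

lemma TT_T: "is_prime p \<Longrightarrow> x \<in> TT p \<Longrightarrow> x \<in> T"
  unfolding T_def using TT_Mp by (intro Sig_base[of TT p x] TT_sg) auto

lemma ZZ_Z: "is_prime p \<Longrightarrow> x \<in> ZZ p \<Longrightarrow> x \<in> Z"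
  unfolding Z_def using ZZ_Mp by (intro Sig_base[of ZZ p x] ZZ_sg) auto

lemma T_p: "x \<in> T \<Longrightarrow> is_prime p \<Longrightarrow> el {p} (x ^ i) \<Longrightarrow> x ^ i \<in> TT p"
  unfolding T_def by (rule Sig_pow)

lemma Z_p: "x \<in> Z \<Longrightarrow> is_prime p \<Longrightarrow> el {p} (x ^ i) \<Longrightarrow> x ^ i \<in> ZZ p"
  unfolding Z_def by (rule Sig_pow)

lemma Bs_B: "b \<in> Bs \<Longrightarrow> b \<in> B"
  by (simp add: Bs_def)

lemma Bs_sg: "sg Bs"
  by (rule sgI) (auto simp: Bs_def intro: sg_one[OF B_sg] sg_mult[OF B_sg] sg_inv[OF B_sg] el_mult B_comm el_inv)

lemma Bs_el: "b \<in> Bs \<Longrightarrow> p \<in> piT \<Longrightarrow> el (-{p}) b"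
  unfolding Bs_def by (auto elim: el_mono)

lemma Bs_T_comm:
  assumes "b \<in> Bs" "x \<in> T"
  shows "b * x = x * b"
proof -
  have "T \<subseteq> {y. b * y = y * b}"
    unfolding T_def
  proof (rule Sig_least[OF sg_centralizer], rule subsetI, rule CollectI)
    fix p x assume p: "is_prime p" and x: "x \<in> TT p"
    show "b * x = x * b"
    proof (cases "TT p = {1}")
      case False
      then have "el (-{p}) b" using assms p Bs_el by (simp add: piT_def)
      then have "cj x b = x" using assms p x TT_centralized Bs_B by blast
      then show ?thesis by (simp add: cj_fix_iff)
    qed (use x in simp)
  qed
  then show ?thesis using assms by blast
qed

text \<open>Only the part of \<open>ap p\<close> prime to \<open>piS\<close> lies in
  \<open>As\<close>, but the rest acts trivially on \<open>TT p\<close>. Indeed, by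
  \<open>s.B_decomp\<close> its \<open>q\<close>-components are products of a
  \<open>q\<close>-element of \<open>B\<close>, where \<open>q \<noteq> p\<close>, and of elements
  of \<open>M\<close>, and all of these centralize \<open>TT p\<close>.\<close>

lemma TT_com_As:
  assumes p: "is_prime p" and x: "x \<in> TT p"
  shows "x \<in> gen {com y a | y a. y \<in> T \<and> a \<in> As}"
proof -
  let ?a = "ap p"
  obtain y where y: "y \<in> TT p" "x = com y ?a" using TT_com[OF p x] by blast
  obtain i j where ij: "?a = ?a ^ i * ?a ^ j" "el (- piS) (?a ^ i)" "el (- (- piS)) (?a ^ j)"
    using el_split[OF periodic[OF ap_G[OF p]], of "- piS"] by blast
  have cen: "z * ?a ^ j = ?a ^ j * z" if z: "z \<in> TT p" for z
  proof -
    have "?a ^ j \<in> {g. z * g = g * z}"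
    proof (rule in_sg_by_primes[OF _ sg_centralizer])
      show "el UNIV (?a ^ j)" using el_pow[OF periodic[OF ap_G[OF p]]] .
      fix q k assume q: "is_prime q" "el {q} ((?a ^ j) ^ k)"
      define c where "c = (?a ^ j) ^ k"
      have cA: "c \<in> A" unfolding c_def using ap_A[OF p] A_sg by (simp only: sg_pow)
      show "(?a ^ j) ^ k \<in> {g. z * g = g * z}"
      proof (cases "c = 1")
        case True
        then show ?thesis unfolding c_def by simp
      next
        case False
        have "el piS c" unfolding c_def using ij(3) el_pow by (metis double_compl)
        then have qS: "q \<in> piS" using el_coprime[of piS c "{q}"] q(2) False unfolding c_def by blast
        have "el (-{p}) c" unfolding c_def using ap_el[OF p] by (intro el_pow)
        then have pq: "p \<noteq> q" using q(2) False Compl_el unfolding c_def by blast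
        obtain b t m where btm: "b \<in> B" "el {q} b" "t \<in> s.TT q" "m \<in> Mp' q" "c = b * t * m"
          using s.B_decomp[OF q(1) _ cA] qS q(2) unfolding piS_def c_def by blast
        have "el (-{p}) b" using btm(2) pq by (auto elim: el_mono)
        then have "cj z b = z" using TT_centralized[OF p z btm(1)] by blast
        then have zb: "z * b = b * z" by (simp only: cj_fix_iff)
        have zt: "z * t = t * z" using TT_M[OF p z] s.TT_M[OF q(1) btm(3)] by (rule M_comm)
        have zm: "z * m = m * z" using TT_M[OF p z] Mp'_M[OF btm(4)] by (rule M_comm)
        have "c \<in> {g. z * g = g * z}" unfolding btm(5)
          by (intro sg_mult[OF sg_centralizer]) (simp_all only: mem_Collect_eq zb zt zm)
        then show ?thesis unfolding c_def .
      qed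
    qed
    then show ?thesis by (rule CollectD)
  qed
  have "com y (?a ^ i * ?a ^ j) = com y (?a ^ j) * cj (com y (?a ^ i)) (?a ^ j)"
    by (rule com_mult_right)
  also have "com y (?a ^ j) = 1" using cen[OF y(1)] by (simp only: com_one_iff)
  also have "com y (?a ^ i) \<in> TT p"
    unfolding com_alt(1) using TT_sg[OF p] y(1) ap_G[OF p] sg_pow[OF G_sg]
    by (intro sg_mult sg_inv TT_normal[OF p]) auto
  then have "cj (com y (?a ^ i)) (?a ^ j) = com y (?a ^ i)"
    using cen by (simp only: cj_fix_iff)
  finally have "x = com y (?a ^ i)" using y(2) ij(1) by simp
  moreover have "?a ^ i \<in> As" unfolding As_def using ij(2) sg_pow[OF A_sg ap_A[OF p]] by simp
  ultimately show ?thesis using TT_T[OF p y(1)] by (blast intro: gen_base)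
qed

lemma T_com_As: "T \<subseteq> gen {com y a | y a. y \<in> T \<and> a \<in> As}"
  using Sig_least[OF sg_gen, of TT] TT_com_As T_def by blast

lemma com_K1_pow:
  assumes p: "is_prime p" and ab: "a \<in> A" "b \<in> B" "p \<in> piT \<Longrightarrow> el (-{p}) b"
    and el: "el {p} (com a b ^ i)"
  shows "com a b ^ i \<in> AC p"
proof (cases "TT p = {1}")
  case True
  have "com a b ^ i \<in> M" using ab by (intro sg_pow[OF M_sg] com_M A_G B_G)
  then have "com a b ^ i \<in> Mp p" using el by (simp add: Mp_def)
  then show ?thesis by (rule AC_all[OF p True])
next
  case False
  then have "p \<in> piT" using p by (simp add: piT_def)
  then show ?thesis using K1_pow[OF p com_K1[OF p ab(1,2)]] ab(3) el by blast
qed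

text \<open>The \<open>p\<close>-component of \<open>[x, g]\<close> lies in \<open>ZZ p\<close> and
  is fixed by \<open>g\<close>; by \<open>moved_order\<close> its order divides an exponent of
  \<open>g\<close>, which is prime to \<open>p\<close>.\<close>

lemma com_moves_p':
  assumes p: "is_prime p" and G: "x \<in> G" "g \<in> G" "el (-{p}) g" and c: "com x g \<in> Z"
    and fixed: "\<And>z. z \<in> ZZ p \<Longrightarrow> cj z g = z"
  shows "com x g \<in> Mp' p"
proof -
  obtain i j where ij: "com x g = com x g ^ i * com x g ^ j" "com x g ^ i \<in> Mp p" "com x g ^ j \<in> Mp' p"
    using M_split[OF com_M[OF G(1,2)]] by blast
  let ?u = "com x g ^ i"
  have u: "?u \<in> ZZ p" using Z_p[OF c p Mp_el[OF ij(2)]] .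
  obtain n where n: "0 < n" "coprime n p" "g ^ n = 1" using G(3) el_p'_iff[OF p] by blast
  have "?u ^ n \<in> Mp' p"
  proof (rule moved_order[OF Mp'_sg _ _ _ _ ij(3) n(3)])
    show "cj x g = x * ?u * com x g ^ j" unfolding cj_com mult.assoc ij(1)[symmetric] ..
    show "?u * k = k * ?u" if "k \<in> Mp' p" for k
      using Mp_M[OF ij(2)] Mp'_M[OF that] by (rule M_comm)
  qed (simp_all only: Mp'_normal[OF _ G(2)] fixed[OF u])
  then have "?u ^ n = 1" using Mp_Mp' sg_pow[OF Mp_sg ij(2)] by blast
  then have "?u = 1"
    using el_coprime[of "{p}" ?u "-{p}"] Mp_el[OF ij(2)] el_p'_iff[OF p, of ?u] n by blast
  then show ?thesis using ij by (metis mult_1_left)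
qed

text \<open>The commutator identity \<open>[a b, y] = [a, y]\<^sup>b\<close> is applied to \<open>y = s.ap p\<close>, which acts
  fixed-point-freely on \<open>s.TT p\<close>.\<close>

lemma product_in_M:
  assumes p: "is_prime p" and ab: "a \<in> A" "b \<in> B" "p \<in> piS \<Longrightarrow> el (-{p}) a" and m: "a * b \<in> M"
    and el: "el {p} ((a * b) ^ i)"
  shows "(a * b) ^ i \<in> s.AC p"
proof (cases "s.TT p = {1}")
  case True
  have "(a * b) ^ i \<in> Mp p" using el sg_pow[OF M_sg m] by (simp add: Mp_def)
  then show ?thesis by (rule s.AC_all[OF p True])
next
  case False
  then have a': "el (-{p}) a" using p ab(3) by (simp add: piS_def)
  let ?y = "s.ap p"
  let ?x = "(a * b) ^ i"
  have y: "?y \<in> B" "?y \<in> G" using s.ap_A[OF p] s.ap_G[OF p] by auto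
  interpret y: abn M ?y using y M_sg M_normal by (intro abn_M) auto
  have x: "?x \<in> Mp p" "?x \<in> M" using el sg_pow[OF M_sg m] by (simp_all add: Mp_def)
  have K_sg: "sg (s.K1 p)" using p by (rule s.K1_sg)
  have "com ?y a \<in> s.K1 p" using p y(1) ab(1) a' by (rule s.com_K1)
  then have "com a ?y \<in> s.K1 p" using sg_inv[OF K_sg] by (metis com_inv)
  then have "cj (com a ?y) b * com b ?y \<in> s.K1 p"
    using s.K1_normal[OF p _ B_G[OF ab(2)]] B_comm[OF ab(2) y(1)] by (simp add: com_one_iff[THEN iffD2])
  then have "com (a * b) ?y \<in> s.K1 p" by (simp only: com_mult_left)
  then have K: "com ?x ?y \<in> s.K1 p" using sg_pow[OF K_sg] m by (simp only: y.com_pow)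
  obtain c t where ct: "c \<in> s.AC p" "t \<in> s.TT p" "?x = c * t" using s.Mp_split[OF p x(1)] by blast
  have M: "c \<in> M" "t \<in> M" using Mp_M[OF s.AC_Mp[OF ct(1)]] s.TT_M[OF p ct(2)] .
  have "com c ?y = 1" using s.AC_fix[OF ct(1)] by (simp add: com_alt(1))
  then have "com ?x ?y = com t ?y" unfolding ct(3) using M by (simp add: y.com_hom)
  moreover have "com t ?y \<in> s.TT p"
    unfolding com_alt(1) using ct(2) y(2) by (intro sg_mult sg_inv s.TT_sg[OF p] s.TT_normal[OF p])
  ultimately have "com t ?y = 1" using s.K1_TT[OF p] K by metis
  then have "cj t ?y = t" by (simp add: cj_com)
  then have "t = 1" using s.TT_fix[OF p ct(2)] by blast
  then show ?thesis using ct by simp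
qed

end

context prod_lc
begin

lemma swap_T: "prod_lc.T B A = S" and swap_S: "prod_lc.S B A = T"
  and swap_ZZ: "prod_lc.ZZ B A = ZZ" and swap_Z: "prod_lc.Z B A = Z"
  and swap_piT: "prod_lc.piT B A = piS" and swap_piS: "prod_lc.piS B A = piT"
  and swap_Bs: "prod_lc.Bs B A = As" and swap_As: "prod_lc.As B A = Bs"
proof -
  interpret s: prod_lc B A by (rule swap_lc)
  show "s.T = S" "s.S = T" by (simp_all only: s.T_def T_def s.S_def S_def swap_Sig)
  show ZZ: "s.ZZ = ZZ" by (rule ext) (simp only: s.ZZ_def ZZ_def Int_commute)
  show "s.Z = Z" by (simp only: s.Z_def Z_def swap_Sig ZZ)
  show pi: "s.piT = piS" "s.piS = piT" by (simp_all only: s.piT_def piT_def s.piS_def piS_def)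
  show "s.Bs = As" "s.As = Bs" by (simp_all only: s.Bs_def Bs_def s.As_def As_def pi)
qed

interpretation s: prod_lc B A
  rewrites "factorized.G B A = G" and "factorized.M B A = M"
    and "factorized.Mp B A = Mp" and "factorized.Mp' B A = Mp'" and "prod_lc.Sig B A = Sig"
    and "prod_lc.T B A = S" and "prod_lc.S B A = T" and "prod_lc.ZZ B A = ZZ" and "prod_lc.Z B A = Z"
    and "prod_lc.piT B A = piS" and "prod_lc.piS B A = piT"
    and "prod_lc.Bs B A = As" and "prod_lc.As B A = Bs"
  by (rule swap_lc swap_G swap_M swap_Mp swap_Mp' swap_Sig swap_T swap_S swap_ZZ swap_Z swap_piT
      swap_piS swap_Bs swap_As)+

lemma TT2_sg: "is_prime p \<Longrightarrow> sg (pr (s.TT p) (TT p))"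
  by (intro sg_pr s.TT_sg TT_sg s.TT_normal) (auto intro: M_G TT_M)

lemma ST_sg: "sg ST"
  unfolding ST_def by (intro sg_pr s.T_sg T_sg s.T_normal) (auto intro: M_G T_M)

lemma ST_normal: "x \<in> ST \<Longrightarrow> g \<in> G \<Longrightarrow> cj x g \<in> ST"
  unfolding ST_def by (elim prE) (simp add: prI s.T_normal T_normal)

lemma ST_M: "x \<in> ST \<Longrightarrow> x \<in> M"
  unfolding ST_def by (elim prE) (simp add: sg_mult[OF M_sg] T_M s.T_M)

lemma ST_G: "x \<in> ST \<Longrightarrow> x \<in> G"
  using ST_M M_G by blast

lemma S_ST: "x \<in> S \<Longrightarrow> x \<in> ST" and T_ST: "x \<in> T \<Longrightarrow> x \<in> ST"
  unfolding ST_def by (rule pr_left[OF T_sg], assumption) (rule pr_right[OF s.T_sg], assumption)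

lemma ST_Sig: "ST \<subseteq> Sig (\<lambda>p. pr (s.TT p) (TT p))"
proof -
  let ?P = "Sig (\<lambda>p. pr (s.TT p) (TT p))"
  have "S \<subseteq> ?P" unfolding S_def using pr_left[OF TT_sg] by (intro Sig_mono) blast
  moreover have "T \<subseteq> ?P" unfolding T_def using pr_right[OF s.TT_sg] by (intro Sig_mono) blast
  moreover have "sg ?P" using TT2_sg by (rule Sig_sg)
  ultimately show ?thesis unfolding ST_def by (auto elim!: prE intro: sg_mult)
qed

lemma TT2_ZZ:
  assumes p: "is_prime p" and x: "x \<in> pr (s.TT p) (TT p)" "x \<in> ZZ p"
  shows "x = 1"
proof -
  obtain u t where ut: "u \<in> s.TT p" "t \<in> TT p" "x = u * t" using x(1) by (elim prE)
  have z: "x \<in> AC p" "x \<in> s.AC p" using x(2) by (auto simp: ZZ_def)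
  have "t = inverse u * x" using ut(3) by simp
  then have "t \<in> AC p" using s.TT_sAC[OF p ut(1)] z(1) AC_sg sg_mult sg_inv by metis
  then have "t = 1" using AC_TT[OF p] ut(2) by blast
  then show ?thesis using s.AC_TT[OF p z(2)] ut by simp
qed

lemma ST_Z: "x \<in> ST \<Longrightarrow> x \<in> Z \<Longrightarrow> x = 1"
  using ST_Sig unfolding Z_def
  by (intro Sig_Int[of "\<lambda>p. pr (s.TT p) (TT p)" ZZ x]) (simp_all add: TT2_ZZ subset_iff)

lemma S_Int_T: "x \<in> S \<Longrightarrow> x \<in> T \<Longrightarrow> x = 1"
  unfolding S_def T_def using Sig_Int[of s.TT TT x] AC_TT s.TT_sAC by blast

lemma Mp_three:
  assumes p: "is_prime p" and x: "x \<in> Mp p"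
  shows "x \<in> pr ST Z"
proof -
  obtain c t where ct: "c \<in> AC p" "t \<in> TT p" "x = c * t" using Mp_split[OF p x] by blast
  obtain d u where du: "d \<in> s.AC p" "u \<in> s.TT p" "c = d * u" using s.Mp_split[OF p AC_Mp[OF ct(1)]] by blast
  have "d = c * inverse u" using du(3) by (simp add: mult.assoc)
  then have "d \<in> AC p" using s.TT_sAC[OF p du(2)] ct(1) AC_sg sg_mult sg_inv by metis
  then have d: "d \<in> Z" using du(1) ZZ_Z[OF p] by (simp add: ZZ_def)
  have ut: "u * t \<in> ST" using S_ST[OF s.TT_T[OF p du(2)]] T_ST[OF TT_T[OF p ct(2)]] by (rule sg_mult[OF ST_sg])
  have "x = d * (u * t)" unfolding ct(3) du(3) by (simp only: mult.assoc)
  also have "\<dots> = (u * t) * d" using Z_M[OF d] ST_M[OF ut] by (rule M_comm)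
  finally show ?thesis using prI[OF ut d] by simp
qed

lemma M_three: "x \<in> M \<Longrightarrow> x \<in> pr ST Z"
proof (rule in_sg_by_primes)
  assume x: "x \<in> M"
  then show "el UNIV x" by (rule M_el)
  show "sg (pr ST Z)" by (intro sg_pr ST_sg Z_sg ST_normal) (auto intro: M_G Z_M)
  fix p i assume "is_prime p" "el {p} (x ^ i)"
  then show "x ^ i \<in> pr ST Z" using x sg_pow[OF M_sg] by (intro Mp_three) (simp_all add: Mp_def)
qed

lemma com_Z:
  assumes ab: "a \<in> As" "b \<in> Bs"
  shows "com a b \<in> Z"
proof -
  have AB: "a \<in> A" "b \<in> B" using ab Bs_B s.Bs_B by auto
  have "com a b ^ i \<in> ZZ p" if p: "is_prime p" and el: "el {p} (com a b ^ i)" for p i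
  proof -
    have "com a b ^ i \<in> AC p" using p AB el Bs_el[OF ab(2)] by (intro com_K1_pow)
    moreover have "com b a ^ i \<in> s.AC p"
    proof (rule s.com_K1_pow[OF p AB(2,1) s.Bs_el[OF ab(1)]])
      have "inverse (com a b ^ i) = com b a ^ i" by (simp add: com_inv)
      then show "el {p} (com b a ^ i)" using el_inv[OF el] by metis
    qed
    then have "inverse (com b a ^ i) \<in> s.AC p" by (rule sg_inv[OF s.AC_sg])
    then have "com a b ^ i \<in> s.AC p" by (simp add: com_inv)
    ultimately show ?thesis by (simp add: ZZ_def)
  qed
  then show ?thesis unfolding Z_def Sig_def using com_M[OF A_G[OF AB(1)] B_G[OF AB(2)]] by simp
qed

text \<open>This is what separates \<open>ST\<close> from \<open>pr As Bs\<close>, since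
  \<open>ST\<close> lies in \<open>M\<close> and meets \<open>Z\<close> trivially.\<close>

lemma product_in_M_Z:
  assumes ab: "a \<in> As" "b \<in> Bs" and m: "a * b \<in> M"
  shows "a * b \<in> Z"
proof -
  have AB: "a \<in> A" "b \<in> B" using ab Bs_B s.Bs_B by auto
  have m': "inverse b * inverse a \<in> M" using sg_inv[OF M_sg m] by simp
  have "(a * b) ^ i \<in> ZZ p" if p: "is_prime p" and el: "el {p} ((a * b) ^ i)" for p i
  proof -
    have inv: "inverse ((a * b) ^ i) = (inverse b * inverse a) ^ i" by simp
    have "(a * b) ^ i \<in> s.AC p" using p AB s.Bs_el[OF ab(1)] m el by (intro product_in_M)
    moreover have "(inverse b * inverse a) ^ i \<in> AC p"
    proof (rule s.product_in_M[OF p sg_inv[OF B_sg AB(2)] sg_inv[OF A_sg AB(1)] _ m'])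
      show "p \<in> piT \<Longrightarrow> el (-{p}) (inverse b)" using Bs_el[OF ab(2)] by (rule el_inv)
      show "el {p} ((inverse b * inverse a) ^ i)" using el_inv[OF el] inv by metis
    qed
    then have "(a * b) ^ i \<in> AC p" using sg_inv[OF AC_sg] inv by (metis inv_inv)
    ultimately show ?thesis by (simp add: ZZ_def)
  qed
  then show ?thesis unfolding Z_def Sig_def using m by simp
qed

lemma ZZ_A: "is_prime p \<Longrightarrow> z \<in> ZZ p \<Longrightarrow> a \<in> A \<Longrightarrow> el (-{p}) a \<Longrightarrow> cj z a = z"
  unfolding ZZ_def using AC_centralized by blast

lemma ZZ_B: "is_prime p \<Longrightarrow> z \<in> ZZ p \<Longrightarrow> b \<in> B \<Longrightarrow> el (-{p}) b \<Longrightarrow> cj z b = z"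
  unfolding ZZ_def using s.AC_centralized by blast

text \<open>For each prime \<open>p\<close> at least one of \<open>a\<close> and \<open>b\<close> is
  a \<open>p'\<close>-element. It centralizes \<open>ZZ p\<close>, so the commutator has no
  \<open>p\<close>-component.\<close>

lemma coprime_commute_AB:
  assumes ab: "a \<in> A" "b \<in> B" "el Q a" "el (-Q) b" "com a b \<in> Z"
  shows "a * b = b * a"
proof -
  have G: "a \<in> G" "b \<in> G" using ab A_G B_G by auto
  have "com a b \<in> {1}"
  proof (rule in_sg_by_primes[OF M_el[OF com_M[OF G]]])
    show "sg {1::'a}" by (simp add: sg_def)
    fix p i assume p: "is_prime p" "el {p} (com a b ^ i)"
    have "com a b \<in> Mp' p"
    proof (cases "p \<in> Q")
      case True
      then have "el (-{p}) b" using ab(4) by (auto elim: el_mono)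
      then show ?thesis using ZZ_B[OF p(1) _ ab(2)] by (intro com_moves_p'[OF p(1) G _ ab(5)])
    next
      case False
      then have a': "el (-{p}) a" using ab(3) by (auto elim: el_mono)
      have "com b a \<in> Z" using sg_inv[OF Z_sg ab(5)] by (simp only: com_inv)
      then have "com b a \<in> Mp' p"
        using ZZ_A[OF p(1) _ ab(1) a'] by (intro com_moves_p'[OF p(1) G(2,1) a'])
      from sg_inv[OF Mp'_sg this] show ?thesis by (simp only: com_inv)
    qed
    then have "el (-{p}) (com a b ^ i)" using Mp'_el el_pow by blast
    then show "com a b ^ i \<in> {1}" using p(2) Compl_el by blast
  qed
  then show ?thesis by (simp add: com_one_iff)
qed

lemma p'_Z_commute:
  assumes p: "is_prime p" and b: "b \<in> B" "el {p} b" and z: "z \<in> Z" "el (-{p}) z"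
  shows "b * z = z * b"
proof -
  have "z \<in> {y. b * y = y * b}"
  proof (rule in_sg_by_primes[OF M_el[OF Z_M[OF z(1)]] sg_centralizer])
    fix q i assume q: "is_prime q" "el {q} (z ^ i)"
    show "z ^ i \<in> {y. b * y = y * b}"
    proof (cases "q = p")
      case True
      then have "z ^ i = 1" using q(2) el_pow[OF z(2)] Compl_el by blast
      then show ?thesis by simp
    next
      case False
      then have "el (-{q}) b" using b(2) by (auto elim: el_mono)
      then have "cj (z ^ i) b = z ^ i" using ZZ_B[OF q(1) Z_p[OF z(1) q] b(1)] by blast
      then have "z ^ i * b = b * z ^ i" by (simp only: cj_fix_iff)
      then show ?thesis by (intro CollectI) (rule sym)
    qed
  qed
  then show ?thesis by (rule CollectD)
qed

text \<open>As \<open>TT p\<close> is nontrivial, \<open>A\<close> contains \<open>AC p\<close> and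
  thus \<open>s.TT p\<close>. If \<open>a2 = b * m\<close> in \<open>A\<close> were nontrivial, an
  element \<open>s0\<close> of order \<open>p\<close> in \<open>s.TT p\<close> would be a power of
  it, say \<open>b^l * m2\<close>. Comparing primary parts gives \<open>m2 = 1\<close> and
  \<open>s0\<close> in \<open>B\<close>, so \<open>s.ap p\<close> would fix
  \<open>s0\<close>.\<close>

lemma A_both_sections:
  assumes p: "p \<in> piS" "p \<in> piT" and a: "a \<in> A"
    and dec: "b \<in> B" "u \<in> s.TT p" "m \<in> Mp' p" "a = b * u * m" "el {p} a" "el {p} b"
  shows "a \<in> s.TT p"
proof -
  have pr: "is_prime p" using p by (simp add: piS_def)
  have ne: "TT p \<noteq> {1}" "s.TT p \<noteq> {1}" using p by (auto simp: piS_def piT_def)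
  have SA: "x \<in> A" if "x \<in> s.TT p" for x using AC_A[OF pr ne(1) s.TT_sAC[OF pr that]] .
  define a2 where "a2 = a * inverse u"
  have uM: "u \<in> M" "m \<in> M" using s.TT_M[OF pr dec(2)] Mp'_M[OF dec(3)] .
  have a2A: "a2 \<in> A" unfolding a2_def using a sg_inv[OF A_sg SA[OF dec(2)]] by (rule sg_mult[OF A_sg])
  have um: "u * m = m * u" using uM by (rule M_comm)
  have "a = b * m * u" unfolding dec(4) mult.assoc um ..
  then have a2: "a2 = b * m" unfolding a2_def by (simp add: mult.assoc)
  have el2: "el {p} a2" unfolding a2_def
    using dec(5) el_inv[OF Mp_el[OF s.TT_Mp[OF pr dec(2)]]] a sg_inv[OF A_sg SA[OF dec(2)]] A_comm
    by (intro el_mult)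
  have "a2 = 1"
  proof (rule ccontr)
    assume "a2 \<noteq> 1"
    then obtain i where i: "a2 ^ i \<noteq> 1" "(a2 ^ i) ^ p = 1" using order_p_power[OF pr el2] by blast
    obtain s1 where s1: "s1 \<in> s.TT p" "s1 \<noteq> 1" using ne(2) sg_one[OF s.TT_sg[OF pr]] by blast
    then obtain j where j: "s1 ^ j \<noteq> 1" "(s1 ^ j) ^ p = 1"
      using order_p_power[OF pr Mp_el[OF s.TT_Mp[OF pr s1(1)]]] by blast
    define s0 where "s0 = s1 ^ j"
    have s0: "s0 \<in> s.TT p" "s0 \<noteq> 1" "s0 ^ p = 1"
      using j sg_pow[OF s.TT_sg[OF pr] s1(1)] by (auto simp: s0_def)
    have elP: "el {p} s0" "el {p} (a2 ^ i)" using Mp_el[OF s.TT_Mp[OF pr s0(1)]] el_pow[OF el2] .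
    have "a2 ^ i \<in> {x \<in> A. el {p} x}" "s0 \<in> {x \<in> A. el {p} x}"
      using SA[OF s0(1)] sg_pow[OF A_sg a2A] elP by auto
    then obtain k where k: "s0 = (a2 ^ i) ^ k"
      using uniserial_socle_gen[OF A_uniserial[OF pr] pr _ _ i(1) i(2) s0(3)] by blast
    define l where "l = i * k"
    have "s0 = (b * m) ^ l" unfolding l_def power_mult using k a2 by simp
    moreover obtain m2 where m2: "m2 \<in> Mp' p" "(b * m) ^ l = b ^ l * m2"
      using pow_mod_normal[OF Mp'_sg Mp'_normal[OF _ B_G[OF dec(1)]] dec(3), of l] by blast
    ultimately have s0b: "s0 = b ^ l * m2" by simp
    have "b ^ l = s0 * inverse m2" unfolding s0b by (simp add: mult.assoc)
    then have "b ^ l \<in> M" using s.TT_M[OF pr s0(1)] Mp'_M[OF m2(1)] sg_mult[OF M_sg] sg_inv[OF M_sg] by metis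
    then have bl: "b ^ l \<in> Mp p" using el_pow[OF dec(6)] by (simp add: Mp_def)
    have "m2 = inverse (b ^ l) * s0" unfolding s0b by (rule inv_cancel_left[symmetric])
    then have "m2 \<in> Mp p" using bl s.TT_Mp[OF pr s0(1)] sg_mult[OF Mp_sg] sg_inv[OF Mp_sg] by metis
    then have "m2 = 1" using m2(1) Mp_Mp' by blast
    then have "s0 \<in> B" using s0b sg_pow[OF B_sg dec(1)] by simp
    then have "cj s0 (s.ap p) = s0" using s.ap_A[OF pr] by (intro cj_eqI B_comm)
    then show False using s.TT_fix[OF pr s0(1)] s0(2) by blast
  qed
  then have "a = u" unfolding a2_def by (metis inv_inv inv_unique)
  then show ?thesis using dec(2) by simp
qed

text \<open>This recovers what is lost in passing from \<open>A\<close> to \<open>As\<close>. When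
  \<open>p\<close> is not in \<open>piT\<close>, the decomposition \<open>a = b * u * m\<close> is
  spoiled only by the component \<open>z\<close> of \<open>m\<close> in \<open>Z\<close>. Being a
  \<open>p'\<close>-element, \<open>z\<close> commutes with \<open>b\<close>; raising
  \<open>a = (b * z) * w\<close> to a power of \<open>p\<close> puts a \<open>p\<close>-power of
  \<open>z\<close> into \<open>ST\<close>, so \<open>z\<close> is also a \<open>p\<close>-element
  and hence trivial.\<close>

lemma A_section:
  assumes p: "p \<in> piS" and a: "a \<in> A" "el {p} a"
  shows "a \<in> pr ST {b \<in> Bs. el piS b}"
proof -
  have pr: "is_prime p" "s.TT p \<noteq> {1}" using p by (auto simp: piS_def)
  obtain b u m where bum: "b \<in> B" "el {p} b" "u \<in> s.TT p" "m \<in> Mp' p" "a = b * u * m"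
    using s.B_decomp[OF pr a] by blast
  have one: "1 \<in> {b \<in> Bs. el piS b}" using sg_one[OF Bs_sg] by simp
  show ?thesis
  proof (cases "p \<in> piT")
    case True
    have "a \<in> s.TT p" using A_both_sections[OF p True a(1) bum(1,3,4,5) a(2) bum(2)] .
    then have "a * 1 \<in> pr ST {b \<in> Bs. el piS b}" using S_ST[OF s.TT_T[OF pr(1)]] one by (intro prI)
    then show ?thesis by simp
  next
    case False
    obtain v z where vz: "v \<in> ST" "z \<in> Z" "m = v * z" using M_three[OF Mp'_M[OF bum(4)]] by (elim prE)
    obtain n where n: "0 < n" "coprime n p" "m ^ n = 1" using Mp'_el[OF bum(4)] el_p'_iff[OF pr(1)] by blast
    have "v ^ n * z ^ n = 1"
      using n(3) power_mult_commuting[OF M_comm[OF ST_M[OF vz(1)] Z_M[OF vz(2)]], of n] vz(3) by simp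
    then have "inverse (v ^ n) = z ^ n" by (rule inv_unique)
    then have "z ^ n \<in> ST" using sg_inv[OF ST_sg sg_pow[OF ST_sg vz(1)]] by metis
    then have "z ^ n = 1" using ST_Z sg_pow[OF Z_sg vz(2)] by blast
    then have z': "el (-{p}) z" using el_p'_iff[OF pr(1)] n by blast
    define w where "w = u * v"
    have w: "w \<in> ST" unfolding w_def using S_ST[OF s.TT_T[OF pr(1) bum(3)]] vz(1) by (rule sg_mult[OF ST_sg])
    have "a = b * (w * z)" unfolding bum(5) vz(3) w_def by (simp only: mult.assoc)
    also have "w * z = z * w" using ST_M[OF w] Z_M[OF vz(2)] by (rule M_comm)
    finally have a_eq: "a = (b * z) * w" by (simp only: mult.assoc)
    have bzG: "b * z \<in> G" using B_G[OF bum(1)] M_G[OF Z_M[OF vz(2)]] by (rule sg_mult[OF G_sg])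
    have bz: "b * z = z * b" using p'_Z_commute[OF pr(1) bum(1,2) vz(2) z'] .
    obtain k l where kl: "a ^ (p ^ k) = 1" "b ^ (p ^ l) = 1" using a(2) bum(2) el_p_iff[OF pr(1)] by blast
    define q where "q = p ^ (k + l)"
    have q: "a ^ q = 1" "b ^ q = 1"
      using power_one_dvd[OF kl(1), of q] power_one_dvd[OF kl(2), of q] by (simp_all add: q_def power_add)
    obtain w2 where w2: "w2 \<in> ST" "((b * z) * w) ^ q = (b * z) ^ q * w2"
      using pow_mod_normal[OF ST_sg ST_normal[OF _ bzG] w, of q] by blast
    have "(b * z) ^ q = z ^ q" using power_mult_commuting[OF bz, of q] q(2) by simp
    then have "z ^ q * w2 = 1" using w2(2) q(1) a_eq by simp
    then have "inverse (z ^ q) = w2" by (rule inv_unique)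
    then have "z ^ q \<in> ST" using sg_inv[OF ST_sg w2(1)] by (metis inv_inv)
    then have "z ^ q = 1" using ST_Z sg_pow[OF Z_sg vz(2)] by blast
    then have "el {p} z" using el_p_iff[OF pr(1)] by (auto simp: q_def)
    then have "z = 1" using z' Compl_el by blast
    then have "a = cj w (inverse b) * b" unfolding a_eq by (simp add: cj_def mult.assoc)
    moreover have "cj w (inverse b) \<in> ST" using ST_normal[OF w B_G[OF sg_inv[OF B_sg bum(1)]]] .
    moreover have "b \<in> {b \<in> Bs. el piS b}" using bum(1,2) False p by (auto simp: Bs_def elim: el_mono)
    ultimately show ?thesis using prI by metis
  qed
qed

lemma A_piS:
  assumes a: "a \<in> A" "el piS a"
  shows "a \<in> pr ST {b \<in> Bs. el piS b}"
proof -
  let ?K = "{b \<in> Bs. el piS b}"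
  have K0: "sg ?K"
    by (rule sgI) (auto intro: sg_one[OF Bs_sg] sg_mult[OF Bs_sg] sg_inv[OF Bs_sg] el_inv el_mult B_comm[OF Bs_B Bs_B])
  have K: "sg (pr ST ?K)" by (intro sg_pr ST_sg K0) (auto intro: ST_normal B_G Bs_B)
  show ?thesis
  proof (rule in_sg_by_primes[OF periodic[OF A_G[OF a(1)]] K])
    fix p i assume p: "is_prime p" "el {p} (a ^ i)"
    show "a ^ i \<in> pr ST ?K"
    proof (cases "a ^ i = 1")
      case True
      then show ?thesis using sg_one[OF K] by simp
    next
      case False
      have "p \<in> piS"
      proof (rule ccontr)
        assume "p \<notin> piS"
        then have "a ^ i = 1" using el_coprime[OF p(2) el_pow[OF a(2)]] by blast
        then show False using False by simp
      qed
      then show ?thesis using A_section p(2) sg_pow[OF A_sg a(1)] by blast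
    qed
  qed
qed

lemma swap_ST: "prod_lc.ST B A = ST"
proof -
  have "pr T S = pr S T"
  proof (intro equalityI subsetI)
    fix x assume "x \<in> pr T S"
    then obtain t u where *: "t \<in> T" "u \<in> S" "x = t * u" by (elim prE)
    have "x = u * t" unfolding *(3) using T_M[OF *(1)] s.T_M[OF *(2)] by (rule M_comm)
    then show "x \<in> pr S T" using prI[OF *(2,1)] by simp
  next
    fix x assume "x \<in> pr S T"
    then obtain u t where *: "u \<in> S" "t \<in> T" "x = u * t" by (elim prE)
    have "x = t * u" unfolding *(3) using s.T_M[OF *(1)] T_M[OF *(2)] by (rule M_comm)
    then show "x \<in> pr T S" using prI[OF *(2,1)] by simp
  qed
  then show ?thesis unfolding s.ST_def ST_def .
qed

lemma A_As_split:
  assumes "a \<in> A"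
  obtains a1 a2 where "a1 \<in> As" "a2 \<in> A" "el piS a2" "a = a1 * a2"
proof -
  obtain i j where ij: "a = a ^ i * a ^ j" "el (- piS) (a ^ i)" "el (- (- piS)) (a ^ j)"
    using el_split[OF periodic[OF A_G[OF assms]], of "- piS"] by blast
  then show ?thesis using that[of "a ^ i" "a ^ j"] sg_pow[OF A_sg assms] by (simp add: As_def)
qed

end

section \<open>Existence\<close>

text \<open>\<open>e\<close> and \<open>f\<close> are the idempotents of the Chinese remainder
  theorem, realized as exponents.\<close>

lemma split_exponents:
  assumes "coprime m (n::nat)" "0 < m" "0 < n"
  obtains e f where "\<And>z::'g::monoid_mult. z ^ m = 1 \<Longrightarrow> z ^ e = z \<and> z ^ f = 1"
    "\<And>z::'g. z ^ n = 1 \<Longrightarrow> z ^ e = 1 \<and> z ^ f = z"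
    "\<And>z::'g. z ^ (m * n) = 1 \<Longrightarrow> z = z ^ e * z ^ f \<and> (z ^ e) ^ m = 1 \<and> (z ^ f) ^ n = 1"
proof -
  obtain e where e: "[e = 1] (mod m)" "[e = 0] (mod n)"
    using binary_chinese_remainder_nat[OF assms(1)] by blast
  obtain f where f: "[f = 0] (mod m)" "[f = 1] (mod n)"
    using binary_chinese_remainder_nat[OF assms(1)] by blast
  have "[e + f = 1 + 0] (mod m)" "[e + f = 0 + 1] (mod n)"
    using e f by (intro cong_add; simp)+
  then have ef: "[e + f = 1] (mod m * n)"
    using assms(1) by (intro coprime_cong_mult_nat) simp_all
  show ?thesis
  proof
    fix z :: 'g
    show "z ^ e = z \<and> z ^ f = 1" if "z ^ m = 1"
      using power_eq_cong[OF that, of e 1] power_eq_cong[OF that, of f 0] e f by (simp add: cong_def)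
    show "z ^ e = 1 \<and> z ^ f = z" if "z ^ n = 1"
      using power_eq_cong[OF that, of f 1] power_eq_cong[OF that, of e 0] e f by (simp add: cong_def)
    show "z = z ^ e * z ^ f \<and> (z ^ e) ^ m = 1 \<and> (z ^ f) ^ n = 1" if z: "z ^ (m * n) = 1"
    proof (intro conjI)
      have "z ^ (e + f) = z ^ 1" using power_eq_cong[OF z, of "e + f" 1] ef by (simp add: cong_def)
      then show "z = z ^ e * z ^ f" by (simp add: power_add)
      have "m * n dvd e * m" "m * n dvd f * n" using e(2) f(1) by (auto simp: cong_0_iff mult.commute)
      then show "(z ^ e) ^ m = 1" "(z ^ f) ^ n = 1"
        using power_one_dvd[OF z] by (simp_all only: power_mult[symmetric])
    qed
  qed
qed

text \<open>Pairs suffice for finite subsets by \<open>loc_cyclic_finite_cover\<close>, and natural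
  exponents suffice for periodic groups by \<open>powi_as_power\<close>.\<close>

definition loc_cyclic :: "'g::mult_group set \<Rightarrow> bool" where
  "loc_cyclic D \<longleftrightarrow> (\<forall>x\<in>D. \<forall>y\<in>D. \<exists>z\<in>D. \<exists>i j. x = z ^ i \<and> y = z ^ j)"

text \<open>Induction on a common exponent: split off one prime, take \<open>w\<close> for the
  \<open>p\<close>-parts by comparability and \<open>z\<close> for the rest by induction. Both are
  powers of \<open>w * z\<close>, as their exponents are coprime.\<close>

lemma loc_cyclic_of_uniserial:
  assumes D: "sg D" "\<And>x y. x \<in> D \<Longrightarrow> y \<in> D \<Longrightarrow> x * y = y * x" "\<And>x. x \<in> D \<Longrightarrow> el UNIV x"
    and u: "\<And>p. is_prime p \<Longrightarrow> uniserial {x \<in> D. el {p} x}"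
  shows "loc_cyclic D"
proof -
  have main: "\<exists>z\<in>D. z ^ n = 1 \<and> (\<exists>i j. x = z ^ i \<and> y = z ^ j)"
    if "0 < n" "x \<in> D" "y \<in> D" "x ^ n = 1" "y ^ n = 1" for n x y
    using that
  proof (induction n arbitrary: x y rule: less_induct)
    case (less n)
    show ?case
    proof (cases "n = 1")
      case True
      then show ?thesis using less.prems by (intro bexI[of _ 1]) (auto intro: sg_one[OF D(1)])
    next
      case False
      then obtain p where p: "is_prime p" "p dvd n" using prime_factor_nat by blast
      obtain k m where km: "n = p ^ k * m" "\<not> p dvd m"
        using prime_power_canonical[OF p(1) less.prems(1)] by (metis mult.commute)
      have p1: "1 < p" using p(1) prime_gt_1_nat by blast
      have pos: "0 < p ^ k" "0 < m" using km less.prems(1) p1 by (auto intro: gr0I)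
      have "k \<noteq> 0" using km p by (metis mult_1 power_0)
      then have "1 < p ^ k" using p1 one_less_power[of p k] by simp
      then have mn: "m < n" using km pos by simp
      have cop: "coprime (p ^ k) m"
        using p(1) km(2) by (metis coprime_power_left_iff prime_imp_coprime)
      obtain e f where ef: "\<And>z::'a. z ^ (p ^ k) = 1 \<Longrightarrow> z ^ e = z \<and> z ^ f = 1"
        "\<And>z::'a. z ^ m = 1 \<Longrightarrow> z ^ e = 1 \<and> z ^ f = z"
        "\<And>z::'a. z ^ (p ^ k * m) = 1 \<Longrightarrow> z = z ^ e * z ^ f \<and> (z ^ e) ^ (p ^ k) = 1 \<and> (z ^ f) ^ m = 1"
        using split_exponents[OF cop pos] by metis
      have x: "x = x ^ e * x ^ f" "(x ^ e) ^ (p ^ k) = 1" "(x ^ f) ^ m = 1"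
        using ef(3)[of x] less.prems(4) km(1) by auto
      have y: "y = y ^ e * y ^ f" "(y ^ e) ^ (p ^ k) = 1" "(y ^ f) ^ m = 1"
        using ef(3)[of y] less.prems(5) km(1) by auto
      note xD = sg_pow[OF D(1) less.prems(2)] and yD = sg_pow[OF D(1) less.prems(3)]
      obtain z where z: "z \<in> D" "z ^ m = 1" "\<exists>i j. x ^ f = z ^ i \<and> y ^ f = z ^ j"
        using less.IH[OF mn pos(2) xD yD x(3) y(3)] by blast
      have "x ^ e \<in> {x \<in> D. el {p} x}" "y ^ e \<in> {x \<in> D. el {p} x}"
        using xD yD x(2) y(2) el_p_iff[OF p(1)] by auto
      then have "(\<exists>k. x ^ e = (y ^ e) ^ k) \<or> (\<exists>k. y ^ e = (x ^ e) ^ k)" by (rule uniserialD[OF u[OF p(1)]])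
      then obtain w where w: "w \<in> D" "w ^ (p ^ k) = 1" "\<exists>i j. x ^ e = w ^ i \<and> y ^ e = w ^ j"
        using xD yD x(2) y(2) by (metis power_one_right)
      obtain i j i' j' where ij: "x ^ f = z ^ i" "y ^ f = z ^ j" "x ^ e = w ^ i'" "y ^ e = w ^ j'"
        using z(3) w(3) by blast
      have c: "w * z = z * w" using w(1) z(1) by (rule D(2))
      have "(w * z) ^ e = w" "(w * z) ^ f = z"
        unfolding power_mult_commuting[OF c] using ef(1)[OF w(2)] ef(2)[OF z(2)] by simp_all
      then have "x = (w * z) ^ (e * i') * (w * z) ^ (f * i)" "y = (w * z) ^ (e * j') * (w * z) ^ (f * j)"
        using x(1) y(1) ij by (simp_all only: power_mult)
      then have "\<exists>i j. x = (w * z) ^ i \<and> y = (w * z) ^ j" by (metis power_add)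
      moreover have "(w * z) ^ n = 1"
        unfolding power_mult_commuting[OF c] km(1)
        using power_one_dvd[OF w(2), of "p ^ k * m"] power_one_dvd[OF z(2), of "p ^ k * m"] by simp
      moreover have "w * z \<in> D" using w z sg_mult[OF D(1)] by blast
      ultimately show ?thesis by blast
    qed
  qed
  show ?thesis unfolding loc_cyclic_def
  proof (intro ballI)
    fix x y assume xy: "x \<in> D" "y \<in> D"
    obtain m n where "0 < m" "x ^ m = 1" "0 < n" "y ^ n = 1"
      using D(3)[OF xy(1)] D(3)[OF xy(2)] by (auto simp: el_def)
    then have "0 < m * n" "x ^ (m * n) = 1" "y ^ (m * n) = 1"
      using power_one_dvd[of x m "m * n"] power_one_dvd[of y n "m * n"] by auto
    then show "\<exists>z\<in>D. \<exists>i j. x = z ^ i \<and> y = z ^ j" using main[of "m * n" x y] xy by blast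
  qed
qed

lemma loc_cyclic_comm: "loc_cyclic D \<Longrightarrow> x \<in> D \<Longrightarrow> y \<in> D \<Longrightarrow> x * y = y * x"
  unfolding loc_cyclic_def by (metis add.commute power_add)

lemma loc_cyclic_finite_cover:
  assumes D: "loc_cyclic D" "sg D" "finite F" "F \<subseteq> D"
  shows "\<exists>z\<in>D. \<forall>x\<in>F. \<exists>i. x = z ^ i"
  using D(3,4)
proof (induction F rule: finite_induct)
  case empty
  then show ?case using sg_one[OF D(2)] by blast
next
  case (insert x F)
  then obtain z where z: "z \<in> D" "\<forall>x\<in>F. \<exists>i. x = z ^ i" by auto
  then obtain w i j where w: "w \<in> D" "x = w ^ i" "z = w ^ j" using D(1) insert unfolding loc_cyclic_def by blast
  then have "\<forall>y\<in>insert x F. \<exists>i. y = w ^ i" using z(2) by (metis insertE power_mult)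
  then show ?case using w(1) by blast
qed

definition loc_nilpotent :: "'g::mult_group set \<Rightarrow> bool" where
  "loc_nilpotent H \<longleftrightarrow> (\<forall>F. finite F \<and> F \<subseteq> H \<longrightarrow> (\<exists>n. lower_series (gen F) n \<subseteq> {1}))"

text \<open>For a subgroup of a periodic group these are the prime divisors of element orders,
  because an element of order divisible by \<open>p\<close> has a power of order
  \<open>p\<close>.\<close>

definition primes_of :: "'g::mult_group set \<Rightarrow> nat set" where
  "primes_of D = {p. is_prime p \<and> (\<exists>x\<in>D. x \<noteq> 1 \<and> x ^ p = 1)}"

text \<open>The predicate \<open>decomposition\<close> of the statement, for subgroups of a \<open>mult_group\<close>.\<close>

definition decomp :: "'g::mult_group set \<Rightarrow> 'g set \<Rightarrow> 'g set \<Rightarrow> 'g set \<Rightarrow> 'g set \<Rightarrow> 'g set \<Rightarrow> 'g set \<Rightarrow> bool" where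
  "decomp G A B S T A1 B1 \<longleftrightarrow>
     S \<subseteq> G \<and> sg S \<and> (\<forall>x\<in>S. \<forall>g\<in>G. cj x g \<in> S) \<and> loc_cyclic S \<and>
     T \<subseteq> G \<and> sg T \<and> (\<forall>x\<in>T. \<forall>g\<in>G. cj x g \<in> T) \<and> loc_cyclic T \<and>
     sg A1 \<and> A1 \<subseteq> A \<and> sg B1 \<and> B1 \<subseteq> B \<and> sg (pr A1 B1) \<and> loc_nilpotent (pr A1 B1) \<and>
     S \<inter> T = {1} \<and> (\<forall>x\<in>S. \<forall>y\<in>T. x * y = y * x) \<and>
     pr S T \<inter> pr A1 B1 = {1} \<and> G = pr (pr S T) (pr A1 B1) \<and>
     S \<inter> A1 = {1} \<and> (\<forall>x\<in>S. \<forall>y\<in>A1. x * y = y * x) \<and>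
     T \<inter> B1 = {1} \<and> (\<forall>x\<in>T. \<forall>y\<in>B1. x * y = y * x) \<and>
     G = pr (pr S A1) (pr T B1) \<and>
     primes_of S \<inter> primes_of A1 = {} \<and> primes_of T \<inter> primes_of B1 = {} \<and>
     S = gen {com x y | x y. x \<in> S \<and> y \<in> B1} \<and> T = gen {com x y | x y. x \<in> T \<and> y \<in> A1}"

context prod_lc
begin

interpretation s: prod_lc B A
  rewrites "factorized.G B A = G" and "factorized.M B A = M"
    and "factorized.Mp B A = Mp" and "factorized.Mp' B A = Mp'" and "prod_lc.Sig B A = Sig"
    and "prod_lc.T B A = S" and "prod_lc.S B A = T" and "prod_lc.ZZ B A = ZZ" and "prod_lc.Z B A = Z"
    and "prod_lc.piT B A = piS" and "prod_lc.piS B A = piT"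
    and "prod_lc.Bs B A = As" and "prod_lc.As B A = Bs" and "prod_lc.ST B A = ST"
  by (rule swap_lc swap_G swap_M swap_Mp swap_Mp' swap_Sig swap_T swap_S swap_ZZ swap_Z swap_piT
      swap_piS swap_Bs swap_As swap_ST)+

lemma Bs_G: "b \<in> Bs \<Longrightarrow> b \<in> G" and As_G: "a \<in> As \<Longrightarrow> a \<in> G"
  using B_G A_G Bs_B s.Bs_B by auto

lemma G_decomp:
  assumes g: "g \<in> G"
  shows "g \<in> pr ST (pr As Bs)"
proof -
  obtain a b where ab: "a \<in> A" "b \<in> B" "g = a * b" using g by (elim G_cases)
  obtain a1 a2 where a: "a1 \<in> As" "a2 \<in> A" "el piS a2" "a = a1 * a2" using A_As_split[OF ab(1)] by blast
  obtain b1 b2 where b: "b1 \<in> Bs" "b2 \<in> B" "el piT b2" "b = b1 * b2" using s.A_As_split[OF ab(2)] by blast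
  have bc: "b = b2 * b1" using b Bs_B B_comm by blast
  obtain u c where uc: "u \<in> ST" "c \<in> Bs" "el piS c" "a2 = u * c"
    using A_piS[OF a(2,3)] by (auto elim: prE)
  obtain v d where vd: "v \<in> ST" "d \<in> As" "el piT d" "b2 = v * d"
    using s.A_piS[OF b(2,3)] by (auto elim: prE)
  \<comment> \<open>The factors \<open>c\<close> and \<open>d\<close> come out in the wrong order.
    They commute, because \<open>c\<close> is a \<open>piS\<close>-element and \<open>d\<close>,
    belonging to \<open>As\<close>, has order prime to \<open>piS\<close>.\<close>
  have "el (-piS) d" using vd(2) by (simp add: As_def)
  then have dc: "d * c = c * d"
    using coprime_commute_AB[OF s.Bs_B[OF vd(2)] Bs_B[OF uc(2)], of "-piS"] uc(3) com_Z[OF vd(2) uc(2)]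
    by simp
  have G: "a1 \<in> G" "c \<in> G" using As_G[OF a(1)] Bs_G[OF uc(2)] by auto
  have "g = a1 * u * c * v * d * b1" unfolding ab(3) a(4) bc uc(4) vd(4) by (simp only: mult.assoc)
  also have "\<dots> = (cj u (inverse a1) * cj v (inverse (a1 * c))) * (a1 * (c * d) * b1)"
    by (simp add: cj_def mult.assoc)
  also have "a1 * (c * d) * b1 = (a1 * d) * (c * b1)" unfolding dc[symmetric] by (simp only: mult.assoc)
  finally have "g = (cj u (inverse a1) * cj v (inverse (a1 * c))) * ((a1 * d) * (c * b1))" .
  moreover have "cj u (inverse a1) * cj v (inverse (a1 * c)) \<in> ST"
    using uc(1) vd(1) sg_inv[OF G_sg G(1)] sg_inv[OF G_sg sg_mult[OF G_sg G]]
    by (intro sg_mult[OF ST_sg] ST_normal)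
  moreover have "(a1 * d) * (c * b1) \<in> pr As Bs"
    using a(1) vd(2) uc(2) b(1) by (intro prI sg_mult[OF Bs_sg] sg_mult[OF s.Bs_sg])
  ultimately show ?thesis using prI by metis
qed

lemma ST_AsBs:
  assumes u: "u \<in> ST" "z \<in> Z" and ab: "a \<in> As" "b \<in> Bs" "u = z * (a * b)"
  shows "u = 1"
proof -
  have "a * b = inverse z * u" using ab(3) by simp
  then have "a * b \<in> M" using sg_mult[OF M_sg sg_inv[OF M_sg Z_M[OF u(2)]] ST_M[OF u(1)]] by simp
  then have "a * b \<in> Z" using ab by (intro product_in_M_Z)
  then have "u \<in> Z" using ab(3) u(2) sg_mult[OF Z_sg] by simp
  then show ?thesis using u(1) ST_Z by blast
qed

text \<open>With the factor \<open>Z\<close>, which contains the commutators of \<open>As\<close>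
  and \<open>Bs\<close>, closure under multiplication is immediate; \<open>H1_eq\<close> then shows
  that this factor adds nothing.\<close>

definition H1 :: "'a set" where "H1 = {z * (a * b) | z a b. z \<in> Z \<and> a \<in> As \<and> b \<in> Bs}"

lemma H1I: "z \<in> Z \<Longrightarrow> a \<in> As \<Longrightarrow> b \<in> Bs \<Longrightarrow> z * (a * b) \<in> H1"
  by (auto simp: H1_def)

lemma H1_sg: "sg H1"
proof (rule sgI)
  show "1 \<in> H1" using H1I[OF sg_one[OF Z_sg] sg_one[OF s.Bs_sg] sg_one[OF Bs_sg]] by simp
next
  fix x y assume "x \<in> H1" "y \<in> H1"
  then obtain z a b z' a' b' where *: "z \<in> Z" "a \<in> As" "b \<in> Bs" "z' \<in> Z" "a' \<in> As" "b' \<in> Bs"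
    "x = z * (a * b)" "y = z' * (a' * b')" by (auto simp: H1_def)
  let ?c = "com (inverse b) (inverse a')"
  have "com (inverse a') (inverse b) \<in> Z"
    using * by (intro com_Z sg_inv[OF Bs_sg] sg_inv[OF s.Bs_sg])
  then have "?c \<in> Z" using sg_inv[OF Z_sg] by (metis com_inv)
  moreover have "x * y = (z * cj z' (inverse (a * b)) * cj ?c (inverse a)) * ((a * a') * (b * b'))"
    unfolding *(7,8) by (simp add: cj_def com_def mult.assoc)
  moreover have "inverse (a * b) \<in> G" "inverse a \<in> G"
    using sg_inv[OF G_sg sg_mult[OF G_sg As_G[OF *(2)] Bs_G[OF *(3)]]] sg_inv[OF G_sg As_G[OF *(2)]] .
  ultimately show "x * y \<in> H1"
    using H1I[of "z * cj z' (inverse (a * b)) * cj ?c (inverse a)" "a * a'" "b * b'"] *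
    by (simp only: sg_mult[OF Z_sg] sg_mult[OF Bs_sg] sg_mult[OF s.Bs_sg] Z_normal)
next
  fix x assume "x \<in> H1"
  then obtain z a b where *: "z \<in> Z" "a \<in> As" "b \<in> Bs" "x = z * (a * b)" by (auto simp: H1_def)
  have "com b a \<in> Z" using sg_inv[OF Z_sg com_Z[OF *(2,3)]] by (simp only: com_inv)
  moreover have "inverse x = (com b a * cj (inverse z) (b * a)) * (inverse a * inverse b)"
    unfolding *(4) by (simp add: cj_def com_def mult.assoc)
  moreover have "b * a \<in> G" using * by (intro sg_mult[OF G_sg] As_G Bs_G)
  ultimately show "inverse x \<in> H1"
    using H1I[of "com b a * cj (inverse z) (b * a)" "inverse a" "inverse b"] *
    by (simp only: sg_mult[OF Z_sg] sg_inv[OF Z_sg] sg_inv[OF Bs_sg] sg_inv[OF s.Bs_sg] Z_normal)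
qed

text \<open>Factorizing an element of \<open>H1\<close> by \<open>G_decomp\<close> leaves a
  component in \<open>ST\<close> that lies in \<open>H1\<close> as well, and \<open>ST_AsBs\<close>
  makes it trivial.\<close>

lemma H1_eq: "H1 = pr As Bs"
proof (intro equalityI subsetI)
  have sub: "x \<in> H1" if "x \<in> pr As Bs" for x
    using that H1I[OF sg_one[OF Z_sg]] by (elim prE) simp
  then show "x \<in> H1" if "x \<in> pr As Bs" for x using that .
  fix h assume h: "h \<in> H1"
  then obtain z a b where zab: "z \<in> Z" "a \<in> As" "b \<in> Bs" "h = z * (a * b)" by (auto simp: H1_def)
  have "h \<in> G" unfolding zab(4) using zab by (intro sg_mult[OF G_sg] As_G Bs_G M_G Z_M)
  then have "h \<in> pr ST (pr As Bs)" by (rule G_decomp)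
  then obtain u k where uk: "u \<in> ST" "k \<in> pr As Bs" "h = u * k" by (rule prE) blast
  have "u = h * inverse k" using uk(3) by (simp add: mult.assoc)
  then have "u \<in> H1" using h sub[OF uk(2)] H1_sg sg_mult sg_inv by metis
  then obtain z' a' b' where "z' \<in> Z" "a' \<in> As" "b' \<in> Bs" "u = z' * (a' * b')" by (auto simp: H1_def)
  then have "u = 1" using ST_AsBs[OF uk(1)] by blast
  then show "h \<in> pr As Bs" using uk by simp
qed

lemma AsBs_sg: "sg (pr As Bs)"
  using H1_sg unfolding H1_eq .

lemma AsBs_ST: "x \<in> ST \<Longrightarrow> x \<in> pr As Bs \<Longrightarrow> x = 1"
  using ST_AsBs[of x 1] sg_one[OF Z_sg] by (elim prE) simp

lemma nilpotent_AsBs: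
  assumes a: "a \<in> As" and b: "b \<in> Bs"
  shows "\<exists>n. lower_series (gen {a, b}) n \<subseteq> {1}"
proof -
  note c = com_Z[OF a b]
  obtain N where N: "0 < N" "com a b ^ N = 1" using M_el[OF Z_M[OF c]] by (auto simp: el_def)
  obtain n1 where n1: "0 < n1" "a ^ n1 = 1" using periodic[OF As_G[OF a]] by (auto simp: el_def)
  obtain n2 where n2: "0 < n2" "b ^ n2 = 1" using periodic[OF Bs_G[OF b]] by (auto simp: el_def)
  \<comment> \<open>Bounding the exponent by that of \<open>[a, b]\<close> gives one nilpotency
    bound from \<open>act_AC\<close> for all of \<open>V\<close>.\<close>
  define V where "V = {v \<in> Z. v ^ N = 1}"
  have V_sg: "sg V"
  proof (rule sgI)
    fix x y assume "x \<in> V" "y \<in> V"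
    then have xy: "x \<in> Z" "y \<in> Z" "x ^ N = 1" "y ^ N = 1" by (auto simp: V_def)
    then show "x * y \<in> V"
      using sg_mult[OF Z_sg xy(1,2)] power_mult_commuting[OF M_comm[OF Z_M[OF xy(1)] Z_M[OF xy(2)]], of N]
      by (simp add: V_def)
  next
    fix x assume x: "x \<in> V"
    then have "inverse (x ^ N) = 1" by (simp add: V_def del: inv_power)
    then show "inverse x \<in> V" using x sg_inv[OF Z_sg] by (simp add: V_def)
  qed (simp add: V_def sg_one[OF Z_sg])
  show ?thesis
  proof (rule nilpotent_pair[OF As_G[OF a] Bs_G[OF b] V_sg])
    show "V \<subseteq> M" using Z_M by (auto simp: V_def)
    show "cj v g \<in> V" if "v \<in> V" "g \<in> G" for v g
      using that Z_normal by (auto simp: V_def simp flip: cj_pow)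
    show "com a b \<in> V" using c N by (simp add: V_def)
    show "act a ([:-1, 1:] ^ (n1 * N)) v = 1" if "v \<in> V" for v
    proof (rule act_AC[OF s.Bs_B[OF a] n1(2,1) _ _ N(1)])
      show "v \<in> M" "v ^ N = 1" using that Z_M by (auto simp: V_def)
      show "v ^ i \<in> AC p" if "is_prime p" "el {p} (v ^ i)" for p i
        using Z_p[of v p i] that \<open>v \<in> V\<close> by (auto simp: V_def ZZ_def)
    qed
    show "act b ([:-1, 1:] ^ (n2 * N)) v = 1" if "v \<in> V" for v
    proof (rule s.act_AC[OF Bs_B[OF b] n2(2,1) _ _ N(1)])
      show "v \<in> M" "v ^ N = 1" using that Z_M by (auto simp: V_def)
      show "v ^ i \<in> s.AC p" if "is_prime p" "el {p} (v ^ i)" for p i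
        using Z_p[of v p i] that \<open>v \<in> V\<close> by (auto simp: V_def ZZ_def)
    qed
  qed
qed

lemma loc_cyclic_B: "loc_cyclic B"
  unfolding loc_cyclic_def using B_lc by blast

lemma loc_cyclic_Bs: "loc_cyclic Bs"
  unfolding loc_cyclic_def
proof (intro ballI)
  fix x y assume xy: "x \<in> Bs" "y \<in> Bs"
  then have "x \<in> B" "y \<in> B" "el (- piT) x" "el (- piT) y" by (auto simp: Bs_def)
  then obtain z i j where "z \<in> B" "el (- piT) z" "x = z ^ i" "y = z ^ j"
    using locally_cyclic_el[OF periodic[OF B_G] B_sg B_lc, of x y] by blast
  then show "\<exists>z\<in>Bs. \<exists>i j. x = z ^ i \<and> y = z ^ j" by (auto simp: Bs_def)
qed

lemma loc_cyclic_T: "loc_cyclic T"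
proof (rule loc_cyclic_of_uniserial[OF T_sg])
  fix p assume p: "is_prime p"
  have "{x \<in> T. el {p} x} \<subseteq> TT p" using T_p[OF _ p, of _ 1] by auto
  then show "uniserial {x \<in> T. el {p} x}" using uniserial_mono[OF TT_uniserial[OF p]] by blast
qed (auto intro: M_comm T_M M_el)

lemma T_Bs:
  assumes x: "x \<in> T" "x \<in> Bs"
  shows "x = 1"
proof -
  have "x \<in> {1}"
  proof (rule in_sg_by_primes[OF M_el[OF T_M[OF x(1)]]])
    show "sg {1::'a}" by (simp add: sg_def)
    fix p i assume p: "is_prime p" "el {p} (x ^ i)"
    have t: "x ^ i \<in> TT p" using T_p[OF x(1) p] .
    show "x ^ i \<in> {1}"
    proof (cases "TT p = {1}")
      case False
      then have "el (-{p}) (x ^ i)" using Bs_el[OF x(2)] p by (intro el_pow) (simp add: piT_def)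
      then show ?thesis using Compl_el[OF p(2)] by blast
    qed (use t in auto)
  qed
  then show ?thesis by simp
qed

lemma primes_of_T_Bs: "primes_of T \<inter> primes_of Bs = {}"
proof -
  have False if p: "p \<in> primes_of T" "p \<in> primes_of Bs" for p
  proof -
    obtain x y where xy: "is_prime p" "x \<in> T" "x \<noteq> 1" "x ^ p = 1" "y \<in> Bs" "y \<noteq> 1" "y ^ p = 1"
      using p by (auto simp: primes_of_def)
    have el: "el {p} x" "el {p} y" using xy el_p_of_pow by auto
    then have "x \<in> TT p" using T_p[OF xy(2,1), of 1] by simp
    then have "p \<in> piT" using xy by (auto simp: piT_def)
    then have "el (-{p}) y" using Bs_el xy by blast
    then show False using el(2) Compl_el xy(6) by blast
  qed
  then show ?thesis by blast
qed

lemma T_eq_com: "T = gen {com x y | x y. x \<in> T \<and> y \<in> As}"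
proof
  show "gen {com x y | x y. x \<in> T \<and> y \<in> As} \<subseteq> T"
  proof (rule gen_least[OF T_sg], safe)
    fix x y assume "x \<in> T" "y \<in> As"
    then show "com x y \<in> T" unfolding com_alt(1) by (simp only: T_normal As_G sg_mult[OF T_sg] sg_inv[OF T_sg])
  qed
qed (rule T_com_As)

end

context prod_lc
begin

interpretation s: prod_lc B A
  rewrites "factorized.G B A = G" and "factorized.M B A = M"
    and "factorized.Mp B A = Mp" and "factorized.Mp' B A = Mp'" and "prod_lc.Sig B A = Sig"
    and "prod_lc.T B A = S" and "prod_lc.S B A = T" and "prod_lc.ZZ B A = ZZ" and "prod_lc.Z B A = Z"
    and "prod_lc.piT B A = piS" and "prod_lc.piS B A = piT"
    and "prod_lc.Bs B A = As" and "prod_lc.As B A = Bs" and "prod_lc.ST B A = ST"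
  by (rule swap_lc swap_G swap_M swap_Mp swap_Mp' swap_Sig swap_T swap_S swap_ZZ swap_Z swap_piT
      swap_piS swap_Bs swap_As swap_ST)+

text \<open>By local cyclicity the \<open>As\<close>-factors of a finite set are powers of one
  element, and so are the \<open>Bs\<close>-factors; this leaves the two-generator case.\<close>

lemma loc_nilpotent_AsBs: "loc_nilpotent (pr As Bs)"
  unfolding loc_nilpotent_def
proof (intro allI impI)
  fix F :: "'a set" assume F: "finite F \<and> F \<subseteq> pr As Bs"
  have "\<forall>x\<in>F. \<exists>a b. a \<in> As \<and> b \<in> Bs \<and> x = a * b" using F unfolding pr_def by blast
  then obtain f g where fg: "\<And>x. x \<in> F \<Longrightarrow> f x \<in> As \<and> g x \<in> Bs \<and> x = f x * g x" by metis
  obtain a where a: "a \<in> As" "\<forall>x\<in>f ` F. \<exists>i. x = a ^ i"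
    using loc_cyclic_finite_cover[OF s.loc_cyclic_Bs s.Bs_sg, of "f ` F"] F fg by blast
  obtain b where b: "b \<in> Bs" "\<forall>x\<in>g ` F. \<exists>i. x = b ^ i"
    using loc_cyclic_finite_cover[OF loc_cyclic_Bs Bs_sg, of "g ` F"] F fg by blast
  have "F \<subseteq> gen {a, b}"
  proof
    fix x assume x: "x \<in> F"
    obtain i j where "f x = a ^ i" "g x = b ^ j" using a(2) b(2) x by blast
    then have "x = a ^ i * b ^ j" using fg[OF x] by simp
    then show "x \<in> gen {a, b}"
      by (simp add: gen_base sg_mult[OF sg_gen] sg_pow[OF sg_gen])
  qed
  then have "gen F \<subseteq> gen {a, b}" by (rule gen_least[OF sg_gen])
  then show "\<exists>n. lower_series (gen F) n \<subseteq> {1}" using nilpotent_AsBs[OF a(1) b(1)] lower_series_mono by (meson subset_trans)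
qed

theorem decomp_exists: "decomp G A B S T As Bs"
proof -
  have e1: "H \<inter> K = {1}" if "sg H" "sg K" "\<And>x. x \<in> H \<Longrightarrow> x \<in> K \<Longrightarrow> x = 1" for H K :: "'a set"
    using that sg_one by blast
  have G1: "G = pr (pr S T) (pr As Bs)"
  proof (intro equalityI subsetI)
    show "g \<in> pr (pr S T) (pr As Bs)" if "g \<in> G" for g using G_decomp[OF that] unfolding ST_def .
    show "g \<in> G" if "g \<in> pr (pr S T) (pr As Bs)" for g
      using that ST_G As_G Bs_G unfolding ST_def[symmetric] by (auto elim!: prE intro!: sg_mult[OF G_sg])
  qed
  have G2: "G = pr (pr S As) (pr T Bs)"
  proof (intro equalityI subsetI)
    fix g assume "g \<in> G"
    then obtain x where x: "x \<in> pr S T" "\<exists>k\<in>pr As Bs. g = x * k" unfolding G1 by (auto elim: prE)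
    then obtain u t a b where *: "u \<in> S" "t \<in> T" "a \<in> As" "b \<in> Bs" "g = u * t * (a * b)"
      by (auto elim!: prE)
    have "g = (u * a) * (cj t a * b)" unfolding *(5) by (simp add: cj_def mult.assoc)
    then show "g \<in> pr (pr S As) (pr T Bs)"
      using prI[OF prI[OF *(1,3)] prI[OF T_normal[OF *(2) As_G[OF *(3)]] *(4)]] by simp
  next
    fix g assume "g \<in> pr (pr S As) (pr T Bs)"
    then show "g \<in> G" using M_G[OF T_M] M_G[OF s.T_M] As_G Bs_G by (auto elim!: prE intro!: sg_mult[OF G_sg])
  qed
  show ?thesis unfolding decomp_def
  proof (intro conjI ballI)
    show "S \<subseteq> G" "T \<subseteq> G" using M_G[OF T_M] M_G[OF s.T_M] by auto
    show "As \<subseteq> A" "Bs \<subseteq> B" using s.Bs_B Bs_B by auto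
    show "S \<inter> T = {1}" using S_Int_T by (intro e1 s.T_sg T_sg)
    show "pr S T \<inter> pr As Bs = {1}" using AsBs_ST unfolding ST_def by (intro e1 AsBs_sg ST_sg[unfolded ST_def])
    show "S \<inter> As = {1}" using s.T_Bs by (intro e1 s.T_sg s.Bs_sg)
    show "T \<inter> Bs = {1}" using T_Bs by (intro e1 T_sg Bs_sg)
    show "x * y = y * x" if "x \<in> S" "y \<in> T" for x y using M_comm[OF s.T_M T_M] that by blast
    show "x * y = y * x" if "x \<in> S" "y \<in> As" for x y using s.Bs_T_comm[OF that(2,1)] by (rule sym)
    show "x * y = y * x" if "x \<in> T" "y \<in> Bs" for x y using Bs_T_comm[OF that(2,1)] by (rule sym)
  qed (fact T_sg s.T_sg T_normal s.T_normal loc_cyclic_T s.loc_cyclic_T Bs_sg s.Bs_sg AsBs_sg loc_nilpotent_AsBs G1 G2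
      primes_of_T_Bs s.primes_of_T_Bs T_eq_com s.T_eq_com)+
qed

end

section \<open>Uniqueness\<close>

lemma lower_series_normal:
  assumes "sg K" "x \<in> lower_series K n" "k \<in> K"
  shows "cj x k \<in> lower_series K n"
  using assms(2,3)
proof (induction n arbitrary: x)
  case 0
  then show ?case using assms(1) sg_cj by simp
next
  case (Suc n)
  let ?C = "{com x y | x y. x \<in> lower_series K n \<and> y \<in> K}"
  have "cj x k \<in> gen ?C"
  proof (rule gen_cj)
    fix z assume "z \<in> ?C"
    then obtain u v where "u \<in> lower_series K n" "v \<in> K" "z = com u v" by blast
    then have "cj z k = com (cj u k) (cj v k)" "cj u k \<in> lower_series K n" "cj v k \<in> K"
      using Suc sg_cj[OF assms(1)] by (simp_all add: cj_com_distrib)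
    then show "cj z k \<in> gen ?C" by (blast intro: gen_base)
  qed (use Suc in simp)
  then show ?case by simp
qed

lemma lower_series_sg: "sg K \<Longrightarrow> sg (lower_series K n)"
  by (cases n) (simp_all add: sg_gen)

text \<open>Modulo \<open>V\<close> the elements \<open>h\<close> and \<open>c\<close>
  commute.\<close>

lemma central_power:
  assumes V: "sg V" "\<And>v k. v \<in> V \<Longrightarrow> k \<in> K \<Longrightarrow> cj v k \<in> V" "sg K" and "h \<in> K" "c \<in> K" "com c h \<in> V"
  shows "\<exists>v\<in>V. (h * c) ^ r = h ^ r * c ^ r * v"
proof (induction r)
  case 0
  then show ?case using sg_one[OF V(1)] by (intro bexI[of _ 1]) simp_all
next
  case (Suc r)
  then obtain v where v: "v \<in> V" "(h * c) ^ r = h ^ r * c ^ r * v" by blast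
  have "c \<in> {x \<in> K. com x h \<in> V}" using assms(5,6) by simp
  then have "c ^ r \<in> {x \<in> K. com x h \<in> V}"
    by (rule sg_pow[OF sg_com_into[OF V(1) _ V(3)], rotated]) (rule V(2))
  then have cr: "com (c ^ r) h \<in> V" by simp
  have *: "x * d * v * (h * c) = (x * h) * (d * c) * cj (com d h * cj v h) c" for x d
    by (simp add: com_def cj_def mult.assoc)
  have "(h * c) ^ Suc r = h ^ r * c ^ r * v * (h * c)" unfolding power_Suc2 v(2) ..
  also have "\<dots> = h ^ Suc r * c ^ Suc r * cj (com (c ^ r) h * cj v h) c" unfolding power_Suc2 by (rule *)
  finally have "(h * c) ^ Suc r = h ^ Suc r * c ^ Suc r * cj (com (c ^ r) h * cj v h) c" .
  moreover have "cj (com (c ^ r) h * cj v h) c \<in> V"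
    using cr v(1) assms(4,5) by (intro V(2) sg_mult[OF V(1)])
  ultimately show ?case by blast
qed

text \<open>The commutator of \<open>h\<close> and \<open>h'\<close> descends through the lower central series of the subgroup
  they generate, since modulo each next term it is central.\<close>

lemma loc_nilpotent_coprime:
  assumes H: "loc_nilpotent H" and h: "h \<in> H" "h' \<in> H" "h ^ r = 1" "h' ^ s = 1" "coprime r s" "0 < r"
  shows "com h h' = 1"
proof -
  let ?K = "gen {h, h'}"
  have K: "sg ?K" by (rule sg_gen)
  have hK: "h \<in> ?K" "h' \<in> ?K" by (auto intro: gen_base)
  define c where "c = com h h'"
  have cK: "c \<in> ?K" unfolding c_def using K hK by (rule sg_com)
  have c: "c \<in> lower_series ?K m" for m
  proof (induction m)
    case 0
    then show ?case using cK by simp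
  next
    case (Suc m)
    let ?V = "lower_series ?K (Suc m)"
    have V: "sg ?V" "\<And>v k. v \<in> ?V \<Longrightarrow> k \<in> ?K \<Longrightarrow> cj v k \<in> ?V"
      using lower_series_sg[OF K] lower_series_normal[OF K] by blast+
    have com_V: "com x k \<in> ?V" if "x \<in> lower_series ?K m" "k \<in> ?K" for x k
      using that by (auto intro: gen_base)
    have ic: "inverse c \<in> lower_series ?K m" using Suc by (rule sg_inv[OF lower_series_sg[OF K]])
    obtain v where v: "v \<in> ?V" "(h * c) ^ r = h ^ r * c ^ r * v"
      using central_power[OF V K hK(1) cK com_V[OF Suc hK(1)]] by blast
    have "h * c = cj h h'" by (simp add: cj_com c_def)
    then have "c ^ r * v = 1" using v(2) h(3) by (simp flip: cj_pow)
    then have "c ^ r = inverse v" by (metis inv_unique inv_inv)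
    then have cr: "c ^ r \<in> ?V" using v(1) sg_inv[OF V(1)] by metis
    obtain w where w: "w \<in> ?V" "(h' * inverse c) ^ s = h' ^ s * inverse c ^ s * w"
      using central_power[OF V K hK(2) sg_inv[OF K cK] com_V[OF ic hK(2)]] by blast
    have "h' * inverse c = cj h' h" by (simp add: cj_com c_def com_inv)
    then have "inverse c ^ s * w = 1" using w(2) h(4) by (simp flip: cj_pow)
    then have "inverse (inverse c ^ s) = w" by (rule inv_unique)
    then have "c ^ s \<in> ?V" using w(1) by simp
    then show ?case using sg_pow_coprime[OF V(1) cr _ h(5,6)] by blast
  qed
  obtain n where "lower_series ?K n \<subseteq> {1}" using H h(1,2) unfolding loc_nilpotent_def by (metis empty_subsetI finite.emptyI finite.insertI insert_subset)
  then show ?thesis using c[of n] unfolding c_def by blast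
qed

text \<open>Abstracts the \<open>p\<close>-component of \<open>T\<close> in an arbitrary
  decomposition, with \<open>A1\<close> enlarged to \<open>A\<close>; \<open>com_sectionI\<close>
  provides the instances.\<close>

locale com_section = prod_lc +
  fixes p :: nat and D
  assumes p: "is_prime p" and D_sg: "sg D" and D_G: "\<And>x. x \<in> D \<Longrightarrow> x \<in> G"
    and D_normal: "\<And>x g. x \<in> D \<Longrightarrow> g \<in> G \<Longrightarrow> cj x g \<in> D"
    and D_el: "\<And>x. x \<in> D \<Longrightarrow> el {p} x" and D_uniserial: "uniserial D"
    and D_com: "D \<subseteq> gen {com x a | x a. x \<in> D \<and> a \<in> A}"
begin

lemma D_Mp: "x \<in> D \<Longrightarrow> x \<in> Mp p"
proof -
  have "gen {com x a | x a. x \<in> D \<and> a \<in> A} \<subseteq> M"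
    by (rule gen_least[OF M_sg]) (auto intro: com_M D_G A_G)
  then show "x \<in> D \<Longrightarrow> x \<in> Mp p" using D_com D_el by (auto simp: Mp_def)
qed

lemma D_M: "x \<in> D \<Longrightarrow> x \<in> M"
  using D_Mp Mp_M by blast

lemma D_comm: "x \<in> D \<Longrightarrow> y \<in> D \<Longrightarrow> x * y = y * x"
  using D_M M_comm by blast

lemma abn_D: "g \<in> G \<Longrightarrow> abn D g"
  using D_M by (intro abn_M D_sg D_normal) auto

lemma D_cj_pow: "x \<in> D \<Longrightarrow> g \<in> G \<Longrightarrow> \<exists>k. cj x g = x ^ k"
  using uniserial_cj[OF p D_uniserial] D_normal D_el by blast

text \<open>Otherwise \<open>[w, g] = w^l\<close> with \<open>l\<close> prime to \<open>p\<close>,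
  and iterating \<open>g - 1\<close> never reaches 1, although \<open>g\<close> acts
  unipotently.\<close>

lemma p_element_fixes_socle:
  assumes w: "w \<in> D" "w ^ p = 1" and g: "g \<in> G" "el {p} g"
  shows "cj w g = w"
proof (rule ccontr)
  assume n: "cj w g \<noteq> w"
  interpret abn D g using g(1) by (rule abn_D)
  obtain k where "cj w g = w ^ k" using D_cj_pow[OF w(1) g(1)] by blast
  then have "com w g = w ^ (p - 1 + k)"
    using inverse_as_power[OF w(2) prime_gt_0_nat[OF p]] by (simp add: com_alt(1) power_add)
  then obtain l where l: "com w g = w ^ l" by blast
  have lp: "\<not> p dvd l"
  proof
    assume "p dvd l"
    then have "com w g = 1" using l power_one_dvd[OF w(2)] by simp
    then show False using n by (simp add: cj_com)
  qed
  let ?F = "[:-1, 1:] :: int poly"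
  have iter: "act g (?F ^ m) w = w ^ (l ^ m)" for m
  proof (induction m)
    case (Suc m)
    have "act g (?F ^ Suc m) w = act g (?F ^ m) (com w g)"
      using w(1) by (simp only: power_Suc2 act_mult act_com)
    also have "\<dots> = (w ^ (l ^ m)) ^ l" unfolding l using Suc w(1) by (simp add: act_pow)
    finally show ?case by (simp only: power_mult[symmetric] power_Suc2)
  qed simp
  obtain j where j: "g ^ (p ^ j) = 1" using g(2) el_p_iff[OF p] by blast
  have "act g (?F ^ (p ^ j * 1)) w = 1"
    using w j by (intro unipotent p) simp_all
  then have "w ^ (l ^ (p ^ j * 1)) = 1" by (simp only: iter)
  moreover have "\<not> p dvd l ^ (p ^ j * 1)" using lp p prime_dvd_power by blast
  ultimately have "w = 1" using p_pow_gen[OF p D_el[OF w(1)]] by (metis power_one)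
  then show False using n by simp
qed

lemma p'_element_centralizes:
  assumes w: "w \<in> D" "w \<noteq> 1" and g: "g \<in> G" "el (-{p}) g" "cj w g = w" and x: "x \<in> D"
  shows "cj x g = x"
proof (rule ccontr)
  assume "cj x g \<noteq> x"
  then have "w = 1"
    using uniserial_act_coprime(2)[OF p D_sg D_Mp D_normal[OF _ g(1)] D_uniserial g(2,1) x] w(1) g(3) by blast
  then show False using w(2) by simp
qed

end

text \<open>The elements of \<open>A\<close> of order prime to \<open>p\<close> act trivially on \<open>D\<close>; then \<open>D\<close> turns out to be
  a Pruefer group.\<close>

locale divisible_section = com_section +
  fixes w
  assumes w: "w \<in> D" "w \<noteq> 1" "w ^ p = 1"
    and cen: "\<And>a x. a \<in> A \<Longrightarrow> el (-{p}) a \<Longrightarrow> x \<in> D \<Longrightarrow> cj x a = x"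
begin

lemma A_fixes_w: "a \<in> A \<Longrightarrow> cj w a = w"
proof -
  assume a: "a \<in> A"
  obtain i j where ij: "a = a ^ i * a ^ j" "el {p} (a ^ i)" "el (-{p}) (a ^ j)"
    using el_split[OF periodic[OF A_G[OF a]], of "{p}"] by blast
  have "cj w (a ^ i) = w" using ij(2) sg_pow[OF A_sg a] by (intro p_element_fixes_socle w A_G)
  moreover have "cj w (a ^ j) = w" using ij(3) sg_pow[OF A_sg a] w(1) by (intro cen)
  ultimately have "cj w (a ^ i * a ^ j) = w" by (simp flip: cj_cj)
  then show ?thesis using ij(1) by simp
qed

lemma w_power: "x \<in> D \<Longrightarrow> x \<noteq> 1 \<Longrightarrow> \<exists>k. w = x ^ k"
proof -
  assume x: "x \<in> D" "x \<noteq> 1"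
  obtain i where i: "x ^ i \<noteq> 1" "(x ^ i) ^ p = 1" using order_p_power[OF p D_el[OF x(1)] x(2)] by blast
  then obtain k where "w = (x ^ i) ^ k"
    using uniserial_socle_gen[OF D_uniserial p sg_pow[OF D_sg x(1)] w(1) i w(3)] by blast
  then have "w = x ^ (i * k)" by (simp add: power_mult)
  then show ?thesis ..
qed

text \<open>If \<open>a\<close> raises \<open>x\<close> to the power \<open>k\<close>, then it
  raises \<open>w\<close>, a power of \<open>x\<close>, to the same power. As \<open>a\<close> fixes
  \<open>w\<close>, the exponent \<open>k - 1\<close> of \<open>[x, a]\<close> is divisible by
  \<open>p\<close>.\<close>

lemma com_pth_power:
  assumes x: "x \<in> D" and a: "a \<in> A"
  obtains k where "com x a = (x ^ k) ^ p"
proof (cases "x = 1")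
  case True
  then show ?thesis using that[of 0] by simp
next
  case False
  obtain k where k: "cj x a = x ^ k" using D_cj_pow[OF x A_G[OF a]] by blast
  obtain i where i: "w = x ^ i" using w_power[OF x False] by blast
  have "w = cj x a ^ i" using A_fixes_w[OF a] i by (simp add: cj_pow)
  also have "\<dots> = w ^ k" unfolding k i by (simp add: mult.commute flip: power_mult)
  finally have wk: "w = w ^ k" .
  then have "k \<noteq> 0" using w(2) by (metis power_0)
  then obtain l where l: "k = Suc l" by (meson not0_implies_Suc)
  have "w * w ^ l = w * 1" using wk unfolding l by simp
  then have "w ^ l = 1" by (simp only: mult_left_cancel_iff)
  have "p dvd l"
  proof (rule ccontr)
    assume "\<not> p dvd l"
    then show False using p_pow_gen[OF p D_el[OF w(1)]] \<open>w ^ l = 1\<close> w(2) by (metis power_one)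
  qed
  then obtain m where "l = m * p" by (auto simp: dvd_def mult.commute)
  moreover have "com x a = x ^ l" unfolding com_alt(1) k l by simp
  ultimately show ?thesis using that[of m] by (simp add: power_mult)
qed

text \<open>The commutators generating \<open>D\<close> are \<open>p\<close>-th powers by
  \<open>com_pth_power\<close>, and \<open>p\<close>-th powers form a subgroup of the abelian group
  \<open>D\<close>.\<close>

lemma divisible:
  assumes "x \<in> D"
  obtains y where "y \<in> D" "x = y ^ p"
proof -
  let ?P = "{y ^ p | y. y \<in> D}"
  have "sg ?P"
  proof (rule sgI)
    show "1 \<in> ?P" using sg_one[OF D_sg] by (metis (mono_tags, lifting) mem_Collect_eq power_one)
  next
    fix u v assume "u \<in> ?P" "v \<in> ?P"
    then obtain y z where yz: "y \<in> D" "z \<in> D" "u = y ^ p" "v = z ^ p" by blast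
    then have "u * v = (y * z) ^ p" using power_mult_commuting[OF D_comm[OF yz(1,2)]] by simp
    then show "u * v \<in> ?P" using sg_mult[OF D_sg yz(1,2)] by blast
  next
    fix u assume "u \<in> ?P"
    then obtain y where y: "y \<in> D" "u = y ^ p" by blast
    then have "inverse u = inverse y ^ p" by simp
    then show "inverse u \<in> ?P" using sg_inv[OF D_sg y(1)] by blast
  qed
  moreover have "{com x a | x a. x \<in> D \<and> a \<in> A} \<subseteq> ?P"
  proof safe
    fix x a assume "x \<in> D" "a \<in> A"
    then show "\<exists>y. com x a = y ^ p \<and> y \<in> D" using com_pth_power sg_pow[OF D_sg] by metis
  qed
  ultimately have "D \<subseteq> ?P" using D_com gen_least by blast
  then show ?thesis using that assms by blast
qed

text \<open>The image of \<open>c - 1\<close> contains a nontrivial \<open>d\<close> and, by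
  divisibility, a \<open>p^i\<close>-th root of it for every \<open>i\<close>. If \<open>x\<close>
  has exponent \<open>p^i\<close>, that root is not a power of \<open>x\<close>, so \<open>x\<close>
  is a power of the root.\<close>

lemma com_surj:
  assumes c: "c \<in> A" and t: "t \<in> D" "cj t c \<noteq> t" and x: "x \<in> D"
  obtains y where "y \<in> D" "x = com y c"
proof -
  interpret abn D c using A_G[OF c] by (rule abn_D)
  let ?E = "{com y c | y. y \<in> D}"
  define d where "d = com t c"
  have d: "d \<in> ?E" "d \<noteq> 1" using t by (auto simp: d_def cj_com)
  have roots: "\<exists>e\<in>?E. e ^ (p ^ i) = d" for i
  proof (induction i)
    case 0
    show ?case using d(1) by (intro bexI[of _ d]) simp_all
  next
    case (Suc i)
    then obtain y where y: "y \<in> D" "com y c ^ (p ^ i) = d" by blast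
    obtain z where z: "z \<in> D" "y = z ^ p" using divisible[OF y(1)] .
    have "com y c = com z c ^ p" using z by (simp add: com_pow)
    then have "com z c ^ (p ^ Suc i) = d" using y(2) by (simp add: power_mult)
    then show ?case using z(1) by blast
  qed
  obtain i where i: "x ^ (p ^ i) = 1" using D_el[OF x] el_p_iff[OF p] by blast
  obtain y where y: "y \<in> D" "com y c ^ (p ^ i) = d" using roots[of i] by blast
  have "\<nexists>k. com y c = x ^ k"
  proof
    assume "\<exists>k. com y c = x ^ k"
    then obtain k where "com y c = x ^ k" ..
    then have "d = (x ^ (p ^ i)) ^ k" using y(2) by (simp add: mult.commute flip: power_mult)
    then show False using i d(2) by simp
  qed
  then obtain k where "x = com y c ^ k" using uniserialD[OF D_uniserial com_closed[OF y(1)] x] by blast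
  then have "x = com (y ^ k) c" using y(1) by (simp add: com_pow)
  then show ?thesis using that sg_pow[OF D_sg y(1)] by blast
qed

lemma last_moving_power:
  assumes a: "a \<in> A" "el {p} a" and t: "t \<in> D" "cj t a \<noteq> t"
  obtains k u where "u \<in> D" "cj u (a ^ (p ^ k)) \<noteq> u" "\<And>x. x \<in> D \<Longrightarrow> cj x (a ^ (p ^ Suc k)) = x"
proof -
  define P where "P k \<longleftrightarrow> (\<forall>x\<in>D. cj x (a ^ (p ^ k)) = x)" for k
  obtain j where "a ^ (p ^ j) = 1" using a(2) el_p_iff[OF p] by blast
  then have "P j" by (simp add: P_def)
  define m where "m = (LEAST k. P k)"
  have Pm: "P m" unfolding m_def using \<open>P j\<close> by (rule LeastI)
  have "m \<noteq> 0"
  proof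
    assume "m = 0"
    then have "cj t (a ^ (p ^ 0)) = t" using Pm t(1) unfolding P_def by blast
    then show False using t(2) by simp
  qed
  then obtain k where k: "m = Suc k" by (meson not0_implies_Suc)
  have "\<not> P k" using not_less_Least[of k P] k by (simp add: m_def)
  then obtain u where "u \<in> D" "cj u (a ^ (p ^ k)) \<noteq> u" by (auto simp: P_def)
  then show ?thesis using that Pm unfolding k P_def by blast
qed

text \<open>Every \<open>x\<close> is a commutator \<open>[y, c]\<close>, and
  \<open>nrm p (X - 1) = X^p - 1\<close> annihilates \<open>y\<close>.\<close>

lemma norm_trivial:
  assumes c: "c \<in> A" and t: "t \<in> D" "cj t c \<noteq> t" and cp: "\<And>x. x \<in> D \<Longrightarrow> cj x (c ^ p) = x" and x: "x \<in> D"
  shows "act c (nrm p) x = 1"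
proof -
  interpret abn D c using A_G[OF c] by (rule abn_D)
  obtain y where y: "y \<in> D" "x = com y c" using com_surj[OF c t x] .
  have "act c (nrm p) x = act c ([:-1, 1:] * nrm p) y"
    unfolding mult.commute[of _ "nrm p"] using y by (simp only: act_mult act_com)
  then show ?thesis using y(1) cp by (simp only: nrm_mult act_xn_minus_1)
qed

lemma not_centralized: "\<exists>a\<in>A. \<exists>t\<in>D. cj t a \<noteq> t"
proof (rule ccontr)
  assume "\<not> ?thesis"
  then have "{com x a | x a. x \<in> D \<and> a \<in> A} \<subseteq> {1}" by (auto simp: com_alt(1))
  then have "gen {com x a | x a. x \<in> D \<and> a \<in> A} \<subseteq> {1}" by (intro gen_least) (auto simp: sg_def)
  then show False using D_com w by blast
qed

lemma moving_p_element:
  obtains a t where "a \<in> A" "el {p} a" "t \<in> D" "cj t a \<noteq> t"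
proof -
  obtain a t where at: "a \<in> A" "t \<in> D" "cj t a \<noteq> t" using not_centralized by blast
  obtain i j where ij: "a = a ^ i * a ^ j" "el {p} (a ^ i)" "el (-{p}) (a ^ j)"
    using el_split[OF periodic[OF A_G[OF at(1)]], of "{p}"] by blast
  note ai = sg_pow[OF A_sg at(1)]
  have "cj t (a ^ i) \<noteq> t"
  proof
    assume "cj t (a ^ i) = t"
    then have "cj t (a ^ i * a ^ j) = t" using cen[OF ai ij(3) at(2)] by (simp flip: cj_cj)
    then show False using at(3) ij(1) by simp
  qed
  then show ?thesis using that ai ij(2) at(2) by blast
qed

text \<open>Let \<open>c\<close> be the last power of \<open>a\<close> that moves \<open>D\<close>,
  and let \<open>x^p = w\<close>. Then \<open>[x, c]\<close> is a power of \<open>w\<close>, so it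
  is fixed by \<open>c\<close> and has exponent \<open>p\<close>. For odd \<open>p\<close>,
  \<open>nrm_expand2\<close> makes the norm of \<open>x\<close> equal to \<open>w\<close>, but norms
  are trivial.\<close>

lemma p_eq_2: "p = 2"
proof (rule ccontr)
  assume p2: "p \<noteq> 2"
  obtain a t where at: "a \<in> A" "el {p} a" "t \<in> D" "cj t a \<noteq> t" using moving_p_element .
  obtain u k where u: "u \<in> D" "cj u (a ^ (p ^ k)) \<noteq> u" "\<And>x. x \<in> D \<Longrightarrow> cj x (a ^ (p ^ Suc k)) = x"
    by (rule last_moving_power[OF at], rule that)
  define c where "c = a ^ (p ^ k)"
  have c: "c \<in> A" "cj u c \<noteq> u" using u sg_pow[OF A_sg at(1)] by (auto simp: c_def)
  have "c ^ p = a ^ (p ^ Suc k)" by (simp add: c_def mult.commute flip: power_mult)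
  then have cp: "cj x (c ^ p) = x" if "x \<in> D" for x using u(3) that by simp
  interpret abn D c using A_G[OF c(1)] by (rule abn_D)
  obtain x where x: "x \<in> D" "w = x ^ p" using divisible[OF w(1)] .
  obtain m where "com x c = (x ^ m) ^ p" using com_pth_power[OF x(1) c(1)] .
  then have com: "com x c = w ^ m" unfolding x(2) by (simp add: mult.commute flip: power_mult)
  obtain g where g: "nrm p = [:int p:] + [:-1, 1:] * g" "int p dvd poly g 1"
    using nrm_expand2[OF p p2] by blast
  have "act c (nrm p) x = w * act c g (com x c)"
    unfolding g(1) mult.commute[of _ g] using x
    by (simp only: act_add act_mult act_com act_const power_int_of_nat)
  also have "act c g (com x c) = 1"
  proof -
    obtain r where r: "poly g 1 = int p * r" using g(2) by (auto simp: dvd_def)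
    have "cj (w ^ m) c = w ^ m" using A_fixes_w[OF c(1)] by (simp add: cj_pow)
    moreover have "(w ^ m) ^ p = 1" using w(3) by (metis mult.commute power_mult power_one)
    ultimately show ?thesis unfolding com by (simp add: act_fixed r powi_mult)
  qed
  finally have "w = 1" using norm_trivial[OF c(1) u(1) c(2) cp x(1)] by simp
  then show False using w(2) by simp
qed

lemma infinite_D: "infinite D"
proof
  assume fin: "finite D"
  have "(\<lambda>x. x ^ p) ` D = D"
  proof
    show "(\<lambda>x. x ^ p) ` D \<subseteq> D" using sg_pow[OF D_sg] by blast
    show "D \<subseteq> (\<lambda>x. x ^ p) ` D" using divisible by blast
  qed
  then have "inj_on (\<lambda>x. x ^ p) D" using fin by (simp add: eq_card_imp_inj_on)
  then have "w = 1" using w sg_one[OF D_sg] by (auto dest: inj_onD[of _ _ w 1])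
  then show False using w(2) by simp
qed

text \<open>Trivial norms mean that the last moving power \<open>c\<close> of \<open>a\<close>
  inverts \<open>D\<close>. If \<open>c\<close> were the square of some \<open>e\<close> in
  \<open>A\<close>, then for \<open>y^2 = w\<close> the commutator \<open>[y, e]\<close> would be a
  power of \<open>w\<close>, and \<open>c\<close> would fix \<open>y\<close>, an element of order 4,
  instead of inverting it. So \<open>c = a\<close>.\<close>

lemma square_centralizes:
  assumes a: "a \<in> A" "el {p} a" and x: "x \<in> D"
  shows "cj x (a ^ 2) = x"
proof (cases "\<exists>t\<in>D. cj t a \<noteq> t")
  case False
  then show ?thesis using x by (simp add: power2_eq_square flip: cj_cj)
next
  case True
  then obtain t where t: "t \<in> D" "cj t a \<noteq> t" by blast
  obtain u k where u: "u \<in> D" "cj u (a ^ (p ^ k)) \<noteq> u" "\<And>x. x \<in> D \<Longrightarrow> cj x (a ^ (p ^ Suc k)) = x"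
    by (rule last_moving_power[OF a t], rule that)
  define c where "c = a ^ (p ^ k)"
  have c: "c \<in> A" "cj u c \<noteq> u" using u sg_pow[OF A_sg a(1)] by (auto simp: c_def)
  have cp: "cj x (c ^ p) = x" if "x \<in> D" for x
  proof -
    have "c ^ p = a ^ (p ^ Suc k)" by (simp add: c_def mult.commute flip: power_mult)
    then show ?thesis using u(3) that by simp
  qed
  have inverts: "cj x c = inverse x" if x: "x \<in> D" for x
  proof -
    interpret abn D c using A_G[OF c(1)] by (rule abn_D)
    have "nrm p = 1 + [:0, 1:]" unfolding p_eq_2 by (simp add: numeral_2_eq_2)
    then have "act c (nrm p) x = x * cj x c"
      using x by (simp only: act_add act_1 act_x)
    then show ?thesis using norm_trivial[OF c(1) u(1) c(2) cp x] by (metis inv_unique)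
  qed
  have "k = 0"
  proof (rule ccontr)
    assume "k \<noteq> 0"
    then obtain l where l: "k = Suc l" by (meson not0_implies_Suc)
    define e where "e = a ^ (p ^ l)"
    have eA: "e \<in> A" unfolding e_def using A_sg a(1) by (rule sg_pow)
    have ce: "c = e * e" unfolding c_def e_def l by (simp add: p_eq_2 mult_2 flip: power_add)
    obtain y where y: "y \<in> D" "w = y ^ p" using divisible[OF w(1)] .
    obtain m where m: "com y e = (y ^ m) ^ p" using com_pth_power[OF y(1) eA] .
    have ym: "(y ^ m) ^ p = w ^ m" unfolding y(2) by (simp add: mult.commute flip: power_mult)
    have wm: "cj (w ^ m) e = w ^ m" using A_fixes_w[OF eA] by (simp add: cj_pow)
    have "cj y e = y * w ^ m" using m ym by (simp add: cj_com)
    then have "cj y c = y * (w ^ m * w ^ m)" unfolding ce cj_cj[symmetric] by (simp add: wm mult.assoc)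
    also have "w ^ m * w ^ m = (w ^ p) ^ m" by (simp add: p_eq_2 mult_2 flip: power_mult power_add)
    finally have "inverse y = y" using inverts[OF y(1)] w(3) by simp
    then have "y * y = 1" by (metis right_inv)
    then show False using y(2) w(2) by (simp add: p_eq_2 power2_eq_square)
  qed
  then show ?thesis using u(3)[OF x] by (simp add: p_eq_2)
qed

text \<open>An element \<open>a\<close> that moves \<open>D\<close> is not a square of a 2-element
  of \<open>A\<close>, so by comparability all 2-elements of \<open>A\<close> are powers of
  \<open>a\<close>.\<close>

lemma finite_A_p: "finite {a \<in> A. el {p} a}"
proof -
  obtain a t where at: "a \<in> A" "el {p} a" "t \<in> D" "cj t a \<noteq> t" using moving_p_element .
  have pw: "\<exists>k. x = a ^ k" if x: "x \<in> A" "el {p} x" for x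
  proof (rule ccontr)
    assume n: "\<nexists>k. x = a ^ k"
    then obtain k where k: "a = x ^ k" using uniserialD[OF A_uniserial[OF p], of a x] at x by blast
    have "p dvd k"
    proof (rule ccontr)
      assume "\<not> p dvd k"
      then show False using p_pow_gen[OF p x(2)] k n by metis
    qed
    then obtain m where "k = m * 2" using p_eq_2 by (auto simp: dvd_def mult.commute)
    then have "a = (x ^ m) ^ 2" using k by (simp add: power_mult)
    then have "cj t a = t" using square_centralizes[OF sg_pow[OF A_sg x(1)] el_pow[OF x(2)] at(3)] by simp
    then show False using at(4) by simp
  qed
  obtain n where n: "0 < n" "a ^ n = 1" using at(2) by (auto simp: el_def)
  have "{a \<in> A. el {p} a} \<subseteq> (\<lambda>k. a ^ k) ` {..<n}"
  proof
    fix x assume "x \<in> {a \<in> A. el {p} a}"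
    then obtain k where "x = a ^ k" using pw by blast
    then have "x = a ^ (k mod n)" using power_eq_mod[OF n(2)] by metis
    then show "x \<in> (\<lambda>k. a ^ k) ` {..<n}" using n(1) by simp
  qed
  then show ?thesis by (rule finite_subset) simp
qed

text \<open>With \<open>u\<close> and \<open>v\<close> the \<open>p\<close>- and
  \<open>p'\<close>-parts of \<open>a\<close>, the element \<open>h = inverse u * d\<close> is a
  \<open>p\<close>-element modulo \<open>D\<close>, hence a \<open>p\<close>-element. It commutes
  with \<open>v\<close>, which centralizes \<open>D\<close>. So \<open>h\<close> is the
  \<open>p\<close>-part of \<open>b = inverse v * h\<close>, and \<open>d = u * h\<close>.\<close>

lemma D_factors:
  assumes d: "d \<in> D"
  obtains a b where "a \<in> A" "el {p} a" "b \<in> B" "el {p} b" "d = a * b"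
proof -
  obtain a b where ab: "a \<in> A" "b \<in> B" "d = a * b" using D_G[OF d] by (elim G_cases)
  obtain i j where a: "a = a ^ i * a ^ j" "el {p} (a ^ i)" "el (-{p}) (a ^ j)"
    using el_split[OF periodic[OF A_G[OF ab(1)]], of "{p}"] by blast
  obtain k l where b: "b = b ^ k * b ^ l" "el {p} (b ^ k)" "el (-{p}) (b ^ l)"
    using el_split[OF periodic[OF B_G[OF ab(2)]], of "{p}"] by blast
  define u where "u = a ^ i"
  define v where "v = a ^ j"
  have uv: "u \<in> A" "v \<in> A" "a = u * v" "el {p} u" "el (-{p}) v"
    using a sg_pow[OF A_sg ab(1)] by (auto simp: u_def v_def)
  have vd: "d * v = v * d" using cen[OF uv(2,5) d] by (simp only: cj_fix_iff)
  have uvc: "u * v = v * u" using uv(1,2) by (rule A_comm)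
  define h where "h = inverse u * d"
  have iu: "inverse u \<in> G" using uv(1) by (intro A_G sg_inv[OF A_sg])
  obtain q where q: "inverse u ^ (p ^ q) = 1" using el_inv[OF uv(4)] el_p_iff[OF p] by blast
  obtain d' where d': "d' \<in> D" "(inverse u * d) ^ (p ^ q) = inverse u ^ (p ^ q) * d'"
    using pow_mod_normal[OF D_sg D_normal[OF _ iu] d] by blast
  have "el {p} (h ^ (p ^ q))" using d' q D_el by (simp add: h_def)
  moreover have "r \<in> {p}" if "is_prime r" "r dvd p ^ q" for r
    using that p by (auto dest: prime_dvd_power primes_dvd_imp_eq)
  ultimately have elh: "el {p} h" using prime_gt_0_nat[OF p] by (intro el_power_iff[of "{p}" h "p ^ q"]) auto
  have "inverse v * inverse u = inverse u * inverse v" using uvc by (metis inv_mult)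
  moreover have "inverse v * d = d * inverse v" using vd by (metis inv_comm)
  ultimately have hv: "h * inverse v = inverse v * h" unfolding h_def by (metis mult.assoc)
  have "b = inverse v * h" unfolding h_def using ab(3) uv(3) by (simp add: mult.assoc)
  then have b1: "b = h * inverse v" using hv by simp
  have "b ^ k * b ^ l = b ^ l * b ^ k" by (simp add: add.commute flip: power_add)
  then have "h = b ^ k"
    using comm_split_unique[OF b1 b(1) hv _ elh b(2) el_inv[OF uv(5)] b(3)] by blast
  moreover have "u * h = d" by (simp add: h_def)
  ultimately have "d = u * b ^ k" by metis
  then show ?thesis using that uv(1,4) b(2) sg_pow[OF B_sg ab(2)] by blast
qed

text \<open>The infinite group \<open>D\<close> has only finitely many possible
  \<open>A\<close>-factors, so infinitely many elements share one, and their quotients lie in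
  \<open>B\<close>. An infinite intersection of two uniserial \<open>p\<close>-groups is all of
  each, since no single element has infinitely many powers.\<close>

lemma D_eq: "D = {b \<in> B. el {p} b}"
proof -
  let ?B = "{b \<in> B. el {p} b}"
  have B_sg': "sg ?B" by (rule sgI) (auto intro: sg_one[OF B_sg] sg_mult[OF B_sg] sg_inv[OF B_sg] el_mult B_comm el_inv)
  have "\<forall>d\<in>D. \<exists>a. a \<in> {a \<in> A. el {p} a} \<and> inverse a * d \<in> ?B"
  proof
    fix d assume "d \<in> D"
    then obtain a b where "a \<in> A" "el {p} a" "b \<in> B" "el {p} b" "d = a * b" using D_factors by blast
    then show "\<exists>a. a \<in> {a \<in> A. el {p} a} \<and> inverse a * d \<in> ?B" by (intro exI[of _ a]) simp
  qed
  from bchoice[OF this] obtain f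
    where "\<forall>d\<in>D. f d \<in> {a \<in> A. el {p} a} \<and> inverse (f d) * d \<in> ?B" ..
  then have f: "f d \<in> {a \<in> A. el {p} a}" "inverse (f d) * d \<in> ?B" if "d \<in> D" for d
    using that by blast+
  have "finite (f ` D)" using f(1) finite_A_p by (meson finite_subset image_subsetI)
  then obtain d0 where d0: "d0 \<in> D" "infinite {d \<in> D. f d = f d0}"
    using pigeonhole_infinite[OF infinite_D] by blast
  let ?g = "\<lambda>d. inverse d0 * d"
  have "inj_on ?g {d \<in> D. f d = f d0}" by (auto simp: inj_on_def)
  then have inf: "infinite (?g ` {d \<in> D. f d = f d0})" using d0(2) finite_imageD by blast
  moreover have "?g ` {d \<in> D. f d = f d0} \<subseteq> D \<inter> ?B"
  proof safe
    fix d assume d: "d \<in> D" "f d = f d0"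
    show "?g d \<in> D" using d(1) d0(1) by (intro sg_mult[OF D_sg] sg_inv[OF D_sg])
    have "inverse (inverse (f d0) * d0) * (inverse (f d) * d) \<in> ?B"
      using f(2)[OF d0(1)] f(2)[OF d(1)] sg_mult[OF B_sg'] sg_inv[OF B_sg'] by blast
    then have "?g d \<in> ?B" using d(2) by (simp add: mult.assoc)
    then show "?g d \<in> B" "el {p} (?g d)" by auto
  qed
  ultimately have infB: "infinite (D \<inter> ?B)" by (meson finite_subset)
  have fin: "finite {y. \<exists>k. y = x ^ k}" if elx: "el {p} x" for x :: 'a
  proof -
    obtain n where n: "0 < n" "x ^ n = 1" using elx by (auto simp: el_def)
    have "{y. \<exists>k. y = x ^ k} \<subseteq> (\<lambda>k. x ^ k) ` {..<n}"
      using power_eq_mod[OF n(2)] n(1) by (auto simp: image_iff intro: mod_less_divisor)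
    then show ?thesis by (rule finite_subset) simp
  qed
  have ex: "\<exists>y\<in>D \<inter> ?B. \<nexists>k. y = x ^ k" if "el {p} x" for x
  proof (rule ccontr)
    assume "\<not> ?thesis"
    then have "D \<inter> ?B \<subseteq> {y. \<exists>k. y = x ^ k}" by blast
    then show False using infB fin[OF that] finite_subset by blast
  qed
  show ?thesis
  proof
    show "D \<subseteq> ?B"
    proof
      fix x assume x: "x \<in> D"
      obtain y where y: "y \<in> D \<inter> ?B" "\<nexists>k. y = x ^ k"
        using ex[OF D_el[OF x]] by blast
      then obtain k where "x = y ^ k" using uniserialD[OF D_uniserial x, of y] by blast
      then show "x \<in> ?B" using y(1) sg_pow[OF B_sg'] by blast
    qed
    show "?B \<subseteq> D"
    proof
      fix x assume x: "x \<in> ?B"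
      then have "el {p} x" by simp
      then obtain y where y: "y \<in> D \<inter> ?B" "\<nexists>k. y = x ^ k"
        using ex by blast
      then obtain k where "x = y ^ k" using uniserialD[OF B_uniserial[OF p] x, of y] by blast
      then show "x \<in> D" using y(1) sg_pow[OF D_sg] by blast
    qed
  qed
qed

end

context com_section
begin

lemma socle_element: "D \<noteq> {1} \<Longrightarrow> \<exists>w\<in>D. w \<noteq> 1 \<and> w ^ p = 1"
proof -
  assume "D \<noteq> {1}"
  then obtain x where x: "x \<in> D" "x \<noteq> 1" using sg_one[OF D_sg] by blast
  then show ?thesis using order_p_power[OF p D_el[OF x(1)] x(2)] sg_pow[OF D_sg x(1)] by metis
qed

text \<open>By \<open>p_eq_2\<close> some \<open>p'\<close>-element \<open>a\<close> of
  \<open>A\<close> moves \<open>D\<close>, and then every element of \<open>D\<close> is a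
  commutator with \<open>a\<close>.\<close>

lemma odd_section:
  assumes "p \<noteq> 2"
  shows "D \<subseteq> TT p"
proof (cases "D = {1}")
  case True
  then show ?thesis using sg_one[OF TT_sg[OF p]] by simp
next
  case False
  then obtain w where w: "w \<in> D" "w \<noteq> 1" "w ^ p = 1" using socle_element by blast
  have "\<exists>a\<in>A. el (-{p}) a \<and> (\<exists>x\<in>D. cj x a \<noteq> x)"
  proof (rule ccontr)
    assume "\<not> ?thesis"
    then interpret divisible_section A B p D w using w by unfold_locales blast+
    show False using p_eq_2 assms by blast
  qed
  then obtain a t where a: "a \<in> A" "el (-{p}) a" "t \<in> D" "cj t a \<noteq> t" by blast
  show ?thesis
  proof
    fix x assume "x \<in> D"
    then obtain y where "y \<in> D" "x = com y a"
      using uniserial_act_coprime(1)[OF p D_sg D_Mp D_normal[OF _ A_G[OF a(1)]] D_uniserial a(2) A_G[OF a(1)] a(3,4)] by blast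
    then show "x \<in> TT p" using Tc_TT[OF p a(1,2)] TcI D_Mp by blast
  qed
qed

lemma two_section:
  assumes p2: "p = 2" and "D \<noteq> {1}"
  shows "D = {b \<in> B. el {2} b}" "infinite D" "finite {a \<in> A. el {2} a}"
proof -
  obtain w where w: "w \<in> D" "w \<noteq> 1" "w ^ p = 1" using socle_element assms(2) by blast
  have "cj x a = x" if a: "a \<in> A" "el (-{p}) a" "x \<in> D" for a x
  proof (rule p'_element_centralizes[OF w(1,2) A_G[OF a(1)] a(2) _ a(3)])
    obtain k where k: "cj w a = w ^ k" using D_cj_pow[OF w(1) A_G[OF a(1)]] by blast
    \<comment> \<open>A group of order 2 has no automorphism besides the identity.\<close>
    have "w ^ k = w ^ (k mod 2)" using power_eq_mod[of w 2 k] w(3) p2 by simp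
    moreover have "w ^ k \<noteq> 1" using k w(2) by (metis cj_eq_one)
    ultimately show "cj w a = w"
      using k by (cases "even k") (auto simp: even_iff_mod_2_eq_zero odd_iff_mod_2_eq_one)
  qed
  then interpret divisible_section A B p D w using w by unfold_locales
  show "D = {b \<in> B. el {2} b}" "infinite D" "finite {a \<in> A. el {2} a}"
    using D_eq infinite_D finite_A_p unfolding p2 by auto
qed

end

section \<open>Comparison of two decompositions\<close>

context prod_lc
begin

lemma com_sectionI:
  assumes p: "is_prime p" and T': "T' \<subseteq> G" "sg T'" "\<And>x g. x \<in> T' \<Longrightarrow> g \<in> G \<Longrightarrow> cj x g \<in> T'" "loc_cyclic T'"
    and com: "T' = gen {com x y | x y. x \<in> T' \<and> y \<in> A1}" "A1 \<subseteq> A"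
  shows "com_section A B p {x \<in> T'. el {p} x}"
proof -
  let ?D = "{x \<in> T'. el {p} x}"
  have "gen {com x y | x y. x \<in> T' \<and> y \<in> A1} \<subseteq> M"
  proof (rule gen_least[OF M_sg], safe)
    fix x y assume "x \<in> T'" "y \<in> A1"
    then show "com x y \<in> M" using com(2) T'(1) by (intro com_M[OF _ A_G]) auto
  qed
  then have T'M: "T' \<subseteq> M" using com(1) by simp
  have D_sg: "sg ?D"
    by (rule sgI) (auto intro: sg_one[OF T'(2)] sg_mult[OF T'(2)] sg_inv[OF T'(2)] el_mult loc_cyclic_comm[OF T'(4)] el_inv)
  let ?C = "gen {com x a | x a. x \<in> ?D \<and> a \<in> A}"
  have D_Mp: "x \<in> Mp p" if "x \<in> ?D" for x using that T'M by (auto simp: Mp_def)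
  have com_D: "com x a \<in> Mp p" if "x \<in> ?D" "a \<in> A" for x a
    using abn.com_closed[OF abn_Mp[OF A_G[OF that(2)]] D_Mp[OF that(1)]] .
  have C_Mp: "?C \<subseteq> Mp p"
  proof (rule gen_least[OF Mp_sg], rule subsetI)
    fix z assume "z \<in> {com x a | x a. x \<in> ?D \<and> a \<in> A}"
    then obtain x a where "x \<in> ?D" "a \<in> A" "z = com x a" by blast
    then show "z \<in> Mp p" using com_D by simp
  qed
  \<comment> \<open>\<open>F\<close> demands \<open>[D, A]\<close> at the prime \<open>p\<close> and
    is the full component elsewhere. Once the generators \<open>[t, a]\<close> of \<open>T'\<close>
    are in \<open>Sig F\<close>, the \<open>p\<close>-component of \<open>T'\<close> falls into
    \<open>[D, A]\<close>.\<close>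
  define F where "F q = (if q = p then ?C else Mp q)" for q
  have F_sg: "sg (F q)" for q by (simp add: F_def sg_gen Mp_sg)
  have "T' \<subseteq> Sig F"
  proof -
    have "gen {com x y | x y. x \<in> T' \<and> y \<in> A1} \<subseteq> Sig F"
    proof (rule gen_least[OF Sig_sg[OF F_sg]], safe)
      fix t a assume t: "t \<in> T'" and "a \<in> A1"
      then have a: "a \<in> A" "a \<in> G" using com(2) A_G by auto
      interpret abn M a using a(2) M_sg M_normal by (intro abn_M) auto
      have tM: "t \<in> M" using t T'M by blast
      have "com t a ^ i \<in> F q" if q: "is_prime q" "el {q} (com t a ^ i)" for q i
      proof (cases "q = p")
        case False
        have "com t a ^ i \<in> M" using sg_pow[OF M_sg com_closed[OF tM]] .
        then show ?thesis using q(2) False by (simp add: F_def Mp_def)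
      next
        case True
        define u where "u = t ^ i"
        have u: "u \<in> M" "u \<in> T'" unfolding u_def using sg_pow[OF M_sg tM] sg_pow[OF T'(2) t] .
        have eq: "com t a ^ i = com u a" using tM by (simp add: u_def com_pow)
        obtain k l where kl: "u = u ^ k * u ^ l" "u ^ k \<in> Mp p" "u ^ l \<in> Mp' p" using M_split[OF u(1)] by blast
        have cu: "com u a = com (u ^ k) a * com (u ^ l) a"
        proof -
          have "com (u ^ k * u ^ l) a = com (u ^ k) a * com (u ^ l) a"
            using kl(2,3) by (intro com_hom Mp_M Mp'_M)
          then show ?thesis using kl(1) by simp
        qed
        have "u ^ k \<in> ?D" using kl(2) Mp_el sg_pow[OF T'(2) u(2)] by blast
        then have c: "com (u ^ k) a \<in> ?C" using a(1) by (blast intro: gen_base)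
        have m: "com (u ^ l) a \<in> Mp' p"
          unfolding com_alt(1) using kl(3) a(2) by (simp only: sg_mult[OF Mp'_sg] sg_inv[OF Mp'_sg] Mp'_normal)
        have "com u a ^ 1 \<in> ?C"
          using q(2) True eq by (intro part_in[OF sg_gen C_Mp c m cu]) simp
        then show ?thesis using eq True by (simp add: F_def)
      qed
      then show "com t a \<in> Sig F" using com_closed[OF tM] by (simp add: Sig_def)
    qed
    then show ?thesis using com(1) by simp
  qed
  then have D_C: "?D \<subseteq> ?C" using Sig_p[of _ F p] p by (auto simp: F_def)
  have "uniserial ?D"
  proof (rule locally_cyclic_uniserial[OF p])
    show "el UNIV x" if "x \<in> T'" for x using T'(1) periodic that by blast
    show "\<exists>z\<in>T'. \<exists>i j. x = z ^ i \<and> y = z ^ j" if "x \<in> T'" "y \<in> T'" for x y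
      using T'(4) that unfolding loc_cyclic_def by blast
  qed
  then show ?thesis
  proof (unfold_locales)
    show "sg ?D" "?D \<subseteq> ?C" "is_prime p" by (fact D_sg D_C p)+
    show "x \<in> G" if "x \<in> ?D" for x using that T'(1) by blast
    show "cj x g \<in> ?D" if "x \<in> ?D" "g \<in> G" for x g using that T'(3)[of x g] el_cj[of "{p}" x g] by simp
  qed simp_all
qed

interpretation s: prod_lc B A
  rewrites "factorized.G B A = G" and "factorized.M B A = M"
    and "factorized.Mp B A = Mp" and "factorized.Mp' B A = Mp'" and "prod_lc.Sig B A = Sig"
    and "prod_lc.T B A = S" and "prod_lc.S B A = T"
  by (rule swap_lc swap_G swap_M swap_Mp swap_Mp' swap_Sig swap_T swap_S)+

text \<open>Modulo \<open>S' T'\<close> the group is locally nilpotent, so the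
  \<open>p\<close>-elements of \<open>TT p\<close> commute there with the \<open>p'\<close>-element
  \<open>ap p\<close>; hence \<open>TT p\<close>, consisting of commutators with
  \<open>ap p\<close>, lies in \<open>S' T'\<close>. For odd \<open>p\<close> the
  \<open>S'\<close>-component of an element of \<open>TT p\<close> is in \<open>s.TT p\<close> by
  \<open>odd_section\<close> and is centralized by \<open>ap p\<close>, so commutators with
  \<open>ap p\<close> fall into \<open>T'\<close>.\<close>

lemma T_least:
  assumes S': "S' \<subseteq> G" "sg S'" "\<And>x g. x \<in> S' \<Longrightarrow> g \<in> G \<Longrightarrow> cj x g \<in> S'" "loc_cyclic S'"
      "S' = gen {com x y | x y. x \<in> S' \<and> y \<in> B1}" "B1 \<subseteq> B"
    and T': "T' \<subseteq> G" "sg T'" "\<And>x g. x \<in> T' \<Longrightarrow> g \<in> G \<Longrightarrow> cj x g \<in> T'" "loc_cyclic T'"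
      "T' = gen {com x y | x y. x \<in> T' \<and> y \<in> A1}" "A1 \<subseteq> A"
    and ST': "S' \<inter> T' = {1}" "\<And>x y. x \<in> S' \<Longrightarrow> y \<in> T' \<Longrightarrow> x * y = y * x"
    and H: "sg H" "loc_nilpotent H" "pr S' T' \<inter> H = {1}" "G = pr (pr S' T') H"
  shows "T \<subseteq> T'"
proof -
  let ?N = "pr S' T'"
  have N_sg: "sg ?N" using S'(2,3) T'(1,2) by (intro sg_pr) auto
  have N_normal: "cj x g \<in> ?N" if "x \<in> ?N" "g \<in> G" for x g
    using that(1) S'(3) T'(3) that(2) by (elim prE) (simp add: prI)
  have N_G: "x \<in> G" if "x \<in> ?N" for x
    using that S'(1) T'(1) by (elim prE) (auto intro: sg_mult[OF G_sg])
  have H_G: "x \<in> G" if "x \<in> H" for x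
    unfolding H(4) using pr_right[OF N_sg that] .
  have dec: "\<exists>u\<in>?N. \<exists>h\<in>H. x = h * u \<and> (\<forall>n. x ^ n = 1 \<longrightarrow> h ^ n = 1)" if x: "x \<in> G" for x
  proof -
    obtain u h where uh: "u \<in> ?N" "h \<in> H" "x = u * h"
      using x unfolding H(4) by (rule prE) blast
    have hG: "h \<in> G" using H_G uh by blast
    let ?u = "cj u h"
    have eq: "x = h * ?u" unfolding uh(3) by (simp add: cj_def mult.assoc)
    have u': "?u \<in> ?N" using N_normal uh(1) hG by blast
    have "h ^ n = 1" if n: "x ^ n = 1" for n
    proof -
      obtain v where v: "v \<in> ?N" "(h * ?u) ^ n = h ^ n * v"
        using pow_mod_normal[OF N_sg N_normal[OF _ hG] u', of n] by blast
      then have "h ^ n * v = 1" using n eq by simp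
      then have "inverse (h ^ n) = v" by (rule inv_unique)
      then have "inverse (h ^ n) \<in> ?N" using v(1) by metis
      moreover have "inverse (h ^ n) \<in> H" using sg_inv[OF H(1) sg_pow[OF H(1) uh(2)]] .
      ultimately have "inverse (h ^ n) = 1" using H(3) by blast
      then show ?thesis by (simp only: inv_eq_one_iff)
    qed
    then show ?thesis using eq u' uh(2) by blast
  qed
  have comN: "com x g \<in> ?N" if "x \<in> ?N" "g \<in> G" for x g
    unfolding com_alt(1) using that N_normal by (simp only: sg_mult[OF N_sg] sg_inv[OF N_sg])
  have TT_T': "TT p \<subseteq> T'" if p: "is_prime p" for p
  proof (cases "p = 2")
    case True
    then show ?thesis using TT_2 sg_one[OF T'(2)] by auto
  next
    case p2: False
    let ?a = "ap p"
    obtain s where s: "0 < s" "coprime s p" "?a ^ s = 1" using ap_el[OF p] el_p'_iff[OF p] by blast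
    have in_N: "com y ?a \<in> ?N" if y: "y \<in> TT p" for y
    proof -
      have yG: "y \<in> G" using TT_M[OF p y] M_G by blast
      obtain k where k: "y ^ (p ^ k) = 1" using Mp_el[OF TT_Mp[OF p y]] el_p_iff[OF p] by blast
      obtain u h where uh: "u \<in> ?N" "h \<in> H" "y = h * u" "\<And>n. y ^ n = 1 \<Longrightarrow> h ^ n = 1"
        using dec[OF yG] by blast
      obtain v g where vg: "v \<in> ?N" "g \<in> H" "?a = g * v" "\<And>n. ?a ^ n = 1 \<Longrightarrow> g ^ n = 1"
        using dec[OF ap_G[OF p]] by blast
      have "coprime (p ^ k) s" using s(2) by (simp add: coprime_commute)
      then have hg: "com h g = 1"
        using loc_nilpotent_coprime[OF H(2) uh(2) vg(2) uh(4)[OF k] vg(4)[OF s(3)]] prime_gt_0_nat[OF p] by simp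
      have "com v h \<in> ?N" using comN vg(1) H_G uh(2) by blast
      then have hv: "com h v \<in> ?N" using sg_inv[OF N_sg] by (metis com_inv)
      have "com h ?a = com h v * cj (com h g) v" unfolding vg(3) by (rule com_mult_right)
      then have ha: "com h ?a \<in> ?N" using hg hv by simp
      have "com y ?a = cj (com h ?a) u * com u ?a" unfolding uh(3) by (rule com_mult_left)
      moreover have "cj (com h ?a) u \<in> ?N" using N_normal[OF ha N_G[OF uh(1)]] .
      moreover have "com u ?a \<in> ?N" using comN[OF uh(1) ap_G[OF p]] .
      ultimately show ?thesis using sg_mult[OF N_sg] by simp
    qed
    interpret cs: com_section B A p "{x \<in> S'. el {p} x}"
      by (rule s.com_sectionI[OF p S'])
    show ?thesis
    proof
      fix x assume "x \<in> TT p"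
      then obtain y where y: "y \<in> TT p" "x = com y ?a" using TT_com[OF p] by blast
      \<comment> \<open>Writing \<open>y\<close> itself as a commutator places it in
        \<open>?N\<close>, so that it can be split between \<open>S'\<close> and
        \<open>T'\<close>.\<close>
      obtain y2 where y2: "y2 \<in> TT p" "y = com y2 ?a" using TT_com[OF p y(1)] by blast
      have "y \<in> ?N" using in_N[OF y2(1)] y2(2) by simp
      then obtain u t where ut: "u \<in> S'" "t \<in> T'" "y = u * t" by (elim prE)
      have c: "u * t = t * u" using ST'(2) ut by blast
      obtain k where k: "y ^ (p ^ k) = 1" using Mp_el[OF TT_Mp[OF p y(1)]] el_p_iff[OF p] by blast
      have "u ^ (p ^ k) * t ^ (p ^ k) = 1" using k ut(3) power_mult_commuting[OF c] by simp
      then have eq: "inverse (u ^ (p ^ k)) = t ^ (p ^ k)" by (rule inv_unique)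
      have "inverse (u ^ (p ^ k)) \<in> T'" unfolding eq using T'(2) ut(2) by (rule sg_pow)
      from sg_inv[OF T'(2) this] have "u ^ (p ^ k) \<in> S' \<inter> T'"
        using sg_pow[OF S'(2) ut(1)] by (simp only: inv_inv IntI)
      then have "u ^ (p ^ k) = 1" using ST'(1) by blast
      then have "u \<in> {x \<in> S'. el {p} x}" using ut(1) el_p_iff[OF p] by blast
      then have uS: "u \<in> s.TT p" using cs.odd_section[OF p2] by blast
      then have "cj u ?a = u" using s.TT_centralized[OF p _ ap_A[OF p] ap_el[OF p]] by blast
      then have "com u ?a = 1" by (simp add: com_alt(1))
      then have "com y ?a = com t ?a" unfolding ut(3) com_mult_left by simp
      moreover have "com t ?a \<in> T'"
        unfolding com_alt(1) using ut(2) T'(3) ap_G[OF p] by (simp only: sg_mult[OF T'(2)] sg_inv[OF T'(2)])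
      ultimately show "x \<in> T'" using y(2) by simp
    qed
  qed
  then show ?thesis unfolding T_def by (rule Sig_least[OF T'(2)])
qed

end

lemma decompD:
  assumes "decomp G A B S T A1 B1"
  shows "S \<subseteq> G" "sg S" "\<forall>x\<in>S. \<forall>g\<in>G. cj x g \<in> S" "loc_cyclic S"
    and "T \<subseteq> G" "sg T" "\<forall>x\<in>T. \<forall>g\<in>G. cj x g \<in> T" "loc_cyclic T"
    and "A1 \<subseteq> A" "B1 \<subseteq> B" "sg (pr A1 B1)" "loc_nilpotent (pr A1 B1)"
    and "S \<inter> T = {1}" "\<forall>x\<in>S. \<forall>y\<in>T. x * y = y * x"
    and "pr S T \<inter> pr A1 B1 = {1}" "G = pr (pr S T) (pr A1 B1)"
    and "S = gen {com x y | x y. x \<in> S \<and> y \<in> B1}" "T = gen {com x y | x y. x \<in> T \<and> y \<in> A1}"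
  using assms unfolding decomp_def by - (elim conjE, assumption)+

context prod_lc
begin

interpretation s: prod_lc B A
  rewrites "factorized.G B A = G" and "factorized.M B A = M"
    and "factorized.Mp B A = Mp" and "factorized.Mp' B A = Mp'" and "prod_lc.Sig B A = Sig"
    and "prod_lc.T B A = S" and "prod_lc.S B A = T"
  by (rule swap_lc swap_G swap_M swap_Mp swap_Mp' swap_Sig swap_T swap_S)+

theorem decomp_least:
  assumes d: "decomp G A B S' T' A1 B1"
  shows "S \<subseteq> S'" "T \<subseteq> T'"
proof -
  note f = decompD[OF d]
  have c: "x * y = y * x" if "x \<in> S'" "y \<in> T'" for x y using f(14) that by blast
  have nS: "cj x g \<in> S'" if "x \<in> S'" "g \<in> G" for x g using f(3) that by blast
  have nT: "cj x g \<in> T'" if "x \<in> T'" "g \<in> G" for x g using f(7) that by blast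
  have prc: "pr T' S' = pr S' T'"
  proof (intro equalityI subsetI)
    fix x assume "x \<in> pr T' S'"
    then obtain t u where *: "t \<in> T'" "u \<in> S'" "x = t * u" by (elim prE)
    then have "x = u * t" using c[OF *(2,1)] by simp
    then show "x \<in> pr S' T'" using prI[OF *(2,1)] by simp
  next
    fix x assume "x \<in> pr S' T'"
    then obtain u t where *: "u \<in> S'" "t \<in> T'" "x = u * t" by (elim prE)
    then have "x = t * u" using c[OF *(1,2)] by simp
    then show "x \<in> pr T' S'" using prI[OF *(2,1)] by simp
  qed
  show "T \<subseteq> T'"
    by (rule T_least[OF f(1,2) nS f(4,17,10,5,6) nT f(8,18,9,13) c f(11,12,15,16)])
  show "S \<subseteq> S'"
  proof (rule s.T_least[OF f(5,6) nT f(8,18,9,1,2) nS f(4,17,10) _ _ f(11,12)])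
    show "T' \<inter> S' = {1}" using f(13) by (simp only: Int_commute)
    show "pr T' S' \<inter> pr A1 B1 = {1}" "G = pr (pr T' S') (pr A1 B1)" unfolding prc by (fact f(15) f(16))+
    show "x * y = y * x" if "x \<in> T'" "y \<in> S'" for x y using c[OF that(2,1)] by (rule sym)
  qed
qed

lemma decomp_T_part:
  assumes d: "decomp G A B S' T' A1 B1" and p: "is_prime p"
  shows "com_section A B p {x \<in> T'. el {p} x}"
proof -
  note f = decompD[OF d]
  have nT: "cj x g \<in> T'" if "x \<in> T'" "g \<in> G" for x g using f(7) that by blast
  show ?thesis by (rule com_sectionI[OF p f(5,6) nT f(8,18,9)])
qed

lemma decomp_S_part:
  assumes d: "decomp G A B S' T' A1 B1" and p: "is_prime p"
  shows "com_section B A p {x \<in> S'. el {p} x}"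
proof -
  note f = decompD[OF d]
  have nS: "cj x g \<in> S'" if "x \<in> S'" "g \<in> G" for x g using f(3) that by blast
  show ?thesis by (rule s.com_sectionI[OF p f(1,2) nS f(4,17,10)])
qed

lemma two_parts:
  assumes d: "decomp G A B S' T' A1 B1"
  shows "2 \<in> primes_of T' \<Longrightarrow> {x \<in> T'. el {2} x} = {b \<in> B. el {2} b} \<and> infinite {b \<in> B. el {2} b} \<and> finite {a \<in> A. el {2} a}"
    and "2 \<in> primes_of S' \<Longrightarrow> {x \<in> S'. el {2} x} = {a \<in> A. el {2} a} \<and> infinite {a \<in> A. el {2} a} \<and> finite {b \<in> B. el {2} b}"
proof -
  have ne: "{x \<in> D. el {2} x} \<noteq> {1}" if two: "2 \<in> primes_of D" for D :: "'a set"
  proof -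
    obtain x where "x \<in> D" "x \<noteq> 1" "x ^ 2 = 1" using two by (auto simp: primes_of_def)
    then show ?thesis using el_p_of_pow[OF two_is_prime_nat] by blast
  qed
  interpret t: com_section A B 2 "{x \<in> T'. el {2} x}" using d by (rule decomp_T_part) simp
  interpret u: com_section B A 2 "{x \<in> S'. el {2} x}" using d by (rule decomp_S_part) simp
  show "{x \<in> T'. el {2} x} = {b \<in> B. el {2} b} \<and> infinite {b \<in> B. el {2} b} \<and> finite {a \<in> A. el {2} a}"
    if "2 \<in> primes_of T'" using t.two_section[OF refl ne[OF that]] by simp
  show "{x \<in> S'. el {2} x} = {a \<in> A. el {2} a} \<and> infinite {a \<in> A. el {2} a} \<and> finite {b \<in> B. el {2} b}"
    if "2 \<in> primes_of S'" using u.two_section[OF refl ne[OF that]] by simp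
qed

lemma primes_of_two: "x \<in> D \<Longrightarrow> sg D \<Longrightarrow> el {2} x \<Longrightarrow> x \<noteq> 1 \<Longrightarrow> 2 \<in> primes_of D"
proof -
  assume x: "x \<in> D" "sg D" "el {2} x" "x \<noteq> 1"
  obtain i where "x ^ i \<noteq> 1" "(x ^ i) ^ 2 = 1" using order_p_power[OF two_is_prime_nat x(3,4)] .
  then show ?thesis unfolding primes_of_def using sg_pow[OF x(2,1), of i] by auto
qed

text \<open>For odd primes \<open>odd_section\<close> puts the components into those of the least
  pair. At 2, a nontrivial part of \<open>S\<close> requires infinitely many 2-elements in
  \<open>A\<close> and finitely many in \<open>B\<close>, a nontrivial part of \<open>T\<close> the
  reverse, and the part is then everything possible. So \<open>A\<close> and \<open>B\<close> decide
  where involutions can occur, and \<open>two\<close> decides whether they do.\<close>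

lemma decomp_unique_subset:
  assumes d: "decomp G A B S1 T1 A1 B1" and e: "decomp G A B S2 T2 A2 B2"
    and two: "2 \<in> primes_of S1 \<union> primes_of T1 \<Longrightarrow> 2 \<in> primes_of S2 \<union> primes_of T2"
  shows "S1 \<subseteq> S2" "T1 \<subseteq> T2"
proof -
  note sgs = decompD(2,6)[OF d] decompD(2,6)[OF e] decompD(1,5)[OF d]
  show "S1 \<subseteq> S2"
  proof
    fix x assume x: "x \<in> S1"
    show "x \<in> S2"
    proof (rule in_sg_by_primes[OF periodic sgs(3)])
      show "x \<in> G" using x sgs by blast
      fix p i assume p: "is_prime p" "el {p} (x ^ i)"
      have xi: "x ^ i \<in> S1" using sg_pow[OF sgs(1) x] .
      show "x ^ i \<in> S2"
      proof (cases "p = 2")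
        case False
        interpret c: com_section B A p "{x \<in> S1. el {p} x}" using decomp_S_part[OF d p(1)] .
        have "x ^ i \<in> s.TT p" using c.odd_section[OF False] xi p by blast
        then show ?thesis using s.TT_T[OF p(1)] decomp_least(1)[OF e] by blast
      next
        case True
        show ?thesis
        proof (cases "x ^ i = 1")
          case False
          then have two1: "2 \<in> primes_of S1" using primes_of_two[OF xi sgs(1)] p(2) True by simp
          then have "2 \<in> primes_of S2 \<union> primes_of T2" using two by blast
          then have "2 \<in> primes_of S2" using two_parts(1)[OF e] two_parts(2)[OF d two1] by blast
          then show ?thesis using two_parts(2)[OF e] two_parts(2)[OF d two1] xi p(2) True by blast
        qed (simp add: sg_one sgs)
      qed
    qed
  qed
  show "T1 \<subseteq> T2"
  proof
    fix x assume x: "x \<in> T1"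
    show "x \<in> T2"
    proof (rule in_sg_by_primes[OF periodic sgs(4)])
      show "x \<in> G" using x sgs by blast
      fix p i assume p: "is_prime p" "el {p} (x ^ i)"
      have xi: "x ^ i \<in> T1" using sg_pow[OF sgs(2) x] .
      show "x ^ i \<in> T2"
      proof (cases "p = 2")
        case False
        interpret c: com_section A B p "{x \<in> T1. el {p} x}" using decomp_T_part[OF d p(1)] .
        have "x ^ i \<in> TT p" using c.odd_section[OF False] xi p by blast
        then show ?thesis using TT_T[OF p(1)] decomp_least(2)[OF e] by blast
      next
        case True
        show ?thesis
        proof (cases "x ^ i = 1")
          case False
          then have two1: "2 \<in> primes_of T1" using primes_of_two[OF xi sgs(2)] p(2) True by simp
          then have "2 \<in> primes_of S2 \<union> primes_of T2" using two by blast
          then have "2 \<in> primes_of T2" using two_parts(2)[OF e] two_parts(1)[OF d two1] by blast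
          then show ?thesis using two_parts(1)[OF e] two_parts(1)[OF d two1] xi p(2) True by blast
        qed (simp add: sg_one sgs)
      qed
    qed
  qed
qed

end

section \<open>Transfer to HOL-Algebra\<close>

text \<open>Cayley's theorem carries the results over from the class \<open>mult_group\<close>, in which terms need no
  carrier conditions, to the groups of HOL-Algebra.\<close>

typedef 'a symm = "{f :: 'a \<Rightarrow> 'a. bij f}"
  by (rule exI[of _ id]) simp

instantiation symm :: (type) mult_group
begin

definition one_symm :: "'a symm" where "1 = Abs_symm id"
definition times_symm :: "'a symm \<Rightarrow> 'a symm \<Rightarrow> 'a symm" where
  "f * g = Abs_symm (Rep_symm f \<circ> Rep_symm g)"
definition inverse_symm :: "'a symm \<Rightarrow> 'a symm" where
  "inverse f = Abs_symm (inv_into UNIV (Rep_symm f))"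
definition divide_symm :: "'a symm \<Rightarrow> 'a symm \<Rightarrow> 'a symm" where
  "divide_symm f g = Abs_symm (Rep_symm f \<circ> inv_into UNIV (Rep_symm g))"

instance
proof
  fix f g h :: "'a symm"
  have bij: "bij (Rep_symm f)" for f :: "'a symm" using Rep_symm by auto
  have times: "Rep_symm (f * g) = Rep_symm f \<circ> Rep_symm g" for f g :: "'a symm"
    unfolding times_symm_def using bij by (intro Abs_symm_inverse) (auto intro: bij_comp)
  have one: "Rep_symm (1 :: 'a symm) = id"
    unfolding one_symm_def by (intro Abs_symm_inverse) simp
  have inv: "Rep_symm (inverse f) = inv_into UNIV (Rep_symm f)"
    unfolding inverse_symm_def using bij by (intro Abs_symm_inverse) (simp add: bij_imp_bij_inv)
  show "f * g * h = f * (g * h)" "1 * f = f" "f * 1 = f"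
    by (simp_all add: Rep_symm_inject[symmetric] times one comp_assoc)
  show "inverse f * f = 1"
    using bij[of f] by (simp add: Rep_symm_inject[symmetric] times one inv bij_is_inj)
qed

end

text \<open>The identity outside the carrier extends left multiplication to a permutation of the
  whole type.\<close>

definition cayley :: "('a, 'b) monoid_scheme \<Rightarrow> 'a \<Rightarrow> 'a symm" where
  "cayley G g = Abs_symm (\<lambda>x. if x \<in> carrier G then g \<otimes>\<^bsub>G\<^esub> x else x)"

locale embedded_group = group G for G (structure) +
  fixes \<phi> :: "'a \<Rightarrow> 'g::mult_group"
  assumes \<phi>_mult: "\<And>x y. x \<in> carrier G \<Longrightarrow> y \<in> carrier G \<Longrightarrow> \<phi> (x \<otimes> y) = \<phi> x * \<phi> y"
    and \<phi>_inj: "inj_on \<phi> (carrier G)"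

lemma (in group) cayley_embedding: "embedded_group G (cayley G)"
proof -
  let ?f = "\<lambda>g x. if x \<in> carrier G then g \<otimes> x else x"
  have inv: "?f (inv g) \<circ> ?f g = id" if "g \<in> carrier G" for g
    using that by (auto simp: fun_eq_iff simp flip: m_assoc)
  have bij: "bij (?f g)" if "g \<in> carrier G" for g
    using inv[of g] inv[of "inv g"] inv_closed[OF that] unfolding inv_inv[OF that]
    by (intro o_bij[of "?f (inv g)"]) (use that in blast)+
  have rep: "Rep_symm (cayley G g) = ?f g" if "g \<in> carrier G" for g
    unfolding cayley_def using bij[OF that] by (intro Abs_symm_inverse) simp
  have "cayley G (x \<otimes> y) = cayley G x * cayley G y" if xy: "x \<in> carrier G" "y \<in> carrier G" for x y
  proof -
    have "?f (x \<otimes> y) = ?f x \<circ> ?f y" using xy by (auto simp: fun_eq_iff m_assoc)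
    then have 1: "Abs_symm (?f (x \<otimes> y)) = Abs_symm (?f x \<circ> ?f y)" by (rule arg_cong)
    have 2: "Abs_symm (?f x \<circ> ?f y) = cayley G x * cayley G y"
      unfolding times_symm_def rep[OF xy(1)] rep[OF xy(2)] ..
    have 3: "cayley G (x \<otimes> y) = Abs_symm (?f (x \<otimes> y))" by (rule cayley_def)
    show ?thesis by (rule trans[OF 3 trans[OF 1 2]])
  qed
  moreover have "inj_on (cayley G) (carrier G)"
  proof (rule inj_onI)
    fix x y assume xy: "x \<in> carrier G" "y \<in> carrier G" "cayley G x = cayley G y"
    have "?f x = ?f y" using rep[OF xy(1)] rep[OF xy(2)] unfolding xy(3) by (rule trans[OF sym])
    then have "?f x \<one> = ?f y \<one>" by (rule fun_cong)
    then show "x = y" using xy(1,2) by simp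
  qed
  ultimately show ?thesis
    by (intro embedded_group.intro embedded_group_axioms.intro is_group)
qed

lemma powi_as_power:
  assumes "x ^ n = (1::'g::mult_group)" "0 < n"
  shows "\<exists>m. x powi k = x ^ m"
proof (cases "k \<ge> 0")
  case False
  then have "x powi k = (x ^ (n - 1)) ^ nat (- k)"
    using inverse_as_power[OF assms] by (simp add: power_int_def)
  then show ?thesis by (metis power_mult)
qed (auto simp: power_int_def)

lemma loc_cyclic_subgroup:
  assumes "loc_cyclic D" "\<And>x. x \<in> D \<Longrightarrow> el UNIV x" "sg E" "E \<subseteq> D"
  shows "loc_cyclic E"
proof (rule loc_cyclic_of_uniserial[OF assms(3)])
  fix p assume p: "is_prime p"
  have "uniserial {x \<in> D. el {p} x}"
    by (rule locally_cyclic_uniserial[OF p]) (use assms(1,2) in \<open>auto simp: loc_cyclic_def\<close>)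
  then show "uniserial {x \<in> E. el {p} x}" by (rule uniserial_mono) (use assms(4) in auto)
qed (use assms loc_cyclic_comm in blast)+

section \<open>Transport of the notions along an embedding\<close>

context embedded_group
begin

lemma \<phi>_one: "\<phi> \<one> = 1"
  using \<phi>_mult[of \<one> \<one>] by (metis l_one mult_1_right mult_left_cancel_iff one_closed)

lemma \<phi>_inv: "x \<in> carrier G \<Longrightarrow> \<phi> (inv x) = inverse (\<phi> x)"
  using \<phi>_mult[of x "inv x"] by (simp add: \<phi>_one mult_group_class.inv_unique)

lemma \<phi>_pow: "x \<in> carrier G \<Longrightarrow> \<phi> (x [^] (n::nat)) = \<phi> x ^ n"
  by (induction n) (simp_all add: \<phi>_one \<phi>_mult power_Suc2 del: power_Suc)

lemma \<phi>_int_pow: "x \<in> carrier G \<Longrightarrow> \<phi> (x [^] (k::int)) = \<phi> x powi k"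
  unfolding int_pow_def2 power_int_def
  by (cases "0 \<le> k") (simp_all only: if_True if_False simp_thms not_le[symmetric] \<phi>_pow \<phi>_inv nat_pow_closed inv_power)

lemma \<phi>_eq_iff: "x \<in> carrier G \<Longrightarrow> y \<in> carrier G \<Longrightarrow> \<phi> x = \<phi> y \<longleftrightarrow> x = y"
  using \<phi>_inj by (auto dest: inj_onD)

lemma \<phi>_mem: "U \<subseteq> carrier G \<Longrightarrow> x \<in> carrier G \<Longrightarrow> \<phi> x \<in> \<phi> ` U \<longleftrightarrow> x \<in> U"
  by (rule inj_on_image_mem_iff[OF \<phi>_inj])

lemma \<phi>_image_eq: "U \<subseteq> carrier G \<Longrightarrow> V \<subseteq> carrier G \<Longrightarrow> \<phi> ` U = \<phi> ` V \<longleftrightarrow> U = V"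
  by (rule inj_on_image_eq_iff[OF \<phi>_inj])

lemma \<phi>_image_subset: "U \<subseteq> carrier G \<Longrightarrow> V \<subseteq> carrier G \<Longrightarrow> \<phi> ` U \<subseteq> \<phi> ` V \<longleftrightarrow> U \<subseteq> V"
  using \<phi>_mem by blast

lemma \<phi>_com:
  "x \<in> carrier G \<Longrightarrow> y \<in> carrier G \<Longrightarrow> \<phi> (inv x \<otimes> inv y \<otimes> x \<otimes> y) = com (\<phi> x) (\<phi> y)"
  by (simp add: \<phi>_mult \<phi>_inv com_def)

lemma \<phi>_subgroup:
  assumes U: "U \<subseteq> carrier G"
  shows "subgroup U G \<longleftrightarrow> sg (\<phi> ` U)"
proof
  assume s: "subgroup U G"
  show "sg (\<phi> ` U)"
  proof (rule sgI)
    show "1 \<in> \<phi> ` U" using subgroup.one_closed[OF s] \<phi>_one by force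
  next
    fix a b assume "a \<in> \<phi> ` U" "b \<in> \<phi> ` U"
    then obtain x y where xy: "x \<in> U" "y \<in> U" "a = \<phi> x" "b = \<phi> y" by blast
    then have "a * b = \<phi> (x \<otimes> y)" using U \<phi>_mult[of x y] by (auto simp: subset_iff)
    then show "a * b \<in> \<phi> ` U" using subgroup.m_closed[OF s xy(1,2)] by blast
  next
    fix a assume "a \<in> \<phi> ` U"
    then obtain x where x: "x \<in> U" "a = \<phi> x" by blast
    then have "inverse a = \<phi> (inv x)" using U \<phi>_inv[of x] by (auto simp: subset_iff)
    then show "inverse a \<in> \<phi> ` U" using subgroup.m_inv_closed[OF s x(1)] by blast
  qed
next
  assume s: "sg (\<phi> ` U)"
  show "subgroup U G"
  proof
    show "U \<subseteq> carrier G" by (rule U)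
    show "\<one> \<in> U" using sg_one[OF s] \<phi>_one \<phi>_mem[OF U one_closed] by simp
    fix x assume x: "x \<in> U"
    then have xc: "x \<in> carrier G" using U by blast
    show "inv x \<in> U" using sg_inv[OF s, of "\<phi> x"] x xc \<phi>_mem[OF U, of "inv x"] by (simp add: \<phi>_inv)
    fix y assume y: "y \<in> U"
    then have yc: "y \<in> carrier G" using U by blast
    show "x \<otimes> y \<in> U"
      using sg_mult[OF s, of "\<phi> x" "\<phi> y"] x y xc yc \<phi>_mem[OF U, of "x \<otimes> y"] by (simp add: \<phi>_mult)
  qed
qed

lemma \<phi>_vimage:
  assumes "V \<subseteq> \<phi> ` carrier G"
  obtains U where "U \<subseteq> carrier G" "\<phi> ` U = V"
  using assms by (metis subset_imageE)

lemma \<phi>_generate: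
  assumes U: "U \<subseteq> carrier G"
  shows "\<phi> ` generate G U = gen (\<phi> ` U)"
proof
  have sub: "generate G U \<subseteq> carrier G" using generate_incl[OF U] .
  show "\<phi> ` generate G U \<subseteq> gen (\<phi> ` U)"
  proof
    fix y assume "y \<in> \<phi> ` generate G U"
    then obtain x where "x \<in> generate G U" "y = \<phi> x" by blast
    from this(1) have "\<phi> x \<in> gen (\<phi> ` U)"
    proof (induction x)
      case one
      then show ?case using sg_one[OF sg_gen] \<phi>_one by simp
    next
      case (incl h)
      then show ?case by (simp add: gen_base)
    next
      case (inv h)
      then have "h \<in> carrier G" using U by blast
      then show ?case using inv by (simp add: \<phi>_inv sg_inv[OF sg_gen] gen_base)
    next
      case (eng h1 h2)
      then have "h1 \<in> carrier G" "h2 \<in> carrier G" using sub by auto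
      then show ?case using eng by (simp add: \<phi>_mult sg_mult[OF sg_gen])
    qed
    then show "y \<in> gen (\<phi> ` U)" using \<open>y = \<phi> x\<close> by simp
  qed
  have "sg (\<phi> ` generate G U)" using \<phi>_subgroup[OF sub] generate_is_subgroup[OF U] by simp
  then show "gen (\<phi> ` U) \<subseteq> \<phi> ` generate G U"
    by (rule gen_least) (auto intro: generate.incl)
qed

lemma commutators_carrier:
  assumes "U \<subseteq> carrier G" "V \<subseteq> carrier G"
  shows "{inv x \<otimes> inv y \<otimes> x \<otimes> y | x y. x \<in> U \<and> y \<in> V} \<subseteq> carrier G"
  using assms by blast

lemma commutator_subgroup_carrier:
  assumes "U \<subseteq> carrier G" "V \<subseteq> carrier G"
  shows "commutator_subgroup G U V \<subseteq> carrier G"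
  unfolding commutator_subgroup_def by (rule generate_incl[OF commutators_carrier[OF assms]])

lemma \<phi>_commutator_subgroup:
  assumes UV: "U \<subseteq> carrier G" "V \<subseteq> carrier G"
  shows "\<phi> ` commutator_subgroup G U V = gen {com x y | x y. x \<in> \<phi> ` U \<and> y \<in> \<phi> ` V}"
proof -
  let ?C = "{inv x \<otimes> inv y \<otimes> x \<otimes> y | x y. x \<in> U \<and> y \<in> V}"
  have "\<phi> ` ?C = {com x y | x y. x \<in> \<phi> ` U \<and> y \<in> \<phi> ` V}"
  proof (intro equalityI subsetI)
    fix z assume "z \<in> \<phi> ` ?C"
    then obtain x y where xy: "x \<in> U" "y \<in> V" "z = \<phi> (inv x \<otimes> inv y \<otimes> x \<otimes> y)" by blast
    then have "z = com (\<phi> x) (\<phi> y)" using UV \<phi>_com[of x y] by (auto simp: subset_iff)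
    then show "z \<in> {com x y | x y. x \<in> \<phi> ` U \<and> y \<in> \<phi> ` V}" using xy by blast
  next
    fix z assume "z \<in> {com x y | x y. x \<in> \<phi> ` U \<and> y \<in> \<phi> ` V}"
    then obtain x y where xy: "x \<in> U" "y \<in> V" "z = com (\<phi> x) (\<phi> y)" by blast
    then have "z = \<phi> (inv x \<otimes> inv y \<otimes> x \<otimes> y)" using UV \<phi>_com[of x y] by (auto simp: subset_iff)
    then show "z \<in> \<phi> ` ?C" using xy by blast
  qed
  then show ?thesis
    unfolding commutator_subgroup_def using \<phi>_generate[OF commutators_carrier[OF UV]] by simp
qed

lemma lower_central_carrier: "lower_central G n \<subseteq> carrier G"
  by (induction n) (simp_all add: commutator_subgroup_carrier)

lemma \<phi>_lower_central: "\<phi> ` lower_central G n = lower_series (\<phi> ` carrier G) n"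
  by (induction n) (simp_all add: \<phi>_commutator_subgroup[OF lower_central_carrier subset_refl])

lemma \<phi>_nilpotent_group: "nilpotent_group G \<longleftrightarrow> (\<exists>n. lower_series (\<phi> ` carrier G) n \<subseteq> {1})"
proof -
  have C: "sg (\<phi> ` carrier G)" using \<phi>_subgroup[OF subset_refl] subgroup_self by blast
  have "lower_central G n = {\<one>} \<longleftrightarrow> lower_series (\<phi> ` carrier G) n \<subseteq> {1}" for n
  proof -
    have "lower_central G n = {\<one>} \<longleftrightarrow> \<phi> ` lower_central G n = \<phi> ` {\<one>}"
      using \<phi>_image_eq[OF lower_central_carrier, of "{\<one>}" n] by simp
    also have "\<dots> \<longleftrightarrow> lower_series (\<phi> ` carrier G) n = {1}" by (simp add: \<phi>_lower_central \<phi>_one)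
    also have "\<dots> \<longleftrightarrow> lower_series (\<phi> ` carrier G) n \<subseteq> {1}" using sg_one[OF lower_series_sg[OF C]] by blast
    finally show ?thesis .
  qed
  then show ?thesis by (simp add: nilpotent_group_def)
qed

lemma embedded_subgroup:
  assumes "subgroup H G"
  shows "embedded_group (G\<lparr>carrier := H\<rparr>) \<phi>"
proof -
  interpret H: group "G\<lparr>carrier := H\<rparr>" using subgroup_imp_group[OF assms] .
  show ?thesis
    using subgroup.subset[OF assms] \<phi>_mult inj_on_subset[OF \<phi>_inj]
    by unfold_locales (auto simp: subset_iff)
qed

lemma embedded_subgroup_generated: "embedded_group (subgroup_generated G F) \<phi>"
proof -
  interpret K: group "subgroup_generated G F" by (rule group_subgroup_generated)
  have "carrier (subgroup_generated G F) \<subseteq> carrier G" by (rule carrier_subgroup_generated_subset)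
  then show ?thesis
    using \<phi>_mult inj_on_subset[OF \<phi>_inj] by unfold_locales (auto simp: subset_iff)
qed

lemma \<phi>_carrier_subgroup_generated:
  "F \<subseteq> carrier G \<Longrightarrow> \<phi> ` carrier (subgroup_generated G F) = gen (\<phi> ` F)"
  by (simp add: carrier_subgroup_generated Int_absorb1 \<phi>_generate)

lemma \<phi>_locally_nilpotent: "locally_nilpotent G \<longleftrightarrow> loc_nilpotent (\<phi> ` carrier G)"
proof -
  have *: "nilpotent_group (subgroup_generated G F) \<longleftrightarrow> (\<exists>n. lower_series (gen (\<phi> ` F)) n \<subseteq> {1})"
    if "F \<subseteq> carrier G" for F
    using embedded_group.\<phi>_nilpotent_group[OF embedded_subgroup_generated]
    by (simp add: \<phi>_carrier_subgroup_generated[OF that])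
  show ?thesis
  proof
    assume l: "locally_nilpotent G"
    show "loc_nilpotent (\<phi> ` carrier G)" unfolding loc_nilpotent_def
    proof (intro allI impI)
      fix F assume F: "finite F \<and> F \<subseteq> \<phi> ` carrier G"
      then obtain E where "E \<subseteq> carrier G" "finite E" "F = \<phi> ` E" by (meson finite_subset_image)
      then show "\<exists>n. lower_series (gen F) n \<subseteq> {1}" using l * unfolding locally_nilpotent_def by blast
    qed
  next
    assume l: "loc_nilpotent (\<phi> ` carrier G)"
    show "locally_nilpotent G" unfolding locally_nilpotent_def
    proof (intro allI impI)
      fix F assume F: "finite F \<and> F \<subseteq> carrier G"
      then have "finite (\<phi> ` F) \<and> \<phi> ` F \<subseteq> \<phi> ` carrier G" by blast
      then show "nilpotent_group (subgroup_generated G F)" using l * F unfolding loc_nilpotent_def by blast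
    qed
  qed
qed

lemma \<phi>_el_UNIV: "periodic G \<Longrightarrow> x \<in> carrier G \<Longrightarrow> el UNIV (\<phi> x)"
  unfolding periodic_def using \<phi>_pow \<phi>_one by (metis el_UNIV)

text \<open>Periodicity reconciles the integer exponents of \<open>cyclic_group\<close> with the
  natural exponents of \<open>loc_cyclic\<close>.\<close>

lemma \<phi>_locally_cyclic:
  assumes per: "periodic G"
  shows "locally_cyclic G \<longleftrightarrow> loc_cyclic (\<phi> ` carrier G)"
proof
  assume l: "locally_cyclic G"
  show "loc_cyclic (\<phi> ` carrier G)" unfolding loc_cyclic_def
  proof (intro ballI)
    fix a b assume "a \<in> \<phi> ` carrier G" "b \<in> \<phi> ` carrier G"
    then obtain x y where xy: "x \<in> carrier G" "y \<in> carrier G" "a = \<phi> x" "b = \<phi> y" by blast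
    let ?K = "subgroup_generated G {x, y}"
    interpret K: embedded_group ?K \<phi> by (rule embedded_subgroup_generated)
    have "cyclic_group ?K" using l xy unfolding locally_cyclic_def by simp
    then obtain z where z: "z \<in> carrier ?K" "carrier ?K = range (\<lambda>n::int. z [^]\<^bsub>?K\<^esub> n)"
      using K.cyclic_group by blast
    have zG: "z \<in> carrier G" using z(1) carrier_subgroup_generated_subset by blast
    obtain n where n: "0 < n" "\<phi> z ^ n = 1" using \<phi>_el_UNIV[OF per zG] by (auto simp: el_def)
    have pw: "\<exists>m. \<phi> u = \<phi> z ^ m" if u: "u \<in> carrier ?K" for u
    proof -
      obtain k :: int where "u = z [^]\<^bsub>?K\<^esub> k" using u z(2) by blast
      then have "\<phi> u = \<phi> z powi k" using K.\<phi>_int_pow[OF z(1)] by simp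
      then show ?thesis using powi_as_power[OF n(2,1)] by metis
    qed
    have "x \<in> carrier ?K" "y \<in> carrier ?K"
      using xy by (simp_all add: carrier_subgroup_generated generate.incl)
    then obtain i j where "a = \<phi> z ^ i" "b = \<phi> z ^ j" using pw xy(3,4) by blast
    then show "\<exists>z\<in>\<phi> ` carrier G. \<exists>i j. a = z ^ i \<and> b = z ^ j" using zG by blast
  qed
next
  assume l: "loc_cyclic (\<phi> ` carrier G)"
  show "locally_cyclic G" unfolding locally_cyclic_def
  proof (intro allI impI)
    fix F assume F: "finite F \<and> F \<subseteq> carrier G"
    let ?K = "subgroup_generated G F"
    interpret K: embedded_group ?K \<phi> by (rule embedded_subgroup_generated)
    have img: "\<phi> ` carrier ?K = gen (\<phi> ` F)" using F by (simp add: \<phi>_carrier_subgroup_generated)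
    have KG: "carrier ?K \<subseteq> carrier G" by (rule carrier_subgroup_generated_subset)
    have "loc_cyclic (gen (\<phi> ` F))"
    proof (rule loc_cyclic_subgroup[OF l _ sg_gen])
      show "el UNIV x" if "x \<in> \<phi> ` carrier G" for x using that \<phi>_el_UNIV[OF per] by blast
      show "gen (\<phi> ` F) \<subseteq> \<phi> ` carrier G" using KG unfolding img[symmetric] by (rule image_mono)
    qed
    then obtain c where c: "c \<in> gen (\<phi> ` F)" "\<forall>x\<in>\<phi> ` F. \<exists>i. x = c ^ i"
      using loc_cyclic_finite_cover[of "gen (\<phi> ` F)" "\<phi> ` F"] F sg_gen gen_base
      by (metis finite_imageI subsetI)
    then obtain z where z: "z \<in> carrier ?K" "c = \<phi> z" unfolding img[symmetric] by blast
    obtain n where n: "0 < n" "c ^ n = 1" using \<phi>_el_UNIV[OF per] z KG by (auto simp: el_def)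
    have "sg {y. \<exists>i. y = c ^ i}"
    proof (rule sgI)
      show "1 \<in> {y. \<exists>i. y = c ^ i}" by (auto intro: exI[of _ 0])
    next
      fix u v assume "u \<in> {y. \<exists>i. y = c ^ i}" "v \<in> {y. \<exists>i. y = c ^ i}"
      then obtain i j where "u = c ^ i" "v = c ^ j" by blast
      then have "u * v = c ^ (i + j)" by (simp only: power_add)
      then show "u * v \<in> {y. \<exists>i. y = c ^ i}" by blast
    next
      fix u assume "u \<in> {y. \<exists>i. y = c ^ i}"
      then obtain i where "u = c ^ i" by blast
      then have "inverse u = (c ^ (n - 1)) ^ i" using inverse_as_power[OF n(2,1)] by simp
      then have "inverse u = c ^ ((n - 1) * i)" by (simp only: power_mult)
      then show "inverse u \<in> {y. \<exists>i. y = c ^ i}" by blast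
    qed
    then have gen_c: "gen (\<phi> ` F) \<subseteq> {y. \<exists>i. y = c ^ i}" using c(2) by (intro gen_least) auto
    have "carrier ?K = range (\<lambda>k::int. z [^]\<^bsub>?K\<^esub> k)"
    proof (intro equalityI subsetI)
      fix x assume x: "x \<in> carrier ?K"
      then have "\<phi> x \<in> gen (\<phi> ` F)" using img by blast
      then obtain i where "\<phi> x = c ^ i" using gen_c by blast
      then have "\<phi> x = \<phi> (z [^]\<^bsub>?K\<^esub> (int i))" using z K.\<phi>_int_pow[OF z(1), of "int i"] by simp
      then have "x = z [^]\<^bsub>?K\<^esub> (int i)" using K.\<phi>_eq_iff[OF x K.int_pow_closed[OF z(1)]] by blast
      then show "x \<in> range (\<lambda>k::int. z [^]\<^bsub>?K\<^esub> k)" by (rule range_eqI)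
    next
      fix x assume "x \<in> range (\<lambda>k::int. z [^]\<^bsub>?K\<^esub> k)"
      then show "x \<in> carrier ?K" using K.int_pow_closed[OF z(1)] by blast
    qed
    then show "cyclic_group ?K" using K.cyclic_group z(1) by blast
  qed
qed

lemma \<phi>_prime_set:
  assumes per: "periodic G" and U: "subgroup U G"
  shows "prime_set G U = primes_of (\<phi> ` U)"
proof (intro equalityI subsetI)
  note UG = subgroup.subset[OF U]
  fix p assume "p \<in> prime_set G U"
  then obtain x where x: "is_prime p" "x \<in> U" "p dvd ord x" by (auto simp: prime_set_def)
  have xG: "x \<in> carrier G" using x UG by blast
  obtain n :: nat where n: "0 < n" "x [^] n = \<one>" using per xG unfolding periodic_def by blast
  then have "ord x dvd n" using pow_eq_id[OF xG] by blast
  then have pos: "0 < ord x" using n(1) by (cases "ord x") auto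
  obtain k where k: "ord x = k * p" using x(3) by (auto simp: dvd_def mult.commute)
  have kpos: "0 < k" using k pos by (cases k) auto
  define y where "y = x [^] k"
  have yU: "y \<in> U" unfolding y_def using subgroup_int_pow_closed[OF U x(2), of "int k"] by (simp add: int_pow_int)
  have "y [^] p = \<one>" unfolding y_def using xG k pow_ord_eq_1[OF xG] by (simp add: nat_pow_pow)
  moreover have "y \<noteq> \<one>"
  proof
    assume "y = \<one>"
    then have "ord x dvd k" unfolding y_def using pow_eq_id[OF xG] by blast
    then have "k * p \<le> k" using kpos k by (metis dvd_imp_le)
    then show False using kpos prime_gt_1_nat[OF x(1)] by simp
  qed
  moreover have yG: "y \<in> carrier G" using yU UG by blast
  ultimately have "\<phi> y ^ p = 1" "\<phi> y \<noteq> 1"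
    using \<phi>_pow[OF yG, of p] \<phi>_one \<phi>_eq_iff[OF yG one_closed] by auto
  then show "p \<in> primes_of (\<phi> ` U)" using yU x(1) by (auto simp: primes_of_def)
next
  note UG = subgroup.subset[OF U]
  fix p assume "p \<in> primes_of (\<phi> ` U)"
  then obtain y where y: "is_prime p" "y \<in> U" "\<phi> y \<noteq> 1" "\<phi> y ^ p = 1" by (auto simp: primes_of_def)
  have yG: "y \<in> carrier G" using y UG by blast
  have "\<phi> (y [^] p) = \<phi> \<one>" using y(4) \<phi>_pow[OF yG] \<phi>_one by simp
  then have "y [^] p = \<one>" using \<phi>_eq_iff[OF nat_pow_closed[OF yG] one_closed] by blast
  then have "ord y dvd p" using pow_eq_id[OF yG] by blast
  moreover have "ord y \<noteq> 1" using y(3) \<phi>_one ord_eq_1[OF yG] by auto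
  ultimately have "ord y = p" using y(1) by (metis prime_nat_iff)
  then show "p \<in> prime_set G U" using y(1,2) dvd_refl[of p] unfolding prime_set_def by blast
qed

lemma \<phi>_set_mult:
  assumes "U \<subseteq> carrier G" "V \<subseteq> carrier G"
  shows "\<phi> ` (U <#> V) = pr (\<phi> ` U) (\<phi> ` V)"
proof (intro equalityI subsetI)
  fix z assume "z \<in> \<phi> ` (U <#> V)"
  then obtain x y where xy: "x \<in> U" "y \<in> V" "z = \<phi> (x \<otimes> y)" unfolding set_mult_def by blast
  then have "z = \<phi> x * \<phi> y" using assms \<phi>_mult[of x y] by (auto simp: subset_iff)
  then show "z \<in> pr (\<phi> ` U) (\<phi> ` V)" using xy by (auto intro: prI)
next
  fix z assume "z \<in> pr (\<phi> ` U) (\<phi> ` V)"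
  then obtain x y where xy: "x \<in> U" "y \<in> V" "z = \<phi> x * \<phi> y" by (auto elim: prE)
  then have "z = \<phi> (x \<otimes> y)" using assms \<phi>_mult[of x y] by (auto simp: subset_iff)
  then show "z \<in> \<phi> ` (U <#> V)" using xy unfolding set_mult_def by blast
qed

lemma \<phi>_normal:
  assumes U: "U \<subseteq> carrier G"
  shows "U \<lhd> G \<longleftrightarrow> sg (\<phi> ` U) \<and> (\<forall>x\<in>\<phi> ` U. \<forall>g\<in>\<phi> ` carrier G. cj x g \<in> \<phi> ` U)"
proof -
  \<comment> \<open>The double inverse matches the form \<open>g \<otimes> x \<otimes> inv g\<close>
    of \<open>normal_inv_iff\<close>, with \<open>inv g\<close> in place of
    \<open>g\<close>.\<close>
  have conj: "cj (\<phi> x) (\<phi> g) = \<phi> (inv g \<otimes> x \<otimes> inv (inv g))" if "x \<in> U" "g \<in> carrier G" for x g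
    using that U by (auto simp: cj_def \<phi>_mult \<phi>_inv subset_iff)
  have "(\<forall>x\<in>\<phi> ` U. \<forall>g\<in>\<phi> ` carrier G. cj x g \<in> \<phi> ` U) \<longleftrightarrow>
      (\<forall>x\<in>U. \<forall>g\<in>carrier G. inv g \<otimes> x \<otimes> inv (inv g) \<in> U)"
    using conj \<phi>_mem[OF U] U by (auto simp: subset_iff)
  also have "\<dots> \<longleftrightarrow> (\<forall>g\<in>carrier G. \<forall>x\<in>U. g \<otimes> x \<otimes> inv g \<in> U)"
    by (metis inv_closed inv_inv)
  finally show ?thesis unfolding normal_inv_iff \<phi>_subgroup[OF U] by simp
qed

lemma \<phi>_commute:
  assumes "U \<subseteq> carrier G" "V \<subseteq> carrier G"
  shows "(\<forall>x\<in>U. \<forall>y\<in>V. x \<otimes> y = y \<otimes> x) \<longleftrightarrow> (\<forall>x\<in>\<phi> ` U. \<forall>y\<in>\<phi> ` V. x * y = y * x)"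
proof -
  have "x \<otimes> y = y \<otimes> x \<longleftrightarrow> \<phi> x * \<phi> y = \<phi> y * \<phi> x" if "x \<in> U" "y \<in> V" for x y
  proof -
    have "x \<in> carrier G" "y \<in> carrier G" using that assms by auto
    then show ?thesis using \<phi>_eq_iff[of "x \<otimes> y" "y \<otimes> x"] by (simp add: \<phi>_mult)
  qed
  then show ?thesis by auto
qed

lemma \<phi>_Int_trivial:
  assumes "U \<subseteq> carrier G" "V \<subseteq> carrier G"
  shows "U \<inter> V = {\<one>} \<longleftrightarrow> \<phi> ` U \<inter> \<phi> ` V = {1}"
proof -
  have "\<phi> ` U \<inter> \<phi> ` V = \<phi> ` (U \<inter> V)" using inj_on_image_Int[OF \<phi>_inj assms] by simp
  moreover have "U \<inter> V = {\<one>} \<longleftrightarrow> \<phi> ` (U \<inter> V) = \<phi> ` {\<one>}"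
    using \<phi>_image_eq[of "U \<inter> V" "{\<one>}"] assms by auto
  ultimately show ?thesis by (simp add: \<phi>_one)
qed

lemma periodic_subgroup: "periodic G \<Longrightarrow> subgroup H G \<Longrightarrow> periodic (G\<lparr>carrier := H\<rparr>)"
  using subgroup.subset[of H G] by (auto simp: periodic_def simp flip: nat_pow_consistent)

lemma \<phi>_locally_cyclic_subgroup:
  assumes "periodic G" "subgroup H G"
  shows "locally_cyclic (G\<lparr>carrier := H\<rparr>) \<longleftrightarrow> loc_cyclic (\<phi> ` H)"
  using embedded_group.\<phi>_locally_cyclic[OF embedded_subgroup periodic_subgroup] assms by simp

lemma \<phi>_locally_nilpotent_subgroup:
  assumes "subgroup H G"
  shows "locally_nilpotent (G\<lparr>carrier := H\<rparr>) \<longleftrightarrow> loc_nilpotent (\<phi> ` H)"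
  using embedded_group.\<phi>_locally_nilpotent[OF embedded_subgroup[OF assms]] by simp

lemma \<phi>_decomposition:
  assumes per: "periodic G" and sub: "A \<subseteq> carrier G" "B \<subseteq> carrier G"
    and c: "S \<subseteq> carrier G" "T \<subseteq> carrier G" "A1 \<subseteq> carrier G" "B1 \<subseteq> carrier G"
  shows "decomposition G A B S T A1 B1 \<longleftrightarrow>
    decomp (\<phi> ` carrier G) (\<phi> ` A) (\<phi> ` B) (\<phi> ` S) (\<phi> ` T) (\<phi> ` A1) (\<phi> ` B1)"
proof -
  have prods: "A1 <#> B1 \<subseteq> carrier G" "S <#> T \<subseteq> carrier G" "S <#> A1 \<subseteq> carrier G" "T <#> B1 \<subseteq> carrier G"
    "(S <#> T) <#> (A1 <#> B1) \<subseteq> carrier G" "(S <#> A1) <#> (T <#> B1) \<subseteq> carrier G"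
    using c by (simp_all add: set_mult_closed)
  note sm = \<phi>_set_mult[OF c(3,4)] \<phi>_set_mult[OF c(1,2)] \<phi>_set_mult[OF c(1,3)] \<phi>_set_mult[OF c(2,4)]
    \<phi>_set_mult[OF prods(2,1)] \<phi>_set_mult[OF prods(3,4)]
  have eqs: "carrier G = (S <#> T) <#> (A1 <#> B1) \<longleftrightarrow>
      \<phi> ` carrier G = pr (pr (\<phi> ` S) (\<phi> ` T)) (pr (\<phi> ` A1) (\<phi> ` B1))"
    "carrier G = (S <#> A1) <#> (T <#> B1) \<longleftrightarrow>
      \<phi> ` carrier G = pr (pr (\<phi> ` S) (\<phi> ` A1)) (pr (\<phi> ` T) (\<phi> ` B1))"
    using \<phi>_image_eq[OF subset_refl prods(5)] \<phi>_image_eq[OF subset_refl prods(6)] sm by metis+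
  have coms: "S = commutator_subgroup G S B1 \<longleftrightarrow>
      \<phi> ` S = gen {com x y | x y. x \<in> \<phi> ` S \<and> y \<in> \<phi> ` B1}"
    "T = commutator_subgroup G T A1 \<longleftrightarrow>
      \<phi> ` T = gen {com x y | x y. x \<in> \<phi> ` T \<and> y \<in> \<phi> ` A1}"
    using \<phi>_image_eq[OF c(1) commutator_subgroup_carrier[OF c(1,4)]]
      \<phi>_image_eq[OF c(2) commutator_subgroup_carrier[OF c(2,3)]]
    by (simp_all only: \<phi>_commutator_subgroup[OF c(1,4)] \<phi>_commutator_subgroup[OF c(2,3)])
  note ints = \<phi>_Int_trivial[OF c(1,2)] \<phi>_Int_trivial[OF c(1,3)] \<phi>_Int_trivial[OF c(2,4)]
    \<phi>_Int_trivial[OF prods(2,1)]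
  note comm = \<phi>_commute[OF c(1,2)] \<phi>_commute[OF c(1,3)] \<phi>_commute[OF c(2,4)]
  note subs = \<phi>_subgroup[OF c(1)] \<phi>_subgroup[OF c(2)] \<phi>_subgroup[OF c(3)] \<phi>_subgroup[OF c(4)]
    \<phi>_subgroup[OF prods(1)] \<phi>_subgroup[OF prods(2)]
  note norms = \<phi>_normal[OF c(1)] \<phi>_normal[OF c(2)] \<phi>_normal[OF prods(2)]
  note incl = \<phi>_image_subset[OF c(3) sub(1)] \<phi>_image_subset[OF c(4) sub(2)]
  note lower_series = \<phi>_locally_cyclic_subgroup[OF per] \<phi>_locally_nilpotent_subgroup
  note primes_of = \<phi>_prime_set[OF per]
  have Cs: "\<phi> ` S \<subseteq> \<phi> ` carrier G" "\<phi> ` T \<subseteq> \<phi> ` carrier G" using c by blast+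
  show ?thesis
  proof
    assume d: "decomposition G A B S T A1 B1"
    note d = d[unfolded decomposition_def direct_product_def semidirect_product_def]
    have s: "subgroup S G" "subgroup T G" "subgroup A1 G" "subgroup B1 G" "subgroup (A1 <#> B1) G"
      using d by simp_all
    show "decomp (\<phi> ` carrier G) (\<phi> ` A) (\<phi> ` B) (\<phi> ` S) (\<phi> ` T) (\<phi> ` A1) (\<phi> ` B1)"
      using d Cs
      unfolding decomp_def norms eqs coms ints comm incl sm
        lower_series(1)[OF s(1)] lower_series(1)[OF s(2)] lower_series(2)[OF s(5)] primes_of[OF s(1)] primes_of[OF s(2)] primes_of[OF s(3)] primes_of[OF s(4)] subs
      by satx
  next
    assume d: "decomp (\<phi> ` carrier G) (\<phi> ` A) (\<phi> ` B) (\<phi> ` S) (\<phi> ` T) (\<phi> ` A1) (\<phi> ` B1)"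
    note f = decompD[OF d]
    note d' = d[unfolded decomp_def]
    have sgs: "sg (\<phi> ` A1)" "sg (\<phi> ` B1)" using d' by simp_all
    have s: "subgroup S G" "subgroup T G" "subgroup A1 G" "subgroup B1 G" "subgroup (A1 <#> B1) G"
      unfolding subs sm using f sgs by blast+
    \<comment> \<open>\<open>decomp\<close> records the normality of \<open>S\<close> and
      \<open>T\<close> separately, whereas the semidirect product asks for that of their
      product.\<close>
    have N: "sg (pr (\<phi> ` S) (\<phi> ` T))" using f(2,3,5,6) by (intro sg_pr) blast+
    have NN: "\<forall>x\<in>pr (\<phi> ` S) (\<phi> ` T). \<forall>g\<in>\<phi> ` carrier G. cj x g \<in> pr (\<phi> ` S) (\<phi> ` T)"
    proof (intro ballI)
      fix x g assume x: "x \<in> pr (\<phi> ` S) (\<phi> ` T)" and g: "g \<in> \<phi> ` carrier G"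
      obtain u v where uv: "u \<in> \<phi> ` S" "v \<in> \<phi> ` T" "x = u * v" using x by (rule prE)
      have "cj u g \<in> \<phi> ` S" "cj v g \<in> \<phi> ` T" using f(3,7) uv g by blast+
      then show "cj x g \<in> pr (\<phi> ` S) (\<phi> ` T)" unfolding uv(3) cj_simps by (rule prI)
    qed
    show "decomposition G A B S T A1 B1"
      using d' N NN
      unfolding decomposition_def direct_product_def semidirect_product_def norms eqs coms ints comm incl sm
        lower_series(1)[OF s(1)] lower_series(1)[OF s(2)] lower_series(2)[OF s(5)] primes_of[OF s(1)] primes_of[OF s(2)] primes_of[OF s(3)] primes_of[OF s(4)] subs
      by satx
  qed
qed

end

lemma decomposition_carrier:
  assumes "decomposition G A B S T A1 B1"
  shows "S \<subseteq> carrier G" "T \<subseteq> carrier G" "A1 \<subseteq> carrier G" "B1 \<subseteq> carrier G" "subgroup S G" "subgroup T G"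
  proof -
  show s: "subgroup S G" "subgroup T G" using assms unfolding decomposition_def direct_product_def by blast+
  have "subgroup A1 G" "subgroup B1 G" using assms unfolding decomposition_def by blast+
  then show "S \<subseteq> carrier G" "T \<subseteq> carrier G" "A1 \<subseteq> carrier G" "B1 \<subseteq> carrier G"
    using s by (auto dest: subgroup.subset)
qed

theorem theorem1p1:
  fixes G :: "('a, 'b) monoid_scheme" and A B :: "'a set"
  assumes "group G" and "periodic G"
    and "subgroup A G" and "subgroup B G"
    and "carrier G = A <#>\<^bsub>G\<^esub> B"
    and "locally_cyclic (G\<lparr>carrier := A\<rparr>)" and "locally_cyclic (G\<lparr>carrier := B\<rparr>)"
  shows "(\<exists>S T. decomposition_pair G A B S T \<and>
            (\<forall>S' T'. decomposition_pair G A B S' T' \<longrightarrow> S \<subseteq> S' \<and> T \<subseteq> T')) \<and>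
         (\<forall>S T S' T'. decomposition_pair G A B S T \<and> decomposition_pair G A B S' T' \<and>
            (2 \<in> prime_set G S \<union> prime_set G T \<longleftrightarrow> 2 \<in> prime_set G S' \<union> prime_set G T')
            \<longrightarrow> S = S' \<and> T = T')"
proof -
  interpret group G by fact
  define \<phi> where "\<phi> = cayley G"
  interpret embedded_group G \<phi> unfolding \<phi>_def by (rule cayley_embedding)
  have AG: "A \<subseteq> carrier G" and BG: "B \<subseteq> carrier G"
    using assms(3,4) by (auto dest: subgroup.subset)
  have lcA: "loc_cyclic (\<phi> ` A)" and lcB: "loc_cyclic (\<phi> ` B)"
    using assms \<phi>_locally_cyclic_subgroup by blast+
  have img: "\<phi> ` carrier G = pr (\<phi> ` A) (\<phi> ` B)"
    using \<phi>_set_mult[OF AG BG] assms(5) by metis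
  interpret f: factorized "\<phi> ` A" "\<phi> ` B"
  proof
    show "sg (\<phi> ` A)" "sg (\<phi> ` B)" using \<phi>_subgroup AG BG assms(3,4) by blast+
    then have sgC: "sg (\<phi> ` carrier G)" using \<phi>_subgroup[OF subset_refl] subgroup_self by blast
    show "x * y = y * x" if "x \<in> \<phi> ` A" "y \<in> \<phi> ` A" for x y using loc_cyclic_comm[OF lcA that] .
    show "x * y = y * x" if "x \<in> \<phi> ` B" "y \<in> \<phi> ` B" for x y using loc_cyclic_comm[OF lcB that] .
    fix a b assume "a \<in> \<phi> ` A" "b \<in> \<phi> ` B"
    then have "b * a \<in> \<phi> ` carrier G" using AG BG by (intro sg_mult[OF sgC]) auto
    then show "\<exists>a'\<in>\<phi> ` A. \<exists>b'\<in>\<phi> ` B. b * a = a' * b'" unfolding img by (rule prE) blast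
  qed
  have fG: "f.G = \<phi> ` carrier G" unfolding img f.G_def pr_def ..
  interpret f: prod_lc "\<phi> ` A" "\<phi> ` B"
  proof unfold_locales
    show "el UNIV g" if "g \<in> f.G" for g using that \<phi>_el_UNIV[OF assms(2)] unfolding fG by blast
    show "\<exists>z\<in>\<phi> ` A. \<exists>i j. x = z ^ i \<and> y = z ^ j" if "x \<in> \<phi> ` A" "y \<in> \<phi> ` A" for x y
      using lcA that unfolding loc_cyclic_def by blast
    show "\<exists>z\<in>\<phi> ` B. \<exists>i j. x = z ^ i \<and> y = z ^ j" if "x \<in> \<phi> ` B" "y \<in> \<phi> ` B" for x y
      using lcB that unfolding loc_cyclic_def by blast
  qed
  have dec: "decomp f.G (\<phi> ` A) (\<phi> ` B) (\<phi> ` S) (\<phi> ` T) (\<phi> ` A1) (\<phi> ` B1)"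
    if "decomposition G A B S T A1 B1" for S T A1 B1
    using \<phi>_decomposition[OF assms(2) AG BG decomposition_carrier(1-4)[OF that]] that unfolding fG by blast
  show ?thesis
  proof (intro conjI allI impI)
    note D = f.decomp_exists
    have "f.S \<subseteq> \<phi> ` carrier G" "f.T \<subseteq> \<phi> ` carrier G" using decompD(1,5)[OF D] unfolding fG .
    moreover have "f.As \<subseteq> \<phi> ` carrier G" "f.Bs \<subseteq> \<phi> ` carrier G" using decompD(9,10)[OF D] AG BG by blast+
    ultimately obtain S T A1 B1 where
      c: "S \<subseteq> carrier G" "T \<subseteq> carrier G" "A1 \<subseteq> carrier G" "B1 \<subseteq> carrier G"
      and e: "\<phi> ` S = f.S" "\<phi> ` T = f.T" "\<phi> ` A1 = f.As" "\<phi> ` B1 = f.Bs"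
      by (metis \<phi>_vimage)
    have "decomposition G A B S T A1 B1"
      using \<phi>_decomposition[OF assms(2) AG BG c] D unfolding e fG by blast
    then have "decomposition_pair G A B S T" unfolding decomposition_pair_def by blast
    moreover have "S \<subseteq> S' \<and> T \<subseteq> T'" if pair: "decomposition_pair G A B S' T'" for S' T'
    proof -
      obtain A2 B2 where d: "decomposition G A B S' T' A2 B2"
        using pair unfolding decomposition_pair_def by blast
      note c' = decomposition_carrier[OF d]
      show ?thesis
        using f.decomp_least[OF dec[OF d]] \<phi>_image_subset[OF c(1) c'(1)] \<phi>_image_subset[OF c(2) c'(2)]
        unfolding e by blast
    qed
    ultimately show "\<exists>S T. decomposition_pair G A B S T \<and>
        (\<forall>S' T'. decomposition_pair G A B S' T' \<longrightarrow> S \<subseteq> S' \<and> T \<subseteq> T')" by blast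
  next
    fix S T S' T'
    assume a: "decomposition_pair G A B S T \<and> decomposition_pair G A B S' T' \<and>
            (2 \<in> prime_set G S \<union> prime_set G T \<longleftrightarrow> 2 \<in> prime_set G S' \<union> prime_set G T')"
    then obtain A1 B1 A2 B2 where d: "decomposition G A B S T A1 B1" "decomposition G A B S' T' A2 B2"
      unfolding decomposition_pair_def by blast
    note c = decomposition_carrier[OF d(1)] and c' = decomposition_carrier[OF d(2)]
    have two: "2 \<in> primes_of (\<phi> ` S) \<union> primes_of (\<phi> ` T) \<longleftrightarrow> 2 \<in> primes_of (\<phi> ` S') \<union> primes_of (\<phi> ` T')"
      using a c(5,6) c'(5,6) by (simp add: \<phi>_prime_set[OF assms(2)])
    have "\<phi> ` S \<subseteq> \<phi> ` S'" "\<phi> ` T \<subseteq> \<phi> ` T'" "\<phi> ` S' \<subseteq> \<phi> ` S" "\<phi> ` T' \<subseteq> \<phi> ` T"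
      using f.decomp_unique_subset[OF dec[OF d(1)] dec[OF d(2)]]
        f.decomp_unique_subset[OF dec[OF d(2)] dec[OF d(1)]] two by blast+
    then show "S = S'" "T = T'"
      using \<phi>_image_eq[OF c(1) c'(1)] \<phi>_image_eq[OF c(2) c'(2)] by blast+
  qed
qed

end
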